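(* Let $k,q\ge1$ and let $w\in W^{2,2}_{\mathrm{loc}}(\mathbb R^2,\mathcal A_q(\mathbb R^k))$ be a nonzero Dirichlet-stationary map, homogeneous of degree $\sigma>1$. Then $\sigma\ge1+\frac1q$.
   Context: **$Q$-points.** For a finite-dimensional Euclidean space $E$, $\mathcal A_Q(E)$ is the set of unordered $Q$-tuples $T=\sum_{\ell=1}^Q[\![T_\ell]\!]$ of points of $E$ counted with multiplicity ($[\![p]\!]$ is the Dirac mass at $p$), with metric $\mathcal G(T,S)=\min_{\sigma\in\mathfrak S_Q}\big(\sum_\ell|T_\ell-S_{\sigma(\ell)}|^2\big)^{1/2}$. On $\operatorname{Hom}$ spaces, $A:B=\operatorname{tr}(A^*B)$ and $|A|^2=A:A$. **Sobolev maps.** Let $\Omega\subset\mathbb R^n$ be open and $\xi$ Almgren's bi-Lipschitz embedding of $\mathcal A_Q(E)$ into some $\mathbb R^N$. $v\in W^{1,2}(\Omega,\mathcal A_Q(E))$ if $\xi\circ v\in W^{1,2}(\Omega,\mathbb R^N)$. Such $v$ is a.e. approximately differentiable: for a.e. $x$, writing $v(x)=\sum_\ell[\![a_\ell]\!]$, there are $A_\ell\in\operatorname{Hom}(\mathbb R^n,E)$, with $A_\ell=A_m$ whenever $a_\ell=a_m$, and a measurable set $F$ with density $1$ at $x$ such that $\mathcal G(v(x+h),\sum_\ell[\![a_\ell+A_\ell h]\!])=o(|h|)$ as $h\to0$, $x+h\in F$. One sets $j_1v=\sum_\ell[\![(a_\ell,A_\ell)]\!]$, $Dv=\sum_\ell[\![A_\ell]\!]$.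 $v\in W^{2,2}$ if $v\in W^{1,2}$ and $j_1v\in W^{1,2}(\Omega,\mathcal A_Q(E\times\operatorname{Hom}(\mathbb R^n,E)))$. Local spaces are defined as usual. **Dirichlet stationarity.** $v=\sum_\ell[\![v_\ell]\!]\in W^{1,2}_{\mathrm{loc}}(\Omega,\mathcal A_Q(\mathbb R^k))$ (with $j_1v=\sum_\ell[\![(v_\ell,Dv_\ell)]\!]$) is Dirichlet-stationary if $\int_\Omega\sum_\ell Dv_\ell:D(\psi(x,v_\ell))=0$ for all $\psi\in C_c^1(\Omega\times\mathbb R^k,\mathbb R^k)$, where $D(\psi(x,v_\ell))=D_x\psi+D_y\psi\,Dv_\ell$, and $\int_\Omega\sum_\ell\{\frac12|Dv_\ell|^2\operatorname{div}\zeta-Dv_\ell:(Dv_\ell D\zeta)\}=0$ for all $\zeta\in C_c^1(\Omega,\mathbb R^n)$. **Homogeneity.** $v$ is homogeneous of degree $\sigma$ (with centre $0$) if, for every $\lambda>0$, $v(\lambda x)=\sum_\ell[\![\lambda^\sigma v_\ell(x)]\!]$ for a.e. $x$. Nonzero means not a.e. equal to $q[\![0]\!]$. *)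

theory Defs
  imports "HOL-Analysis.Analysis" "HOL-Combinatorics.Permutations" "HOL-Library.Multiset"
begin

text \<open>
  A point of \<open>A\<^sub>Q(E)\<close> is a multiset over \<open>E\<close> of size \<open>Q\<close>; \<open>E\<close> is any Euclidean space type.
  \<open>Hom(\<real>\<^sup>n, \<real>\<^sup>k)\<close> is the matrix type \<open>real^'n^'k\<close>, whose inner product is
  \<open>A : B = tr(A\<^sup>* B)\<close>, so that its norm is the Hilbert-Schmidt norm, and
  \<open>\<real>\<^sup>k \<times> Hom(\<real>\<^sup>n, \<real>\<^sup>k)\<close> is the product type with its Euclidean norm.
\<close>

section \<open>The metric on Q-points\<close>

text \<open>Minimum over all enumerations of both arguments (of equal size); \<open>qdist_mset\<close> below
  gives the form with permutations.\<close>

definition qdist :: "'e::euclidean_space multiset \<Rightarrow> 'e multiset \<Rightarrow> real" where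
  "qdist T S = Min {sqrt (\<Sum>l<size T. (norm (xs ! l - ys ! l))\<^sup>2) | xs ys. mset xs = T \<and> mset ys = S}"

lemma qdist_mset:
  fixes xs ys :: "'e::euclidean_space list"
  assumes len: "length xs = length ys"
  shows "qdist (mset xs) (mset ys) =
    Min ((\<lambda>\<sigma>. sqrt (\<Sum>l<length xs. (norm (xs ! l - ys ! (\<sigma> l)))\<^sup>2)) ` {\<sigma>. \<sigma> permutes {..<length xs}})"
proof -
  let ?n = "length xs"
  have "{sqrt (\<Sum>l<size (mset xs). (norm (us ! l - vs ! l))\<^sup>2) | us vs. mset us = mset xs \<and> mset vs = mset ys}
      = (\<lambda>\<sigma>. sqrt (\<Sum>l<?n. (norm (xs ! l - ys ! (\<sigma> l)))\<^sup>2)) ` {\<sigma>. \<sigma> permutes {..<?n}}" (is "?A = ?B")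
  proof
    show "?A \<subseteq> ?B"
    proof
      fix r assume "r \<in> ?A"
      then obtain us vs where r: "r = sqrt (\<Sum>l<?n. (norm (us ! l - vs ! l))\<^sup>2)"
        and us: "mset us = mset xs" and vs: "mset vs = mset ys" by auto
      obtain p where p: "p permutes {..<?n}" "permute_list p xs = us"
        using mset_eq_permutation[OF us] by auto
      obtain s where s: "s permutes {..<?n}" "permute_list s ys = vs"
        using mset_eq_permutation[OF vs] len by auto
      have ip: "inv p permutes {..<?n}" using permutes_inv[OF p(1)] .
      have "(\<Sum>l<?n. (norm (us ! l - vs ! l))\<^sup>2) = (\<Sum>l<?n. (norm (xs ! (p l) - ys ! (s l)))\<^sup>2)"
        using p s len by (intro sum.cong) (auto simp: permute_list_nth)
      also have "\<dots> = (\<Sum>l<?n. (norm (xs ! l - ys ! ((s \<circ> inv p) l)))\<^sup>2)"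
        using sum.permute[OF ip, of "\<lambda>l. (norm (xs ! (p l) - ys ! (s l)))\<^sup>2"]
        by (simp add: o_def permutes_inverses[OF p(1)])
      finally show "r \<in> ?B"
        using r permutes_compose[OF ip s(1)] by (intro image_eqI[of _ _ "s \<circ> inv p"]) simp_all
    qed
    show "?B \<subseteq> ?A"
    proof
      fix r assume "r \<in> ?B"
      then obtain s where s: "s permutes {..<?n}"
        and r: "r = sqrt (\<Sum>l<?n. (norm (xs ! l - ys ! (s l)))\<^sup>2)" by auto
      have "r = sqrt (\<Sum>l<?n. (norm (xs ! l - permute_list s ys ! l))\<^sup>2)"
        unfolding r using s len by (intro arg_cong[of _ _ sqrt] sum.cong) (auto simp: permute_list_nth)
      moreover have "mset (permute_list s ys) = mset ys" using s len by simp
      ultimately show "r \<in> ?A"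
        by (intro CollectI exI[of _ xs] exI[of _ "permute_list s ys"]) simp
    qed
  qed
  then show ?thesis by (simp add: qdist_def)
qed


section \<open>Real-valued Sobolev functions\<close>

text \<open>Elements of \<open>C\<^sub>c\<^sup>1(U)\<close> are extended by zero to the whole space.\<close>

definition Cc1 :: "'a::euclidean_space set \<Rightarrow> ('a \<Rightarrow> 'b::euclidean_space) \<Rightarrow> bool" where
  "Cc1 U f \<longleftrightarrow>
     (\<forall>x. f differentiable (at x)) \<and>
     (\<forall>h. continuous_on UNIV (\<lambda>x. frechet_derivative f (at x) h)) \<and>
     compact (closure {x. f x \<noteq> 0}) \<and> closure {x. f x \<noteq> 0} \<subseteq> U"

definition L2_on :: "'a::euclidean_space set \<Rightarrow> ('a \<Rightarrow> real) \<Rightarrow> bool" where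
  "L2_on U f \<longleftrightarrow> f \<in> borel_measurable (lebesgue_on U) \<and> integrable (lebesgue_on U) (\<lambda>x. (f x)\<^sup>2)"

definition weak_partial ::
  "'a::euclidean_space set \<Rightarrow> 'a \<Rightarrow> ('a \<Rightarrow> real) \<Rightarrow> ('a \<Rightarrow> real) \<Rightarrow> bool" where
  "weak_partial U b f g \<longleftrightarrow>
     (\<forall>\<phi>. Cc1 U \<phi> \<longrightarrow>
        (\<integral>x. f x * frechet_derivative \<phi> (at x) b \<partial>lebesgue_on U) = - (\<integral>x. g x * \<phi> x \<partial>lebesgue_on U))"

definition W12_real :: "'a::euclidean_space set \<Rightarrow> ('a \<Rightarrow> real) \<Rightarrow> bool" where
  "W12_real U f \<longleftrightarrow> L2_on U f \<and> (\<forall>b\<in>Basis. \<exists>g. L2_on U g \<and> weak_partial U b f g)"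


section \<open>Almgren's embedding and multivalued Sobolev maps\<close>

text \<open>
  Almgren's map \<open>\<xi>\<close> for a list \<open>es\<close> of \<open>h\<close> unit vectors sends \<open>T\<close> to \<open>1 / sqrt h\<close> times the
  \<open>h\<close>-tuple of the increasingly ordered arrays of the projections of \<open>T\<close> on the vectors of \<open>es\<close>.
  The target is \<open>\<real>\<^sup>N\<close> with \<open>N = h Q\<close>, its coordinates being indexed by pairs \<open>(l, m)\<close>
  with \<open>l < h\<close> and \<open>m < Q\<close>.
\<close>

definition almgren_xi :: "'e::euclidean_space list \<Rightarrow> nat \<Rightarrow> nat \<Rightarrow> 'e multiset \<Rightarrow> real" where
  "almgren_xi es l m T =
     sorted_list_of_multiset (image_mset (\<lambda>p. p \<bullet> es ! l) T) ! m / sqrt (real (length es))"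

text \<open>The directions have to be chosen such that the map is a bi-Lipschitz embedding of
  \<open>A\<^sub>Q(E)\<close>; Almgren's theorem says that such choices exist.\<close>

definition almgren_embedding :: "nat \<Rightarrow> 'e::euclidean_space list \<Rightarrow> bool" where
  "almgren_embedding Q es \<longleftrightarrow>
     (\<forall>e\<in>set es. norm e = 1) \<and>
     (\<exists>c>0. \<exists>C. \<forall>T S. size T = Q \<and> size S = Q \<longrightarrow>
        (let d = sqrt (\<Sum>l<length es. \<Sum>m<Q. (almgren_xi es l m T - almgren_xi es l m S)\<^sup>2)
         in c * qdist T S \<le> d \<and> d \<le> C * qdist T S))"

text \<open>The space does not depend on the chosen directions: any two bi-Lipschitz embeddings
  differ by a Lipschitz map. In a hypothesis the existential quantifier amounts to an arbitrary
  choice of the directions.\<close>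

definition W12 :: "'a::euclidean_space set \<Rightarrow> nat \<Rightarrow> ('a \<Rightarrow> 'e::euclidean_space multiset) \<Rightarrow> bool" where
  "W12 U Q v \<longleftrightarrow>
     (\<forall>x\<in>U. size (v x) = Q) \<and>
     (\<exists>es. almgren_embedding Q es \<and>
        (\<forall>l<length es. \<forall>m<Q. W12_real U (\<lambda>x. almgren_xi es l m (v x))))"


section \<open>First jets and second order Sobolev maps\<close>

definition density_one :: "'a::euclidean_space set \<Rightarrow> 'a \<Rightarrow> bool" where
  "density_one F x \<longleftrightarrow> F \<in> sets lebesgue \<and>
     ((\<lambda>r. measure lebesgue (F \<inter> ball x r) / measure lebesgue (ball x r)) \<longlongrightarrow> 1) (at_right 0)"

text \<open>\<open>J\<close> consists of the pairs \<open>(a\<^sub>l, A\<^sub>l)\<close>.\<close>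

definition approx_jet ::
  "(real^'n \<Rightarrow> (real^'k) multiset) \<Rightarrow> real^'n \<Rightarrow> ((real^'k) \<times> (real^'n^'k)) multiset \<Rightarrow> bool" where
  "approx_jet v x J \<longleftrightarrow>
     image_mset fst J = v x \<and>
     (\<forall>a A B. (a, A) \<in># J \<and> (a, B) \<in># J \<longrightarrow> A = B) \<and>
     (\<exists>F. density_one F x \<and>
        ((\<lambda>h. qdist (v (x + h)) (image_mset (\<lambda>(a, A). a + A *v h) J) / norm h) \<longlongrightarrow> 0)
          (at 0 within {h. x + h \<in> F}))"

text \<open>An approximate jet is unique if it exists, and for a Sobolev map it exists almost
  everywhere; the value at other points is a dummy.\<close>

definition j1 ::
  "(real^'n \<Rightarrow> (real^'k) multiset) \<Rightarrow> real^'n \<Rightarrow> ((real^'k) \<times> (real^'n^'k)) multiset" where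
  "j1 v x = (if \<exists>J. approx_jet v x J then SOME J. approx_jet v x J
             else replicate_mset (size (v x)) (0, 0))"

definition W22 :: "(real^'n) set \<Rightarrow> nat \<Rightarrow> (real^'n \<Rightarrow> (real^'k) multiset) \<Rightarrow> bool" where
  "W22 U Q v \<longleftrightarrow> W12 U Q v \<and> W12 U Q (j1 v)"

definition compactly_inside :: "'a::euclidean_space set \<Rightarrow> 'a set \<Rightarrow> bool" where
  "compactly_inside U \<Omega> \<longleftrightarrow> open U \<and> compact (closure U) \<and> closure U \<subseteq> \<Omega>"

definition W12_loc :: "'a::euclidean_space set \<Rightarrow> nat \<Rightarrow> ('a \<Rightarrow> 'e::euclidean_space multiset) \<Rightarrow> bool" where
  "W12_loc \<Omega> Q v \<longleftrightarrow> (\<forall>U. compactly_inside U \<Omega> \<longrightarrow> W12 U Q v)"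

definition W22_loc :: "(real^'n) set \<Rightarrow> nat \<Rightarrow> (real^'n \<Rightarrow> (real^'k) multiset) \<Rightarrow> bool" where
  "W22_loc \<Omega> Q v \<longleftrightarrow> (\<forall>U. compactly_inside U \<Omega> \<longrightarrow> W22 U Q v)"


section \<open>Dirichlet-stationary and homogeneous maps\<close>

text \<open>The integrands are integrable for every map in \<open>W12_loc\<close>; \<open>has_bochner_integral\<close> is used
  because the integral of a non-integrable function is \<open>0\<close> by convention.\<close>

definition outer_stationary :: "(real^'n) set \<Rightarrow> (real^'n \<Rightarrow> (real^'k) multiset) \<Rightarrow> bool" where
  "outer_stationary \<Omega> v \<longleftrightarrow>
     (\<forall>\<psi> :: (real^'n) \<times> (real^'k) \<Rightarrow> real^'k. Cc1 (\<Omega> \<times> UNIV) \<psi> \<longrightarrow>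
        has_bochner_integral (lebesgue_on \<Omega>)
          (\<lambda>x. \<Sum>(a, A)\<in>#j1 v x.
             A \<bullet> (jacobian (\<lambda>x'. \<psi> (x', a)) (at x) + jacobian (\<lambda>y. \<psi> (x, y)) (at a) ** A)) 0)"

definition inner_stationary :: "(real^'n) set \<Rightarrow> (real^'n \<Rightarrow> (real^'k) multiset) \<Rightarrow> bool" where
  "inner_stationary \<Omega> v \<longleftrightarrow>
     (\<forall>\<zeta> :: real^'n \<Rightarrow> real^'n. Cc1 \<Omega> \<zeta> \<longrightarrow>
        has_bochner_integral (lebesgue_on \<Omega>)
          (\<lambda>x. \<Sum>(a, A)\<in>#j1 v x.
             1/2 * (norm A)\<^sup>2 * trace (jacobian \<zeta> (at x)) - A \<bullet> (A ** jacobian \<zeta> (at x))) 0)"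

definition dirichlet_stationary ::
  "(real^'n) set \<Rightarrow> nat \<Rightarrow> (real^'n \<Rightarrow> (real^'k) multiset) \<Rightarrow> bool" where
  "dirichlet_stationary \<Omega> Q v \<longleftrightarrow> W12_loc \<Omega> Q v \<and> outer_stationary \<Omega> v \<and> inner_stationary \<Omega> v"

definition homogeneous_map ::
  "real \<Rightarrow> ('a::euclidean_space \<Rightarrow> 'e::euclidean_space multiset) \<Rightarrow> bool" where
  "homogeneous_map \<sigma> v \<longleftrightarrow>
     (\<forall>r>0. AE x in lebesgue. v (r *\<^sub>R x) = image_mset (\<lambda>a. (r powr \<sigma>) *\<^sub>R a) (v x))"

definition nonzero_map :: "nat \<Rightarrow> ('a::euclidean_space \<Rightarrow> 'e::euclidean_space multiset) \<Rightarrow> bool" where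
  "nonzero_map Q v \<longleftrightarrow> \<not> (AE x in lebesgue. v x = replicate_mset Q 0)"

end

theory Submission
  imports Defs
begin

text \<open>
  Along almost every circle around the origin the jets \<open>(a, A)\<close> of \<open>w\<close> form an absolutely
  continuous curve of multisets, because \<open>j1 w\<close> is a Sobolev map. Homogeneity gives Euler's
  equation \<open>A x = \<sigma> a\<close>, so a jet is determined by \<open>a\<close> and the tangential derivative
  \<open>b = A (perp x)\<close>. Testing the outer variation with fields of the form
  \<open>|x|\<^sup>2 \<phi>(x) \<chi>(y) e\<^sub>i\<close> and letting \<open>\<chi>\<close> concentrate at the individual sheets shows that every
  sheet is a harmonic oscillator, \<open>a' = b\<close> and \<open>b' = - \<sigma>\<^sup>2 a\<close>. Pulling the sheets back by the flow
  of this oscillator gives a multiset of phases that does not depend on the angle. After one turn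
  the multiset of jets is the same, so the phases are permuted by the oscillator flow over the time
  \<open>2 pi\<close>; a nonzero phase has period \<open>2 pi l\<close> for some \<open>1 \<le> l \<le> q\<close>, that is \<open>\<sigma> l\<close> is an
  integer, and it exceeds \<open>l\<close> since \<open>\<sigma> > 1\<close>.

  All curves are taken along the rotation group acting on almost every starting point, which avoids
  measurable selections of sheets.
\<close>

section \<open>Functions of one variable with an integral modulus of continuity\<close>

text \<open>Sheets cannot be followed through their crossings, so the curve of jets is seen only
  through symmetric sums \<open>\<Sum>z\<in>#J t. F (t, z)\<close>. These have a derivative at
  almost every angle, because the sorted Almgren coordinates are absolutely continuous and two of
  them cross with different speeds at most countably often; a sum with integral modulus whose
  derivative vanishes almost everywhere is constant. The way back from sums to single sheets rests
  on the rule that coinciding values carry the same matrix: distinct jets over a point have distinct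
  values \<open>a\<close>, and a bump in \<open>a\<close> isolates one of them. The exceptional null
  set depends on the test function, hence the bumps are taken from a countable family. The factor
  \<open>|x|^2\<close> of the test field clears the denominator of the polar decomposition of the
  gradient. Second order regularity enters where the tangential derivative \<open>b\<close> is
  itself differentiated along the circle. Angles run over \<open>[0, 4 pi]\<close> so that a generic
  \<open>t\<close> and \<open>t + 2 pi\<close> are both available.\<close>

lemma negligible_not_derivative_of_integral:
  fixes g :: "real \<Rightarrow> real"
  assumes g: "g integrable_on {a..b}"
  shows "negligible {t \<in> {a<..<b}. \<not> ((\<lambda>s. integral {a..s} g) has_real_derivative g t) (at t)}"
proof -
  \<comment> \<open>Points with arbitrarily short intervals on which \<open>g t\<close> misses the
    average of \<open>g\<close> by more than \<open>1 / Suc n\<close>. Such intervals form a Vitali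
    cover of \<open>E n\<close>, while Henstock's lemma bounds the total defect of disjoint ones;
    absolute integrability of \<open>g\<close> is not involved.\<close>
  define E where "E n = {t \<in> {a<..<b}. \<forall>d>0. \<exists>u v. u \<le> t \<and> t \<le> v \<and> u < v \<and> v - u < d \<and>
     {u..v} \<subseteq> {a<..<b} \<and> \<bar>(v - u) * g t - integral {u..v} g\<bar> > (v - u) / real (Suc n)}" for n
  have neg: "negligible (E n)" for n
  proof (subst negligible_outer_le, intro allI impI)
    fix e :: real assume "e > 0"
    \<comment> \<open>Each selected interval has a defect of at least its length over
      \<open>Suc n\<close>, so a total defect below \<open>e / Suc n\<close> leaves total length
      below \<open>e\<close>.\<close>
    then have "e / Suc n > 0" by simp
    from Henstock_lemma[OF g[folded box_real(2)] this] obtain \<gamma> where \<gamma>: "gauge \<gamma>"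
      and hen: "\<And>p. \<lbrakk>p tagged_partial_division_of (cbox a b); \<gamma> fine p\<rbrakk> \<Longrightarrow>
             sum (\<lambda>(x,k). norm(measure lborel k *\<^sub>R g x - integral k g)) p < e / Suc n"
      by blast
    define K where "K = {(t,u,v). t \<in> E n \<and> u \<le> t \<and> t \<le> v \<and> u < v \<and> {u..v} \<subseteq> \<gamma> t \<and> {u..v} \<subseteq> {a<..<b} \<and>
       \<bar>(v - u) * g t - integral {u..v} g\<bar> > (v - u) / real (Suc n)}"
    define c where "c = (\<lambda>(t::real,u::real,v::real). (u + v) / 2)"
    define r where "r = (\<lambda>(t::real,u::real,v::real). (v - u) / 2)"
    have cb: "cball (c i) (r i) = {fst (snd i)..snd (snd i)}" for i
      by (cases i) (auto simp: c_def r_def cball_eq_atLeastAtMost field_simps)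
    have rpos: "0 < r i" if "i \<in> K" for i using that by (auto simp: K_def r_def)
    have cov: "\<exists>i. i \<in> K \<and> x \<in> cball (c i) (r i) \<and> r i < d" if "x \<in> E n" "0 < d" for x d
    proof -
      have "open (\<gamma> x)" "x \<in> \<gamma> x" using \<gamma> by (auto simp: gauge_def)
      then obtain d1 where d1: "d1 > 0" "ball x d1 \<subseteq> \<gamma> x" using open_contains_ball by blast
      have "min d d1 > 0" using that d1 by simp
      with \<open>x \<in> E n\<close> obtain u v where uv: "u \<le> x" "x \<le> v" "u < v" "v - u < min d d1"
        "{u..v} \<subseteq> {a<..<b}" "\<bar>(v - u) * g x - integral {u..v} g\<bar> > (v - u) / real (Suc n)"
        unfolding E_def by blast
      have "{u..v} \<subseteq> ball x d1" using uv by (auto simp: dist_real_def)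
      then have "(x,u,v) \<in> K" using uv d1 that by (auto simp: K_def)
      moreover have "x \<in> cball (c (x,u,v)) (r (x,u,v))" unfolding cb using uv by simp
      moreover have "r (x,u,v) < d" using uv by (simp add: r_def)
      ultimately show ?thesis by blast
    qed
    obtain C where C: "countable C" "C \<subseteq> K"
      "pairwise (\<lambda>i j. disjnt (cball (c i) (r i)) (cball (c j) (r j))) C"
      "negligible (E n - (\<Union>i\<in>C. cball (c i) (r i)))"
      using Vitali_covering_theorem_cballs[of K r "E n" c, OF rpos cov] by blast
    have fin: "measure lebesgue (\<Union>i\<in>I. cball (c i) (r i)) \<le> e" if I: "I \<subseteq> C" "finite I" for I
    proof -
      define p where "p = (\<lambda>(t,u,v). (t, {u..v})) ` I"
      have IK: "I \<subseteq> K" using I C by auto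
      have inj: "inj_on (\<lambda>(t,u,v). (t::real, {u..v::real})) I"
        by (rule inj_onI) (use IK in \<open>auto simp: K_def Icc_eq_Icc\<close>)
      have p1: "p tagged_partial_division_of (cbox a b)"
        unfolding tagged_partial_division_of_def
      proof (intro conjI allI impI)
        show "finite p" using I by (simp add: p_def)
      next
        fix x k assume "(x, k) \<in> p"
        then show "x \<in> k" "k \<subseteq> cbox a b" "\<exists>a b. k = cbox a b"
          using IK by (fastforce simp: p_def K_def)+
      next
        fix x1 k1 x2 k2 assume h: "(x1, k1) \<in> p \<and> (x2, k2) \<in> p \<and> (x1, k1) \<noteq> (x2, k2)"
        then obtain i j where ij: "i \<in> I" "j \<in> I" "(x1, k1) = (\<lambda>(t,u,v). (t, {u..v})) i"
          "(x2, k2) = (\<lambda>(t,u,v). (t, {u..v})) j"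
          unfolding p_def by (elim conjE imageE) blast
        then have "i \<noteq> j" "k1 = cball (c i) (r i)" "k2 = cball (c j) (r j)"
          unfolding cb using h by (auto split: prod.splits)
        note ij = ij(1,2) this
        then have "disjnt k1 k2" using C(3) I(1) by (auto simp: pairwise_def)
        then show "interior k1 \<inter> interior k2 = {}"
          using interior_subset by (fastforce simp: disjnt_def)
      qed
      have p2: "\<gamma> fine p" using IK by (auto simp: fine_def p_def K_def)
      have "(\<Sum>i\<in>I. (snd (snd i) - fst (snd i)) / Suc n)
         \<le> (\<Sum>i\<in>I. \<bar>(snd (snd i) - fst (snd i)) * g (fst i) - integral {fst (snd i)..snd (snd i)} g\<bar>)"
        by (rule sum_mono) (use IK in \<open>auto simp: K_def\<close>)
      also have "\<dots> = sum (\<lambda>(x,k). norm(measure lborel k *\<^sub>R g x - integral k g)) p"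
        unfolding p_def
        by (subst sum.reindex[OF inj]) (use IK in \<open>auto simp: o_def K_def split: prod.splits intro!: sum.cong\<close>)
      also have "\<dots> < e / Suc n" by (rule hen[OF p1 p2])
      finally have "(\<Sum>i\<in>I. (snd (snd i) - fst (snd i))) / Suc n < e / Suc n"
        by (simp add: sum_divide_distrib)
      then have le: "(\<Sum>i\<in>I. (snd (snd i) - fst (snd i))) < e"
        by (simp add: divide_less_cancel)
      have "measure lebesgue (\<Union>i\<in>I. cball (c i) (r i)) \<le> (\<Sum>i\<in>I. measure lebesgue (cball (c i) (r i)))"
        using I by (intro measure_UNION_le) auto
      also have "\<dots> = (\<Sum>i\<in>I. (snd (snd i) - fst (snd i)))"
        by (rule sum.cong) (use IK in \<open>auto simp: cb K_def\<close>)
      finally show ?thesis using le by simp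
    qed
    have m1: "(\<Union>i\<in>C. cball (c i) (r i)) \<in> lmeasurable"
      by (rule fmeasurable_UN_bound[OF C(1)]) (use fin in auto)
    have m2: "measure lebesgue (\<Union>i\<in>C. cball (c i) (r i)) \<le> e"
      by (rule measure_UN_bound[OF C(1)]) (use fin in auto)
    define V where "V = (\<Union>i\<in>C. cball (c i) (r i))"
    have R: "negligible (E n - V)" using C(4) by (simp add: V_def)
    have mV: "V \<in> lmeasurable" "measure lebesgue V \<le> e" using m1 m2 by (simp_all add: V_def)
    show "\<exists>T. E n \<subseteq> T \<and> T \<in> lmeasurable \<and> measure lebesgue T \<le> e"
    proof (intro exI[of _ "V \<union> (E n - V)"] conjI)
      show "E n \<subseteq> V \<union> (E n - V)" by blast
      show "V \<union> (E n - V) \<in> lmeasurable"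
        using mV(1) R by (meson fmeasurable.Un negligible_imp_measurable)
      have "measure lebesgue (V \<union> (E n - V)) = measure lebesgue V"
        by (rule measure_negligible_symdiff[OF mV(1)]) (rule negligible_subset[OF R], blast)
      then show "measure lebesgue (V \<union> (E n - V)) \<le> e" using mV(2) by simp
    qed
  qed
  have "{t \<in> {a<..<b}. \<not> ((\<lambda>s. integral {a..s} g) has_real_derivative g t) (at t)} \<subseteq> (\<Union>n. E n)"
  proof (rule subsetI, rule ccontr)
    fix t assume t: "t \<in> {t \<in> {a<..<b}. \<not> ((\<lambda>s. integral {a..s} g) has_real_derivative g t) (at t)}"
      and nE: "t \<notin> (\<Union>n. E n)"
    have tab: "a < t" "t < b" using t by auto
    have "((\<lambda>s. integral {a..s} g) has_real_derivative g t) (at t)"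
      unfolding has_field_derivative_def has_derivative_at_alt
    proof (intro conjI allI impI)
      show "bounded_linear ((*) (g t))" by (rule bounded_linear_mult_right)
      fix e :: real assume "e > 0"
      then obtain n where n: "1 / real (Suc n) < e" using nat_approx_posE by blast
      have "t \<notin> E n" using nE by blast
      then have "\<exists>d>0. \<forall>u v. \<not> (u \<le> t \<and> t \<le> v \<and> u < v \<and> v - u < d \<and>
        {u..v} \<subseteq> {a<..<b} \<and> \<bar>(v - u) * g t - integral {u..v} g\<bar> > (v - u) / real (Suc n))"
        using t unfolding E_def by blast
      then obtain d where d0: "d > 0" "\<forall>u v. \<not> (u \<le> t \<and> t \<le> v \<and> u < v \<and> v - u < d \<and>
        {u..v} \<subseteq> {a<..<b} \<and> \<bar>(v - u) * g t - integral {u..v} g\<bar> > (v - u) / real (Suc n))"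
        by blast
      have d: "\<bar>(v - u) * g t - integral {u..v} g\<bar> \<le> (v - u) / real (Suc n)"
        if "u \<le> t" "t \<le> v" "u < v" "v - u < d" "{u..v} \<subseteq> {a<..<b}" for u v
        using d0(2) that by (meson not_less)
      show "\<exists>d>0. \<forall>y. norm (y - t) < d \<longrightarrow>
        norm (integral {a..y} g - integral {a..t} g - g t * (y - t)) \<le> e * norm (y - t)"
      proof (intro exI conjI allI impI)
        show "min d (min (t - a) (b - t)) > 0" using d0(1) tab by auto
        fix y assume y: "norm (y - t) < min d (min (t - a) (b - t))"
        show "norm (integral {a..y} g - integral {a..t} g - g t * (y - t)) \<le> e * norm (y - t)"
        proof (cases y t rule: linorder_cases)
          case less
          have "integral {a..y} g + integral {y..t} g = integral {a..t} g"
            using less y tab by (intro Henstock_Kurzweil_Integration.integral_combine integrable_on_subinterval[OF g]) auto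
          moreover have "\<bar>(t - y) * g t - integral {y..t} g\<bar> \<le> (t - y) / real (Suc n)"
            using less y tab by (intro d) auto
          ultimately have "norm (integral {a..y} g - integral {a..t} g - g t * (y - t)) \<le> (1 / real (Suc n)) * (t - y)"
            by (simp add: algebra_simps)
          also have "\<dots> \<le> e * (t - y)" using n less by (intro mult_right_mono) auto
          finally show ?thesis using less by simp
        next
          case greater
          have "integral {a..t} g + integral {t..y} g = integral {a..y} g"
            using greater y tab by (intro Henstock_Kurzweil_Integration.integral_combine integrable_on_subinterval[OF g]) auto
          moreover have "\<bar>(y - t) * g t - integral {t..y} g\<bar> \<le> (y - t) / real (Suc n)"
            using greater y tab by (intro d) auto
          ultimately have "norm (integral {a..y} g - integral {a..t} g - g t * (y - t)) \<le> (1 / real (Suc n)) * (y - t)"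
            by (simp add: algebra_simps)
          also have "\<dots> \<le> e * (y - t)" using n greater by (intro mult_right_mono) auto
          finally show ?thesis using greater by simp
        qed simp
      qed
    qed
    then show False using t by simp
  qed
  moreover have "negligible (\<Union>n. E n)"
    by (rule negligible_countable_Union) (use neg in auto)
  ultimately show ?thesis by (rule negligible_subset[rotated])
qed

text \<open>A crossing with different speeds is isolated, since the difference quotient of
  \<open>c - c'\<close> stays nonzero nearby. The crossings that keep distance
  \<open>1 / Suc n\<close> from all others form a set without limit points, hence a countable
  one.\<close>

lemma countable_crossings:
  fixes c c' :: "real \<Rightarrow> real"
  shows "countable {t. c t = c' t \<and> (\<exists>d d'. (c has_real_derivative d) (at t) \<and>
           (c' has_real_derivative d') (at t) \<and> d \<noteq> d')}" (is "countable ?S")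
proof -
  define S where "S n = {t \<in> ?S. \<forall>s\<in>?S. s \<noteq> t \<longrightarrow> 1 / real (Suc n) \<le> \<bar>s - t\<bar>}" for n
  have "countable (S n)" for n
  proof (rule no_limpt_imp_countable, rule notI)
    fix x assume x: "x islimpt S n"
    have pos: "0 < 1 / (2 * real (Suc n))" by simp
    from x[unfolded islimpt_approachable, rule_format, OF pos] obtain y
      where y: "y \<in> S n" "y \<noteq> x" "dist y x < 1 / (2 * real (Suc n))" by auto
    have "dist y x > 0" using y by simp
    from x[unfolded islimpt_approachable, rule_format, OF this] obtain z
      where z: "z \<in> S n" "z \<noteq> x" "dist z x < dist y x" by auto
    have "z \<noteq> y" using z by auto
    then have "1 / real (Suc n) \<le> \<bar>z - y\<bar>" using y z by (auto simp: S_def)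
    moreover have "\<bar>z - y\<bar> < 1 / (2 * real (Suc n)) + 1 / (2 * real (Suc n))"
      using y(3) z(3) by (auto simp: dist_real_def)
    ultimately show False by (simp add: field_simps)
  qed
  moreover have "?S \<subseteq> (\<Union>n. S n)"
  proof
    fix t assume t: "t \<in> ?S"
    then obtain d d' where d: "c t = c' t" "(c has_real_derivative d) (at t)"
      "(c' has_real_derivative d') (at t)" "d \<noteq> d'" by auto
    have "((\<lambda>s. c s - c' s) has_real_derivative (d - d')) (at t)" using d by (intro DERIV_diff)
    then have "((\<lambda>s. ((c s - c' s) - (c t - c' t)) / (s - t)) \<longlongrightarrow> d - d') (at t)"
      by (simp add: has_field_derivative_iff)
    then have "\<forall>\<^sub>F s in at t. ((c s - c' s) - (c t - c' t)) / (s - t) \<noteq> 0"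
      using d(4) by (intro tendsto_imp_eventually_ne) auto
    then obtain r where r: "r > 0" "\<And>s. s \<noteq> t \<Longrightarrow> dist s t < r \<Longrightarrow> c s \<noteq> c' s"
      unfolding eventually_at using d(1) by auto
    obtain n where n: "1 / real (Suc n) < r" using r(1) nat_approx_posE by blast
    have "1 / real (Suc n) \<le> \<bar>s - t\<bar>" if "s \<in> ?S" "s \<noteq> t" for s
    proof (rule ccontr)
      assume "\<not> ?thesis"
      then have "dist s t < r" using n by (simp add: dist_real_def)
      then show False using r(2)[of s] that by blast
    qed
    then have "t \<in> S n" using t by (auto simp: S_def)
    then show "t \<in> (\<Union>n. S n)" by blast
  qed
  ultimately show ?thesis by (meson countable_UN countable_subset countableI_type)
qed

text \<open>The endpoint difference telescopes over a fine tagged division. Cells tagged at good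
  points are estimated by the zero derivative, cells tagged in the null set by Henstock's lemma.
  This is the rigidity of absolutely continuous functions.\<close>

lemma equal_ends_of_integral_modulus:
  fixes F g :: "real \<Rightarrow> real"
  assumes ab: "a \<le> b" and g: "g integrable_on {a..b}"
    and mod: "\<And>s t. a \<le> s \<Longrightarrow> s \<le> t \<Longrightarrow> t \<le> b \<Longrightarrow> \<bar>F t - F s\<bar> \<le> integral {s..t} g"
    and der: "negligible {t \<in> {a..b}. \<not> (\<forall>e>0. \<exists>d>0. \<forall>s\<in>{a..b}. \<bar>s - t\<bar> < d \<longrightarrow> \<bar>F s - F t\<bar> \<le> e * \<bar>s - t\<bar>)}"
  shows "F a = F b"
proof -
  define N where "N = {t \<in> {a..b}. \<not> (\<forall>e>0. \<exists>d>0. \<forall>s\<in>{a..b}. \<bar>s - t\<bar> < d \<longrightarrow> \<bar>F s - F t\<bar> \<le> e * \<bar>s - t\<bar>)}"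
  \<comment> \<open>With \<open>g\<close> replaced by 0 on the null set, the Henstock defect of a
    cell tagged there is the integral of \<open>g\<close> over the cell.\<close>
  define g' where "g' t = (if t \<in> N then 0 else g t)" for t
  have negN: "negligible N" using der by (simp add: N_def)
  have g': "g' integrable_on {a..b}"
    by (rule integrable_spike[OF g negN]) (simp add: g'_def)
  have ig': "integral {s..t} g' = integral {s..t} g" for s t
    by (rule integral_spike[OF negN]) (simp add: g'_def)
  have bound: "\<bar>F b - F a\<bar> \<le> e * (b - a) + e" if "e > 0" for e
  proof -
    from Henstock_lemma[OF g'[folded box_real(2)] \<open>e > 0\<close>] obtain \<gamma> where \<gamma>: "gauge \<gamma>"
      and hen: "\<And>p. \<lbrakk>p tagged_partial_division_of (cbox a b); \<gamma> fine p\<rbrakk> \<Longrightarrow>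
             sum (\<lambda>(x,k). norm(measure lborel k *\<^sub>R g' x - integral k g')) p < e"
      by blast
    have "\<exists>d>0. t \<in> {a..b} - N \<longrightarrow> (\<forall>s\<in>{a..b}. \<bar>s - t\<bar> < d \<longrightarrow> \<bar>F s - F t\<bar> \<le> e * \<bar>s - t\<bar>)" for t
    proof (cases "t \<in> {a..b} - N")
      case True
      then show ?thesis using \<open>e > 0\<close> unfolding N_def by blast
    next
      case False
      then show ?thesis by (intro exI[of _ 1] conjI impI) simp_all
    qed
    then obtain d where d: "\<And>t. d t > 0" "\<And>t s. t \<in> {a..b} - N \<Longrightarrow> s \<in> {a..b} \<Longrightarrow> \<bar>s - t\<bar> < d t \<Longrightarrow> \<bar>F s - F t\<bar> \<le> e * \<bar>s - t\<bar>"
      by metis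
    have "gauge (\<lambda>t. \<gamma> t \<inter> ball t (d t))" using \<gamma> d(1) by (auto simp: gauge_def)
    then obtain p where p: "p tagged_division_of {a..b}" "(\<lambda>t. \<gamma> t \<inter> ball t (d t)) fine p"
      using fine_division_exists_real by blast
    have fin: "finite p" using p(1) by auto
    have "F b - F a = (\<Sum>(x,k)\<in>p. F (Sup k) - F (Inf k))"
      using additive_tagged_division_1[OF ab p(1), of F] by simp
    also have "\<bar>\<dots>\<bar> \<le> (\<Sum>(x,k)\<in>p. \<bar>F (Sup k) - F (Inf k)\<bar>)"
      unfolding split_def by (rule sum_abs)
    also have "\<dots> \<le> (\<Sum>(x,k)\<in>p. e * measure lborel k + norm(measure lborel k *\<^sub>R g' x - integral k g'))"
    proof (rule sum_mono, clarify)
      fix x k assume xk: "(x, k) \<in> p"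
      then obtain u v where k: "k = {u..v}" using p(1) by (metis box_real(2) tagged_division_ofD(4))
      have xin: "x \<in> k" "k \<subseteq> {a..b}" using xk p(1) by (auto dest: tagged_division_ofD)
      have kd: "k \<subseteq> ball x (d x)" using p(2) xk by (auto simp: fine_def)
      have uv: "u \<le> x" "x \<le> v" "u \<le> v" using xin k by auto
      have uvab: "u \<in> {a..b}" "v \<in> {a..b}" "x \<in> {a..b}" using xin k uv by auto
      have Sk: "Sup k = v" "Inf k = u" using uv by (auto simp: k)
      show "\<bar>F (Sup k) - F (Inf k)\<bar> \<le> e * measure lborel k + norm(measure lborel k *\<^sub>R g' x - integral k g')"
      proof (cases "x \<in> N")
        case True
        have "\<bar>F v - F u\<bar> \<le> integral {u..v} g" using uv uvab by (intro mod) auto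
        also have "\<dots> \<le> norm(measure lborel k *\<^sub>R g' x - integral k g')" using True by (simp add: g'_def k ig')
        finally show ?thesis using \<open>e > 0\<close> unfolding Sk by (simp add: add_increasing)
      next
        case False
        have "u \<in> k" "v \<in> k" using uv by (simp_all add: k)
        then have "u \<in> ball x (d x)" "v \<in> ball x (d x)" using kd by blast+
        then have "\<bar>F u - F x\<bar> \<le> e * \<bar>u - x\<bar>" "\<bar>F v - F x\<bar> \<le> e * \<bar>v - x\<bar>"
          using False uvab by (auto intro!: d simp: dist_real_def)
        then have "\<bar>F v - F u\<bar> \<le> e * (v - u)" using uv by (simp add: algebra_simps)
        then show ?thesis unfolding Sk using uv by (simp add: k add_increasing2)
      qed
    qed
    also have "\<dots> = e * (\<Sum>(x,k)\<in>p. measure lborel k) + (\<Sum>(x,k)\<in>p. norm(measure lborel k *\<^sub>R g' x - integral k g'))"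
      by (simp add: split_def sum.distrib sum_distrib_left)
    also have "(\<Sum>(x,k)\<in>p. measure lborel k) = b - a"
      using additive_content_tagged_division[OF p(1)[folded box_real(2)]] ab by simp
    also have "(\<Sum>(x,k)\<in>p. norm(measure lborel k *\<^sub>R g' x - integral k g')) \<le> e"
      using p by (intro less_imp_le hen) (auto simp: fine_def tagged_division_of_def)
    finally show ?thesis by simp
  qed
  have "\<bar>F b - F a\<bar> \<le> 0 + e" if "e > 0" for e
  proof -
    have "e / (b - a + 1) > 0" using that ab by simp
    from bound[OF this] have "\<bar>F b - F a\<bar> \<le> e / (b - a + 1) * ((b - a) + 1)"
      by (simp only: distrib_left mult_1_right)
    then show ?thesis using ab by simp
  qed
  then show ?thesis using field_le_epsilon[of "\<bar>F b - F a\<bar>" 0] by force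
qed

text \<open>A Sobolev map agrees with its good representative at almost every angle only, so
  rigidity is needed for functions controlled on a set \<open>G\<close> of full measure. The
  extension of \<open>F\<close> inherits the modulus of \<open>H\<close>, and the zero derivative at
  good points survives because every point is approximated by points of \<open>G\<close> in position
  and in \<open>H\<close> at once.\<close>

lemma constant_of_integral_modulus:
  fixes F g :: "real \<Rightarrow> real"
  assumes g: "g integrable_on {a..b}"
    and negG: "negligible ({a..b} - G)" and GI: "G \<subseteq> {a..b}"
    and mod: "\<And>s t. s \<in> G \<Longrightarrow> t \<in> G \<Longrightarrow> s \<le> t \<Longrightarrow> \<bar>F t - F s\<bar> \<le> integral {s..t} g"
    and g0: "\<And>t. t \<in> {a..b} \<Longrightarrow> 0 \<le> g t"
    and der: "negligible {t \<in> G. \<not> (\<forall>e>0. \<exists>d>0. \<forall>s\<in>G. \<bar>s - t\<bar> < d \<longrightarrow> \<bar>F s - F t\<bar> \<le> e * \<bar>s - t\<bar>)}"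
    and st: "s \<in> G" "t \<in> G" "s < t"
  shows "F s = F t"
proof -
  define H where "H t = integral {a..t} g" for t
  have sub: "g integrable_on {u..v}" if "a \<le> u" "v \<le> b" for u v
    by (rule integrable_on_subinterval[OF g]) (use that in auto)
  have Hdiff: "H v - H u = integral {u..v} g" if "a \<le> u" "u \<le> v" "v \<le> b" for u v
    using Henstock_Kurzweil_Integration.integral_combine[of a u v g] sub that by (simp add: H_def)
  have Hmono: "H u \<le> H v" if "a \<le> u" "u \<le> v" "v \<le> b" for u v
  proof -
    have "0 \<le> integral {u..v} g" using that g0 by (intro integral_nonneg sub) auto
    then show ?thesis using Hdiff[OF that] by simp
  qed
  have modH: "\<bar>F u - F v\<bar> \<le> \<bar>H u - H v\<bar>" if "u \<in> G" "v \<in> G" for u v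
  proof -
    have ab: "a \<le> u" "u \<le> b" "a \<le> v" "v \<le> b" using that GI by auto
    show ?thesis
    proof (cases "u \<le> v")
      case True
      then show ?thesis using mod[OF that] Hdiff[of u v] ab by linarith
    next
      case False
      then show ?thesis using mod[OF that(2,1)] Hdiff[of v u] ab by linarith
    qed
  qed
  have contH: "continuous_on {a..b} H" unfolding H_def by (rule indefinite_integral_continuous_1[OF g])
  \<comment> \<open>the McShane extension of \<open>F\<close> from \<open>G\<close>, with respect to the pseudo-distance given by \<open>H\<close>\<close>
  define E where "E u = (INF v\<in>G. F v + \<bar>H u - H v\<bar>)" for u
  have bdd: "bdd_below ((\<lambda>v. F v + \<bar>H u - H v\<bar>) ` G)" for u
  proof (rule bdd_belowI2[of _ "F s - \<bar>H u - H s\<bar>"])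
    fix v assume "v \<in> G"
    then show "F s - \<bar>H u - H s\<bar> \<le> F v + \<bar>H u - H v\<bar>" using modH[OF st(1), of v] by linarith
  qed
  have Gne: "G \<noteq> {}" using st by auto
  have EF: "E u = F u" if "u \<in> G" for u
    unfolding E_def
  proof (rule antisym)
    show "(INF v\<in>G. F v + \<bar>H u - H v\<bar>) \<le> F u" by (rule cINF_lower2[OF bdd that]) simp
    show "F u \<le> (INF v\<in>G. F v + \<bar>H u - H v\<bar>)"
    proof (rule cINF_greatest[OF Gne])
      fix v assume "v \<in> G"
      then show "F u \<le> F v + \<bar>H u - H v\<bar>" using modH[OF that, of v] by linarith
    qed
  qed
  have EH1: "E u \<le> E v + \<bar>H u - H v\<bar>" for u v
  proof -
    have "E u - \<bar>H u - H v\<bar> \<le> (INF w\<in>G. F w + \<bar>H v - H w\<bar>)"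
    proof (rule cINF_greatest[OF Gne])
      fix w assume "w \<in> G"
      then have "E u \<le> F w + \<bar>H u - H w\<bar>" unfolding E_def by (rule cINF_lower[OF bdd])
      then show "E u - \<bar>H u - H v\<bar> \<le> F w + \<bar>H v - H w\<bar>" by linarith
    qed
    then show ?thesis by (simp add: E_def)
  qed
  have EH: "\<bar>E u - E v\<bar> \<le> \<bar>H u - H v\<bar>" for u v using EH1[of u v] EH1[of v u] by linarith
  have "a \<le> s" "t \<le> b" using st GI by auto
  then have ab: "a < b" using st(3) by linarith
  have approx: "\<exists>v\<in>G. \<bar>v - u\<bar> < \<eta> \<and> \<bar>H v - H u\<bar> < \<eta>" if u: "u \<in> {a..b}" "\<eta> > 0" for u \<eta>
  proof -
    obtain \<delta> where \<delta>: "\<delta> > 0" "\<And>v. v \<in> {a..b} \<Longrightarrow> \<bar>v - u\<bar> < \<delta> \<Longrightarrow> \<bar>H v - H u\<bar> < \<eta>"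
      using contH u unfolding continuous_on_iff dist_real_def by blast
    let ?W = "{a<..<b} \<inter> ball u (min \<delta> \<eta>)"
    have "?W \<noteq> {}"
    proof -
      have "u \<in> closure {a<..<b}" using u ab by simp
      then have "\<exists>y\<in>{a<..<b}. dist y u < min \<delta> \<eta>"
        using \<delta>(1) \<open>\<eta> > 0\<close> by (simp only: closure_approachable)
      then show ?thesis by (auto simp: dist_commute)
    qed
    moreover have "open ?W" by auto
    ultimately have "\<not> negligible ?W" by (rule open_not_negligible[rotated])
    then have "\<not> ?W \<subseteq> {a..b} - G" using negG negligible_subset by blast
    then obtain v where v: "v \<in> ?W" "v \<notin> {a..b} - G" by blast
    then have "v \<in> G" "\<bar>v - u\<bar> < min \<delta> \<eta>" "v \<in> {a..b}" by (auto simp: dist_real_def abs_minus_commute)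
    then show ?thesis using \<delta> by (intro bexI[of _ v]) auto
  qed
  let ?bad = "{t \<in> G. \<not> (\<forall>e>0. \<exists>d>0. \<forall>s\<in>G. \<bar>s - t\<bar> < d \<longrightarrow> \<bar>F s - F t\<bar> \<le> e * \<bar>s - t\<bar>)}"
  have "s \<le> t" using st by simp
  moreover have "g integrable_on {s..t}" using \<open>a \<le> s\<close> \<open>t \<le> b\<close> by (rule sub)
  moreover have "\<bar>E v - E u\<bar> \<le> integral {u..v} g" if "s \<le> u" "u \<le> v" "v \<le> t" for u v
    proof -
      have "a \<le> s" "t \<le> b" using st GI by auto
      then have "a \<le> u" "v \<le> b" using that by linarith+
      then show ?thesis using EH[of v u] Hdiff[of u v] Hmono[of u v] that by simp
    qed
  moreover have "negligible {u \<in> {s..t}. \<not> (\<forall>e>0. \<exists>d>0. \<forall>v\<in>{s..t}. \<bar>v - u\<bar> < d \<longrightarrow> \<bar>E v - E u\<bar> \<le> e * \<bar>v - u\<bar>)}"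
    proof (rule negligible_subset[OF negligible_Un[OF negG der]], rule subsetI, rule ccontr)
      fix u assume u: "u \<in> {u \<in> {s..t}. \<not> (\<forall>e>0. \<exists>d>0. \<forall>v\<in>{s..t}. \<bar>v - u\<bar> < d \<longrightarrow> \<bar>E v - E u\<bar> \<le> e * \<bar>v - u\<bar>)}"
        and nu: "u \<notin> ({a..b} - G) \<union> ?bad"
      have "u \<in> {a..b}" using u st GI by auto
      then have uG: "u \<in> G" and good: "\<forall>e>0. \<exists>d>0. \<forall>v\<in>G. \<bar>v - u\<bar> < d \<longrightarrow> \<bar>F v - F u\<bar> \<le> e * \<bar>v - u\<bar>"
        using nu by auto
      have "\<exists>d>0. \<forall>v\<in>{s..t}. \<bar>v - u\<bar> < d \<longrightarrow> \<bar>E v - E u\<bar> \<le> e * \<bar>v - u\<bar>" if "e > 0" for e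
      proof -
        obtain d where d: "d > 0" "\<And>v. v \<in> G \<Longrightarrow> \<bar>v - u\<bar> < d \<Longrightarrow> \<bar>F v - F u\<bar> \<le> e * \<bar>v - u\<bar>"
          using good \<open>e > 0\<close> by metis
        have "\<bar>E v - E u\<bar> \<le> e * \<bar>v - u\<bar>" if v: "v \<in> {s..t}" "\<bar>v - u\<bar> < d" for v
        proof (rule field_le_epsilon)
          fix \<eta> :: real assume "\<eta> > 0"
          \<comment> \<open>The first entry keeps the approximating point within \<open>d\<close> of
            \<open>u\<close>; the second absorbs the error \<open>e * \<eta>'\<close> from the
            shifted point together with \<open>\<eta>'\<close> from the modulus of
            \<open>H\<close>.\<close>
          define \<eta>' where "\<eta>' = min (d - \<bar>v - u\<bar>) (\<eta> / (1 + e))"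
          have "\<eta>' > 0" using v \<open>\<eta> > 0\<close> \<open>e > 0\<close> by (simp add: \<eta>'_def)
          moreover have "v \<in> {a..b}" using v st GI by auto
          ultimately obtain w where w: "w \<in> G" "\<bar>w - v\<bar> < \<eta>'" "\<bar>H w - H v\<bar> < \<eta>'"
            using approx by blast
          have "\<bar>w - u\<bar> < d" using w(2) unfolding \<eta>'_def by linarith
          then have "\<bar>E w - E u\<bar> \<le> e * \<bar>w - u\<bar>" using d(2)[OF w(1)] EF uG w(1) by simp
          also have "\<dots> \<le> e * (\<bar>v - u\<bar> + \<eta>')" using w(2) \<open>e > 0\<close> by (intro mult_left_mono) auto
          finally have "\<bar>E v - E u\<bar> \<le> e * \<bar>v - u\<bar> + (1 + e) * \<eta>'"
            using EH[of w v] w(3) by (simp add: algebra_simps)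
          also have "(1 + e) * \<eta>' \<le> (1 + e) * (\<eta> / (1 + e))"
            using \<open>e > 0\<close> by (intro mult_left_mono) (auto simp: \<eta>'_def)
          also have "\<dots> = \<eta>" using \<open>e > 0\<close> by simp
          finally show "\<bar>E v - E u\<bar> \<le> e * \<bar>v - u\<bar> + \<eta>" by simp
        qed
        then show ?thesis using d(1) by blast
      qed
      then show False using u by blast
    qed
  ultimately have "E s = E t" by (rule equal_ends_of_integral_modulus)
  then show ?thesis using EF st by simp
qed

section \<open>Multisets of points along curves\<close>

lemma sum_mset_nth: "(\<Sum>z\<in>#mset xs. f z) = (\<Sum>i<length xs. f (xs ! i))"
  for f :: "'a \<Rightarrow> 'b::comm_monoid_add"
  by (simp add: sum_mset_sum_list sum_list_sum_nth lessThan_atLeast0 flip: mset_map)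

lemma qdist_mset_le:
  fixes xs ys :: "'e::euclidean_space list"
  assumes "length xs = length ys"
  shows "qdist (mset xs) (mset ys) \<le> sqrt (\<Sum>l<length xs. (norm (xs ! l - ys ! l))\<^sup>2)"
  unfolding qdist_mset[OF assms]
  by (rule Min_le) (auto intro: finite_permutations image_eqI[of _ _ id] permutes_id)

lemma qdist_attained:
  fixes S T :: "'e::euclidean_space multiset"
  assumes "size S = size T"
  obtains xs ys where "mset xs = S" "mset ys = T" "length xs = length ys"
    "qdist S T = sqrt (\<Sum>l<length xs. (norm (xs ! l - ys ! l))\<^sup>2)"
proof -
  obtain xs where xs: "mset xs = S" using ex_mset by blast
  obtain ys where ys: "mset ys = T" using ex_mset by blast
  have len: "length xs = length ys" using assms xs ys by auto
  let ?A = "(\<lambda>\<sigma>. sqrt (\<Sum>l<length xs. (norm (xs ! l - ys ! (\<sigma> l)))\<^sup>2)) ` {\<sigma>. \<sigma> permutes {..<length xs}}"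
  have "Min ?A \<in> ?A" by (rule Min_in) (auto intro: finite_permutations permutes_id)
  then obtain \<sigma> where \<sigma>: "\<sigma> permutes {..<length ys}"
    "qdist S T = sqrt (\<Sum>l<length xs. (norm (xs ! l - ys ! (\<sigma> l)))\<^sup>2)"
    using qdist_mset[OF len] xs ys len by auto
  show ?thesis
  proof (rule that[of xs "permute_list \<sigma> ys"])
    show "mset (permute_list \<sigma> ys) = T" using \<sigma>(1) ys by simp
    show "qdist S T = sqrt (\<Sum>l<length xs. (norm (xs ! l - permute_list \<sigma> ys ! l))\<^sup>2)"
      unfolding \<sigma>(2) using \<sigma>(1) len by (intro arg_cong[of _ _ sqrt] sum.cong) (auto simp: permute_list_nth)
  qed (use xs len in auto)
qed

lemma qdist_nonneg: "size S = size T \<Longrightarrow> 0 \<le> qdist S T"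
  by (rule qdist_attained[of S T]) (auto intro: sum_nonneg)

lemma qdist_matching:
  fixes S T :: "'e::euclidean_space multiset"
  assumes "size S = size T"
  obtains xs ys where "mset xs = S" "mset ys = T" "length xs = length ys"
    "\<And>i. i < length xs \<Longrightarrow> norm (xs ! i - ys ! i) \<le> qdist S T"
proof -
  obtain xs ys where *: "mset xs = S" "mset ys = T" "length xs = length ys"
    "qdist S T = sqrt (\<Sum>l<length xs. (norm (xs ! l - ys ! l))\<^sup>2)"
    using qdist_attained[OF assms] .
  have "norm (xs ! i - ys ! i) \<le> qdist S T" if "i < length xs" for i
    unfolding *(4) by (rule real_le_rsqrt, rule member_le_sum) (use that in auto)
  then show ?thesis using that * by blast
qed

lemma qdist_le_uniform:
  fixes xs ys :: "'e::euclidean_space list"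
  assumes "length xs = length ys" and "\<And>i. i < length xs \<Longrightarrow> norm (xs ! i - ys ! i) \<le> r" and "0 \<le> r"
  shows "qdist (mset xs) (mset ys) \<le> sqrt (real (length xs)) * r"
proof -
  have "(\<Sum>l<length xs. (norm (xs ! l - ys ! l))\<^sup>2) \<le> (\<Sum>l<length xs. r\<^sup>2)"
    by (intro sum_mono power_mono) (use assms in auto)
  then have "sqrt (\<Sum>l<length xs. (norm (xs ! l - ys ! l))\<^sup>2) \<le> sqrt (real (length xs) * r\<^sup>2)"
    by (intro real_sqrt_le_mono) simp
  also have "\<dots> = sqrt (real (length xs)) * r" using assms by (simp add: real_sqrt_mult)
  finally show ?thesis using qdist_mset_le[OF assms(1)] by linarith
qed

section \<open>Almgren coordinates and differentiability of multiset-valued curves\<close>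

lemma almgren_embedding_lower:
  fixes es :: "'e::euclidean_space list"
  assumes "almgren_embedding Q es"
  obtains K where "K > 0" "\<And>T S. size T = Q \<Longrightarrow> size S = Q \<Longrightarrow>
    qdist T S \<le> K * (\<Sum>l<length es. \<Sum>m<Q. \<bar>almgren_xi es l m T - almgren_xi es l m S\<bar>)"
proof -
  from assms obtain c C where c: "c > 0" and *: "\<And>T S. size T = Q \<Longrightarrow> size S = Q \<Longrightarrow>
     c * qdist T S \<le> sqrt (\<Sum>l<length es. \<Sum>m<Q. (almgren_xi es l m T - almgren_xi es l m S)\<^sup>2)"
    unfolding almgren_embedding_def Let_def by blast
  show ?thesis
  proof (rule that[of "1 / c"])
    show "1 / c > 0" using c by simp
    fix T S :: "'e multiset" assume TS: "size T = Q" "size S = Q"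
    define f where "f = (\<lambda>(l, m). almgren_xi es l m T - almgren_xi es l m S)"
    have "c * qdist T S \<le> sqrt (\<Sum>l<length es. \<Sum>m<Q. (almgren_xi es l m T - almgren_xi es l m S)\<^sup>2)"
      by (rule *[OF TS])
    \<comment> \<open>The Euclidean norm is traded for the sum of absolute values, because the
      latter can be integrated term by term along a circle.\<close>
    also have "\<dots> = L2_set f ({..<length es} \<times> {..<Q})"
      unfolding L2_set_def f_def by (simp add: sum.cartesian_product case_prod_unfold)
    also have "\<dots> \<le> (\<Sum>i\<in>{..<length es} \<times> {..<Q}. \<bar>f i\<bar>)" by (rule L2_set_le_sum_abs)
    also have "\<dots> = (\<Sum>l<length es. \<Sum>m<Q. \<bar>almgren_xi es l m T - almgren_xi es l m S\<bar>)"
      unfolding f_def by (simp add: sum.cartesian_product case_prod_unfold)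
    finally show "qdist T S \<le> 1 / c * (\<Sum>l<length es. \<Sum>m<Q. \<bar>almgren_xi es l m T - almgren_xi es l m S\<bar>)"
      using c by (simp add: field_simps)
  qed
qed

lemma ex_almgren_xi_eq:
  assumes "z \<in># T"
  shows "\<exists>m<size T. almgren_xi es l m T = (z \<bullet> es ! l) / sqrt (real (length es))"
proof -
  let ?M = "image_mset (\<lambda>p. p \<bullet> es ! l) T"
  have "z \<bullet> es ! l \<in> set (sorted_list_of_multiset ?M)" using assms by simp
  then obtain m where "m < length (sorted_list_of_multiset ?M)" "sorted_list_of_multiset ?M ! m = z \<bullet> es ! l"
    by (metis in_set_conv_nth)
  moreover have "length (sorted_list_of_multiset ?M) = size T"
    by (metis mset_sorted_list_of_multiset size_image_mset size_mset)
  ultimately show ?thesis unfolding almgren_xi_def by auto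
qed

lemma almgren_xi_replicate:
  assumes "m < Q"
  shows "almgren_xi es l m (replicate_mset Q v) = (v \<bullet> es ! l) / sqrt (real (length es))"
proof -
  define M where "M = image_mset (\<lambda>p. p \<bullet> es ! l) (replicate_mset Q v)"
  define L where "L = sorted_list_of_multiset M"
  have "length L = size M" by (metis L_def mset_sorted_list_of_multiset size_mset)
  then have "m < length L" using assms by (simp add: M_def)
  then have "L ! m \<in> set L" by simp
  then have "L ! m \<in># M" by (simp add: L_def)
  then have "L ! m = v \<bullet> es ! l" using assms by (simp add: M_def)
  then show ?thesis by (simp add: almgren_xi_def L_def M_def del: image_replicate_mset)
qed

text \<open>The directions of a bi-Lipschitz embedding must span: a vector orthogonal to all of them
  would make \<open>Q\<close> copies of it indistinguishable from \<open>Q\<close> copies of 0. The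
  map from a vector to its projections therefore has a linear left inverse, which later turns
  projected speeds into a velocity vector.\<close>

lemma almgren_reconstruction:
  fixes es :: "'e::euclidean_space list"
  assumes emb: "almgren_embedding Q es" and Q: "Q \<ge> 1"
  obtains g :: "(nat \<Rightarrow> real) \<Rightarrow> 'e" and B where "B \<ge> 0"
    "\<And>v \<delta>. norm (v - g \<delta>) \<le> B * (\<Sum>l<length es. \<bar>(v \<bullet> es ! l) / sqrt (real (length es)) - \<delta> l\<bar>)"
proof -
  let ?s = "sqrt (real (length es))"
  obtain K where K: "K > 0" "\<And>T S. size T = Q \<Longrightarrow> size S = Q \<Longrightarrow>
    qdist T S \<le> K * (\<Sum>l<length es. \<Sum>m<Q. \<bar>almgren_xi es l m T - almgren_xi es l m (S::'e multiset)\<bar>)"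
    using almgren_embedding_lower[OF emb] by blast
  \<comment> \<open>The symmetric operator of the frame \<open>es\<close>; its quadratic form is a
    sum of squared projections, which identifies the kernel.\<close>
  define L where "L v = (\<Sum>l<length es. ((v \<bullet> es ! l) / ?s) *\<^sub>R es ! l)" for v :: 'e
  have linL: "linear L"
    unfolding L_def by (rule linearI) (simp_all add: inner_add_left add_divide_distrib scaleR_add_left sum.distrib scaleR_sum_right)
  have "inj L"
  proof (rule linear_injective_0[THEN iffD2, OF linL, rule_format])
    fix v :: 'e assume "L v = 0"
    then have "v \<bullet> L v = 0" by simp
    then have "(\<Sum>l<length es. (v \<bullet> es ! l)\<^sup>2 / ?s) = 0"
      by (simp add: L_def inner_sum_right power2_eq_square)
    then have z: "(v \<bullet> es ! l)\<^sup>2 / ?s = 0" if "l < length es" for l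
      using that by (subst (asm) sum_nonneg_eq_0_iff) auto
    have zero: "(v \<bullet> es ! l) = 0" if "l < length es" for l
    proof -
      have "?s \<noteq> 0" using that by (cases es) auto
      then show ?thesis using z[OF that] by simp
    qed
    let ?T = "replicate_mset Q v" and ?S = "replicate_mset Q (0::'e)"
    have sz: "size ?T = size ?S" by simp
    obtain xs ys where xy: "mset xs = ?T" "mset ys = ?S" "length xs = length ys"
      "\<And>i. i < length xs \<Longrightarrow> norm (xs ! i - ys ! i) \<le> qdist ?T ?S"
      using qdist_matching[OF sz] by blast
    have lx: "length xs = Q" using xy(1) by (metis size_mset size_replicate_mset)
    then have "xs ! 0 \<in> set xs" "ys ! 0 \<in> set ys" using Q xy(3) by auto
    then have "xs ! 0 \<in># mset xs" "ys ! 0 \<in># mset ys" by simp_all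
    then have "xs ! 0 = v" "ys ! 0 = 0"
      unfolding xy(1,2) by (simp_all split: if_splits)
    then have "norm v \<le> qdist ?T ?S" using xy(4)[of 0] lx Q by simp
    also have "\<dots> \<le> K * (\<Sum>l<length es. \<Sum>m<Q. \<bar>almgren_xi es l m ?T - almgren_xi es l m ?S\<bar>)"
      by (rule K) simp_all
    also have "\<dots> = 0" by (simp add: almgren_xi_replicate zero)
    finally show "v = 0" by simp
  qed
  then obtain g where g: "linear g" "g \<circ> L = id" using linear_injective_left_inverse[OF linL] by blast
  obtain B where B: "B > 0" "\<And>x. norm (g x) \<le> B * norm x" using linear_bounded_pos[OF g(1)] by blast
  show ?thesis
  proof (rule that[of B "\<lambda>\<delta>. g (\<Sum>l<length es. \<delta> l *\<^sub>R es ! l)"])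
    show "B \<ge> 0" using B by simp
    fix v :: 'e and \<delta> :: "nat \<Rightarrow> real"
    have "v - g (\<Sum>l<length es. \<delta> l *\<^sub>R es ! l) = g (L v - (\<Sum>l<length es. \<delta> l *\<^sub>R es ! l))"
      using g(2) by (simp add: linear_diff[OF g(1)] fun_eq_iff)
    also have "norm \<dots> \<le> B * norm (L v - (\<Sum>l<length es. \<delta> l *\<^sub>R es ! l))" by (rule B)
    also have "L v - (\<Sum>l<length es. \<delta> l *\<^sub>R es ! l) = (\<Sum>l<length es. ((v \<bullet> es ! l) / ?s - \<delta> l) *\<^sub>R es ! l)"
      by (simp add: L_def scaleR_left_diff_distrib sum_subtractf)
    also have "norm \<dots> \<le> (\<Sum>l<length es. norm (((v \<bullet> es ! l) / ?s - \<delta> l) *\<^sub>R es ! l))"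
      by (rule norm_sum)
    also have "\<dots> = (\<Sum>l<length es. \<bar>(v \<bullet> es ! l) / ?s - \<delta> l\<bar>)"
      using emb by (intro sum.cong) (auto simp: almgren_embedding_def)
    finally show "norm (v - g (\<Sum>l<length es. \<delta> l *\<^sub>R es ! l))
        \<le> B * (\<Sum>l<length es. \<bar>(v \<bullet> es ! l) / ?s - \<delta> l\<bar>)" using B by simp
  qed
qed

text \<open>The differential \<open>D\<close> depends on the value \<open>ys ! i\<close> only: coinciding sheets move with the same velocity.\<close>

definition qdiff :: "(real \<Rightarrow> 'e::euclidean_space multiset) \<Rightarrow> real set \<Rightarrow> real \<Rightarrow> ('e \<Rightarrow> 'e) \<Rightarrow> bool" where
  "qdiff T G t D \<longleftrightarrow> (\<forall>e>0. \<exists>d>0. \<forall>s\<in>G. \<bar>s - t\<bar> < d \<longrightarrow>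
     (\<exists>xs ys. mset xs = T s \<and> mset ys = T t \<and> length xs = length ys \<and>
        (\<forall>i<length xs. norm (xs ! i - ys ! i - (s - t) *\<^sub>R D (ys ! i)) \<le> e * \<bar>s - t\<bar>)))"

text \<open>The velocity of a value is recovered from the speeds of the sorted coordinates that
  carry its projections. Coordinates with equal value at \<open>t\<close> have equal speed by
  \<open>cross\<close>, so neither relabelling near \<open>t\<close> nor the arbitrary
  \<open>SOME\<close> does harm.\<close>

lemma qdiff_of_almgren_derivatives:
  fixes T :: "real \<Rightarrow> 'e::euclidean_space multiset"
  assumes emb: "almgren_embedding Q es" and Q: "Q \<ge> 1"
    and sz: "\<And>s. s \<in> G \<Longrightarrow> size (T s) = Q" and tG: "t \<in> G"
    and c: "\<And>s l m. s \<in> G \<Longrightarrow> l < length es \<Longrightarrow> m < Q \<Longrightarrow> c l m s = almgren_xi es l m (T s)"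
    and d: "\<And>l m. l < length es \<Longrightarrow> m < Q \<Longrightarrow> (c l m has_real_derivative d l m) (at t)"
    and cross: "\<And>l m m'. l < length es \<Longrightarrow> m < Q \<Longrightarrow> m' < Q \<Longrightarrow> c l m t = c l m' t \<Longrightarrow> d l m = d l m'"
  shows "\<exists>D. qdiff T G t D"
proof -
  let ?h = "length es" and ?s = "sqrt (real (length es))"
  obtain g :: "(nat \<Rightarrow> real) \<Rightarrow> 'e" and B where B: "B \<ge> 0"
    "\<And>v \<delta>. norm (v - g \<delta>) \<le> B * (\<Sum>l<?h. \<bar>(v \<bullet> es ! l) / ?s - \<delta> l\<bar>)"
    by (rule almgren_reconstruction[OF emb Q]) (rule that)
  obtain K where K: "K > 0" "\<And>T S. size T = Q \<Longrightarrow> size S = Q \<Longrightarrow>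
    qdist T S \<le> K * (\<Sum>l<?h. \<Sum>m<Q. \<bar>almgren_xi es l m T - almgren_xi es l m (S::'e multiset)\<bar>)"
    using almgren_embedding_lower[OF emb] by blast
  define D where "D p = g (\<lambda>l. d l (SOME m. m < Q \<and> c l m t = (p \<bullet> es ! l) / ?s))" for p
  have "qdiff T G t D" unfolding qdiff_def
  proof (intro allI impI)
    fix e :: real assume e: "e > 0"
    \<comment> \<open>Each of the \<open>?h\<close> projections is allowed the error
      \<open>e1\<close>, and reconstruction costs the factor \<open>B\<close>; the summand 1 keeps
      the denominator positive.\<close>
    define e1 where "e1 = e / (B * ?h + 1)"
    have den: "B * ?h + 1 > 0" using B(1) by (simp add: add_nonneg_pos)
    have "B * (?h * e1) = e * ((B * ?h) / (B * ?h + 1))" by (simp add: e1_def)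
    also have "\<dots> \<le> e * 1" using e den by (intro mult_left_mono) simp_all
    finally have e1: "e1 > 0" "B * (?h * e1) \<le> e" using e den by (simp_all add: e1_def)
    have lim: "c l m \<midarrow>t\<rightarrow> c l m t" if "l < ?h" "m < Q" for l m
      using DERIV_isCont[OF d[OF that]] by (simp add: isCont_def)
    have "\<forall>\<^sub>F s in at t. \<bar>c l m s - c l m t - (s - t) * d l m\<bar> \<le> e1 * \<bar>s - t\<bar>"
      if "l < ?h" "m < Q" for l m
    proof -
      have "((\<lambda>s. (c l m s - c l m t) / (s - t)) \<longlongrightarrow> d l m) (at t)"
        using d[OF that] by (simp add: has_field_derivative_iff)
      from tendstoD[OF this e1(1)] have "\<forall>\<^sub>F s in at t. \<bar>(c l m s - c l m t) / (s - t) - d l m\<bar> < e1"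
        by (simp add: dist_real_def)
      moreover have "\<forall>\<^sub>F s in at t. s \<noteq> t" by (simp add: eventually_at_filter)
      ultimately show ?thesis
      proof eventually_elim
        case (elim s)
        have "c l m s - c l m t - (s - t) * d l m = ((c l m s - c l m t) / (s - t) - d l m) * (s - t)"
          using elim by (simp add: field_simps)
        then have "\<bar>c l m s - c l m t - (s - t) * d l m\<bar> = \<bar>(c l m s - c l m t) / (s - t) - d l m\<bar> * \<bar>s - t\<bar>"
          by (simp add: abs_mult)
        also have "\<dots> \<le> e1 * \<bar>s - t\<bar>" using elim by (intro mult_right_mono) auto
        finally show ?case .
      qed
    qed
    then have "\<forall>\<^sub>F s in at t. \<forall>l\<in>{..<?h}. \<forall>m\<in>{..<Q}. \<bar>c l m s - c l m t - (s - t) * d l m\<bar> \<le> e1 * \<bar>s - t\<bar>"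
      by (intro eventually_ball_finite finite_lessThan ballI) auto
    moreover
    \<comment> \<open>Coordinates that differ at \<open>t\<close> stay farther apart than the
      matching distance, so in each direction a matched pair of points occupies coordinates with one
      common value at \<open>t\<close>.\<close>
    have gap: "\<forall>\<^sub>F s in at t. c l m t \<noteq> c l m' t \<longrightarrow> K * (\<Sum>l<?h. \<Sum>m<Q. \<bar>c l m s - c l m t\<bar>) < \<bar>c l m s - c l m' t\<bar>"
      if "l < ?h" "m < Q" "m' < Q" for l m m'
    proof (cases "c l m t = c l m' t")
      case False
      have "((\<lambda>s. \<bar>c l m s - c l m' t\<bar> - K * (\<Sum>l<?h. \<Sum>m<Q. \<bar>c l m s - c l m t\<bar>)) \<longlongrightarrow>
         \<bar>c l m t - c l m' t\<bar> - K * (\<Sum>l<?h. \<Sum>m<Q. \<bar>c l m t - c l m t\<bar>)) (at t)"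
        using that by (intro tendsto_intros lim) auto
      from order_tendstoD(1)[OF this, of 0] show ?thesis using False
        by (auto elim: eventually_mono)
    qed simp
    have "\<forall>\<^sub>F s in at t. \<forall>l\<in>{..<?h}. \<forall>m\<in>{..<Q}. \<forall>m'\<in>{..<Q}. c l m t \<noteq> c l m' t \<longrightarrow>
       K * (\<Sum>l<?h. \<Sum>m<Q. \<bar>c l m s - c l m t\<bar>) < \<bar>c l m s - c l m' t\<bar>"
      by (intro eventually_ball_finite finite_lessThan ballI gap) auto
    ultimately have "\<forall>\<^sub>F s in at t. s \<in> G \<longrightarrow> (\<exists>xs ys. mset xs = T s \<and> mset ys = T t \<and> length xs = length ys \<and>
        (\<forall>i<length xs. norm (xs ! i - ys ! i - (s - t) *\<^sub>R D (ys ! i)) \<le> e * \<bar>s - t\<bar>))"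
    proof eventually_elim
      case (elim s)
      show ?case
      proof
        assume sG: "s \<in> G"
        have "size (T s) = size (T t)" using sz sG tG by simp
        then obtain xs ys where xy: "mset xs = T s" "mset ys = T t" "length xs = length ys"
          "\<And>i. i < length xs \<Longrightarrow> norm (xs ! i - ys ! i) \<le> qdist (T s) (T t)"
          by (rule qdist_matching) blast
        have qd: "qdist (T s) (T t) \<le> K * (\<Sum>l<?h. \<Sum>m<Q. \<bar>c l m s - c l m t\<bar>)"
          using K(2)[of "T s" "T t"] sz sG tG c by simp
        have "norm (xs ! i - ys ! i - (s - t) *\<^sub>R D (ys ! i)) \<le> e * \<bar>s - t\<bar>" if i: "i < length xs" for i
        proof (cases "s = t")
          case True
          have "qdist (T s) (T t) \<le> 0" using qd True by simp
          then have "norm (xs ! i - ys ! i) \<le> 0" using xy(4)[OF i] by linarith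
          then show ?thesis using True by simp
        next
          case False
          let ?v = "(1 / (s - t)) *\<^sub>R (xs ! i - ys ! i)"
          have xin: "xs ! i \<in># T s" "ys ! i \<in># T t"
            using i xy(1,2,3) by (metis nth_mem set_mset_mset)+
          have "\<bar>(?v \<bullet> es ! l) / ?s - d l (SOME m. m < Q \<and> c l m t = (ys ! i \<bullet> es ! l) / ?s)\<bar> \<le> e1"
            if l: "l < ?h" for l
          proof -
            obtain m where m: "m < Q" "c l m s = (xs ! i \<bullet> es ! l) / ?s"
              using ex_almgren_xi_eq[OF xin(1), of es l] c sG sz l by auto
            have ex: "\<exists>m. m < Q \<and> c l m t = (ys ! i \<bullet> es ! l) / ?s"
              using ex_almgren_xi_eq[OF xin(2), of es l] c tG sz l by auto
            define m' where "m' = (SOME m. m < Q \<and> c l m t = (ys ! i \<bullet> es ! l) / ?s)"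
            have m': "m' < Q" "c l m' t = (ys ! i \<bullet> es ! l) / ?s"
              using someI_ex[OF ex] unfolding m'_def by auto
            have s1: "?s \<ge> 1" using l by simp
            have ne1: "norm (es ! l) = 1" using emb l by (auto simp: almgren_embedding_def)
            have "\<bar>c l m s - c l m' t\<bar> = \<bar>(xs ! i - ys ! i) \<bullet> es ! l\<bar> / ?s"
              unfolding m m' by (simp add: inner_diff_left diff_divide_distrib[symmetric])
            also have "\<dots> \<le> \<bar>(xs ! i - ys ! i) \<bullet> es ! l\<bar> / 1" using s1 by (intro divide_left_mono) auto
            also have "\<dots> \<le> norm (xs ! i - ys ! i)" using Cauchy_Schwarz_ineq2[of "xs ! i - ys ! i" "es ! l"] ne1 by simp
            also have "\<dots> \<le> K * (\<Sum>l<?h. \<Sum>m<Q. \<bar>c l m s - c l m t\<bar>)" using xy(4)[OF i] qd by simp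
            finally have eq: "c l m t = c l m' t" using elim(2) l m(1) m'(1) by (meson lessThan_iff not_less)
            then have dd: "d l m = d l m'" using cross l m(1) m'(1) by blast
            have "(?v \<bullet> es ! l) / ?s = (c l m s - c l m' t) / (s - t)"
              unfolding m m' by (simp add: inner_diff_left diff_divide_distrib mult.commute)
            then have "(?v \<bullet> es ! l) / ?s - d l m' = (c l m s - c l m t - (s - t) * d l m) / (s - t)"
              using False eq dd by (simp add: field_simps)
            then have "\<bar>(?v \<bullet> es ! l) / ?s - d l m'\<bar> = \<bar>c l m s - c l m t - (s - t) * d l m\<bar> / \<bar>s - t\<bar>"
              by (simp add: abs_divide)
            also have "\<dots> \<le> e1" using elim(1) l m(1) False by (simp add: divide_le_eq)
            finally show ?thesis by (simp add: m'_def)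
          qed
          then have "(\<Sum>l<?h. \<bar>(?v \<bullet> es ! l) / ?s - d l (SOME m. m < Q \<and> c l m t = (ys ! i \<bullet> es ! l) / ?s)\<bar>) \<le> (\<Sum>l<?h. e1)"
            by (intro sum_mono) auto
          then have "norm (?v - D (ys ! i)) \<le> B * (?h * e1)"
            unfolding D_def by (intro order_trans[OF B(2)] mult_left_mono B(1)) simp
          then have le: "norm (?v - D (ys ! i)) \<le> e" using e1(2) by linarith
          have "xs ! i - ys ! i - (s - t) *\<^sub>R D (ys ! i) = (s - t) *\<^sub>R (?v - D (ys ! i))"
            using False by (simp add: scaleR_right_diff_distrib)
          then have "norm (xs ! i - ys ! i - (s - t) *\<^sub>R D (ys ! i)) = \<bar>s - t\<bar> * norm (?v - D (ys ! i))"
            by simp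
          also have "\<dots> \<le> \<bar>s - t\<bar> * e" using le by (intro mult_left_mono) auto
          finally show ?thesis by (simp add: mult.commute)
        qed
        then show "\<exists>xs ys. mset xs = T s \<and> mset ys = T t \<and> length xs = length ys \<and>
        (\<forall>i<length xs. norm (xs ! i - ys ! i - (s - t) *\<^sub>R D (ys ! i)) \<le> e * \<bar>s - t\<bar>)"
          using xy by blast
      qed
    qed
    then obtain r where r: "r > 0" "\<And>s. s \<noteq> t \<Longrightarrow> dist s t < r \<Longrightarrow> s \<in> G \<Longrightarrow> (\<exists>xs ys. mset xs = T s \<and> mset ys = T t \<and> length xs = length ys \<and>
        (\<forall>i<length xs. norm (xs ! i - ys ! i - (s - t) *\<^sub>R D (ys ! i)) \<le> e * \<bar>s - t\<bar>))"
      unfolding eventually_at by blast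
    obtain zs where zs: "mset zs = T t" using ex_mset by blast
    have "\<exists>xs ys. mset xs = T s \<and> mset ys = T t \<and> length xs = length ys \<and>
        (\<forall>i<length xs. norm (xs ! i - ys ! i - (s - t) *\<^sub>R D (ys ! i)) \<le> e * \<bar>s - t\<bar>)"
      if "s \<in> G" "\<bar>s - t\<bar> < r" for s
    proof (cases "s = t")
      case True
      show ?thesis by (rule exI[of _ zs], rule exI[of _ zs]) (simp add: zs True)
    next
      case False
      then show ?thesis using r(2)[OF False] that by (simp add: dist_real_def)
    qed
    then show "\<exists>d>0. \<forall>s\<in>G. \<bar>s - t\<bar> < d \<longrightarrow> (\<exists>xs ys. mset xs = T s \<and> mset ys = T t \<and> length xs = length ys \<and>
        (\<forall>i<length xs. norm (xs ! i - ys ! i - (s - t) *\<^sub>R D (ys ! i)) \<le> e * \<bar>s - t\<bar>))"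
      using r(1) by blast
  qed
  then show ?thesis by blast
qed

text \<open>Every matched pair obeys the chain rule, with constants uniform over the finitely many
  values at \<open>t\<close>. A symmetric sum can thus be differentiated although no sheet is
  selected.\<close>

lemma qdiff_sum_mset_derivative:
  fixes F :: "real \<times> 'e::euclidean_space \<Rightarrow> real"
  assumes qd: "qdiff T G t D"
    and F: "\<And>z. z \<in># T t \<Longrightarrow> (F has_derivative F' z) (at (t, z))"
  shows "((\<lambda>s. \<Sum>z\<in>#T s. F (s, z)) has_real_derivative (\<Sum>z\<in>#T t. F' z (1, D z))) (at t within G)"
proof -
  have single: "\<exists>d>0. \<exists>\<eta>>0. \<forall>s y. \<bar>s - t\<bar> < d \<and> norm (y - z - (s - t) *\<^sub>R D z) \<le> \<eta> * \<bar>s - t\<bar> \<longrightarrow>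
      \<bar>F (s, y) - F (t, z) - (s - t) * F' z (1, D z)\<bar> \<le> e * \<bar>s - t\<bar>"
    if z: "z \<in># T t" and e: "e > 0" for z e
  proof -
    have bl: "bounded_linear (F' z)" using F[OF z] by (rule has_derivative_bounded_linear)
    from bounded_linear.pos_bounded[OF bl] obtain N where N: "N > 0" "\<And>u. norm (F' z u) \<le> norm u * N" by blast
    \<comment> \<open>The displacement of a matched pair is at most
      \<open>(norm (D z) + 2) * |s - t|\<close>. With this \<open>e1\<close> the Taylor error takes
      half of \<open>e\<close>, and \<open>\<eta> * N \<le> e / 2\<close> leaves the other half for
      the deviation from the velocity.\<close>
    define e1 where "e1 = e / (2 * (norm (D z) + 2))"
    have e1: "e1 > 0" using e by (simp add: e1_def add_nonneg_pos)
    have "\<forall>e>0. \<exists>d>0. \<forall>w. norm (w - (t, z)) < d \<longrightarrow> norm (F w - F (t, z) - F' z (w - (t, z))) \<le> e * norm (w - (t, z))"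
      using F[OF z] unfolding has_derivative_at_alt by (rule conjunct2)
    from this[rule_format, OF e1] obtain d where d: "d > 0"
      "\<And>w. norm (w - (t, z)) < d \<Longrightarrow> norm (F w - F (t, z) - F' z (w - (t, z))) \<le> e1 * norm (w - (t, z))"
      by blast
    define \<eta> where "\<eta> = min 1 (e / (2 * N))"
    have \<eta>: "\<eta> > 0" "\<eta> \<le> 1" "\<eta> \<le> e / (2 * N)" using e N(1) by (simp_all add: \<eta>_def)
    have \<eta>N: "\<eta> * N \<le> e / 2" using mult_right_mono[OF \<eta>(3), of N] N(1) by simp
    have C: "norm (D z) + 2 > 0" by (simp add: add_nonneg_pos)
    have pos: "d / (norm (D z) + 2) > 0" using d C by simp
    have "\<bar>F (s, y) - F (t, z) - (s - t) * F' z (1, D z)\<bar> \<le> e * \<bar>s - t\<bar>"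
      if a: "\<bar>s - t\<bar> < d / (norm (D z) + 2) \<and> norm (y - z - (s - t) *\<^sub>R D z) \<le> \<eta> * \<bar>s - t\<bar>" for s y
    proof -
      let ?r = "y - z - (s - t) *\<^sub>R D z"
      have rr: "norm ?r \<le> \<eta> * \<bar>s - t\<bar>" using a by simp
      also have "\<dots> \<le> 1 * \<bar>s - t\<bar>" using \<eta> by (intro mult_right_mono) auto
      finally have r1: "norm ?r \<le> \<bar>s - t\<bar>" by simp
      have yz: "norm (y - z) \<le> norm ?r + norm ((s - t) *\<^sub>R D z)"
        using norm_triangle_ineq[of ?r "(s - t) *\<^sub>R D z"] by simp
      have "norm ((s, y) - (t, z)) \<le> \<bar>s - t\<bar> + norm (y - z)"
        using norm_Pair_le[of "s - t" "y - z"] by simp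
      have nn: "norm ((s, y) - (t, z)) \<le> (norm (D z) + 2) * \<bar>s - t\<bar>"
      proof -
        define P where "P = norm (D z) * \<bar>s - t\<bar>"
        have "norm ((s - t) *\<^sub>R D z) = P" by (simp add: P_def)
        moreover have "(norm (D z) + 2) * \<bar>s - t\<bar> = P + 2 * \<bar>s - t\<bar>" by (simp add: P_def distrib_right)
        moreover have "norm ((s, y) - (t, z)) \<le> norm ((s - t) *\<^sub>R D z) + 2 * \<bar>s - t\<bar>"
        proof -
          have "p \<le> S + 2 * a" if "p \<le> a + n" "n \<le> r + S" "r \<le> a" for p a n r S :: real
            using that by linarith
          from this[OF \<open>norm ((s, y) - (t, z)) \<le> \<bar>s - t\<bar> + norm (y - z)\<close> yz r1] show ?thesis .
        qed
        ultimately show ?thesis by simp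
      qed
      also have "\<dots> < d" using a C by (simp add: field_simps)
      finally have "norm (F (s, y) - F (t, z) - F' z ((s, y) - (t, z))) \<le> e1 * norm ((s, y) - (t, z))"
        by (rule d)
      also have "\<dots> \<le> e1 * ((norm (D z) + 2) * \<bar>s - t\<bar>)" using nn e1 by (intro mult_left_mono) auto
      also have "\<dots> = e / 2 * \<bar>s - t\<bar>" using C by (simp add: e1_def field_simps)
      finally have A: "\<bar>F (s, y) - F (t, z) - F' z ((s, y) - (t, z))\<bar> \<le> e / 2 * \<bar>s - t\<bar>" by simp
      have "linear (F' z)" using bl by (rule bounded_linear.linear)
      then have "F' z ((s - t) *\<^sub>R (1, D z) + (0, ?r)) = (s - t) * F' z (1, D z) + F' z (0, ?r)"
        by (simp only: linear_add linear_scale real_scaleR_def)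
      moreover have "(s - t) *\<^sub>R (1, D z) + (0, ?r) = (s, y) - (t, z)" by simp
      ultimately have "F' z ((s, y) - (t, z)) = (s - t) * F' z (1, D z) + F' z (0, ?r)" by metis
      moreover have "\<bar>F' z (0, ?r)\<bar> \<le> norm ?r * N" using N(2)[of "(0, ?r)"] by (simp add: norm_Pair)
      moreover have "norm ?r * N \<le> (\<eta> * \<bar>s - t\<bar>) * N" using rr N(1) by (intro mult_right_mono) auto
      moreover have "(\<eta> * \<bar>s - t\<bar>) * N \<le> e / 2 * \<bar>s - t\<bar>"
        using mult_right_mono[OF \<eta>N, of "\<bar>s - t\<bar>"] by (simp add: algebra_simps)
      ultimately show ?thesis using A by linarith
    qed
    then show ?thesis using pos \<eta>(1) by blast
  qed
  show ?thesis
    unfolding has_field_derivative_def has_derivative_within_alt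
  proof (intro conjI allI impI)
    show "bounded_linear ((*) (\<Sum>z\<in>#T t. F' z (1, D z)))" by (rule bounded_linear_mult_right)
    fix e :: real assume e: "e > 0"
    define q where "q = real (size (T t)) + 1"
    have q: "q > 0" by (simp add: q_def)
    then have eq: "e / q > 0" using e by simp
    have "\<exists>d \<eta>. d > 0 \<and> \<eta> > 0 \<and> (z \<in># T t \<longrightarrow> (\<forall>s y. \<bar>s - t\<bar> < d \<and> norm (y - z - (s - t) *\<^sub>R D z) \<le> \<eta> * \<bar>s - t\<bar> \<longrightarrow>
      \<bar>F (s, y) - F (t, z) - (s - t) * F' z (1, D z)\<bar> \<le> e / q * \<bar>s - t\<bar>))" for z
    proof (cases "z \<in># T t")
      case True
      then show ?thesis using single[OF True eq] by blast
    next
      case False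
      then show ?thesis by (intro exI[of _ 1]) simp
    qed
    then obtain d \<eta> where d\<eta>: "\<And>z. d z > 0" "\<And>z. \<eta> z > 0"
      "\<And>z s y. z \<in># T t \<Longrightarrow> \<bar>s - t\<bar> < d z \<Longrightarrow> norm (y - z - (s - t) *\<^sub>R D z) \<le> \<eta> z * \<bar>s - t\<bar> \<Longrightarrow>
      \<bar>F (s, y) - F (t, z) - (s - t) * F' z (1, D z)\<bar> \<le> e / q * \<bar>s - t\<bar>" by metis
    define d0 where "d0 = Min (insert 1 (d ` set_mset (T t)))"
    define \<eta>0 where "\<eta>0 = Min (insert 1 (\<eta> ` set_mset (T t)))"
    have d0: "d0 > 0" "\<And>z. z \<in># T t \<Longrightarrow> d0 \<le> d z" using d\<eta>(1) by (auto simp: d0_def)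
    have \<eta>0: "\<eta>0 > 0" "\<And>z. z \<in># T t \<Longrightarrow> \<eta>0 \<le> \<eta> z" using d\<eta>(2) by (auto simp: \<eta>0_def)
    obtain d1 where d1: "d1 > 0" "\<And>s. s \<in> G \<Longrightarrow> \<bar>s - t\<bar> < d1 \<Longrightarrow>
     (\<exists>xs ys. mset xs = T s \<and> mset ys = T t \<and> length xs = length ys \<and>
        (\<forall>i<length xs. norm (xs ! i - ys ! i - (s - t) *\<^sub>R D (ys ! i)) \<le> \<eta>0 * \<bar>s - t\<bar>))"
      using qd \<eta>0(1) unfolding qdiff_def by blast
    show "\<exists>d>0. \<forall>s\<in>G. norm (s - t) < d \<longrightarrow>
      norm ((\<Sum>z\<in>#T s. F (s, z)) - (\<Sum>z\<in>#T t. F (t, z)) - (\<Sum>z\<in>#T t. F' z (1, D z)) * (s - t)) \<le> e * norm (s - t)"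
    proof (intro exI[of _ "min d0 d1"] conjI ballI impI)
      show "min d0 d1 > 0" using d0 d1 by simp
      fix s assume s: "s \<in> G" "norm (s - t) < min d0 d1"
      obtain xs ys where xy: "mset xs = T s" "mset ys = T t" "length xs = length ys"
        "\<And>i. i < length xs \<Longrightarrow> norm (xs ! i - ys ! i - (s - t) *\<^sub>R D (ys ! i)) \<le> \<eta>0 * \<bar>s - t\<bar>"
        using d1(2)[of s] s by auto
      have tm: "\<bar>F (s, xs ! i) - F (t, ys ! i) - (s - t) * F' (ys ! i) (1, D (ys ! i))\<bar> \<le> e / q * \<bar>s - t\<bar>"
        if i: "i < length xs" for i
      proof (rule d\<eta>(3))
        show yi: "ys ! i \<in># T t" using i xy(2,3) by (metis nth_mem set_mset_mset)
        show "\<bar>s - t\<bar> < d (ys ! i)" using s d0(2)[OF yi] by simp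
        have "\<eta>0 * \<bar>s - t\<bar> \<le> \<eta> (ys ! i) * \<bar>s - t\<bar>" using \<eta>0(2)[OF yi] by (intro mult_right_mono) auto
        then show "norm (xs ! i - ys ! i - (s - t) *\<^sub>R D (ys ! i)) \<le> \<eta> (ys ! i) * \<bar>s - t\<bar>" using xy(4)[OF i] by linarith
      qed
      define X where "X = (\<Sum>z\<in>#T s. F (s, z)) - (\<Sum>z\<in>#T t. F (t, z)) - (\<Sum>z\<in>#T t. F' z (1, D z)) * (s - t)"
      have "X = (\<Sum>i<length xs. F (s, xs ! i) - F (t, ys ! i) - (s - t) * F' (ys ! i) (1, D (ys ! i)))"
        unfolding X_def xy(1,2)[symmetric] sum_mset_nth
        by (simp only: xy(3) sum_subtractf sum_distrib_left mult.commute)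
      then have "\<bar>X\<bar> \<le> (\<Sum>i<length xs. \<bar>F (s, xs ! i) - F (t, ys ! i) - (s - t) * F' (ys ! i) (1, D (ys ! i))\<bar>)"
        by (simp only: sum_abs)
      also have "\<dots> \<le> (\<Sum>i<length xs. e / q * \<bar>s - t\<bar>)"
        by (intro sum_mono tm) simp
      also have "\<dots> = (real (length xs) / q) * (e * \<bar>s - t\<bar>)" by simp
      also have "\<dots> \<le> 1 * (e * \<bar>s - t\<bar>)"
      proof (rule mult_right_mono)
        have "length xs = size (T t)" using xy by (metis size_mset)
        then show "real (length xs) / q \<le> 1" by (simp add: q_def)
      qed (use e in simp)
      finally show "norm ((\<Sum>z\<in>#T s. F (s, z)) - (\<Sum>z\<in>#T t. F (t, z)) - (\<Sum>z\<in>#T t. F' z (1, D z)) * (s - t)) \<le> e * norm (s - t)"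
        by (simp add: X_def)
    qed
  qed
qed

section \<open>Compactly supported test functions\<close>

text \<open>The smoothness half of \<open>Cc1\<close>, separated from the support because constants,
  linear maps and compositions have it without compact support.\<close>

definition C1 :: "('a::euclidean_space \<Rightarrow> 'b::euclidean_space) \<Rightarrow> bool" where
  "C1 f \<longleftrightarrow> (\<forall>x. f differentiable (at x)) \<and> (\<forall>h. continuous_on UNIV (\<lambda>x. frechet_derivative f (at x) h))"

lemma C1I:
  assumes "\<And>x. (f has_derivative f' x) (at x)" "\<And>h. continuous_on UNIV (\<lambda>x. f' x h)"
  shows "C1 f"
proof -
  have "frechet_derivative f (at x) = f' x" for x using frechet_derivative_at[OF assms(1)] by simp
  then show ?thesis using assms by (auto simp: C1_def differentiable_def)
qed

lemma C1D: "C1 f \<Longrightarrow> (f has_derivative frechet_derivative f (at x)) (at x)"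
  by (simp add: C1_def frechet_derivative_works[symmetric])

lemma C1_continuous: "C1 f \<Longrightarrow> continuous_on S f"
  by (meson C1D has_derivative_continuous continuous_at_imp_continuous_on)

lemma C1_linear: "C1 f \<Longrightarrow> linear (frechet_derivative f (at x))"
  using C1D has_derivative_linear by blast

text \<open>Continuity of the derivative is postulated for each fixed direction; expanding the
  direction in the basis gives it for directions that vary with the point.\<close>

lemma C1_derivative_continuous:
  assumes f: "C1 f" and y: "continuous_on S y" and v: "continuous_on S v"
  shows "continuous_on S (\<lambda>x. frechet_derivative f (at (y x)) (v x))"
proof -
  have eq: "frechet_derivative f (at (y x)) (v x) = (\<Sum>b\<in>Basis. (v x \<bullet> b) *\<^sub>R frechet_derivative f (at (y x)) b)" for x
  proof -
    note lin = C1_linear[OF f, of "y x"]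
    have "frechet_derivative f (at (y x)) (v x) = frechet_derivative f (at (y x)) (\<Sum>b\<in>Basis. (v x \<bullet> b) *\<^sub>R b)"
      by (simp add: euclidean_representation)
    also have "\<dots> = (\<Sum>b\<in>Basis. (v x \<bullet> b) *\<^sub>R frechet_derivative f (at (y x)) b)"
      by (simp add: linear_sum[OF lin] linear_scale[OF lin])
    finally show ?thesis .
  qed
  have "continuous_on UNIV (\<lambda>x. frechet_derivative f (at x) b)" for b using f by (simp add: C1_def)
  then have "continuous_on S (\<lambda>x. frechet_derivative f (at (y x)) b)" for b
    by (rule continuous_on_compose2[OF _ y]) simp
  then show ?thesis unfolding eq by (intro continuous_intros v)
qed

lemma C1_partial_continuous: "C1 f \<Longrightarrow> continuous_on S (\<lambda>x. frechet_derivative f (at x) h)"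
  by (rule C1_derivative_continuous) (auto intro: continuous_intros)

lemma C1_const: "C1 (\<lambda>x. c)"
  by (rule C1I[where f' = "\<lambda>x h. 0"]) auto

lemma C1_bounded_linear: "bounded_linear f \<Longrightarrow> C1 f"
  by (rule C1I[where f' = "\<lambda>x. f"]) (auto intro: bounded_linear_imp_has_derivative)

lemma C1_add: "C1 f \<Longrightarrow> C1 g \<Longrightarrow> C1 (\<lambda>x. f x + g x)"
  by (rule C1I[where f' = "\<lambda>x h. frechet_derivative f (at x) h + frechet_derivative g (at x) h"])
    (auto intro!: has_derivative_add C1D continuous_on_add C1_partial_continuous)

lemma C1_compose:
  assumes "C1 f" "C1 g" shows "C1 (\<lambda>x. f (g x))"
proof (rule C1I[where f' = "\<lambda>x h. frechet_derivative f (at (g x)) (frechet_derivative g (at x) h)"])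
  show "((\<lambda>x. f (g x)) has_derivative (\<lambda>h. frechet_derivative f (at (g x)) (frechet_derivative g (at x) h))) (at x)" for x
    using diff_chain_at[OF C1D[OF assms(2)] C1D[OF assms(1)]] by (simp add: o_def)
  show "continuous_on UNIV (\<lambda>x. frechet_derivative f (at (g x)) (frechet_derivative g (at x) h))" for h
    using assms by (intro C1_derivative_continuous C1_continuous C1_partial_continuous)
qed

lemma C1_bilinear:
  assumes "bounded_bilinear p" "C1 f" "C1 g" shows "C1 (\<lambda>x. p (f x) (g x))"
proof (rule C1I[where f' = "\<lambda>x h. p (f x) (frechet_derivative g (at x) h) + p (frechet_derivative f (at x) h) (g x)"])
  show "((\<lambda>x. p (f x) (g x)) has_derivative
      (\<lambda>h. p (f x) (frechet_derivative g (at x) h) + p (frechet_derivative f (at x) h) (g x))) (at x)" for x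
    by (rule bounded_bilinear.FDERIV[OF assms(1) C1D[OF assms(2)] C1D[OF assms(3)]])
  show "continuous_on UNIV (\<lambda>x. p (f x) (frechet_derivative g (at x) h) + p (frechet_derivative f (at x) h) (g x))" for h
    using assms(2,3) by (intro continuous_on_add bounded_bilinear.continuous_on[OF assms(1)] C1_continuous C1_partial_continuous)
qed

lemmas C1_mult = C1_bilinear[OF bounded_bilinear_mult]
lemmas C1_inner = C1_bilinear[OF bounded_bilinear_inner]
lemmas C1_scaleR = C1_bilinear[OF bounded_bilinear_scaleR]

lemma C1_ident: "C1 (\<lambda>x. x)" by (rule C1_bounded_linear) (rule bounded_linear_ident)

lemma C1_diff: "C1 f \<Longrightarrow> C1 g \<Longrightarrow> C1 (\<lambda>x. f x - g x)"
  using C1_add[of f "\<lambda>x. (-1) *\<^sub>R g x"] C1_scaleR[OF C1_const, of g "-1"] by simp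

lemma C1_inverse:
  fixes f :: "'a::euclidean_space \<Rightarrow> real"
  assumes f: "C1 f" and nz: "\<And>x. f x \<noteq> 0" shows "C1 (\<lambda>x. inverse (f x))"
proof (rule C1I[where f' = "\<lambda>x h. - (inverse (f x) * frechet_derivative f (at x) h * inverse (f x))"])
  show "((\<lambda>x. inverse (f x)) has_derivative (\<lambda>h. - (inverse (f x) * frechet_derivative f (at x) h * inverse (f x)))) (at x)" for x
    using Deriv.has_derivative_inverse[OF _ C1D[OF f]] nz by blast
  show "continuous_on UNIV (\<lambda>x. - (inverse (f x) * frechet_derivative f (at x) h * inverse (f x)))" for h
    using f nz by (intro continuous_on_minus continuous_on_mult continuous_on_inverse C1_continuous C1_partial_continuous) auto
qed

lemma C1_prod:
  fixes f :: "'i \<Rightarrow> 'a::euclidean_space \<Rightarrow> real"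
  assumes "finite I" "\<And>i. i \<in> I \<Longrightarrow> C1 (f i)" shows "C1 (\<lambda>x. \<Prod>i\<in>I. f i x)"
  using assms by (induction I) (auto intro: C1_const C1_mult)

text \<open>Squaring the positive part removes its kink at 0. This profile underlies the cutoffs of
  boxes and the bumps.\<close>

lemma pos_part_square_has_derivative: "((\<lambda>s::real. (max 0 s)\<^sup>2) has_derivative (\<lambda>h. 2 * max 0 s * h)) (at s)"
proof (cases s "0::real" rule: linorder_cases)
  case less
  have "((\<lambda>s::real. 0) has_derivative (\<lambda>h. 2 * max 0 s * h)) (at s)" using less by simp
  then show ?thesis
    by (rule has_derivative_transform_within_open[of _ _ _ _ "{..<0}"]) (use less in auto)
next
  case greater
  have "((\<lambda>s::real. s\<^sup>2) has_derivative (\<lambda>h. 2 * max 0 s * h)) (at s)"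
    using greater by (auto intro!: derivative_eq_intros)
  then show ?thesis
    by (rule has_derivative_transform_within_open[of _ _ _ _ "{0<..}"]) (use greater in auto)
next
  case equal
  have "((\<lambda>s::real. (max 0 s)\<^sup>2) has_derivative (\<lambda>h. 0)) (at 0)"
    unfolding has_derivative_at_alt
  proof (intro conjI allI impI)
    fix e :: real assume e: "e > 0"
    have "(max 0 y)\<^sup>2 \<le> e * \<bar>y\<bar>" if "\<bar>y\<bar> < e" for y :: real
    proof -
      have "(max 0 y)\<^sup>2 \<le> \<bar>y\<bar>\<^sup>2" by (intro power_mono) auto
      also have "\<dots> \<le> e * \<bar>y\<bar>" unfolding power2_eq_square using that by (intro mult_right_mono) auto
      finally show ?thesis .
    qed
    then show "\<exists>d>0. \<forall>y::real. norm (y - 0) < d \<longrightarrow> norm ((max 0 y)\<^sup>2 - (max 0 0)\<^sup>2 - 0) \<le> e * norm (y - 0)"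
      using e by (intro exI[of _ e]) simp
  qed simp
  then show ?thesis using equal by simp
qed

lemma C1_pos_part_square: "C1 (\<lambda>s::real. (max 0 s)\<^sup>2)"
  by (rule C1I[where f' = "\<lambda>s h. 2 * max 0 s * h"]) (rule pos_part_square_has_derivative, intro continuous_intros)

lemma Cc1_iff: "Cc1 U f \<longleftrightarrow> C1 f \<and> compact (closure {x. f x \<noteq> 0}) \<and> closure {x. f x \<noteq> 0} \<subseteq> U"
  by (auto simp: Cc1_def C1_def)

lemma Cc1_intro:
  assumes "C1 f" "compact K" "K \<subseteq> U" "\<And>x. x \<notin> K \<Longrightarrow> f x = 0"
  shows "Cc1 U f"
proof -
  have "closure {x. f x \<noteq> 0} \<subseteq> K"
    by (rule closure_minimal) (use assms in \<open>auto intro: compact_imp_closed\<close>)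
  moreover from this have "K \<inter> closure {x. f x \<noteq> 0} = closure {x. f x \<noteq> 0}" by blast
  then have "compact (closure {x. f x \<noteq> 0})"
    using compact_Int_closed[OF assms(2) closed_closure] by metis
  ultimately show ?thesis using assms by (auto simp: Cc1_iff)
qed

lemma Cc1_compact_support:
  assumes "Cc1 U f"
  obtains K where "compact K" "K \<subseteq> U" "\<And>x. x \<notin> K \<Longrightarrow> f x = 0"
    "\<And>x h. x \<notin> K \<Longrightarrow> frechet_derivative f (at x) h = 0"
proof (rule that[of "closure {x. f x \<noteq> 0}"])
  show "f x = 0" if "x \<notin> closure {x. f x \<noteq> 0}" for x using that closure_subset[of "{x. f x \<noteq> 0}"] by blast
  show "frechet_derivative f (at x) h = 0" if "x \<notin> closure {x. f x \<noteq> 0}" for x h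
  proof -
    have "((\<lambda>x. 0) has_derivative (\<lambda>h. 0)) (at x)" by simp
    then have "(f has_derivative (\<lambda>h. 0)) (at x)"
      by (rule has_derivative_transform_within_open[of _ _ _ _ "- closure {x. f x \<noteq> 0}"])
        (use that closure_subset[of "{x. f x \<noteq> 0}"] in auto)
    then have "(\<lambda>h. 0) = frechet_derivative f (at x)" by (rule frechet_derivative_at)
    from fun_cong[OF this, of h] show ?thesis by simp
  qed
qed (use assms in \<open>auto simp: Cc1_iff\<close>)

lemma C1_derivative_bound_compact:
  assumes f: "C1 f" and K: "compact K"
  obtains B where "B \<ge> 0" "\<And>x h. x \<in> K \<Longrightarrow> norm (frechet_derivative f (at x) h) \<le> B * norm h"
proof -
  have "bounded ((\<lambda>x. frechet_derivative f (at x) b) ` K)" for b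
    by (intro compact_imp_bounded compact_continuous_image C1_derivative_continuous f K continuous_intros)
  then have "\<forall>b. \<exists>B. \<forall>x\<in>K. norm (frechet_derivative f (at x) b) \<le> B" by (simp add: bounded_iff)
  then obtain B1 where B1: "\<And>b x. x \<in> K \<Longrightarrow> norm (frechet_derivative f (at x) b) \<le> B1 b" by metis
  show ?thesis
  proof (rule that[of "\<Sum>b\<in>Basis. \<bar>B1 b\<bar>"])
    show "(\<Sum>b\<in>Basis. \<bar>B1 b\<bar>) \<ge> 0" by (simp add: sum_nonneg)
    fix x h assume x: "x \<in> K"
    note lin = C1_linear[OF f, of x]
    have "frechet_derivative f (at x) h = frechet_derivative f (at x) (\<Sum>b\<in>Basis. (h \<bullet> b) *\<^sub>R b)"
      by (simp add: euclidean_representation)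
    also have "\<dots> = (\<Sum>b\<in>Basis. (h \<bullet> b) *\<^sub>R frechet_derivative f (at x) b)"
      by (simp add: linear_sum[OF lin] linear_scale[OF lin])
    finally have "norm (frechet_derivative f (at x) h) \<le> (\<Sum>b\<in>Basis. norm ((h \<bullet> b) *\<^sub>R frechet_derivative f (at x) b))"
      by (simp add: sum_norm_le)
    also have "\<dots> \<le> (\<Sum>b\<in>Basis. norm h * \<bar>B1 b\<bar>)"
    proof (rule sum_mono)
      fix b :: 'a assume "b \<in> Basis"
      then have "\<bar>h \<bullet> b\<bar> \<le> norm h" by (rule Basis_le_norm)
      moreover have "norm (frechet_derivative f (at x) b) \<le> \<bar>B1 b\<bar>" using B1[OF x, of b] by linarith
      ultimately show "norm ((h \<bullet> b) *\<^sub>R frechet_derivative f (at x) b) \<le> norm h * \<bar>B1 b\<bar>"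
        by (simp add: mult_mono)
    qed
    also have "\<dots> = (\<Sum>b\<in>Basis. \<bar>B1 b\<bar>) * norm h" by (simp add: sum_distrib_left mult.commute)
    finally show "norm (frechet_derivative f (at x) h) \<le> (\<Sum>b\<in>Basis. \<bar>B1 b\<bar>) * norm h" .
  qed
qed

lemma Cc1_bounded:
  assumes "Cc1 U f"
  obtains B where "\<And>x. norm (f x) \<le> B" "\<And>x h. norm (frechet_derivative f (at x) h) \<le> B * norm h" "B \<ge> 0"
proof -
  have f: "C1 f" using assms by (simp add: Cc1_iff)
  obtain K where K: "compact K" "K \<subseteq> U" "\<And>x. x \<notin> K \<Longrightarrow> f x = 0"
    "\<And>x h. x \<notin> K \<Longrightarrow> frechet_derivative f (at x) h = 0"
    by (rule Cc1_compact_support[OF assms]) (rule that)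
  have "bounded (f ` K)" by (intro compact_imp_bounded compact_continuous_image C1_continuous f K)
  then obtain B0 where B0: "\<And>x. x \<in> K \<Longrightarrow> norm (f x) \<le> B0" by (auto simp: bounded_iff)
  obtain B1 where B1: "B1 \<ge> 0" "\<And>x h. x \<in> K \<Longrightarrow> norm (frechet_derivative f (at x) h) \<le> B1 * norm h"
    by (rule C1_derivative_bound_compact[OF f K(1)]) (rule that)
  show ?thesis
  proof (rule that[of "\<bar>B0\<bar> + B1"])
    show nn: "\<bar>B0\<bar> + B1 \<ge> 0" using B1(1) by simp
    show "norm (f x) \<le> \<bar>B0\<bar> + B1" for x
    proof (cases "x \<in> K")
      case True
      then show ?thesis using B0[OF True] B1(1) by linarith
    qed (use K nn in auto)
    show "norm (frechet_derivative f (at x) h) \<le> (\<bar>B0\<bar> + B1) * norm h" for x h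
    proof (cases "x \<in> K")
      case True
      have "B1 * norm h \<le> (\<bar>B0\<bar> + B1) * norm h" by (intro mult_right_mono) auto
      then show ?thesis using B1(2)[OF True, of h] by linarith
    qed (use K nn in auto)
  qed
qed

section \<open>Approximation of boxes and the fundamental lemma of the calculus of
  variations\<close>

lemma Cc1_box_approximation:
  fixes a b :: "'a::euclidean_space"
  assumes "cbox a b \<subseteq> U"
  obtains \<phi> :: "nat \<Rightarrow> 'a \<Rightarrow> real" where "\<And>n. Cc1 U (\<phi> n)" "\<And>n x. \<bar>\<phi> n x\<bar> \<le> 1"
    "\<And>x. (\<lambda>n. \<phi> n x) \<longlonglongrightarrow> indicator (box a b) x"
proof -
  \<comment> \<open>A rational cutoff: it vanishes for \<open>s \<le> 0\<close> and increases to 1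
    with \<open>n\<close> for every \<open>s > 0\<close>, so products over the faces of a box
    converge boundedly to its indicator.\<close>
  define k where "k n s = 1 - inverse (1 + real n * (max 0 s)\<^sup>2)" for n and s :: real
  have pos: "1 + real n * (max 0 s)\<^sup>2 \<ge> 1" for n s by simp
  have k01: "0 \<le> k n s" "k n s \<le> 1" for n s
    using pos[of n s] by (auto simp: k_def intro: inverse_le_1_iff[THEN iffD2])
  have k0: "k n s = 0" if "s \<le> 0" for n s using that by (simp add: k_def)
  have C1p: "C1 (\<lambda>s. 1 + real n * (max 0 s)\<^sup>2)" for n
    by (intro C1_add C1_mult C1_const C1_pos_part_square)
  have kC: "C1 (k n)" for n
  proof -
    have "C1 (\<lambda>s. inverse (1 + real n * (max 0 s)\<^sup>2))"
    proof (rule C1_inverse[OF C1p])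
      show "1 + real n * (max 0 s)\<^sup>2 \<noteq> 0" for s using pos[of n s] by linarith
    qed
    then show ?thesis unfolding k_def by (intro C1_diff C1_const)
  qed
  have kl: "(\<lambda>n. k n s) \<longlonglongrightarrow> (if s > 0 then 1 else 0)" for s
  proof (cases "s > 0")
    case True
    have "filterlim (\<lambda>n. 1 + real n * (max 0 s)\<^sup>2) at_top sequentially"
      using True by (intro filterlim_tendsto_add_at_top[OF tendsto_const] filterlim_at_top_mult_tendsto_pos[OF tendsto_const _ filterlim_real_sequentially]) auto
    then have "(\<lambda>n. inverse (1 + real n * (max 0 s)\<^sup>2)) \<longlonglongrightarrow> 0"
      by (rule tendsto_inverse_0_at_top)
    then have "(\<lambda>n. 1 - inverse (1 + real n * (max 0 s)\<^sup>2)) \<longlonglongrightarrow> 1 - 0" by (intro tendsto_intros)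
    then show ?thesis using True by (simp add: k_def)
  qed (simp add: k0)
  define \<phi> where "\<phi> n x = (\<Prod>i\<in>Basis. k n (x \<bullet> i - a \<bullet> i) * k n (b \<bullet> i - x \<bullet> i))" for n x
  show ?thesis
  proof (rule that[of \<phi>])
    fix n
    have "C1 (\<phi> n)" unfolding \<phi>_def
      by (intro C1_prod C1_mult C1_compose[OF kC] C1_diff C1_inner C1_const C1_ident) auto
    then show "Cc1 U (\<phi> n)"
    proof (rule Cc1_intro[OF _ compact_cbox assms])
      fix x assume "x \<notin> cbox a b"
      then obtain i where "i \<in> Basis" "x \<bullet> i - a \<bullet> i \<le> 0 \<or> b \<bullet> i - x \<bullet> i \<le> 0" by (auto simp: mem_box not_le)
      then have "i \<in> Basis" "k n (x \<bullet> i - a \<bullet> i) * k n (b \<bullet> i - x \<bullet> i) = 0" using k0 by auto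
      then show "\<phi> n x = 0" unfolding \<phi>_def by (intro prod_zero) auto
    qed
  next
    fix n x
    have "0 \<le> \<phi> n x" unfolding \<phi>_def using k01 by (intro prod_nonneg) auto
    moreover have "\<phi> n x \<le> 1" unfolding \<phi>_def using k01 by (intro prod_le_1) (auto intro: mult_le_one)
    ultimately show "\<bar>\<phi> n x\<bar> \<le> 1" by simp
  next
    fix x
    have "(\<lambda>n. \<phi> n x) \<longlonglongrightarrow> (\<Prod>i\<in>Basis. (if x \<bullet> i - a \<bullet> i > 0 then 1 else 0) * (if b \<bullet> i - x \<bullet> i > 0 then 1 else 0))"
      unfolding \<phi>_def by (intro tendsto_prod tendsto_mult kl)
    also have "(\<Prod>i\<in>Basis. (if x \<bullet> i - a \<bullet> i > 0 then 1 else 0) * (if b \<bullet> i - x \<bullet> i > 0 then 1 else 0)) = (indicator (box a b) x :: real)"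
    proof (cases "x \<in> box a b")
      case True
      then show ?thesis by (auto simp: mem_box intro!: prod.neutral)
    next
      case False
      then obtain i where "i \<in> Basis" "\<not> (x \<bullet> i - a \<bullet> i > 0 \<and> b \<bullet> i - x \<bullet> i > 0)" by (auto simp: mem_box)
      then show ?thesis using False by (auto intro!: prod_zero)
    qed
    finally show "(\<lambda>n. \<phi> n x) \<longlonglongrightarrow> indicator (box a b) x" .
  qed
qed

text \<open>The positive and the negative part of \<open>h\<close> are densities of two measures
  that agree on open boxes. Boxes are stable under intersection and generate the Borel sets, so the
  measures coincide, and with them the densities.\<close>

lemma AE_zero_of_box_integrals:
  fixes h :: "'a::euclidean_space \<Rightarrow> real"
  assumes h: "integrable lborel h"
    and z: "\<And>a b. (\<integral>x. h x * indicator (box a b) x \<partial>lborel) = 0"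
  shows "AE x in lborel. h x = 0"
proof -
  let ?\<mu> = "density lborel (\<lambda>x. ennreal (h x))" and ?\<nu> = "density lborel (\<lambda>x. ennreal (- h x))"
  have hm[measurable]: "h \<in> borel_measurable lborel" using h by simp
  have hm'[measurable]: "h \<in> borel_measurable borel" using hm by simp
  have hi: "integrable lborel (\<lambda>x. h x * indicator (box a b) x)" for a b
    by (rule integrable_mult_indicator[OF _ h, unfolded real_scaleR_def, simplified mult.commute]) simp
  have fin: "(\<integral>\<^sup>+x. ennreal (h x) * indicator S x \<partial>lborel) < \<infinity>" "(\<integral>\<^sup>+x. ennreal (- h x) * indicator S x \<partial>lborel) < \<infinity>" for S
  proof -
    have "(\<integral>\<^sup>+x. ennreal (h x) * indicator S x \<partial>lborel) \<le> (\<integral>\<^sup>+x. norm (h x) \<partial>lborel)"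
      by (intro nn_integral_mono) (auto split: split_indicator intro: ennreal_leI)
    also have "\<dots> < \<infinity>" using h by (simp add: integrable_iff_bounded)
    finally show "(\<integral>\<^sup>+x. ennreal (h x) * indicator S x \<partial>lborel) < \<infinity>" .
    have "(\<integral>\<^sup>+x. ennreal (- h x) * indicator S x \<partial>lborel) \<le> (\<integral>\<^sup>+x. norm (h x) \<partial>lborel)"
      by (intro nn_integral_mono) (auto split: split_indicator intro: ennreal_leI)
    also have "\<dots> < \<infinity>" using h by (simp add: integrable_iff_bounded)
    finally show "(\<integral>\<^sup>+x. ennreal (- h x) * indicator S x \<partial>lborel) < \<infinity>" .
  qed
  have eq: "(\<integral>\<^sup>+x. ennreal (h x) * indicator (box a b) x \<partial>lborel) = (\<integral>\<^sup>+x. ennreal (- h x) * indicator (box a b) x \<partial>lborel)" for a b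
  proof -
    let ?P = "\<integral>\<^sup>+x. ennreal (h x) * indicator (box a b) x \<partial>lborel"
    let ?N = "\<integral>\<^sup>+x. ennreal (- h x) * indicator (box a b) x \<partial>lborel"
    have "0 = enn2real (\<integral>\<^sup>+x. ennreal (h x * indicator (box a b) x) \<partial>lborel) - enn2real (\<integral>\<^sup>+x. ennreal (- (h x * indicator (box a b) x)) \<partial>lborel)"
      using real_lebesgue_integral_def[OF hi, of a b] z[of a b] by simp
    also have "(\<lambda>x. ennreal (h x * indicator (box a b) x)) = (\<lambda>x. ennreal (h x) * indicator (box a b) x)"
      by (auto simp: fun_eq_iff split: split_indicator)
    also have "(\<lambda>x. ennreal (- (h x * indicator (box a b) x))) = (\<lambda>x. ennreal (- h x) * indicator (box a b) x)"
      by (auto simp: fun_eq_iff split: split_indicator)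
    finally have "enn2real ?P = enn2real ?N" by simp
    moreover have "?P < top" "?N < top" using fin[of "box a b"] by simp_all
    ultimately show ?thesis by (metis ennreal_enn2real)
  qed
  have "?\<mu> = ?\<nu>"
  proof (rule measure_eqI_generator_eq)
    let ?E = "range (\<lambda>(a, b). box a b :: 'a set)"
    show "Int_stable ?E" by (auto simp: Int_stable_def box_Int_box)
    show "?E \<subseteq> Pow UNIV" "sets ?\<mu> = sigma_sets UNIV ?E" "sets ?\<nu> = sigma_sets UNIV ?E"
      by (simp_all add: borel_eq_box sets_lborel)
    let ?A = "\<lambda>n::nat. box (- (real n *\<^sub>R One)) (real n *\<^sub>R One) :: 'a set"
    show "range ?A \<subseteq> ?E" by auto
    show "(\<Union>i. ?A i) = UNIV" unfolding UN_box_eq_UNIV ..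
    show "emeasure ?\<mu> (?A i) \<noteq> \<infinity>" for i
      using fin(1)[of "?A i"] by (subst emeasure_density) auto
    show "emeasure ?\<mu> X = emeasure ?\<nu> X" if "X \<in> ?E" for X
      using that eq by (auto simp: emeasure_density)
  qed
  then have "AE x in lborel. ennreal (h x) = ennreal (- h x)"
    by (intro sigma_finite_measure.density_unique[OF lborel.sigma_finite_measure_axioms]) auto
  then show ?thesis
  proof eventually_elim
    fix x assume eq: "ennreal (h x) = ennreal (- h x)"
    show "h x = 0"
    proof (cases "h x \<ge> 0")
      case True
      then have "ennreal (h x) = 0" using eq by (simp add: ennreal_neg)
      then show ?thesis using True by simp
    next
      case False
      then have "ennreal (- h x) = 0" using eq by (simp add: ennreal_neg)
      then show ?thesis using False by simp
    qed
  qed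
qed

text \<open>Bounded approximation by test functions gives vanishing integrals over all boxes whose
  closure lies in \<open>U\<close>. Cutting \<open>h\<close> off to one such box reduces to the
  criterion for arbitrary boxes, since intersections of boxes are boxes; countably many boxes then
  cover \<open>U\<close>.\<close>

lemma fundamental_lemma_calculus_of_variations:
  fixes h :: "'a::euclidean_space \<Rightarrow> real"
  assumes U: "open U" and h: "integrable lborel h"
    and weak: "\<And>\<phi>. Cc1 U \<phi> \<Longrightarrow> (\<integral>x. h x * \<phi> x \<partial>lborel) = 0"
  shows "AE x in lborel. x \<in> U \<longrightarrow> h x = 0"
proof -
  have box0: "(\<integral>x. h x * indicator (box a b) x \<partial>lborel) = 0" if ab: "cbox a b \<subseteq> U" for a b
  proof -
    obtain \<phi> :: "nat \<Rightarrow> 'a \<Rightarrow> real" where \<phi>: "\<And>n. Cc1 U (\<phi> n)" "\<And>n x. \<bar>\<phi> n x\<bar> \<le> 1"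
      "\<And>x. (\<lambda>n. \<phi> n x) \<longlonglongrightarrow> indicator (box a b) x" by (rule Cc1_box_approximation[OF ab]) (rule that)
    have [measurable]: "\<phi> n \<in> borel_measurable borel" for n
      using \<phi>(1) by (intro borel_measurable_continuous_onI C1_continuous) (simp add: Cc1_iff)
    have hm[measurable]: "h \<in> borel_measurable borel" using borel_measurable_integrable[OF h] by simp
    have "(\<lambda>n. \<integral>x. h x * \<phi> n x \<partial>lborel) \<longlonglongrightarrow> (\<integral>x. h x * indicator (box a b) x \<partial>lborel)"
    proof (rule integral_dominated_convergence[where w = "\<lambda>x. norm (h x)"])
      show "AE x in lborel. (\<lambda>n. h x * \<phi> n x) \<longlonglongrightarrow> h x * indicator (box a b) x"
        by (intro AE_I2 tendsto_mult tendsto_const \<phi>)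
      show "AE x in lborel. norm (h x * \<phi> n x) \<le> norm (h x)" for n
        using \<phi>(2) by (intro AE_I2) (simp add: abs_mult mult_left_le)
    qed (use h in auto)
    then show ?thesis using weak[OF \<phi>(1)] by (simp add: LIMSEQ_const_iff)
  qed
  have on_box: "AE x in lborel. x \<in> box a b \<longrightarrow> h x = 0" if ab: "cbox a b \<subseteq> U" for a b
  proof -
    have "AE x in lborel. h x * indicator (box a b) x = 0"
    proof (rule AE_zero_of_box_integrals)
      show "integrable lborel (\<lambda>x. h x * indicator (box a b) x)"
        by (rule integrable_mult_indicator[OF _ h, unfolded real_scaleR_def, simplified mult.commute]) simp
      fix c d :: 'a
      define a' where "a' = (\<Sum>i\<in>Basis. max (a \<bullet> i) (c \<bullet> i) *\<^sub>R i)"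
      define b' where "b' = (\<Sum>i\<in>Basis. min (b \<bullet> i) (d \<bullet> i) *\<^sub>R i)"
      have "box a b \<inter> box c d = box a' b'" by (simp add: box_Int_box a'_def b'_def)
      moreover have "cbox a' b' \<subseteq> cbox a b" by (auto simp: mem_box a'_def b'_def)
      ultimately show "(\<integral>x. h x * indicator (box a b) x * indicator (box c d) x \<partial>lborel) = 0"
        using box0[of a' b'] ab by (simp add: mult.assoc indicator_inter_arith[symmetric])
    qed
    then show ?thesis by eventually_elim (auto split: split_indicator_asm)
  qed
  obtain \<D> where \<D>: "countable \<D>" "\<D> \<subseteq> Pow U" "\<And>X. X \<in> \<D> \<Longrightarrow> \<exists>a b. X = cbox a b" "\<Union>\<D> = U"
    by (rule open_countable_Union_open_cbox[OF U]) (rule that)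
  have "AE x in lborel. \<forall>X\<in>\<D>. x \<in> X \<longrightarrow> h x = 0"
  proof (rule AE_ball_countable[THEN iffD2, OF \<D>(1)], rule ballI)
    fix X assume X: "X \<in> \<D>"
    then obtain a b where ab: "X = cbox a b" "cbox a b \<subseteq> U" using \<D>(2,3) by blast
    \<comment> \<open>The cover of \<open>U\<close> consists of closed boxes, whereas the conclusion
      so far is on open ones.\<close>
    have "negligible (cbox a b - box a b)" by (rule negligible_frontier_interval)
    then have "AE x in lebesgue. x \<notin> cbox a b - box a b"
      by (intro AE_not_in) (simp add: negligible_iff_null_sets)
    then have "AE x in lborel. x \<notin> cbox a b - box a b" by (simp add: AE_completion_iff)
    with on_box[OF ab(2)] show "AE x in lborel. x \<in> X \<longrightarrow> h x = 0"
      by eventually_elim (use ab in auto)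
  qed
  then show ?thesis by eventually_elim (use \<D>(4) in blast)
qed

section \<open>Rotations of the plane and weak derivatives along them\<close>

definition perp :: "real^2 \<Rightarrow> real^2" where "perp x = vector [- x $ 2, x $ 1]"

definition rot :: "real \<Rightarrow> real^2 \<Rightarrow> real^2" where "rot t x = cos t *\<^sub>R x + sin t *\<^sub>R perp x"

lemma perp_nth [simp]: "perp x $ 1 = - x $ 2" "perp x $ 2 = x $ 1"
  by (simp_all add: perp_def vector_2)

lemma vec2_eq_iff: "x = y \<longleftrightarrow> x $ 1 = y $ 1 \<and> x $ 2 = y $ 2" for x y :: "real^2"
  by (simp add: vec_eq_iff forall_2)

lemma inner_vec2: "x \<bullet> y = x $ 1 * y $ 1 + x $ 2 * y $ 2" for x y :: "real^2"
  by (simp add: inner_vec_def sum_2)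

lemma linear_perp: "linear perp"
  by (rule linearI) (simp_all add: vec2_eq_iff)

lemma bounded_linear_perp: "bounded_linear perp"
  using linear_perp by (simp add: linear_conv_bounded_linear)

lemma perp_perp [simp]: "perp (perp x) = - x" by (simp add: vec2_eq_iff)

lemma inner_perp [simp]: "perp x \<bullet> x = 0" "x \<bullet> perp x = 0" by (simp_all add: inner_vec2)

lemma inner_perp_perp [simp]: "perp x \<bullet> perp y = x \<bullet> y" by (simp add: inner_vec2)

lemma norm_perp [simp]: "norm (perp x) = norm x" by (simp add: norm_eq_sqrt_inner)

lemma perp_simps: "perp (x + y) = perp x + perp y" "perp (c *\<^sub>R x) = c *\<^sub>R perp x" "perp (- x) = - perp x" "perp 0 = 0"
  by (simp_all add: vec2_eq_iff)

lemma perp_decomposition: "(x \<bullet> x) *\<^sub>R h = (h \<bullet> x) *\<^sub>R x + (h \<bullet> perp x) *\<^sub>R perp x"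
  by (simp add: vec2_eq_iff inner_vec2 algebra_simps)

lemma rot_0 [simp]: "rot 0 x = x" by (simp add: rot_def)

lemma rot_add: "rot (s + t) x = rot s (rot t x)"
  by (simp add: rot_def cos_add sin_add perp_simps algebra_simps)

lemma rot_minus_cancel [simp]: "rot (- t) (rot t x) = x" "rot t (rot (- t) x) = x"
  using rot_add[of "-t" t x] rot_add[of t "-t" x] by simp_all

lemma rot_2pi: "rot (t + 2 * pi) x = rot t x" by (simp add: rot_def)

lemma perp_rot: "perp (rot t x) = rot t (perp x)" by (simp add: rot_def perp_simps)

lemma linear_rot: "linear (rot t)"
  unfolding rot_def by (rule linearI) (simp_all add: perp_simps algebra_simps)

lemma bounded_linear_rot: "bounded_linear (rot t)"
  using linear_rot by (simp add: linear_conv_bounded_linear)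

lemma norm_rot [simp]: "norm (rot t x) = norm x"
proof -
  have "rot t x \<bullet> rot t x = cos t * (cos t * (x \<bullet> x)) + sin t * (sin t * (x \<bullet> x))"
    by (simp add: rot_def inner_add_left inner_add_right)
  also have "\<dots> = ((cos t)\<^sup>2 + (sin t)\<^sup>2) * (x \<bullet> x)"
    by (simp only: power2_eq_square distrib_right mult.assoc)
  finally show ?thesis by (simp add: norm_eq_sqrt_inner)
qed

lemma rot_scaleR: "rot t (c *\<^sub>R x) = c *\<^sub>R rot t x"
  by (simp add: rot_def perp_simps algebra_simps)

lemma rot_has_vector_derivative: "((\<lambda>t. rot t x) has_vector_derivative perp (rot t x)) (at t within S)"
  unfolding rot_def by (auto intro!: derivative_eq_intros simp: perp_simps algebra_simps)

lemma continuous_on_perp [continuous_intros]: "continuous_on S f \<Longrightarrow> continuous_on S (\<lambda>x. perp (f x))"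
  by (rule bounded_linear.continuous_on[OF bounded_linear_perp])

lemma continuous_on_rot [continuous_intros]:
  fixes S :: "'a::t2_space set"
  shows "continuous_on S f \<Longrightarrow> continuous_on S g \<Longrightarrow> continuous_on S (\<lambda>x. rot (f x) (g x))"
  unfolding rot_def by (intro continuous_intros continuous_on_cos continuous_on_sin)

lemma measurable_rot [measurable (raw)]:
  assumes [measurable]: "f \<in> borel_measurable M" "g \<in> borel_measurable M"
  shows "(\<lambda>x. rot (f x) (g x)) \<in> borel_measurable M"
proof -
  have "continuous_on UNIV (\<lambda>p::real \<times> (real^2). rot (fst p) (snd p))" by (intro continuous_intros)
  then have [measurable]: "(\<lambda>p::real \<times> (real^2). rot (fst p) (snd p)) \<in> borel_measurable borel"
    by (rule borel_measurable_continuous_onI)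
  have "(\<lambda>x. (f x, g x)) \<in> borel_measurable M" by measurable
  from measurable_compose[OF this, of "\<lambda>p. rot (fst p) (snd p)" borel] show ?thesis by simp
qed

lemma orthogonal_transformation_rot: "orthogonal_transformation (rot t)"
  by (simp add: orthogonal_transformation linear_rot)

lemma distr_lborel_rot: "distr lborel lborel (rot t) = lborel"
proof (rule lborel_eqI[symmetric])
  fix l u :: "real^2" assume lu: "\<And>b. b \<in> Basis \<Longrightarrow> l \<bullet> b \<le> u \<bullet> b"
  have vim: "rot t -` box l u = rot (- t) ` box l u"
  proof (intro set_eqI iffI)
    fix x assume "x \<in> rot t -` box l u"
    then show "x \<in> rot (- t) ` box l u" by (intro image_eqI[of _ _ "rot t x"]) auto
  qed auto
  have "rot (- t) ` box l u \<in> lmeasurable"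
    by (rule measurable_orthogonal_image[OF orthogonal_transformation_rot]) simp
  moreover have "measure lebesgue (rot (- t) ` box l u) = measure lebesgue (box l u)"
    by (rule measure_orthogonal_image[OF orthogonal_transformation_rot]) simp
  ultimately have "emeasure lebesgue (rot (- t) ` box l u) = ennreal (measure lebesgue (box l u))"
    by (simp add: emeasure_eq_measure2)
  moreover have "rot t -` box l u \<in> sets borel"
    using measurable_sets[of "rot t" borel borel "box l u"] by simp
  ultimately have "emeasure lborel (rot t -` box l u) = ennreal (measure lborel (box l u))"
    by (simp add: vim)
  then show "emeasure (distr lborel lborel (rot t)) (box l u) = (\<Prod>b\<in>Basis. (u - l) \<bullet> b)"
    using lu by (subst emeasure_distr) (auto simp: measure_lborel_box_eq inner_diff_left)
qed simp

lemma integral_rot: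
  fixes f :: "real^2 \<Rightarrow> real"
  assumes "f \<in> borel_measurable borel"
  shows "(\<integral>x. f (rot t x) \<partial>lborel) = (\<integral>x. f x \<partial>lborel)"
  using integral_distr[of "rot t" lborel lborel f] assms by (simp add: distr_lborel_rot)

lemma integrable_rot:
  fixes f :: "real^2 \<Rightarrow> real"
  assumes "integrable lborel f"
  shows "integrable lborel (\<lambda>x. f (rot t x))"
  using integrable_distr[of "rot t" lborel lborel f] assms by (simp add: distr_lborel_rot)

lemma AE_rot:
  assumes "AE x in lborel. P x" shows "AE x in lborel. P (rot t x)"
proof -
  have "AE x in distr lborel lborel (rot t). P x" unfolding distr_lborel_rot by (rule assms)
  then show ?thesis by (rule AE_distrD[rotated]) simp
qed

lemma integrable_slab:
  fixes F :: "real \<times> (real^2) \<Rightarrow> real"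
  assumes [measurable]: "F \<in> borel_measurable (lborel \<Otimes>\<^sub>M lborel)"
    and int: "\<And>s. s \<in> {0..t} \<Longrightarrow> integrable lborel (\<lambda>x. F (s, x))"
    and bd: "\<And>s. s \<in> {0..t} \<Longrightarrow> (\<integral>x. norm (F (s, x)) \<partial>lborel) \<le> M"
    and out: "\<And>s x. s \<notin> {0..t} \<Longrightarrow> F (s, x) = 0"
  shows "integrable (lborel \<Otimes>\<^sub>M lborel) F"
proof (rule lborel_pair.Fubini_integrable)
  show "integrable lborel (\<lambda>s. \<integral>x. norm (F (s, x)) \<partial>lborel)"
  proof (rule Bochner_Integration.integrable_bound)
    show "integrable lborel (\<lambda>s. indicator {0..t} s *\<^sub>R M)"
      by (intro integrable_scaleR_left integrable_real_indicator) (simp_all add: emeasure_lborel_Icc_eq)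
    show "AE s in lborel. norm (\<integral>x. norm (F (s, x)) \<partial>lborel) \<le> norm (indicator {0..t} s *\<^sub>R M)"
    proof (rule AE_I2)
      fix s
      show "norm (\<integral>x. norm (F (s, x)) \<partial>lborel) \<le> norm (indicator {0..t} s *\<^sub>R M)"
      proof (cases "s \<in> {0..t}")
        case True
        have "0 \<le> (\<integral>x. norm (F (s, x)) \<partial>lborel)" by simp
        then show ?thesis using bd[OF True] True by simp
      next
        case False
        then show ?thesis by (simp add: out)
      qed
    qed
  qed measurable
  show "AE s in lborel. integrable lborel (\<lambda>x. F (s, x))"
  proof (rule AE_I2)
    fix s show "integrable lborel (\<lambda>x. F (s, x))"
      using int out by (cases "s \<in> {0..t}") auto
  qed
qed measurable

lemma integrable_rot_slab:
  fixes g :: "real^2 \<Rightarrow> real"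
  assumes g: "integrable lborel g"
  shows "integrable (lborel \<Otimes>\<^sub>M lborel) (\<lambda>(s, x). indicator {0..t} s * g (rot s x))"
proof (rule integrable_slab[where t = t and M = "\<integral>x. norm (g x) \<partial>lborel"])
  have [measurable]: "g \<in> borel_measurable borel" using borel_measurable_integrable[OF g] by simp
  show "(\<lambda>(s, x). indicator {0..t} s * g (rot s x)) \<in> borel_measurable (lborel \<Otimes>\<^sub>M lborel)" by measurable
  show "integrable lborel (\<lambda>x. case (s, x) of (s, x) \<Rightarrow> indicator {0..t} s * g (rot s x))" for s
    using integrable_rot[OF g, of s] by simp
  have eq: "(\<integral>x. norm (g (rot s x)) \<partial>lborel) = (\<integral>x. norm (g x) \<partial>lborel)" for s
    by (rule integral_rot) measurable
  show "(\<integral>x. norm (case (s, x) of (s, x) \<Rightarrow> indicator {0..t} s * g (rot s x)) \<partial>lborel) \<le> (\<integral>x. norm (g x) \<partial>lborel)"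
    if "s \<in> {0..t}" for s
    using that eq[of s] by (simp add: abs_mult)
qed auto

section \<open>Integrating a weak derivative along the rotation group\<close>

lemma Cc1_rot:
  assumes "Cc1 U \<phi>" and U: "\<And>t x. x \<in> U \<Longrightarrow> rot t x \<in> U"
  shows "Cc1 U (\<lambda>x. \<phi> (rot t x))"
proof -
  have \<phi>: "C1 \<phi>" using assms by (simp add: Cc1_iff)
  obtain K where K: "compact K" "K \<subseteq> U" "\<And>x. x \<notin> K \<Longrightarrow> \<phi> x = 0"
    "\<And>x h. x \<notin> K \<Longrightarrow> frechet_derivative \<phi> (at x) h = 0"
    by (rule Cc1_compact_support[OF assms(1)]) (rule that)
  show ?thesis
  proof (rule Cc1_intro)
    show "C1 (\<lambda>x. \<phi> (rot t x))" by (rule C1_compose[OF \<phi> C1_bounded_linear[OF bounded_linear_rot]])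
    show "compact (rot (- t) ` K)" by (intro compact_continuous_image K continuous_intros)
    show "rot (- t) ` K \<subseteq> U"
    proof (rule image_subsetI)
      fix x assume "x \<in> K"
      then have "x \<in> U" using K(2) by (rule rev_subsetD)
      then show "rot (- t) x \<in> U" by (rule U)
    qed
    show "\<phi> (rot t x) = 0" if "x \<notin> rot (- t) ` K" for x
    proof (rule K(3), rule notI)
      assume "rot t x \<in> K"
      then have "rot (- t) (rot t x) \<in> rot (- t) ` K" by (rule imageI)
      then show False using that by simp
    qed
  qed
qed

lemma mult_le_of_bound: "\<bar>v\<bar> \<le> B \<Longrightarrow> 0 \<le> u \<Longrightarrow> u * \<bar>v\<bar> \<le> B * u" for u v B :: real
  using mult_left_mono[of "\<bar>v\<bar>" B u] by (simp add: mult.commute)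

text \<open>Rotations preserve Lebesgue measure, so the weak identity may be tested with
  \<open>\<phi>\<close> rotated back by \<open>s\<close> and then integrated over \<open>s\<close>
  in \<open>[0, t]\<close>. On the side of \<open>f\<close> the derivatives of the test functions
  integrate to the difference of \<open>\<phi>\<close> and its rotated copy; on the side of
  \<open>g\<close> the rotation moves onto \<open>g\<close>. This replaces polar
  coordinates.\<close>

lemma weak_rot_derivative_integral:
  fixes f g :: "real^2 \<Rightarrow> real"
  assumes U: "\<And>t x. x \<in> U \<Longrightarrow> rot t x \<in> U"
    and f: "integrable lborel f" and g: "integrable lborel g"
    and weak: "\<And>\<phi>. Cc1 U \<phi> \<Longrightarrow> (\<integral>x. f x * frechet_derivative \<phi> (at x) (perp x) \<partial>lborel) = - (\<integral>x. g x * \<phi> x \<partial>lborel)"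
    and t: "0 \<le> t" and \<phi>: "Cc1 U \<phi>"
  shows "(\<integral>x. (f (rot t x) - f x - (\<integral>s. indicator {0..t} s * g (rot s x) \<partial>lborel)) * \<phi> x \<partial>lborel) = 0"
proof -
  have fm[measurable]: "f \<in> borel_measurable borel" and gm[measurable]: "g \<in> borel_measurable borel"
    using borel_measurable_integrable[OF f] borel_measurable_integrable[OF g] by simp_all
  have C1\<phi>: "C1 \<phi>" using \<phi> by (simp add: Cc1_iff)
  have [measurable]: "\<phi> \<in> borel_measurable borel"
    by (intro borel_measurable_continuous_onI C1_continuous C1\<phi>)
  obtain K where K: "compact K" "K \<subseteq> U" "\<And>x. x \<notin> K \<Longrightarrow> \<phi> x = 0"
    "\<And>x h. x \<notin> K \<Longrightarrow> frechet_derivative \<phi> (at x) h = 0"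
    by (rule Cc1_compact_support[OF \<phi>]) (rule that)
  obtain B where B: "\<And>x. norm (\<phi> x) \<le> B" "\<And>x h. norm (frechet_derivative \<phi> (at x) h) \<le> B * norm h" "B \<ge> 0"
    by (rule Cc1_bounded[OF \<phi>]) (rule that)
  have "\<exists>R. \<forall>x\<in>K. norm x \<le> R" using compact_imp_bounded[OF K(1)] by (simp only: bounded_iff)
  then obtain R where "\<forall>x\<in>K. norm x \<le> R" ..
  then have R: "norm x \<le> R" if "x \<in> K" for x using that by (rule bspec)
  \<comment> \<open>It has two readings: the derivative of the rotated test function along the
    rotation field at \<open>y\<close>, and minus its derivative in \<open>s\<close>. The first
    feeds the weak identity, the second the fundamental theorem of calculus.\<close>
  define h where "h s y = frechet_derivative \<phi> (at (rot (- s) y)) (perp (rot (- s) y))" for s y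
  have h_bd: "\<bar>h s y\<bar> \<le> B * \<bar>R\<bar>" for s y
  proof (cases "rot (- s) y \<in> K")
    case True
    have "\<bar>h s y\<bar> \<le> B * norm (perp (rot (- s) y))" unfolding h_def using B(2)[of "rot (- s) y" "perp (rot (- s) y)"] by simp
    also have "\<dots> \<le> B * \<bar>R\<bar>" using R[OF True] B(3) by (intro mult_left_mono) auto
    finally show ?thesis .
  next
    case False
    then show ?thesis using B(3) by (simp add: h_def K(4))
  qed
  have "continuous_on UNIV (\<lambda>p. h (fst p) (snd p))"
    unfolding h_def by (intro C1_derivative_continuous C1\<phi> continuous_intros)
  then have hm: "(\<lambda>p. h (fst p) (snd p)) \<in> borel_measurable borel" by (rule borel_measurable_continuous_onI)
  then have hm'[measurable]: "(\<lambda>(s, y). h s y) \<in> borel_measurable (lborel \<Otimes>\<^sub>M lborel)"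
    by (simp add: lborel_prod split_beta')
  have hs[measurable]: "h s \<in> borel_measurable borel" for s
    unfolding h_def by (intro borel_measurable_continuous_onI C1_derivative_continuous C1\<phi> continuous_intros)
  have h_cont: "continuous_on UNIV (\<lambda>s. h s y)" for y
    unfolding h_def by (intro C1_derivative_continuous C1\<phi> continuous_intros)
  have d\<phi>: "((\<lambda>s. \<phi> (rot (- s) y)) has_real_derivative - h s y) (at s)" for s y
  proof -
    have "((\<lambda>s. rot (- s) y) has_derivative (\<lambda>r. r *\<^sub>R - perp (rot (- s) y))) (at s)"
    proof -
      have "((\<lambda>s. - s) has_vector_derivative - 1) (at s)" by (auto intro!: derivative_eq_intros)
      from vector_diff_chain_at[OF this rot_has_vector_derivative, of y]
      show ?thesis by (simp add: o_def has_vector_derivative_def)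
    qed
    from diff_chain_at[OF this C1D[OF C1\<phi>]]
    have "((\<lambda>s. \<phi> (rot (- s) y)) has_derivative (\<lambda>r. frechet_derivative \<phi> (at (rot (- s) y)) (r *\<^sub>R - perp (rot (- s) y)))) (at s)"
      by (simp add: o_def)
    then show ?thesis unfolding has_field_derivative_def
    proof (rule has_derivative_eq_rhs)
      have "frechet_derivative \<phi> (at (rot (- s) y)) (r *\<^sub>R - perp (rot (- s) y)) = - h s y * r" for r
      using linear_scale[OF C1_linear[OF C1\<phi>], of "rot (- s) y" "-r" "perp (rot (- s) y)"] by (simp add: h_def)
      then show "(\<lambda>r. frechet_derivative \<phi> (at (rot (- s) y)) (r *\<^sub>R - perp (rot (- s) y))) = (*) (- h s y)"
        by blast
    qed
  qed
  have FTC: "(\<integral>s. indicator {0..t} s * h s y \<partial>lborel) = \<phi> y - \<phi> (rot (- t) y)" for y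
  proof -
    have "(\<integral>s. - h s y * indicator {0..t} s \<partial>lborel) = \<phi> (rot (- t) y) - \<phi> (rot (- 0) y)"
    proof (rule integral_FTC_Icc_real[OF t])
      show "((\<lambda>s. \<phi> (rot (- s) y)) has_real_derivative - h s y) (at s)" for s by (rule d\<phi>)
      show "isCont (\<lambda>s. - h s y) s" for s
        using h_cont[of y] by (intro continuous_intros) (simp add: continuous_on_eq_continuous_at)
    qed
    then show ?thesis by (simp add: mult.commute)
  qed
  have int1: "integrable (lborel \<Otimes>\<^sub>M lborel) (\<lambda>(s, y). indicator {0..t} s * (f y * h s y))"
  proof (rule integrable_slab[where t = t and M = "(\<integral>x. norm (f x) \<partial>lborel) * (B * \<bar>R\<bar>)"])
    show "(\<lambda>(s, y). indicator {0..t} s * (f y * h s y)) \<in> borel_measurable (lborel \<Otimes>\<^sub>M lborel)" by measurable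
    have i: "integrable lborel (\<lambda>y. f y * h s y)" for s
    proof (rule Bochner_Integration.integrable_bound)
      show "integrable lborel (\<lambda>y. norm (f y) * (B * \<bar>R\<bar>))" using f by simp
      show "AE y in lborel. norm (f y * h s y) \<le> norm (norm (f y) * (B * \<bar>R\<bar>))"
        using h_bd B(3) by (intro AE_I2) (auto simp: abs_mult intro!: mult_left_mono)
    qed simp
    then show "integrable lborel (\<lambda>x. case (s, x) of (s, y) \<Rightarrow> indicator {0..t} s * (f y * h s y))" for s by simp
    show "(\<integral>x. norm (case (s, x) of (s, y) \<Rightarrow> indicator {0..t} s * (f y * h s y)) \<partial>lborel)
       \<le> (\<integral>x. norm (f x) \<partial>lborel) * (B * \<bar>R\<bar>)" if "s \<in> {0..t}" for s
    proof -
      have "(\<integral>x. norm (f x * h s x) \<partial>lborel) \<le> (\<integral>x. norm (f x) * (B * \<bar>R\<bar>) \<partial>lborel)"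
      proof (rule integral_mono)
        show "integrable lborel (\<lambda>x. norm (f x * h s x))" by (rule integrable_norm[OF i])
        show "norm (f x * h s x) \<le> norm (f x) * (B * \<bar>R\<bar>)" for x
          unfolding norm_mult using h_bd[of s x] by (intro mult_left_mono) auto
      qed (use f in simp)
      then show ?thesis using that by simp
    qed
  qed auto
  have \<phi>s: "(\<integral>y. f y * h s y \<partial>lborel) = - (\<integral>x. g (rot s x) * \<phi> x \<partial>lborel)" for s
  proof -
    have "frechet_derivative (\<lambda>y. \<phi> (rot (- s) y)) (at y) (perp y) = h s y" for y
    proof -
      have "((\<lambda>y. \<phi> (rot (- s) y)) has_derivative (\<lambda>v. frechet_derivative \<phi> (at (rot (- s) y)) (rot (- s) v))) (at y)"
        using diff_chain_at[OF bounded_linear_imp_has_derivative[OF bounded_linear_rot] C1D[OF C1\<phi>]] by (simp add: o_def)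
      from frechet_derivative_at[OF this, symmetric] show ?thesis by (simp add: h_def perp_rot)
    qed
    then have "(\<integral>y. f y * h s y \<partial>lborel) = - (\<integral>y. g y * \<phi> (rot (- s) y) \<partial>lborel)"
      using weak[OF Cc1_rot[OF \<phi> U, of "- s"]] by simp
    also have "(\<integral>y. g y * \<phi> (rot (- s) y) \<partial>lborel) = (\<integral>x. g (rot s x) * \<phi> (rot (- s) (rot s x)) \<partial>lborel)"
      by (rule integral_rot[symmetric]) measurable
    finally show ?thesis by simp
  qed
  have int2: "integrable (lborel \<Otimes>\<^sub>M lborel) (\<lambda>(s, x). (indicator {0..t} s * g (rot s x)) * \<phi> x)"
  proof (rule Bochner_Integration.integrable_bound)
    show "integrable (lborel \<Otimes>\<^sub>M lborel) (\<lambda>p. B * (case p of (s, x) \<Rightarrow> indicator {0..t} s * g (rot s x)))"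
      by (intro integrable_mult_right integrable_rot_slab g)
    show "AE p in lborel \<Otimes>\<^sub>M lborel. norm (case p of (s, x) \<Rightarrow> (indicator {0..t} s * g (rot s x)) * \<phi> x)
         \<le> norm (B * (case p of (s, x) \<Rightarrow> indicator {0..t} s * g (rot s x)))"
      using B(1,3) by (intro AE_I2) (auto simp: abs_mult mult_le_of_bound split: prod.splits)
  qed measurable
  have fi: "integrable lborel (\<lambda>x. f x * u x)" if [measurable]: "u \<in> borel_measurable borel" and "\<And>x. \<bar>u x\<bar> \<le> B" for u
  proof (rule Bochner_Integration.integrable_bound)
    show "integrable lborel (\<lambda>x. B * f x)" using f by simp
    show "AE x in lborel. norm (f x * u x) \<le> norm (B * f x)"
      using that(2) B(3) by (intro AE_I2) (auto simp: abs_mult mult_le_of_bound)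
  qed simp
  have ir: "integrable lborel (\<lambda>x. f (rot t x) * \<phi> x)"
  proof -
    have "integrable lborel (\<lambda>x. f x * \<phi> (rot (-t) x))"
      by (rule fi[of "\<lambda>x. \<phi> (rot (-t) x)"]) (measurable, use B(1) in simp)
    from integrable_rot[OF this, of t] show ?thesis by simp
  qed
  have i0: "integrable lborel (\<lambda>x. f x * \<phi> x)" by (rule fi[of \<phi>]) (measurable, use B(1) in simp)
  have iG: "integrable lborel (\<lambda>x. (\<integral>s. indicator {0..t} s * g (rot s x) \<partial>lborel) * \<phi> x)"
    using lborel_pair.integrable_snd[OF int2] by simp
  define G where "G x = (\<integral>s. indicator {0..t} s * g (rot s x) \<partial>lborel)" for x
  have e1: "(\<integral>x. (f (rot t x) - f x) * \<phi> x \<partial>lborel) = (\<integral>x. f (rot t x) * \<phi> x \<partial>lborel) - (\<integral>x. f x * \<phi> x \<partial>lborel)"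
    using ir i0 by (simp add: left_diff_distrib)
  have e2: "(\<integral>x. f (rot t x) * \<phi> (rot (- t) (rot t x)) \<partial>lborel) = (\<integral>x. f x * \<phi> (rot (- t) x) \<partial>lborel)"
    by (rule integral_rot) measurable
  have e3: "(\<integral>x. f x * \<phi> (rot (- t) x) \<partial>lborel) - (\<integral>x. f x * \<phi> x \<partial>lborel) = (\<integral>x. f x * (\<phi> (rot (- t) x) - \<phi> x) \<partial>lborel)"
    using i0 fi[of "\<lambda>x. \<phi> (rot (- t) x)"] B(1) by (simp add: right_diff_distrib)
  have e4: "f x * (\<phi> (rot (- t) x) - \<phi> x) = - (\<integral>s. indicator {0..t} s * (f x * h s x) \<partial>lborel)" for x
  proof -
    have "(\<integral>s. indicator {0..t} s * (f x * h s x) \<partial>lborel) = f x * (\<integral>s. indicator {0..t} s * h s x \<partial>lborel)"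
      unfolding integral_mult_right_zero[symmetric] by (simp add: mult.left_commute)
    then show ?thesis unfolding FTC by (simp add: right_diff_distrib)
  qed
  have e5: "(\<integral>y. (\<integral>s. indicator {0..t} s * (f y * h s y) \<partial>lborel) \<partial>lborel)
     = (\<integral>s. (\<integral>y. indicator {0..t} s * (f y * h s y) \<partial>lborel) \<partial>lborel)"
    by (rule lborel_pair.Fubini_integral[OF int1])
  have e6: "(\<integral>y. indicator {0..t} s * (f y * h s y) \<partial>lborel) = - (\<integral>x. indicator {0..t} s * g (rot s x) * \<phi> x \<partial>lborel)" for s
    by (simp add: \<phi>s mult.assoc)
  have e7: "(\<integral>s. (\<integral>x. indicator {0..t} s * g (rot s x) * \<phi> x \<partial>lborel) \<partial>lborel)
     = (\<integral>x. (\<integral>s. indicator {0..t} s * g (rot s x) * \<phi> x \<partial>lborel) \<partial>lborel)"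
    by (rule lborel_pair.Fubini_integral[OF int2, symmetric])
  have e8: "(\<integral>s. indicator {0..t} s * g (rot s x) * \<phi> x \<partial>lborel) = G x * \<phi> x" for x
    by (simp add: G_def)
  have "(\<integral>x. (f (rot t x) - f x) * \<phi> x \<partial>lborel) = (\<integral>x. f x * (\<phi> (rot (- t) x) - \<phi> x) \<partial>lborel)"
    using e1 e2 e3 by simp
  also have "\<dots> = - (\<integral>y. (\<integral>s. indicator {0..t} s * (f y * h s y) \<partial>lborel) \<partial>lborel)"
    by (simp only: e4 Bochner_Integration.integral_minus)
  also have "\<dots> = - (\<integral>s. - (\<integral>x. indicator {0..t} s * g (rot s x) * \<phi> x \<partial>lborel) \<partial>lborel)"
    by (simp only: e5 e6)
  also have "\<dots> = (\<integral>x. G x * \<phi> x \<partial>lborel)"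
    by (simp only: Bochner_Integration.integral_minus minus_minus e7 e8)
  finally have "(\<integral>x. (f (rot t x) - f x) * \<phi> x \<partial>lborel) = (\<integral>x. G x * \<phi> x \<partial>lborel)" .
  then have "(\<integral>x. (f (rot t x) - f x) * \<phi> x \<partial>lborel) = (\<integral>x. (\<integral>s. indicator {0..t} s * g (rot s x) \<partial>lborel) * \<phi> x \<partial>lborel)"
    unfolding G_def .
  moreover have "integrable lborel (\<lambda>x. (f (rot t x) - f x) * \<phi> x)" using ir i0 by (simp add: left_diff_distrib)
  ultimately show ?thesis using iG by (simp add: left_diff_distrib)
qed

text \<open>For fixed \<open>t\<close> the fundamental lemma gives the identity at almost every
  \<open>x\<close>. Fubini's theorem exchanges the quantifiers, so that almost every starting point
  has it at almost every angle.\<close>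

lemma weak_rot_derivative_AE:
  fixes f g :: "real^2 \<Rightarrow> real"
  assumes U: "open U" "\<And>t x. x \<in> U \<Longrightarrow> rot t x \<in> U"
    and f: "integrable lborel f" and g: "integrable lborel g"
    and weak: "\<And>\<phi>. Cc1 U \<phi> \<Longrightarrow> (\<integral>x. f x * frechet_derivative \<phi> (at x) (perp x) \<partial>lborel) = - (\<integral>x. g x * \<phi> x \<partial>lborel)"
  shows "AE x in lborel. x \<in> U \<longrightarrow> (\<lambda>s. g (rot s x)) integrable_on {0..T} \<and> (\<lambda>s. \<bar>g (rot s x)\<bar>) integrable_on {0..T} \<and>
      (AE t in lborel. t \<in> {0..T} \<longrightarrow> f (rot t x) = f x + integral {0..t} (\<lambda>s. g (rot s x)))"
proof -
  have fm[measurable]: "f \<in> borel_measurable borel" and gm[measurable]: "g \<in> borel_measurable borel"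
    using borel_measurable_integrable[OF f] borel_measurable_integrable[OF g] by simp_all
  \<comment> \<open>Written with a condition so that joint measurability in \<open>t\<close> and
    \<open>x\<close> follows from the form of the integrand.\<close>
  define G where "G t x = (\<integral>s. (if 0 \<le> s \<and> s \<le> t then g (rot s x) else 0) \<partial>lborel)" for t x
  have Geq: "G t x = (\<integral>s. indicator {0..t} s * g (rot s x) \<partial>lborel)" for t x
    unfolding G_def by (intro Bochner_Integration.integral_cong) (auto split: split_indicator)
  have Gm[measurable]: "(\<lambda>(t, x). G t x) \<in> borel_measurable (lborel \<Otimes>\<^sub>M lborel)"
    unfolding G_def by measurable
  have each: "AE x in lborel. x \<in> U \<longrightarrow> f (rot t x) - f x - G t x = 0" if t: "0 \<le> t" for t
  proof (rule fundamental_lemma_calculus_of_variations[OF U(1)])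
    have "integrable lborel (G t)"
      using lborel_pair.integrable_snd[OF integrable_rot_slab[OF g, of t]] by (simp add: Geq[abs_def])
    then show "integrable lborel (\<lambda>x. f (rot t x) - f x - G t x)" using f integrable_rot[OF f] by simp
    fix \<phi> :: "real^2 \<Rightarrow> real" assume "Cc1 U \<phi>"
    from weak_rot_derivative_integral[OF U(2) f g weak t this]
    show "(\<integral>x. (f (rot t x) - f x - G t x) * \<phi> x \<partial>lborel) = 0" by (simp add: Geq)
  qed
  have Um[measurable]: "U \<in> sets borel" using U(1) by simp
  define P where "P t x \<longleftrightarrow> (x \<in> U \<longrightarrow> t \<in> {0..T} \<longrightarrow> f (rot t x) - f x - G t x = 0)" for t x
  define H where "H p = f (rot (fst p) (snd p)) - f (snd p) - G (fst p) (snd p)" for p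
  have "(\<lambda>p. G (fst p) (snd p)) \<in> borel_measurable (lborel \<Otimes>\<^sub>M lborel)" using Gm by (simp add: case_prod_beta')
  then have [measurable]: "H \<in> borel_measurable (lborel \<Otimes>\<^sub>M lborel)" unfolding H_def by measurable
  have "{p \<in> space (lborel \<Otimes>\<^sub>M lborel). snd p \<in> U \<longrightarrow> fst p \<in> {0..T} \<longrightarrow> H p = 0} \<in> sets (lborel \<Otimes>\<^sub>M lborel)"
    by measurable
  then have "{p \<in> space (lborel \<Otimes>\<^sub>M lborel). P (fst p) (snd p)} \<in> sets (lborel \<Otimes>\<^sub>M lborel)"
    by (simp only: P_def H_def)
  from lborel_pair.AE_commute[of P, OF this]
  have swap: "(AE t in lborel. AE x in lborel. P t x) \<longleftrightarrow> (AE x in lborel. AE t in lborel. P t x)" .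
  have P_each: "AE x in lborel. P t x" for t
  proof (cases "0 \<le> t")
    case True
    show ?thesis using each[OF True] by eventually_elim (unfold P_def, blast)
  qed (simp add: P_def)
  have "AE t in lborel. AE x in lborel. P t x" by (rule AE_I2) (rule P_each)
  then have "AE x in lborel. AE t in lborel. P t x" using swap by blast
  moreover have "AE x in lborel. integrable lborel (\<lambda>s. indicator {0..T} s * g (rot s x))"
    using lborel_pair.AE_integrable_snd[OF integrable_rot_slab[OF g, of T]] .
  ultimately show ?thesis
  proof eventually_elim
    case (elim x)
    show ?case
    proof
      assume xU: "x \<in> U"
      have si: "set_integrable lborel {0..T} (\<lambda>s. g (rot s x))"
        using elim(2) by (simp add: set_integrable_def)
      have "set_integrable lborel {0..T} (\<lambda>s. \<bar>g (rot s x)\<bar>)" using set_integrable_abs[OF si] .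
      note io = set_borel_integral_eq_integral(1)[OF si] set_borel_integral_eq_integral(1)[OF this]
      have Gint: "G t x = integral {0..t} (\<lambda>s. g (rot s x))" if "t \<in> {0..T}" for t
      proof -
        have "set_integrable lborel {0..t} (\<lambda>s. g (rot s x))"
          by (rule set_integrable_subset[OF si]) (use that in auto)
        from set_borel_integral_eq_integral(2)[OF this] show ?thesis
          by (simp add: Geq set_lebesgue_integral_def)
      qed
      have "AE t in lborel. t \<in> {0..T} \<longrightarrow> f (rot t x) = f x + integral {0..t} (\<lambda>s. g (rot s x))"
        using elim(1) by eventually_elim (use xU Gint in \<open>auto simp: P_def\<close>)
      then show "(\<lambda>s. g (rot s x)) integrable_on {0..T} \<and> (\<lambda>s. \<bar>g (rot s x)\<bar>) integrable_on {0..T} \<and>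
        (AE t in lborel. t \<in> {0..T} \<longrightarrow> f (rot t x) = f x + integral {0..t} (\<lambda>s. g (rot s x)))"
        using io by blast
    qed
  qed
qed

section \<open>Sobolev maps on circles\<close>

lemma AE_lborel_iff_negligible: "(AE x in lborel. P x) \<longleftrightarrow> negligible {x. \<not> P x}"
proof -
  have "(AE x in lborel. P x) \<longleftrightarrow> (AE x in lebesgue. P x)" by (simp add: AE_completion_iff)
  also have "\<dots> \<longleftrightarrow> negligible {x. \<not> P x}"
    by (auto simp: eventually_ae_filter_negligible intro: negligible_subset)
  finally show ?thesis .
qed

lemma AE_scaleR:
  assumes "AE x in lborel. P (x::'a::euclidean_space)" "c \<noteq> 0"
  shows "AE x in lborel. P (c *\<^sub>R x)"
proof -
  have "negligible ((\<lambda>x. (1 / c) *\<^sub>R x) ` {x. \<not> P x})"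
    using assms(1) unfolding AE_lborel_iff_negligible
    by (intro negligible_differentiable_image_negligible) (auto intro!: derivative_intros)
  moreover have "{x. \<not> P (c *\<^sub>R x)} \<subseteq> (\<lambda>x. (1 / c) *\<^sub>R x) ` {x. \<not> P x}"
  proof
    fix x assume "x \<in> {x. \<not> P (c *\<^sub>R x)}"
    then have "c *\<^sub>R x \<in> {x. \<not> P x}" by simp
    then have "(1 / c) *\<^sub>R (c *\<^sub>R x) \<in> (\<lambda>x. (1 / c) *\<^sub>R x) ` {x. \<not> P x}" by (rule imageI)
    then show "x \<in> (\<lambda>x. (1 / c) *\<^sub>R x) ` {x. \<not> P x}" using assms(2) by simp
  qed
  ultimately show ?thesis unfolding AE_lborel_iff_negligible by (rule negligible_subset)
qed

lemma AE_swap_measurable: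
  fixes P :: "'p::euclidean_space \<Rightarrow> 'a::euclidean_space \<Rightarrow> bool"
  assumes "{z \<in> space (lborel \<Otimes>\<^sub>M lborel). P (fst z) (snd z)} \<in> sets (lborel \<Otimes>\<^sub>M lborel)"
    and "\<And>p. AE x in lborel. P p x"
  shows "AE x in lborel. AE p in lborel. P p x"
proof -
  have "AE p in lborel. AE x in lborel. P p x" by (rule AE_I2) (rule assms(2))
  then show ?thesis using lborel_pair.AE_commute[of P, OF assms(1)] by blast
qed

text \<open>\<open>P\<close> may fail to be measurable; a Borel null set containing its failures is
  carried through Fubini's theorem instead. For rotations and spirals this says that almost every
  orbit meets a given null set only at a null set of parameters.\<close>

lemma AE_swap_action:
  fixes act :: "'p::euclidean_space \<Rightarrow> 'a::euclidean_space \<Rightarrow> 'a"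
  assumes act: "(\<lambda>z. act (fst z) (snd z)) \<in> borel_measurable (lborel \<Otimes>\<^sub>M lborel)"
    and pres: "\<And>p Q. AE x in lborel. Q x \<Longrightarrow> AE x in lborel. Q (act p x)"
    and P: "AE y in lborel. P y"
  shows "AE x in lborel. AE p in lborel. P (act p x)"
proof -
  obtain N where N: "{y \<in> space lborel. \<not> P y} \<subseteq> N" "emeasure lborel N = 0" "N \<in> sets lborel"
    using P by (rule AE_E)
  have Nb[measurable]: "N \<in> sets borel" using N(3) by simp
  note [measurable] = act
  have "AE y in lborel. y \<notin> N" using N by (intro AE_not_in) auto
  from pres[OF this] have each: "AE x in lborel. act p x \<notin> N" for p .
  have "{z \<in> space (lborel \<Otimes>\<^sub>M lborel). act (fst z) (snd z) \<notin> N} \<in> sets (lborel \<Otimes>\<^sub>M lborel)" by measurable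
  then have "AE x in lborel. AE p in lborel. act p x \<notin> N"
    by (rule AE_swap_measurable[of "\<lambda>p x. act p x \<notin> N"]) (rule each)
  then show ?thesis
  proof eventually_elim
    case (elim x)
    then show ?case by eventually_elim (use N(1) in auto)
  qed
qed

lemma AE_swap_rot: "AE y in lborel. P y \<Longrightarrow> AE x in lborel. AE t in lborel. P (rot t x)"
  by (rule AE_swap_action[of rot]) (measurable, rule AE_rot)

text \<open>Open, rotation invariant, with compact closure away from the origin: local Sobolev
  regularity applies on it, polar formulas are regular there, and homogeneity transports what holds
  there to the plane.\<close>

definition annulus :: "(real^2) set" where "annulus = {x. 1 < norm x \<and> norm x < 2}"

lemma open_annulus: "open annulus"
  unfolding annulus_def by (intro open_Collect_conj open_Collect_less continuous_intros)

lemma annulus_sets[measurable]: "annulus \<in> sets borel" "annulus \<in> sets lebesgue"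
  using open_annulus by auto

lemma rot_annulus [simp]: "rot t x \<in> annulus \<longleftrightarrow> x \<in> annulus" by (simp add: annulus_def)

lemma annulus_subset: "annulus \<subseteq> ball 0 2" "annulus \<subseteq> cball 0 2" by (auto simp: annulus_def)

lemma compactly_inside_annulus: "compactly_inside annulus UNIV"
proof -
  have "bounded annulus" using annulus_subset(1) bounded_subset bounded_ball by blast
  then show ?thesis using open_annulus by (simp add: compactly_inside_def)
qed

lemma lmeasurable_annulus: "annulus \<in> lmeasurable"
  by (rule bounded_set_imp_lmeasurable) (use annulus_subset(1) bounded_subset bounded_ball in \<open>blast, simp\<close>)

lemma integrable_annulus_const: "integrable (lebesgue_on annulus) (\<lambda>x. c::real)"
  using lmeasurable_annulus
  by (intro finite_measure.integrable_const finite_measureI)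
    (simp add: emeasure_restrict_space space_restrict_space fmeasurable_def top.not_eq_extremum)

lemma L2_on_annulus_integrable:
  assumes "L2_on annulus f" shows "integrable (lebesgue_on annulus) f"
proof (rule Bochner_Integration.integrable_bound)
  show "integrable (lebesgue_on annulus) (\<lambda>x. 1 + (f x)\<^sup>2)"
    using assms integrable_annulus_const[of 1] by (simp add: L2_on_def)
  show "f \<in> borel_measurable (lebesgue_on annulus)" using assms by (simp add: L2_on_def)
  have "\<bar>y\<bar> \<le> 1 + y\<^sup>2" for y :: real
    using sum_squares_bound[of 1 "\<bar>y\<bar>"] by simp
  then show "AE x in lebesgue_on annulus. norm (f x) \<le> norm (1 + (f x)\<^sup>2)"
    by (intro AE_I2) (simp add: add_nonneg_nonneg)
qed

lemma AE_annulus_iff: "(AE x in lebesgue_on annulus. P x) \<longleftrightarrow> (AE x in lborel. x \<in> annulus \<longrightarrow> P x)"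
  by (simp add: AE_restrict_space_iff AE_completion_iff)

text \<open>Sobolev functions are only Lebesgue measurable, whereas composition with rotations and
  joint measurability call for Borel functions.\<close>

lemma borel_representative:
  fixes f :: "real^2 \<Rightarrow> real"
  assumes "f \<in> borel_measurable (lebesgue_on annulus)"
  obtains f0 where "f0 \<in> borel_measurable borel" "AE x in lborel. x \<in> annulus \<longrightarrow> f0 x = f x"
    "\<And>x. x \<notin> annulus \<Longrightarrow> f0 x = 0"
proof -
  have "(\<lambda>x. indicator annulus x *\<^sub>R f x) \<in> borel_measurable lebesgue"
    using assms by (subst (asm) borel_measurable_restrict_space_iff) auto
  then obtain f1 where f1: "f1 \<in> borel_measurable lborel" "AE x in lborel. indicator annulus x *\<^sub>R f x = f1 x"
    using completion_ex_borel_measurable_real by blast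
  show ?thesis
  proof (rule that[of "\<lambda>x. indicator annulus x * f1 x"])
    show "(\<lambda>x. indicator annulus x * f1 x) \<in> borel_measurable borel" using f1(1) by simp
    show "AE x in lborel. x \<in> annulus \<longrightarrow> indicator annulus x * f1 x = f x"
      using f1(2) by eventually_elim auto
  qed simp
qed

lemma integral_annulus_representative:
  fixes f f0 u :: "real^2 \<Rightarrow> real"
  assumes f0: "f0 \<in> borel_measurable borel" "AE x in lborel. x \<in> annulus \<longrightarrow> f0 x = f x"
    "\<And>x. x \<notin> annulus \<Longrightarrow> f0 x = 0"
    and u: "u \<in> borel_measurable borel" and fm: "f \<in> borel_measurable (lebesgue_on annulus)"
  shows "(\<integral>x. f x * u x \<partial>lebesgue_on annulus) = (\<integral>x. f0 x * u x \<partial>lborel)"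
    and "integrable (lebesgue_on annulus) f \<Longrightarrow> integrable lborel f0"
proof -
  have fi: "(\<lambda>x. indicator annulus x *\<^sub>R f x) \<in> borel_measurable lebesgue"
    using fm by (subst (asm) borel_measurable_restrict_space_iff) auto
  have f0': "f0 \<in> borel_measurable lborel" using f0(1) by simp
  have ae: "AE x in lebesgue. indicator annulus x *\<^sub>R f x = f0 x"
    unfolding AE_completion_iff using f0(2) by eventually_elim (use f0(3) in \<open>auto split: split_indicator\<close>)
  have fi': "(\<lambda>x. indicator annulus x *\<^sub>R (f x * u x)) \<in> borel_measurable lebesgue"
  proof -
    have "u \<in> borel_measurable lborel" using u by simp
    then have "u \<in> borel_measurable lebesgue" by (rule measurable_completion)
    from borel_measurable_times[OF fi this] show ?thesis by (simp add: mult.assoc)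
  qed
  have "(\<integral>x. f x * u x \<partial>lebesgue_on annulus) = (\<integral>x. indicator annulus x *\<^sub>R (f x * u x) \<partial>lebesgue)"
    by (rule integral_restrict_space) simp
  also have "\<dots> = (\<integral>x. f0 x * u x \<partial>lebesgue)"
  proof (rule integral_cong_AE[OF fi'])
    show "(\<lambda>x. f0 x * u x) \<in> borel_measurable lebesgue"
      using f0(1) u by (intro measurable_completion) simp
    show "AE x in lebesgue. indicator annulus x *\<^sub>R (f x * u x) = f0 x * u x"
      using ae by eventually_elim (auto split: split_indicator)
  qed
  also have "\<dots> = (\<integral>x. f0 x * u x \<partial>lborel)"
    by (rule integral_completion) (use f0 u in simp)
  finally show "(\<integral>x. f x * u x \<partial>lebesgue_on annulus) = (\<integral>x. f0 x * u x \<partial>lborel)" .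
  assume "integrable (lebesgue_on annulus) f"
  then have "integrable lebesgue (\<lambda>x. indicator annulus x *\<^sub>R f x)"
    by (subst (asm) integrable_restrict_space) auto
  then have "integrable lebesgue f0"
    by (rule integrable_cong_AE_imp) (use f0' ae in \<open>auto intro: measurable_completion\<close>)
  then show "integrable lborel f0" using integrable_completion[OF f0'] by simp
qed

text \<open>\<open>c\<close> and \<open>\<gamma>\<close> come from Borel representatives. Their
  agreement with \<open>f\<close> and \<open>g\<close> off a null set of the plane becomes agreement
  at almost every angle of almost every circle.\<close>

lemma weak_rot_derivative_annulus:
  fixes f g :: "real^2 \<Rightarrow> real"
  assumes f: "integrable (lebesgue_on annulus) f" and g: "integrable (lebesgue_on annulus) g"
    and weak: "\<And>\<phi>. Cc1 annulus \<phi> \<Longrightarrow>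
      (\<integral>x. f x * frechet_derivative \<phi> (at x) (perp x) \<partial>lebesgue_on annulus) = - (\<integral>x. g x * \<phi> x \<partial>lebesgue_on annulus)"
  shows "AE x in lborel. x \<in> annulus \<longrightarrow> (\<exists>c \<gamma>. \<gamma> integrable_on {0..T} \<and> (\<lambda>s. \<bar>\<gamma> s\<bar>) integrable_on {0..T} \<and>
      (AE t in lborel. t \<in> {0..T} \<longrightarrow> f (rot t x) = c + integral {0..t} \<gamma> \<and> \<gamma> t = g (rot t x)))"
proof -
  have fm: "f \<in> borel_measurable (lebesgue_on annulus)" and gm: "g \<in> borel_measurable (lebesgue_on annulus)"
    using f g by auto
  obtain f0 where f0: "f0 \<in> borel_measurable borel" "AE x in lborel. x \<in> annulus \<longrightarrow> f0 x = f x"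
    "\<And>x. x \<notin> annulus \<Longrightarrow> f0 x = 0" by (rule borel_representative[OF fm]) (rule that)
  obtain g0 where g0: "g0 \<in> borel_measurable borel" "AE x in lborel. x \<in> annulus \<longrightarrow> g0 x = g x"
    "\<And>x. x \<notin> annulus \<Longrightarrow> g0 x = 0" by (rule borel_representative[OF gm]) (rule that)
  have "AE x in lborel. x \<in> annulus \<longrightarrow> (\<lambda>s. g0 (rot s x)) integrable_on {0..T} \<and> (\<lambda>s. \<bar>g0 (rot s x)\<bar>) integrable_on {0..T} \<and>
      (AE t in lborel. t \<in> {0..T} \<longrightarrow> f0 (rot t x) = f0 x + integral {0..t} (\<lambda>s. g0 (rot s x)))"
  proof (rule weak_rot_derivative_AE[OF open_annulus])
    show "integrable lborel f0"
      by (rule integral_annulus_representative(2)[OF f0 f0(1) fm f])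
    show "integrable lborel g0"
      by (rule integral_annulus_representative(2)[OF g0 g0(1) gm g])
    fix \<phi> :: "real^2 \<Rightarrow> real" assume \<phi>: "Cc1 annulus \<phi>"
    then have C1: "C1 \<phi>" by (simp add: Cc1_iff)
    have m1: "\<phi> \<in> borel_measurable borel" by (rule borel_measurable_continuous_onI[OF C1_continuous[OF C1]])
    have m2: "(\<lambda>x. frechet_derivative \<phi> (at x) (perp x)) \<in> borel_measurable borel"
      by (intro borel_measurable_continuous_onI C1_derivative_continuous[OF C1] continuous_intros)
    show "(\<integral>x. f0 x * frechet_derivative \<phi> (at x) (perp x) \<partial>lborel) = - (\<integral>x. g0 x * \<phi> x \<partial>lborel)"
      using weak[OF \<phi>] integral_annulus_representative(1)[OF f0 m2 fm] integral_annulus_representative(1)[OF g0 m1 gm]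
      by simp
  qed simp
  then show ?thesis using AE_swap_rot[OF f0(2)] AE_swap_rot[OF g0(2)]
  proof eventually_elim
    case (elim x)
    show ?case
    proof
      assume x: "x \<in> annulus"
      have "AE t in lborel. t \<in> {0..T} \<longrightarrow> f0 (rot t x) = f0 x + integral {0..t} (\<lambda>s. g0 (rot s x))"
        using elim(1) x by blast
      then have "AE t in lborel. t \<in> {0..T} \<longrightarrow> f (rot t x) = f0 x + integral {0..t} (\<lambda>s. g0 (rot s x)) \<and> g0 (rot t x) = g (rot t x)"
        using elim(2,3) by eventually_elim (use x in simp)
      then show "\<exists>c \<gamma>. \<gamma> integrable_on {0..T} \<and> (\<lambda>s. \<bar>\<gamma> s\<bar>) integrable_on {0..T} \<and>
          (AE t in lborel. t \<in> {0..T} \<longrightarrow> f (rot t x) = c + integral {0..t} \<gamma> \<and> \<gamma> t = g (rot t x))"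
        using elim(1) x by (intro exI[of _ "f0 x"] exI[of _ "\<lambda>s. g0 (rot s x)"]) blast
    qed
  qed
qed

lemma W12_real_annulus_rot:
  assumes f: "W12_real annulus f"
  shows "AE x in lborel. x \<in> annulus \<longrightarrow> (\<exists>c \<gamma>. \<gamma> integrable_on {0..T} \<and> (\<lambda>s. \<bar>\<gamma> s\<bar>) integrable_on {0..T} \<and>
      (AE t in lborel. t \<in> {0..T} \<longrightarrow> f (rot t x) = c + integral {0..t} \<gamma>))"
proof -
  have "\<forall>b\<in>Basis. \<exists>g. L2_on annulus g \<and> weak_partial annulus b f g" using f by (simp add: W12_real_def)
  then obtain g where g: "\<And>b. b \<in> Basis \<Longrightarrow> L2_on annulus (g b)" "\<And>b. b \<in> Basis \<Longrightarrow> weak_partial annulus b f (g b)"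
    by metis
  define g\<tau> where "g\<tau> x = (\<Sum>b\<in>Basis. g b x * (perp x \<bullet> b))" for x
  have fi: "integrable (lebesgue_on annulus) f" using f by (simp add: W12_real_def L2_on_annulus_integrable)
  have gi: "integrable (lebesgue_on annulus) (g b)" if "b \<in> Basis" for b
    using g(1)[OF that] by (rule L2_on_annulus_integrable)
  have prod: "integrable (lebesgue_on annulus) (\<lambda>x. h x * u x)"
    if h: "integrable (lebesgue_on annulus) h" and u: "continuous_on UNIV u" for h u :: "real^2 \<Rightarrow> real"
  proof -
    have "bounded (u ` cball 0 2)"
      by (intro compact_imp_bounded compact_continuous_image) (use u continuous_on_subset in \<open>blast, simp\<close>)
    then have "\<exists>B. \<forall>x\<in>cball 0 2. norm (u x) \<le> B" by (simp add: bounded_iff)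
    then obtain B where B: "\<forall>x\<in>cball 0 2. norm (u x) \<le> B" ..
    have um: "u \<in> borel_measurable (lebesgue_on annulus)"
      using borel_measurable_continuous_onI[OF u]
      by (intro measurable_restrict_space1 measurable_completion) simp
    show ?thesis
    proof (rule Bochner_Integration.integrable_bound)
      show "integrable (lebesgue_on annulus) (\<lambda>x. B * h x)" using h by simp
      show "(\<lambda>x. h x * u x) \<in> borel_measurable (lebesgue_on annulus)" using h um by simp
      show "AE x in lebesgue_on annulus. norm (h x * u x) \<le> norm (B * h x)"
      proof (rule AE_I2)
        fix x assume "x \<in> space (lebesgue_on annulus)"
        then have "x \<in> cball 0 2" using annulus_subset by (auto simp: space_restrict_space)
        from B[rule_format, OF this] have "\<bar>u x\<bar> \<le> \<bar>B\<bar>" by simp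
        then show "norm (h x * u x) \<le> norm (B * h x)"
          by (simp add: abs_mult mult.commute[of "\<bar>B\<bar>"] mult_left_mono)
      qed
    qed
  qed
  have gti: "integrable (lebesgue_on annulus) g\<tau>"
    unfolding g\<tau>_def by (intro Bochner_Integration.integrable_sum prod gi continuous_intros)
  have "AE x in lborel. x \<in> annulus \<longrightarrow> (\<exists>c \<gamma>. \<gamma> integrable_on {0..T} \<and> (\<lambda>s. \<bar>\<gamma> s\<bar>) integrable_on {0..T} \<and>
      (AE t in lborel. t \<in> {0..T} \<longrightarrow> f (rot t x) = c + integral {0..t} \<gamma> \<and> \<gamma> t = g\<tau> (rot t x)))"
  proof (rule weak_rot_derivative_annulus[OF fi gti])
    fix \<phi> :: "real^2 \<Rightarrow> real" assume \<phi>: "Cc1 annulus \<phi>"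
    then have C1: "C1 \<phi>" by (simp add: Cc1_iff)
    \<comment> \<open>The coefficient \<open>perp x \<bullet> b\<close> does not change in the
      direction \<open>b\<close>, because \<open>perp b \<bullet> b = 0\<close>. The rotation field
      is divergence free, so the partial derivatives combine to a derivative along it without a zero
      order term.\<close>
    define \<phi>b where "\<phi>b b x = (perp x \<bullet> b) * \<phi> x" for b x
    have lin: "bounded_linear (\<lambda>x. perp x \<bullet> b)" for b
      by (rule bounded_linear_compose[OF bounded_linear_inner_left bounded_linear_perp])
    have C1b: "C1 (\<phi>b b)" for b
      unfolding \<phi>b_def by (intro C1_mult C1_bounded_linear[OF lin] C1)
    obtain K where K: "compact K" "K \<subseteq> annulus" "\<And>x. x \<notin> K \<Longrightarrow> \<phi> x = 0"
      "\<And>x h. x \<notin> K \<Longrightarrow> frechet_derivative \<phi> (at x) h = 0"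
      by (rule Cc1_compact_support[OF \<phi>]) (rule that)
    have Cb: "Cc1 annulus (\<phi>b b)" for b
      by (rule Cc1_intro[OF C1b K(1,2)]) (simp add: \<phi>b_def K(3))
    have db: "frechet_derivative (\<phi>b b) (at x) b = (perp x \<bullet> b) * frechet_derivative \<phi> (at x) b" for b x
    proof -
      have "((\<phi>b b) has_derivative (\<lambda>h. (perp x \<bullet> b) * frechet_derivative \<phi> (at x) h + (perp h \<bullet> b) * \<phi> x)) (at x)"
        unfolding \<phi>b_def by (rule has_derivative_mult[OF bounded_linear_imp_has_derivative[OF lin] C1D[OF C1]])
      from frechet_derivative_at[OF this, symmetric] show ?thesis by simp
    qed
    have split: "frechet_derivative \<phi> (at x) (perp x) = (\<Sum>b\<in>Basis. frechet_derivative (\<phi>b b) (at x) b)" for x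
    proof -
      note l = C1_linear[OF C1, of x]
      have "frechet_derivative \<phi> (at x) (perp x) = frechet_derivative \<phi> (at x) (\<Sum>b\<in>Basis. (perp x \<bullet> b) *\<^sub>R b)"
        by (simp add: euclidean_representation)
      also have "\<dots> = (\<Sum>b\<in>Basis. (perp x \<bullet> b) *\<^sub>R frechet_derivative \<phi> (at x) b)"
        by (simp add: linear_sum[OF l] linear_scale[OF l])
      finally show ?thesis by (simp add: db)
    qed
    have "(\<integral>x. f x * frechet_derivative \<phi> (at x) (perp x) \<partial>lebesgue_on annulus)
       = (\<integral>x. (\<Sum>b\<in>Basis. f x * frechet_derivative (\<phi>b b) (at x) b) \<partial>lebesgue_on annulus)"
      by (simp only: split sum_distrib_left)
    also have "\<dots> = (\<Sum>b\<in>Basis. \<integral>x. f x * frechet_derivative (\<phi>b b) (at x) b \<partial>lebesgue_on annulus)"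
      by (intro Bochner_Integration.integral_sum prod[OF fi] C1_partial_continuous C1b)
    also have "\<dots> = (\<Sum>b\<in>Basis. - (\<integral>x. g b x * \<phi>b b x \<partial>lebesgue_on annulus))"
      using g(2) Cb by (intro sum.cong) (auto simp: weak_partial_def)
    also have "\<dots> = - (\<integral>x. (\<Sum>b\<in>Basis. g b x * \<phi>b b x) \<partial>lebesgue_on annulus)"
      by (subst Bochner_Integration.integral_sum) (auto intro!: prod[OF gi] C1_continuous C1b simp: sum_negf)
    also have "(\<integral>x. (\<Sum>b\<in>Basis. g b x * \<phi>b b x) \<partial>lebesgue_on annulus) = (\<integral>x. g\<tau> x * \<phi> x \<partial>lebesgue_on annulus)"
      by (simp add: g\<tau>_def \<phi>b_def sum_distrib_right mult.assoc)
    finally show "(\<integral>x. f x * frechet_derivative \<phi> (at x) (perp x) \<partial>lebesgue_on annulus) = - (\<integral>x. g\<tau> x * \<phi> x \<partial>lebesgue_on annulus)" .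
  qed
  then show ?thesis
  proof eventually_elim
    case (elim x)
    show ?case
    proof
      assume "x \<in> annulus"
      with elim obtain c \<gamma> where *: "\<gamma> integrable_on {0..T}" "(\<lambda>s. \<bar>\<gamma> s\<bar>) integrable_on {0..T}"
        "AE t in lborel. t \<in> {0..T} \<longrightarrow> f (rot t x) = c + integral {0..t} \<gamma> \<and> \<gamma> t = g\<tau> (rot t x)" by blast
      from *(3) have "AE t in lborel. t \<in> {0..T} \<longrightarrow> f (rot t x) = c + integral {0..t} \<gamma>" by eventually_elim blast
      with * show "\<exists>c \<gamma>. \<gamma> integrable_on {0..T} \<and> (\<lambda>s. \<bar>\<gamma> s\<bar>) integrable_on {0..T} \<and>
        (AE t in lborel. t \<in> {0..T} \<longrightarrow> f (rot t x) = c + integral {0..t} \<gamma>)" by blast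
    qed
  qed
qed

text \<open>An absolutely continuous multivalued curve. \<open>G\<close> is a set of good angles of
  full measure, since a Sobolev map is determined only almost everywhere, and \<open>g\<close>
  bounds the metric speed.\<close>

definition circle_regular :: "real \<Rightarrow> (real \<Rightarrow> 'e::euclidean_space multiset) \<Rightarrow> real set \<Rightarrow> (real \<Rightarrow> real) \<Rightarrow> bool" where
  "circle_regular L T G g \<longleftrightarrow> G \<subseteq> {0..L} \<and> negligible ({0..L} - G) \<and> g integrable_on {0..L} \<and> (\<forall>t. 0 \<le> g t) \<and>
     (\<forall>s\<in>G. \<forall>t\<in>G. s \<le> t \<longrightarrow> qdist (T t) (T s) \<le> integral {s..t} g) \<and>
     negligible {t \<in> G. \<not> (\<exists>D. qdiff T G t D)}"

text \<open>The Almgren coordinates are absolutely continuous on almost every circle. At an angle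
  where all of them are differentiable and no two meet with different speeds, the curve of multisets
  has a differential.\<close>

lemma W12_circle_regular:
  fixes T :: "real^2 \<Rightarrow> 'e::euclidean_space multiset"
  assumes T: "W12 annulus Q T" and Q: "Q \<ge> 1"
  shows "AE x in lborel. x \<in> annulus \<longrightarrow> (\<exists>G g. circle_regular L (\<lambda>t. T (rot t x)) G g)"
proof -
  from T obtain es where emb: "almgren_embedding Q es"
    and W: "\<And>l m. l < length es \<Longrightarrow> m < Q \<Longrightarrow> W12_real annulus (\<lambda>x. almgren_xi es l m (T x))"
    by (auto simp: W12_def)
  have sz: "size (T x) = Q" if "x \<in> annulus" for x using T that by (simp add: W12_def)
  let ?h = "length es"
  obtain K where K: "K > 0" "\<And>T S. size T = Q \<Longrightarrow> size S = Q \<Longrightarrow>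
    qdist T S \<le> K * (\<Sum>l<?h. \<Sum>m<Q. \<bar>almgren_xi es l m T - almgren_xi es l m (S::'e multiset)\<bar>)"
    by (rule almgren_embedding_lower[OF emb]) (rule that)
  define \<Phi> where "\<Phi> l m x c \<gamma> \<longleftrightarrow> \<gamma> integrable_on {0..L} \<and> (\<lambda>s. \<bar>\<gamma> s\<bar>) integrable_on {0..L} \<and>
      (AE t in lborel. t \<in> {0..L} \<longrightarrow> almgren_xi es l m (T (rot t x)) = c + integral {0..t} \<gamma>)" for l m x c \<gamma>
  have "AE x in lborel. \<forall>(l, m)\<in>{..<?h} \<times> {..<Q}. x \<in> annulus \<longrightarrow> (\<exists>c \<gamma>. \<Phi> l m x c \<gamma>)"
  proof (rule AE_ball_countable[THEN iffD2])
    show "\<forall>lm\<in>{..<?h} \<times> {..<Q}. AE x in lborel. case lm of (l, m) \<Rightarrow> x \<in> annulus \<longrightarrow> (\<exists>c \<gamma>. \<Phi> l m x c \<gamma>)"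
      using W12_real_annulus_rot[OF W, of _ _ L] by (auto simp: \<Phi>_def)
  qed (intro countable_finite finite_cartesian_product finite_lessThan)
  then show ?thesis
  proof eventually_elim
    case (elim x)
    show ?case
    proof
      assume x: "x \<in> annulus"
      have "\<forall>l m. \<exists>c \<gamma>. l < ?h \<and> m < Q \<longrightarrow> \<Phi> l m x c \<gamma>" using elim x by fastforce
      then obtain c0 \<gamma> where \<Phi>: "\<And>l m. l < ?h \<Longrightarrow> m < Q \<Longrightarrow> \<Phi> l m x (c0 l m) (\<gamma> l m)" by metis
      define c where "c l m t = c0 l m + integral {0..t} (\<gamma> l m)" for l m t
      define G where "G = {t \<in> {0..L}. \<forall>l<?h. \<forall>m<Q. almgren_xi es l m (T (rot t x)) = c l m t}"
      define g where "g t = K * (\<Sum>l<?h. \<Sum>m<Q. \<bar>\<gamma> l m t\<bar>)" for t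
      have int: "\<gamma> l m integrable_on {0..L}" "(\<lambda>s. \<bar>\<gamma> l m s\<bar>) integrable_on {0..L}" if "l < ?h" "m < Q" for l m
        using \<Phi>[OF that] by (auto simp: \<Phi>_def)
      have "circle_regular L (\<lambda>t. T (rot t x)) G g"
        unfolding circle_regular_def
      proof (intro conjI ballI allI impI)
        show "G \<subseteq> {0..L}" by (auto simp: G_def)
        have "negligible (\<Union>l<?h. \<Union>m<Q. {t. \<not> (t \<in> {0..L} \<longrightarrow> almgren_xi es l m (T (rot t x)) = c l m t)})"
        proof (intro negligible_Union ballI finite_imageI finite_lessThan)
          show "\<And>S. S \<in> (\<lambda>l. \<Union>m<Q. {t. \<not> (t \<in> {0..L} \<longrightarrow> almgren_xi es l m (T (rot t x)) = c l m t)}) ` {..<?h} \<Longrightarrow> negligible S"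
            using \<Phi> by (auto simp: \<Phi>_def c_def AE_lborel_iff_negligible intro!: negligible_Union)
        qed
        then show "negligible ({0..L} - G)" by (rule negligible_subset) (auto simp: G_def)
        show "g integrable_on {0..L}" unfolding g_def
          by (intro integrable_on_mult_right integrable_sum) (auto intro: int)
        show "0 \<le> g t" for t unfolding g_def using K(1) by (intro mult_nonneg_nonneg sum_nonneg) auto
        fix s t assume st: "s \<in> G" "t \<in> G" "s \<le> t"
        have ab: "0 \<le> s" "t \<le> L" using st by (auto simp: G_def)
        have sub: "h integrable_on {s..t}" if "h integrable_on {0..L}" for h :: "real \<Rightarrow> real"
          by (rule integrable_on_subinterval[OF that]) (use ab in auto)
        have sub0: "h integrable_on {0..t}" if "h integrable_on {0..L}" for h :: "real \<Rightarrow> real"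
          by (rule integrable_on_subinterval[OF that]) (use ab in auto)
        have diff: "\<bar>almgren_xi es l m (T (rot t x)) - almgren_xi es l m (T (rot s x))\<bar> \<le> integral {s..t} (\<lambda>r. \<bar>\<gamma> l m r\<bar>)"
          if lm: "l < ?h" "m < Q" for l m
        proof -
          have "integral {0..s} (\<gamma> l m) + integral {s..t} (\<gamma> l m) = integral {0..t} (\<gamma> l m)"
            by (rule Henstock_Kurzweil_Integration.integral_combine) (use ab st sub0 int lm in auto)
          then have "almgren_xi es l m (T (rot t x)) - almgren_xi es l m (T (rot s x)) = integral {s..t} (\<gamma> l m)"
            using st lm by (simp add: G_def c_def)
          also have "norm \<dots> \<le> integral {s..t} (\<lambda>r. \<bar>\<gamma> l m r\<bar>)"
            by (rule integral_norm_bound_integral) (use int lm in \<open>auto intro: sub\<close>)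
          finally show ?thesis by simp
        qed
        have "qdist (T (rot t x)) (T (rot s x)) \<le> K * (\<Sum>l<?h. \<Sum>m<Q. \<bar>almgren_xi es l m (T (rot t x)) - almgren_xi es l m (T (rot s x))\<bar>)"
          by (rule K(2)) (use x sz in auto)
        also have "\<dots> \<le> K * (\<Sum>l<?h. \<Sum>m<Q. integral {s..t} (\<lambda>r. \<bar>\<gamma> l m r\<bar>))"
          using K(1) diff by (intro mult_left_mono sum_mono) auto
        also have "(\<Sum>l<?h. \<Sum>m<Q. integral {s..t} (\<lambda>r. \<bar>\<gamma> l m r\<bar>)) = integral {s..t} (\<lambda>r. \<Sum>l<?h. \<Sum>m<Q. \<bar>\<gamma> l m r\<bar>)"
        proof -
          have "integral {s..t} (\<lambda>r. \<Sum>m<Q. \<bar>\<gamma> l m r\<bar>) = (\<Sum>m<Q. integral {s..t} (\<lambda>r. \<bar>\<gamma> l m r\<bar>))" if "l < ?h" for l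
            using that by (intro integral_sum) (auto intro: sub int)
          moreover have "integral {s..t} (\<lambda>r. \<Sum>l<?h. \<Sum>m<Q. \<bar>\<gamma> l m r\<bar>) = (\<Sum>l<?h. integral {s..t} (\<lambda>r. \<Sum>m<Q. \<bar>\<gamma> l m r\<bar>))"
            by (intro integral_sum integrable_sum) (auto intro: sub int)
          ultimately show ?thesis by simp
        qed
        also have "K * integral {s..t} (\<lambda>r. \<Sum>l<?h. \<Sum>m<Q. \<bar>\<gamma> l m r\<bar>) = integral {s..t} g"
          unfolding g_def by simp
        finally show "qdist (T (rot t x)) (T (rot s x)) \<le> integral {s..t} g" .
      next
        define X1 where "X1 l m = {t \<in> {0<..<L}. \<not> ((\<lambda>s. integral {0..s} (\<gamma> l m)) has_real_derivative \<gamma> l m t) (at t)}" for l m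
        define X2 where "X2 l m m' = {t. c l m t = c l m' t \<and> (\<exists>d d'. (c l m has_real_derivative d) (at t) \<and>
           (c l m' has_real_derivative d') (at t) \<and> d \<noteq> d')}" for l m m'
        have X1: "negligible (X1 l m)" if "l < ?h" "m < Q" for l m
          unfolding X1_def by (rule negligible_not_derivative_of_integral[OF int(1)[OF that]])
        have X2: "negligible (X2 l m m')" for l m m'
          unfolding X2_def negligible_iff_null_sets
          by (intro null_sets_completionI countable_imp_null_set_lborel countable_crossings)
        \<comment> \<open>Endpoints, angles where some coordinate is not differentiable, and the
          countably many crossings with different speeds.\<close>
        let ?N = "{0, L} \<union> (\<Union>(l, m)\<in>{..<?h} \<times> {..<Q}. X1 l m) \<union> (\<Union>(l, m, m')\<in>{..<?h} \<times> {..<Q} \<times> {..<Q}. X2 l m m')"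
        have "negligible ?N"
          by (intro negligible_Un negligible_Union finite_imageI finite_cartesian_product finite_lessThan)
            (use X1 X2 in auto)
        moreover have "{t \<in> G. \<not> (\<exists>D. qdiff (\<lambda>t. T (rot t x)) G t D)} \<subseteq> ?N"
        proof (rule subsetI, rule ccontr)
          fix t assume t: "t \<in> {t \<in> G. \<not> (\<exists>D. qdiff (\<lambda>t. T (rot t x)) G t D)}" and nN: "t \<notin> ?N"
          have tG: "t \<in> G" using t by simp
          have tL: "t \<in> {0<..<L}" using tG nN by (auto simp: G_def)
          have "\<exists>D. qdiff (\<lambda>t. T (rot t x)) G t D"
          proof (rule qdiff_of_almgren_derivatives[OF emb Q _ tG, where c = c and d = "\<lambda>l m. \<gamma> l m t"])
            show "size (T (rot s x)) = Q" for s using x by (simp add: sz)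
            show "c l m s = almgren_xi es l m (T (rot s x))" if "s \<in> G" "l < ?h" "m < Q" for s l m
              using that by (simp add: G_def)
            show deriv: "(c l m has_real_derivative \<gamma> l m t) (at t)" if "l < ?h" "m < Q" for l m
            proof -
              have "t \<notin> X1 l m" using nN that by blast
              then have "((\<lambda>s. integral {0..s} (\<gamma> l m)) has_real_derivative \<gamma> l m t) (at t)" using tL by (simp add: X1_def)
              from DERIV_add[OF DERIV_const this, of "c0 l m"] show ?thesis by (simp add: c_def[abs_def])
            qed
            fix l m m' assume lm: "l < ?h" "m < Q" "m' < Q" "c l m t = c l m' t"
            have "t \<notin> X2 l m m'" using nN lm by blast
            then show "\<gamma> l m t = \<gamma> l m' t" using lm deriv[OF lm(1,2)] deriv[OF lm(1,3)] unfolding X2_def by blast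
          qed
          then show False using t by blast
        qed
        ultimately show "negligible {t \<in> G. \<not> (\<exists>D. qdiff (\<lambda>t. T (rot t x)) G t D)}"
          by (rule negligible_subset)
      qed
      then show "\<exists>G g. circle_regular L (\<lambda>t. T (rot t x)) G g" by blast
    qed
  qed
qed

section \<open>Homogeneity under dilations and rotations\<close>

lemma sorted_list_of_multiset_scale:
  fixes c :: real assumes "0 \<le> c"
  shows "sorted_list_of_multiset (image_mset (\<lambda>a. c * a) M) = map (\<lambda>a. c * a) (sorted_list_of_multiset M)"
proof -
  have "sorted (map (\<lambda>a. c * a) (sorted_list_of_multiset M))"
    using assms by (intro sorted_map_mono sorted_sorted_list_of_multiset) (auto intro!: mono_onI mult_left_mono)
  then have "sorted_list_of_multiset (mset (map (\<lambda>a. c * a) (sorted_list_of_multiset M))) = map (\<lambda>a. c * a) (sorted_list_of_multiset M)"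
    by (simp only: sorted_list_of_multiset_mset sorted_sort_id)
  then show ?thesis by simp
qed

lemma almgren_xi_scale:
  assumes "0 \<le> c" "m < size T"
  shows "almgren_xi es l m (image_mset (\<lambda>a. c *\<^sub>R a) T) = c * almgren_xi es l m T"
proof -
  have "image_mset (\<lambda>p. p \<bullet> es ! l) (image_mset (\<lambda>a. c *\<^sub>R a) T) = image_mset (\<lambda>a. c * a) (image_mset (\<lambda>p. p \<bullet> es ! l) T)"
    by (simp add: multiset.map_comp o_def)
  moreover have "length (sorted_list_of_multiset (image_mset (\<lambda>p. p \<bullet> es ! l) T)) = size T"
    by (metis mset_sorted_list_of_multiset size_image_mset size_mset)
  ultimately show ?thesis
    unfolding almgren_xi_def using assms by (simp add: sorted_list_of_multiset_scale)
qed

lemma qdist_zero_imp_eq: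
  fixes S T :: "'e::euclidean_space multiset"
  assumes "size S = size T" "qdist S T \<le> 0" shows "S = T"
proof -
  obtain xs ys where xy: "mset xs = S" "mset ys = T" "length xs = length ys"
    "\<And>i. i < length xs \<Longrightarrow> norm (xs ! i - ys ! i) \<le> qdist S T"
    by (rule qdist_matching[OF assms(1)]) (rule that)
  have "xs ! i = ys ! i" if "i < length xs" for i
  proof -
    have "norm (xs ! i - ys ! i) \<le> 0" using xy(4)[OF that] assms(2) by linarith
    then show ?thesis by simp
  qed
  then have "xs = ys" using xy(3) by (simp add: list_eq_iff_nth_eq)
  then show ?thesis using xy by simp
qed

text \<open>Logarithmic polar coordinates with base point \<open>x\<close>: a translation of the
  parameters is a dilation combined with a rotation.\<close>

definition spiral :: "real \<times> real \<Rightarrow> real^2 \<Rightarrow> real^2" where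
  "spiral p x = exp (fst p) *\<^sub>R rot (snd p) x"

lemma measurable_spiral:
  "(\<lambda>z. spiral (fst z) (snd z)) \<in> borel_measurable (lborel \<Otimes>\<^sub>M lborel)"
proof -
  have "continuous_on UNIV (\<lambda>z. spiral (fst z) (snd z))"
    unfolding spiral_def by (intro continuous_intros)
  then show ?thesis by (simp add: lborel_prod borel_measurable_continuous_onI)
qed

lemma AE_spiral: "AE x in lborel. P x \<Longrightarrow> AE x in lborel. P (spiral p x)"
  unfolding spiral_def by (rule AE_rot[OF AE_scaleR]) auto

text \<open>Homogeneity has an exceptional null set for each dilation factor. Comparing Borel
  representatives of the Almgren coordinates makes the failures a measurable set in all variables,
  and Fubini's theorem then gives almost every starting point the relation at almost all
  parameters.\<close>

lemma homogeneous_spiral: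
  fixes w :: "real^2 \<Rightarrow> 'e::euclidean_space multiset"
  assumes W: "W12 annulus q w" and hom: "homogeneous_map \<sigma> w"
  shows "AE x in lborel. x \<in> annulus \<longrightarrow> (AE p in lborel. spiral p x \<in> annulus \<longrightarrow>
     w (spiral p x) = image_mset (\<lambda>a. exp (\<sigma> * fst p) *\<^sub>R a) (w (rot (snd p) x)))"
proof -
  from W obtain es where emb: "almgren_embedding q es"
    and Wr: "\<And>l m. l < length es \<Longrightarrow> m < q \<Longrightarrow> W12_real annulus (\<lambda>x. almgren_xi es l m (w x))"
    by (auto simp: W12_def)
  have sz: "size (w x) = q" if "x \<in> annulus" for x using W that by (simp add: W12_def)
  let ?h = "length es"
  obtain K where K: "K > 0" "\<And>T S. size T = q \<Longrightarrow> size S = q \<Longrightarrow>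
    qdist T S \<le> K * (\<Sum>l<?h. \<Sum>m<q. \<bar>almgren_xi es l m T - almgren_xi es l m (S::'e multiset)\<bar>)"
    by (rule almgren_embedding_lower[OF emb]) (rule that)
  define Rep where "Rep l m f0 \<longleftrightarrow> f0 \<in> borel_measurable borel \<and>
    (l < ?h \<longrightarrow> m < q \<longrightarrow> (AE x in lborel. x \<in> annulus \<longrightarrow> f0 x = almgren_xi es l m (w x)))" for l m f0
  have ex: "\<exists>f0. f0 \<in> borel_measurable borel \<and> (l < ?h \<longrightarrow> m < q \<longrightarrow> (AE x in lborel. x \<in> annulus \<longrightarrow> f0 x = almgren_xi es l m (w x)))" for l m
  proof (cases "l < ?h \<and> m < q")
    case True
    then have "(\<lambda>x. almgren_xi es l m (w x)) \<in> borel_measurable (lebesgue_on annulus)"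
      using Wr by (simp add: W12_real_def L2_on_def)
    then obtain f0 where "f0 \<in> borel_measurable borel" "AE x in lborel. x \<in> annulus \<longrightarrow> f0 x = almgren_xi es l m (w x)"
      by (rule borel_representative) (rule that)
    then show ?thesis by blast
  next
    case False
    then show ?thesis by (intro exI[of _ "\<lambda>x. 0"]) auto
  qed
  define f0 where "f0 l m = (SOME f0. Rep l m f0)" for l m
  have Rep: "Rep l m (f0 l m)" for l m
  proof -
    have "\<exists>f0. Rep l m f0" unfolding Rep_def by (rule ex)
    from someI_ex[OF this] show ?thesis unfolding f0_def .
  qed
  then have f0m: "\<And>l m. f0 l m \<in> borel_measurable borel"
    and f0: "\<And>l m. l < ?h \<Longrightarrow> m < q \<Longrightarrow> AE x in lborel. x \<in> annulus \<longrightarrow> f0 l m x = almgren_xi es l m (w x)"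
    by (simp_all add: Rep_def)
  have AEf0: "AE x in lborel. \<forall>l<?h. \<forall>m<q. x \<in> annulus \<longrightarrow> f0 l m x = almgren_xi es l m (w x)"
  proof -
    have "AE x in lborel. \<forall>l\<in>{..<?h}. \<forall>m\<in>{..<q}. x \<in> annulus \<longrightarrow> f0 l m x = almgren_xi es l m (w x)"
      by (intro AE_ball_countable[THEN iffD2] ballI countable_finite finite_lessThan f0) auto
    then show ?thesis by eventually_elim auto
  qed
  define P1 where "P1 x \<longleftrightarrow> (\<forall>l<?h. \<forall>m<q. x \<in> annulus \<longrightarrow> f0 l m x = almgren_xi es l m (w x))" for x
  have P1: "AE x in lborel. P1 x" unfolding P1_def by (rule AEf0)
  define H where "H p x \<longleftrightarrow> (x \<in> annulus \<longrightarrow> spiral p x \<in> annulus \<longrightarrow>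
     (\<forall>l\<in>{..<?h}. \<forall>m\<in>{..<q}. f0 l m (spiral p x) = exp (\<sigma> * fst p) * f0 l m (rot (snd p) x)))" for p x
  have "AE x in lborel. AE p in lborel. H p x"
  proof (rule AE_swap_measurable[of H])
    define M where "M = (lborel :: (real \<times> real) measure) \<Otimes>\<^sub>M (lborel :: (real^2) measure)"
    have ms: "(\<lambda>z. spiral (fst z) (snd z)) \<in> borel_measurable M"
      unfolding M_def by (rule measurable_spiral)
    have mr: "(\<lambda>z. rot (snd (fst z)) (snd z)) \<in> borel_measurable M"
      unfolding M_def lborel_prod measurable_lborel2 by (intro borel_measurable_continuous_onI continuous_intros)
    have me: "(\<lambda>z. exp (\<sigma> * fst (fst z))) \<in> borel_measurable M"
      unfolding M_def lborel_prod measurable_lborel2 by (intro borel_measurable_continuous_onI continuous_intros)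
    have mn: "snd \<in> borel_measurable M"
      unfolding M_def lborel_prod measurable_lborel2 by (intro borel_measurable_continuous_onI continuous_intros)
    define A where "A l m z = f0 l m (spiral (fst z) (snd z)) - exp (\<sigma> * fst (fst z)) * f0 l m (rot (snd (fst z)) (snd z))" for l m z
    have [measurable]: "A l m \<in> borel_measurable M" for l m
      unfolding A_def by (intro borel_measurable_diff borel_measurable_times me
          measurable_compose[OF ms f0m] measurable_compose[OF mr f0m])
    have [measurable]: "Measurable.pred M (\<lambda>z. snd z \<in> annulus)" "Measurable.pred M (\<lambda>z. spiral (fst z) (snd z) \<in> annulus)"
      by (rule pred_sets2[OF annulus_sets(1) mn], rule pred_sets2[OF annulus_sets(1) ms])
    have "{z \<in> space M. snd z \<in> annulus \<longrightarrow> spiral (fst z) (snd z) \<in> annulus \<longrightarrow>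
      (\<forall>l\<in>{..<?h}. \<forall>m\<in>{..<q}. A l m z = 0)} \<in> sets M"
      by measurable
    then show "{z \<in> space (lborel \<Otimes>\<^sub>M lborel). H (fst z) (snd z)} \<in> sets (lborel \<Otimes>\<^sub>M lborel)"
      by (simp only: H_def A_def M_def right_minus_eq)
    fix p :: "real \<times> real"
    have "AE x in lborel. w (exp (fst p) *\<^sub>R x) = image_mset (\<lambda>a. (exp (fst p) powr \<sigma>) *\<^sub>R a) (w x)"
      using hom by (simp add: homogeneous_map_def AE_completion_iff)
    then have "AE x in lborel. w (spiral p x) = image_mset (\<lambda>a. (exp (fst p) powr \<sigma>) *\<^sub>R a) (w (rot (snd p) x))"
      unfolding spiral_def by (rule AE_rot)
    then show "AE x in lborel. H p x"
      using AE_rot[OF P1, of "snd p"] AE_spiral[OF P1, of p]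
    proof eventually_elim
      case (elim x)
      have "exp (fst p) powr \<sigma> = exp (\<sigma> * fst p)" by (simp add: powr_def)
      with elim sz show ?case unfolding H_def P1_def
        by (simp add: almgren_xi_scale)
    qed
  qed
  moreover have "AE x in lborel. AE p in lborel. P1 (spiral p x)"
    by (rule AE_swap_action[where act = spiral and P = P1]) (rule measurable_spiral, erule AE_spiral, rule P1)
  moreover have "AE x in lborel. AE p::real \<times> real in lborel. P1 (rot (snd p) x)"
  proof -
    have "continuous_on UNIV (\<lambda>z::(real \<times> real) \<times> (real^2). rot (snd (fst z)) (snd z))" by (intro continuous_intros)
    then have m: "(\<lambda>z::(real \<times> real) \<times> (real^2). rot (snd (fst z)) (snd z)) \<in> borel_measurable (lborel \<Otimes>\<^sub>M lborel)"
      by (simp add: lborel_prod borel_measurable_continuous_onI)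
    show ?thesis
      by (rule AE_swap_action[where act = "\<lambda>p. rot (snd p)" and P = P1]) (rule m, erule AE_rot, rule P1)
  qed
  ultimately show ?thesis
  proof eventually_elim
    case (elim x)
    show ?case
    proof
      assume x: "x \<in> annulus"
      show "AE p in lborel. spiral p x \<in> annulus \<longrightarrow>
        w (spiral p x) = image_mset (\<lambda>a. exp (\<sigma> * fst p) *\<^sub>R a) (w (rot (snd p) x))"
        using elim
      proof eventually_elim
        case (elim p)
        show ?case
        proof
          assume sp: "spiral p x \<in> annulus"
          let ?S = "image_mset (\<lambda>a. exp (\<sigma> * fst p) *\<^sub>R a) (w (rot (snd p) x))"
          have s: "size (w (spiral p x)) = q" "size ?S = q" using sp x sz by simp_all
          have "almgren_xi es l m (w (spiral p x)) = almgren_xi es l m ?S" if "l < ?h" "m < q" for l m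
            using elim that sp x sz by (simp add: H_def P1_def almgren_xi_scale)
          then have "qdist (w (spiral p x)) ?S \<le> 0" using K(2)[OF s] by simp
          then show "w (spiral p x) = ?S" using s by (intro qdist_zero_imp_eq) auto
        qed
      qed
    qed
  qed
qed

section \<open>Approximate jets\<close>

text \<open>The ball of radius \<open>e * s\<close> around \<open>x + s *\<^sub>R v\<close> occupies
  the fraction \<open>(e / 2) ^ DIM('a)\<close> of the ball of radius \<open>2 * s\<close> around
  \<open>x\<close>. At small scales each of two sets of density one misses less than half of that
  fraction, so together they cannot avoid the small ball.\<close>

lemma density_one_meet:
  fixes x v :: "'a::euclidean_space"
  assumes F: "density_one F x" "density_one F' x" and v: "norm v = 1" and e: "0 < e" "e < 1"
  shows "\<exists>d>0. \<forall>s. 0 < s \<and> s < d \<longrightarrow> (\<exists>h. x + h \<in> F \<and> x + h \<in> F' \<and> norm (h - s *\<^sub>R v) < e * s)"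
proof -
  define \<kappa> where "\<kappa> = (e / 2) ^ DIM('a)"
  have \<kappa>: "\<kappa> > 0" using e by (simp add: \<kappa>_def)
  have half: "\<exists>d>0. \<forall>r. 0 < r \<and> r < d \<longrightarrow> measure lebesgue (H \<inter> ball x r) / measure lebesgue (ball x r) > 1 - \<kappa> / 2"
    if "density_one H x" for H
  proof -
    have "((\<lambda>r. measure lebesgue (H \<inter> ball x r) / measure lebesgue (ball x r)) \<longlongrightarrow> 1) (at_right 0)"
      using that by (simp add: density_one_def)
    from order_tendstoD(1)[OF this, of "1 - \<kappa> / 2"]
    have "\<forall>\<^sub>F r in at_right 0. 1 - \<kappa> / 2 < measure lebesgue (H \<inter> ball x r) / measure lebesgue (ball x r)"
      using \<kappa> by simp
    then show ?thesis unfolding eventually_at_right_field by auto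
  qed
  obtain d1 where d1: "d1 > 0" "\<And>r. 0 < r \<Longrightarrow> r < d1 \<Longrightarrow> measure lebesgue (F \<inter> ball x r) / measure lebesgue (ball x r) > 1 - \<kappa> / 2"
    using half[OF F(1)] by blast
  obtain d2 where d2: "d2 > 0" "\<And>r. 0 < r \<Longrightarrow> r < d2 \<Longrightarrow> measure lebesgue (F' \<inter> ball x r) / measure lebesgue (ball x r) > 1 - \<kappa> / 2"
    using half[OF F(2)] by blast
  have Fs: "F \<in> sets lebesgue" "F' \<in> sets lebesgue" using F by (auto simp: density_one_def)
  have "\<exists>h. x + h \<in> F \<and> x + h \<in> F' \<and> norm (h - s *\<^sub>R v) < e * s" if s: "0 < s" "s < min d1 d2 / 2" for s
  proof (rule ccontr)
    assume no: "\<not> (\<exists>h. x + h \<in> F \<and> x + h \<in> F' \<and> norm (h - s *\<^sub>R v) < e * s)"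
    let ?B = "ball x (2 * s)" and ?b = "ball (x + s *\<^sub>R v) (e * s)"
    have volB: "measure lebesgue ?B = unit_ball_vol (real DIM('a)) * (2 * s) ^ DIM('a)"
      using content_ball[of "2 * s" x] s by simp
    have volb: "measure lebesgue ?b = unit_ball_vol (real DIM('a)) * (e * s) ^ DIM('a)"
      using content_ball[of "e * s" "x + s *\<^sub>R v"] s e by simp
    have Bpos: "measure lebesgue ?B > 0" using s by (simp add: volB)
    have "(e * s) ^ DIM('a) = ((e / 2) * (2 * s)) ^ DIM('a)" by simp
    then have "(e * s) ^ DIM('a) = \<kappa> * (2 * s) ^ DIM('a)"
      by (simp only: \<kappa>_def power_mult_distrib)
    then have bk: "measure lebesgue ?b = \<kappa> * measure lebesgue ?B" by (simp add: volB volb)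
    have bB: "?b \<subseteq> ?B"
    proof
      fix y assume "y \<in> ?b"
      then have y: "norm (y - (x + s *\<^sub>R v)) < e * s" by (simp add: dist_norm norm_minus_commute)
      have "norm (y - x) \<le> norm (y - (x + s *\<^sub>R v)) + norm (s *\<^sub>R v)"
        using norm_triangle_ineq[of "y - (x + s *\<^sub>R v)" "s *\<^sub>R v"] by (simp add: algebra_simps)
      moreover have "e * s < s" using e s by simp
      moreover have "norm (s *\<^sub>R v) = s" using v s by simp
      ultimately have "norm (y - x) < 2 * s" using y by linarith
      then show "y \<in> ?B" by (simp add: dist_norm norm_minus_commute)
    qed
    have "?b \<subseteq> (?B - F) \<union> (?B - F')"
    proof
      fix y assume y: "y \<in> ?b"
      then have "norm ((y - x) - s *\<^sub>R v) < e * s" by (simp add: dist_norm norm_minus_commute algebra_simps)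
      then have "y \<notin> F \<or> y \<notin> F'" using no by (metis add.commute diff_add_cancel)
      then show "y \<in> (?B - F) \<union> (?B - F')" using y bB by blast
    qed
    moreover have BF: "?B - F \<in> lmeasurable" "?B - F' \<in> lmeasurable" using Fs by (simp_all add: fmeasurable_Diff)
    ultimately have "measure lebesgue ?b \<le> measure lebesgue ((?B - F) \<union> (?B - F'))"
      by (intro measure_mono_fmeasurable fmeasurable.Un) auto
    also have "\<dots> \<le> measure lebesgue (?B - F) + measure lebesgue (?B - F')"
      using BF by (intro measure_Un_le) auto
    also have "measure lebesgue (?B - F) = measure lebesgue ?B - measure lebesgue (F \<inter> ?B)"
    proof -
      have "?B - F = ?B - (F \<inter> ?B)" by blast
      moreover have "measure lebesgue (?B - (F \<inter> ?B)) = measure lebesgue ?B - measure lebesgue (F \<inter> ?B)"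
        using Fs by (intro measurable_measure_Diff) auto
      ultimately show ?thesis by simp
    qed
    also have "measure lebesgue (?B - F') = measure lebesgue ?B - measure lebesgue (F' \<inter> ?B)"
    proof -
      have "?B - F' = ?B - (F' \<inter> ?B)" by blast
      moreover have "measure lebesgue (?B - (F' \<inter> ?B)) = measure lebesgue ?B - measure lebesgue (F' \<inter> ?B)"
        using Fs by (intro measurable_measure_Diff) auto
      ultimately show ?thesis by simp
    qed
    finally have "\<kappa> * measure lebesgue ?B \<le> 2 * measure lebesgue ?B - measure lebesgue (F \<inter> ?B) - measure lebesgue (F' \<inter> ?B)"
      by (simp add: bk)
    moreover have "measure lebesgue (F \<inter> ?B) > (1 - \<kappa> / 2) * measure lebesgue ?B"
      using d1(2)[of "2 * s"] s Bpos by (simp add: less_divide_eq)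
    moreover have "measure lebesgue (F' \<inter> ?B) > (1 - \<kappa> / 2) * measure lebesgue ?B"
      using d2(2)[of "2 * s"] s Bpos by (simp add: less_divide_eq)
    ultimately show False by (simp add: algebra_simps)
  qed
  then show ?thesis using d1(1) d2(1) by (intro exI[of _ "min d1 d2 / 2"]) auto
qed

text \<open>Coinciding values carry the same matrix, so the matrix is a function of the value, and
  the multiset of jets is an image of the multiset of values.\<close>

lemma jet_multiset_eq:
  assumes "\<forall>a A B. (a, A) \<in># J \<and> (a, B) \<in># J \<longrightarrow> A = B"
  shows "J = image_mset (\<lambda>a. (a, SOME A. (a, A) \<in># J)) (image_mset fst J)"
proof -
  have "(fst z, SOME A. (fst z, A) \<in># J) = z" if "z \<in># J" for z
  proof -
    have "(fst z, snd z) \<in># J" using that by simp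
    then have "(fst z, SOME A. (fst z, A) \<in># J) \<in># J" by (rule someI)
    then have "(SOME A. (fst z, A) \<in># J) = snd z" using assms \<open>(fst z, snd z) \<in># J\<close> by blast
    then show ?thesis by simp
  qed
  then have "image_mset (\<lambda>z. (fst z, SOME A. (fst z, A) \<in># J)) J = image_mset (\<lambda>z. z) J"
    by (intro image_mset_cong) auto
  then show ?thesis by (simp add: multiset.map_comp o_def)
qed

text \<open>In a unit direction \<open>n\<close> with \<open>A *v n \<noteq> A' *v n\<close>, both
  density sets contain a point \<open>x + h\<close> with \<open>h\<close> close to
  \<open>s *\<^sub>R n\<close>. A sheet near \<open>a + A *v h\<close> there is also near some
  \<open>a' + B *v h\<close> of the other jet. For small \<open>h\<close> this forces
  \<open>a' = a\<close>, hence \<open>B = A'\<close>, and then the two linear parts differ by too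
  little.\<close>

lemma approx_jet_matrix_unique:
  fixes v :: "real^'n \<Rightarrow> (real^'k) multiset"
  assumes J: "approx_jet v x J" and J': "approx_jet v x J'"
    and U: "open U" "x \<in> U" "\<And>y. y \<in> U \<Longrightarrow> size (v y) = q"
    and aA: "(a, A) \<in># J" and aA': "(a, A') \<in># J'"
  shows "A = A'"
proof (rule ccontr)
  assume "A \<noteq> A'"
  then obtain u where u: "A *v u \<noteq> A' *v u" by (metis matrix_eq)
  then have "u \<noteq> 0" by auto
  define n where "n = (1 / norm u) *\<^sub>R u"
  have n: "norm n = 1" using \<open>u \<noteq> 0\<close> by (simp add: n_def)
  have "A *v n \<noteq> A' *v n"
    using u \<open>u \<noteq> 0\<close> by (simp add: n_def matrix_vector_mult_scaleR)
  define \<eta> where "\<eta> = norm ((A - A') *v n)"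
  have \<eta>: "\<eta> > 0" using \<open>A *v n \<noteq> A' *v n\<close> by (simp add: \<eta>_def matrix_vector_mult_diff_rdistrib)
  have szJ: "size J = q" "size J' = q"
    using J J' U unfolding approx_jet_def by (metis size_image_mset)+
  define N where "N = 1 + onorm ((*v) (A - A')) + onorm ((*v) A) + (\<Sum>(a', B)\<in>set_mset J'. onorm ((*v) B))"
  have on: "0 \<le> onorm ((*v) B)" for B :: "real^'n^'k" by (rule onorm_pos_le) (rule matrix_vector_mul_bounded_linear)
  have onb: "norm (B *v h) \<le> onorm ((*v) B) * norm h" for B :: "real^'n^'k" and h
    by (rule onorm) (rule matrix_vector_mul_bounded_linear)
  have sumB: "onorm ((*v) B) \<le> (\<Sum>(a', B)\<in>set_mset J'. onorm ((*v) B))" if "(a', B) \<in># J'" for a' B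
    using member_le_sum[of "(a', B)" "set_mset J'" "\<lambda>(a', B). onorm ((*v) B)"] that on by auto
  have N1: "N \<ge> 1" unfolding N_def using on by (simp add: add_nonneg_nonneg sum_nonneg split_beta')
  \<comment> \<open>The errors add up to \<open>s * e * (4 + N)\<close>: \<open>4 * e * s\<close>
    from the two expansions at \<open>norm h < 2 * s\<close>, and \<open>N * e * s\<close> from
    replacing \<open>h\<close> by \<open>s *\<^sub>R n\<close>. This has to stay below
    \<open>s * \<eta>\<close>.\<close>
  define e where "e = min (1 / 2) (\<eta> / (2 * (4 + N)))"
  have e: "0 < e" "e < 1" "e * (4 + N) \<le> \<eta> / 2" 
  proof -
    show "0 < e" "e < 1" using \<eta> N1 by (auto simp: e_def)
    have "e * (4 + N) \<le> \<eta> / (2 * (4 + N)) * (4 + N)" using N1 by (intro mult_right_mono) (auto simp: e_def)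
    also have "\<dots> = \<eta> / 2"
    proof -
      have "z / (2 * k) * k = z / 2" if "k > 0" for z k :: real using that by simp
      then show ?thesis using N1 by (metis add_pos_pos less_le_trans zero_less_numeral zero_less_one)
    qed
    finally show "e * (4 + N) \<le> \<eta> / 2" .
  qed
  obtain F where F: "density_one F x"
    "((\<lambda>h. qdist (v (x + h)) (image_mset (\<lambda>(a, A). a + A *v h) J) / norm h) \<longlongrightarrow> 0) (at 0 within {h. x + h \<in> F})"
    using J unfolding approx_jet_def by blast
  obtain F' where F': "density_one F' x"
    "((\<lambda>h. qdist (v (x + h)) (image_mset (\<lambda>(a, A). a + A *v h) J') / norm h) \<longlongrightarrow> 0) (at 0 within {h. x + h \<in> F'})"
    using J' unfolding approx_jet_def by blast
  have lim: "\<exists>d>0. \<forall>h. x + h \<in> H \<and> h \<noteq> 0 \<and> norm h < d \<longrightarrow> qdist (v (x + h)) (image_mset (\<lambda>(a, A). a + A *v h) K) \<le> e * norm h"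
    if t: "((\<lambda>h. qdist (v (x + h)) (image_mset (\<lambda>(a, A). a + A *v h) K) / norm h) \<longlongrightarrow> 0) (at 0 within {h. x + h \<in> H})" for H K
  proof -
    from tendstoD[OF t e(1)] obtain d where d: "d > 0"
      "\<And>h. x + h \<in> H \<Longrightarrow> h \<noteq> 0 \<Longrightarrow> norm h < d \<Longrightarrow> \<bar>qdist (v (x + h)) (image_mset (\<lambda>(a, A). a + A *v h) K) / norm h\<bar> < e"
      unfolding eventually_at by (auto simp: dist_norm)
    have "qdist (v (x + h)) (image_mset (\<lambda>(a, A). a + A *v h) K) \<le> e * norm h" if h: "x + h \<in> H" "h \<noteq> 0" "norm h < d" for h
    proof -
      have "qdist (v (x + h)) (image_mset (\<lambda>(a, A). a + A *v h) K) / norm h < e" using d(2)[OF h] by linarith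
      then show ?thesis using h(2) by (simp add: divide_less_eq)
    qed
    then show ?thesis using d(1) by blast
  qed
  obtain d1 where d1: "d1 > 0" "\<And>h. x + h \<in> F \<Longrightarrow> h \<noteq> 0 \<Longrightarrow> norm h < d1 \<Longrightarrow> qdist (v (x + h)) (image_mset (\<lambda>(a, A). a + A *v h) J) \<le> e * norm h"
    using lim[OF F(2)] by blast
  obtain d2 where d2: "d2 > 0" "\<And>h. x + h \<in> F' \<Longrightarrow> h \<noteq> 0 \<Longrightarrow> norm h < d2 \<Longrightarrow> qdist (v (x + h)) (image_mset (\<lambda>(a, A). a + A *v h) J') \<le> e * norm h"
    using lim[OF F'(2)] by blast
  obtain d3 where d3: "d3 > 0" "ball x d3 \<subseteq> U" using U open_contains_ball by blast
  obtain d4 where d4: "d4 > 0" "\<And>a'. a' \<in># v x \<Longrightarrow> a' \<noteq> a \<Longrightarrow> d4 \<le> dist a a'"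
    using finite_set_avoid[of "set_mset (v x)" a] by auto
  obtain d5 where d5: "d5 > 0" "\<And>s. 0 < s \<Longrightarrow> s < d5 \<Longrightarrow> (\<exists>h. x + h \<in> F \<and> x + h \<in> F' \<and> norm (h - s *\<^sub>R n) < e * s)"
    using density_one_meet[OF F(1) F'(1) n e(1,2)] by blast
  \<comment> \<open>The entry \<open>d4 / (4 + N)\<close> keeps the displacement of the matched
    sheets smaller than the gap between \<open>a\<close> and the other values at
    \<open>x\<close>.\<close>
  define d where "d = Min {d1, d2, d3, d4 / (4 + N), d5}"
  have N4: "4 + N > 0" using N1 by simp
  have d: "d > 0" "d \<le> d1" "d \<le> d2" "d \<le> d3" "d \<le> d4 / (4 + N)" "d \<le> d5"
    using d1(1) d2(1) d3(1) d4(1) d5(1) N4 by (auto simp: d_def)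
  define s where "s = d / 4"
  have s: "0 < s" "s < d5" using d by (auto simp: s_def)
  obtain h where h: "x + h \<in> F" "x + h \<in> F'" "norm (h - s *\<^sub>R n) < e * s" using d5(2)[OF s] by blast
  have es: "e * s < s" using e s by simp
  have hs: "norm h \<le> norm (h - s *\<^sub>R n) + s"
    using norm_triangle_ineq[of "h - s *\<^sub>R n" "s *\<^sub>R n"] n s by simp
  have h2: "norm h < 2 * s" using hs h(3) es by linarith
  have hd: "norm h < d" using h2 d(1) by (simp add: s_def)
  have h0: "h \<noteq> 0" using h(3) n s es by auto
  have xh: "x + h \<in> U" using d3(2) hd d(4) by (auto simp: dist_norm)
  have q1: "qdist (v (x + h)) (image_mset (\<lambda>(a, A). a + A *v h) J) \<le> e * norm h"
    by (rule d1(2)) (use h h0 hd d in auto)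
  have q2: "qdist (v (x + h)) (image_mset (\<lambda>(a, A). a + A *v h) J') \<le> e * norm h"
    by (rule d2(2)) (use h h0 hd d in auto)
  have s1: "size (v (x + h)) = size (image_mset (\<lambda>(a, A). a + A *v h) J)" using U(3)[OF xh] szJ by simp
  have s2: "size (v (x + h)) = size (image_mset (\<lambda>(a, A). a + A *v h) J')" using U(3)[OF xh] szJ by simp
  obtain xs ys where xy: "mset xs = v (x + h)" "mset ys = image_mset (\<lambda>(a, A). a + A *v h) J" "length xs = length ys"
    "\<And>i. i < length xs \<Longrightarrow> norm (xs ! i - ys ! i) \<le> qdist (v (x + h)) (image_mset (\<lambda>(a, A). a + A *v h) J)"
    by (rule qdist_matching[OF s1]) (rule that)
  have "a + A *v h \<in># mset ys" unfolding xy(2) using aA by force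
  then obtain i where i: "i < length ys" "ys ! i = a + A *v h" by (auto simp: in_set_conv_nth)
  define y where "y = xs ! i"
  have y1: "norm (y - (a + A *v h)) \<le> e * norm h" using xy(3,4) i q1 by (force simp: y_def)
  have yin: "y \<in># v (x + h)" using xy(1,3) i by (metis nth_mem set_mset_mset y_def)
  obtain xs' zs where xz: "mset xs' = v (x + h)" "mset zs = image_mset (\<lambda>(a, A). a + A *v h) J'" "length xs' = length zs"
    "\<And>i. i < length xs' \<Longrightarrow> norm (xs' ! i - zs ! i) \<le> qdist (v (x + h)) (image_mset (\<lambda>(a, A). a + A *v h) J')"
    by (rule qdist_matching[OF s2]) (rule that)
  have "y \<in> set xs'" using yin xz(1) by (metis set_mset_mset)
  then obtain j where j: "j < length xs'" "xs' ! j = y" by (auto simp: in_set_conv_nth)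
  have "zs ! j \<in># mset zs" using j xz(3) by simp
  then obtain a' B where aB: "(a', B) \<in># J'" "zs ! j = a' + B *v h" unfolding xz(2) by auto
  have y2: "norm (y - (a' + B *v h)) \<le> e * norm h" using xz(4)[OF j(1)] j aB q2 by simp
  have eh: "e * norm h \<le> norm h" using e by (simp add: mult_left_le_one_le)
  have "a' = a"
  proof (rule ccontr)
    assume ne: "a' \<noteq> a"
    have "image_mset fst J' = v x" using J' by (simp add: approx_jet_def)
    moreover have "fst (a', B) \<in># image_mset fst J'" using imageI[OF aB(1), of fst] by (simp only: set_image_mset)
    ultimately have "a' \<in># v x" by (simp only: fst_conv)
    then have "d4 \<le> norm (a - a')" using d4(2) ne by (simp add: dist_norm)
    also have "a - a' = (y - (a' + B *v h)) - (y - (a + A *v h)) + B *v h - A *v h" by (simp add: algebra_simps)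
    also have "norm \<dots> \<le> norm (y - (a' + B *v h)) + norm (y - (a + A *v h)) + norm (B *v h) + norm (A *v h)"
    proof -
      have tri: "norm (P - Q + R - S) \<le> norm P + norm Q + norm R + norm S" for P Q R S :: "real^'k"
        using norm_triangle_ineq4[of "P - Q + R" S] norm_triangle_ineq[of "P - Q" R] norm_triangle_ineq4[of P Q] by linarith
      show ?thesis by (rule tri)
    qed
    also have "\<dots> \<le> norm h + norm h + onorm ((*v) B) * norm h + onorm ((*v) A) * norm h"
      by (intro add_mono onb order_trans[OF y1 eh] order_trans[OF y2 eh])
    also have "\<dots> \<le> (4 + N) * norm h"
    proof -
      have "2 + onorm ((*v) B) + onorm ((*v) A) \<le> 4 + N" using sumB[OF aB(1)] on[of "A - A'"] by (simp add: N_def)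
      from mult_right_mono[OF this norm_ge_zero[of h]] show ?thesis by (simp add: algebra_simps)
    qed
    also have "\<dots> < (4 + N) * (d4 / (4 + N))" using hd d(5) N4 by (intro mult_strict_left_mono) auto
    finally show False using N4 by simp
  qed
  then have "B = A'" using aB(1) aA' J' unfolding approx_jet_def by blast
  have "(A - A') *v h = (y - (a + A' *v h)) - (y - (a + A *v h))"
    by (simp add: matrix_vector_mult_diff_rdistrib)
  also have "norm \<dots> \<le> e * norm h + e * norm h"
    using y1 y2 norm_triangle_ineq4[of "y - (a + A' *v h)" "y - (a + A *v h)"] \<open>a' = a\<close> \<open>B = A'\<close> by simp
  finally have b1: "norm ((A - A') *v h) \<le> 4 * e * s" 
    using mult_left_mono[of "norm h" "2 * s" e] h2 e by linarith
  have "s * \<eta> = norm ((A - A') *v (s *\<^sub>R n))"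
    using s by (simp add: \<eta>_def matrix_vector_mult_scaleR)
  also have "(A - A') *v (s *\<^sub>R n) = (A - A') *v h - (A - A') *v (h - s *\<^sub>R n)"
    by (simp add: matrix_vector_mult_diff_distrib)
  also have "norm \<dots> \<le> norm ((A - A') *v h) + norm ((A - A') *v (h - s *\<^sub>R n))"
    by (rule norm_triangle_ineq4)
  also have "norm ((A - A') *v (h - s *\<^sub>R n)) \<le> N * (e * s)"
  proof -
    have "norm ((A - A') *v (h - s *\<^sub>R n)) \<le> onorm ((*v) (A - A')) * norm (h - s *\<^sub>R n)" by (rule onb)
    also have "\<dots> \<le> N * (e * s)"
    proof (rule mult_mono)
      show "onorm ((*v) (A - A')) \<le> N" unfolding N_def using on by (simp add: add_nonneg_nonneg sum_nonneg split_beta')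
    qed (use h(3) N1 in auto)
    finally show ?thesis .
  qed
  finally have "s * \<eta> \<le> s * (e * (4 + N))" using b1 by (simp add: algebra_simps)
  then have "\<eta> \<le> e * (4 + N)" using s(1) by simp
  then show False using e(3) \<eta> by linarith
qed

lemma approx_jet_unique:
  fixes v :: "real^'n \<Rightarrow> (real^'k) multiset"
  assumes J: "approx_jet v x J" and J': "approx_jet v x J'"
    and U: "open U" "x \<in> U" "\<And>y. y \<in> U \<Longrightarrow> size (v y) = q"
  shows "J = J'"
proof -
  have f: "image_mset fst J = v x" "image_mset fst J' = v x" using J J' by (auto simp: approx_jet_def)
  have e: "J = image_mset (\<lambda>a. (a, SOME A. (a, A) \<in># J)) (v x)" "J' = image_mset (\<lambda>a. (a, SOME A. (a, A) \<in># J')) (v x)"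
    using jet_multiset_eq[of J] jet_multiset_eq[of J'] J J' unfolding approx_jet_def by auto
  have "(SOME A. (a, A) \<in># J) = (SOME A. (a, A) \<in># J')" if "a \<in># v x" for a
  proof (rule approx_jet_matrix_unique[OF J J' U])
    have "a \<in># image_mset fst J" "a \<in># image_mset fst J'" using that f by simp_all
    then obtain A A' where "(a, A) \<in># J" "(a, A') \<in># J'" by auto
    then show "(a, SOME A. (a, A) \<in># J) \<in># J" "(a, SOME A. (a, A) \<in># J') \<in># J'" by (auto intro: someI)
  qed
  then have "image_mset (\<lambda>a. (a, SOME A. (a, A) \<in># J)) (v x) = image_mset (\<lambda>a. (a, SOME A. (a, A) \<in># J')) (v x)"
    by (intro image_mset_cong) auto
  then show ?thesis using e by simp
qed

lemma j1_eq:
  fixes v :: "real^'n \<Rightarrow> (real^'k) multiset"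
  assumes "approx_jet v x J" "open U" "x \<in> U" "\<And>y. y \<in> U \<Longrightarrow> size (v y) = q"
  shows "j1 v x = J"
proof -
  have "approx_jet v x (j1 v x)" using someI[of "approx_jet v x" J] assms(1) by (auto simp: j1_def)
  then show ?thesis using approx_jet_unique assms by blast
qed

section \<open>Polar form of the matrix of a jet\<close>

definition outer :: "real^'k \<Rightarrow> real^'n \<Rightarrow> real^'n^'k" where "outer a u = (\<chi> i j. a $ i * u $ j)"

lemma outer_mult [simp]: "outer a u *v h = (u \<bullet> h) *\<^sub>R a"
  by (simp add: vec_eq_iff outer_def matrix_vector_mult_def inner_vec_def sum_distrib_left mult_ac)

text \<open>Euler's relation fixes the matrix on \<open>y\<close>, and the tangential speed
  \<open>b\<close> fixes it on \<open>perp y\<close>; the quotients by \<open>y \<bullet> y\<close>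
  come from expanding in this orthogonal basis.\<close>

definition polar_jet :: "real \<Rightarrow> real^2 \<Rightarrow> real^'k \<Rightarrow> real^'k \<Rightarrow> real^2^'k" where
  "polar_jet \<sigma> y a b = outer ((\<sigma> / (y \<bullet> y)) *\<^sub>R a) y + outer ((1 / (y \<bullet> y)) *\<^sub>R b) (perp y)"

lemma polar_jet_mult:
  "polar_jet \<sigma> y a b *v h = (\<sigma> * ((h \<bullet> y) / (y \<bullet> y))) *\<^sub>R a + ((h \<bullet> perp y) / (y \<bullet> y)) *\<^sub>R b"
  by (simp add: polar_jet_def matrix_vector_mult_add_rdistrib inner_commute)

lemma polar_jet_radial: "y \<noteq> 0 \<Longrightarrow> polar_jet \<sigma> y a b *v y = \<sigma> *\<^sub>R a"
  and polar_jet_tangential: "y \<noteq> 0 \<Longrightarrow> polar_jet \<sigma> y a b *v perp y = b"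
  by (simp_all add: polar_jet_mult)

section \<open>Jets of homogeneous maps\<close>

lemma negligible_snd: "negligible N \<Longrightarrow> negligible {p :: real \<times> real. snd p \<in> N}"
proof -
  assume N: "negligible N"
  then have "AE x in lborel. x \<notin> N" by (simp add: AE_lborel_iff_negligible)
  then obtain N' where N': "{x \<in> space lborel. \<not> x \<notin> N} \<subseteq> N'" "emeasure lborel N' = 0" "N' \<in> sets lborel"
    by (rule AE_E)
  have "(UNIV :: real set) \<times> N' \<in> null_sets (lborel \<Otimes>\<^sub>M lborel)"
    by (rule lborel.times_in_null_sets2) (use N' in auto)
  then have "UNIV \<times> N' \<in> null_sets (lborel :: (real \<times> real) measure)" by (simp add: lborel_prod)
  then have "negligible (UNIV \<times> N' :: (real \<times> real) set)"
    unfolding negligible_iff_null_sets by (rule null_sets_completionI)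
  then show ?thesis by (rule negligible_subset) (use N'(1) in auto)
qed

lemma differentiable_on_spiral: "(\<lambda>p. spiral p x) differentiable_on S"
  unfolding spiral_def rot_def differentiable_on_def differentiable_def
  by (intro ballI exI) (rule derivative_eq_intros refl)+

text \<open>In the basis \<open>y\<close>, \<open>perp y\<close> the point \<open>y + h\<close> is
  the complex number with real part \<open>1 + (h \<bullet> y) / (y \<bullet> y)\<close> and
  imaginary part \<open>(h \<bullet> perp y) / (y \<bullet> y)\<close>. The formula is its polar
  form, \<open>arctan\<close> being the argument in the right half plane.\<close>

lemma spiral_inverse:
  assumes y: "y \<noteq> 0" and a: "0 < 1 + (h \<bullet> y) / (y \<bullet> y)"
  shows "exp (ln ((1 + (h \<bullet> y) / (y \<bullet> y))\<^sup>2 + ((h \<bullet> perp y) / (y \<bullet> y))\<^sup>2) / 2) *\<^sub>R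
     rot (arctan (((h \<bullet> perp y) / (y \<bullet> y)) / (1 + (h \<bullet> y) / (y \<bullet> y)))) y = y + h"
proof -
  define \<alpha> where "\<alpha> = 1 + (h \<bullet> y) / (y \<bullet> y)"
  define \<beta> where "\<beta> = (h \<bullet> perp y) / (y \<bullet> y)"
  define u where "u = \<beta> / \<alpha>"
  have \<alpha>: "\<alpha> > 0" using a by (simp add: \<alpha>_def)
  have yy: "y \<bullet> y \<noteq> 0" using y by simp
  have pos: "1 + u\<^sup>2 > 0" by (simp add: add_pos_nonneg)
  have "\<alpha>\<^sup>2 + \<beta>\<^sup>2 = \<alpha>\<^sup>2 * (1 + u\<^sup>2)" using \<alpha> by (simp add: u_def power_divide distrib_left)
  then have r: "sqrt (\<alpha>\<^sup>2 + \<beta>\<^sup>2) = \<alpha> * sqrt (1 + u\<^sup>2)" using \<alpha> by (simp add: real_sqrt_mult)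
  have pos2: "\<alpha>\<^sup>2 + \<beta>\<^sup>2 > 0" using \<alpha> by (simp add: add_pos_nonneg)
  have "exp (ln (\<alpha>\<^sup>2 + \<beta>\<^sup>2) / 2) = exp (ln (sqrt (\<alpha>\<^sup>2 + \<beta>\<^sup>2)))"
    by (simp only: ln_sqrt[OF less_imp_le[OF pos2]])
  also have "\<dots> = sqrt (\<alpha>\<^sup>2 + \<beta>\<^sup>2)" by (rule exp_ln) (simp only: real_sqrt_gt_0_iff pos2)
  finally have e: "exp (ln (\<alpha>\<^sup>2 + \<beta>\<^sup>2) / 2) = \<alpha> * sqrt (1 + u\<^sup>2)" by (simp add: r)
  have sq: "sqrt (1 + u\<^sup>2) \<noteq> 0" using pos by simp
  have "exp (ln (\<alpha>\<^sup>2 + \<beta>\<^sup>2) / 2) *\<^sub>R rot (arctan u) y = \<alpha> *\<^sub>R y + (\<alpha> * u) *\<^sub>R perp y"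
    unfolding e rot_def cos_arctan sin_arctan using sq by (simp add: scaleR_add_right)
  also have "\<alpha> * u = \<beta>" using \<alpha> by (simp add: u_def)
  also have "\<alpha> *\<^sub>R y + \<beta> *\<^sub>R perp y = y + h"
  proof -
    have "h = (1 / (y \<bullet> y)) *\<^sub>R ((y \<bullet> y) *\<^sub>R h)" using yy by simp
    also have "\<dots> = ((h \<bullet> y) / (y \<bullet> y)) *\<^sub>R y + \<beta> *\<^sub>R perp y"
      unfolding perp_decomposition by (simp add: \<beta>_def scaleR_add_right)
    finally show ?thesis by (simp add: \<alpha>_def scaleR_add_left)
  qed
  finally show ?thesis by (simp add: \<alpha>_def \<beta>_def u_def)
qed

lemma density_one_conegligible:
  fixes y :: "'a::euclidean_space"
  assumes "negligible (- F)" shows "density_one F y"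
proof -
  have s: "F \<in> sets lebesgue"
    using assms by (metis Compl_in_sets_lebesgue double_complement negligible_imp_sets)
  have "measure lebesgue (F \<inter> ball y r) = measure lebesgue (ball y r)" for r
  proof (rule measure_negligible_symdiff)
    show "ball y r \<in> lmeasurable" by simp
    show "negligible (ball y r - F \<inter> ball y r \<union> (F \<inter> ball y r - ball y r))"
      by (rule negligible_subset[OF assms]) auto
  qed
  moreover have "measure lebesgue (ball y r) > 0" if "r > 0" for r
    using content_ball_pos[OF that, of y] by simp
  ultimately have "\<forall>\<^sub>F r in at_right 0. measure lebesgue (F \<inter> ball y r) / measure lebesgue (ball y r) = 1"
    unfolding eventually_at_right_field by (intro exI[of _ 1]) auto
  then have "((\<lambda>r. measure lebesgue (F \<inter> ball y r) / measure lebesgue (ball y r)) \<longlongrightarrow> 1) (at_right 0)"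
    by (rule tendsto_eventually)
  then show ?thesis using s by (simp add: density_one_def)
qed

lemma derivative_bound_eventually:
  assumes "(f has_derivative f') (at x)" "e > 0"
  shows "\<forall>\<^sub>F y in nhds x. norm (f y - f x - f' (y - x)) \<le> e * norm (y - x)"
proof -
  have "\<forall>e>0. \<exists>d>0. \<forall>y. norm (y - x) < d \<longrightarrow> norm (f y - f x - f' (y - x)) \<le> e * norm (y - x)"
    using assms(1) unfolding has_derivative_at_alt by (rule conjunct2)
  from this[rule_format, OF assms(2)] show ?thesis
    unfolding eventually_nhds_metric by (simp add: dist_norm)
qed

text \<open>Homogeneity adds the radial direction to the differential along the circle:
  \<open>y + h\<close> has spiral parameters \<open>(s0 + m h, t0 + \<tau> h)\<close> with
  \<open>m\<close> and \<open>\<tau>\<close> differentiable at 0, so the sheets over it are scaled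
  sheets over a nearby angle. Points with exceptional parameters form a null set, which an
  approximate jet may leave out.\<close>

lemma homogeneous_jet_at:
  fixes w :: "real^2 \<Rightarrow> (real^'k) multiset"
  assumes sz: "\<And>y. y \<in> annulus \<Longrightarrow> size (w y) = q" and x: "x \<in> annulus"
    and G: "negligible ({0..L} - G)"
    and hom: "AE p in lborel. spiral p x \<in> annulus \<longrightarrow>
      w (spiral p x) = image_mset (\<lambda>a. exp (\<sigma> * fst p) *\<^sub>R a) (w (rot (snd p) x))"
    and t0: "0 < t0" "t0 < L" and qd: "qdiff (\<lambda>t. w (rot t x)) G t0 D"
    and y: "y = spiral (s0, t0) x" "y \<in> annulus"
    and wy: "w y = image_mset (\<lambda>a. exp (\<sigma> * s0) *\<^sub>R a) (w (rot t0 x))"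
  shows "approx_jet w y (image_mset (\<lambda>a. (exp (\<sigma> * s0) *\<^sub>R a,
     polar_jet \<sigma> y (exp (\<sigma> * s0) *\<^sub>R a) (exp (\<sigma> * s0) *\<^sub>R D a))) (w (rot t0 x)))" (is "approx_jet w y ?J")
proof -
  define E0 where "E0 = exp (\<sigma> * s0)"
  have E0: "E0 > 0" by (simp add: E0_def)
  define \<rho> where "\<rho> h = (h \<bullet> y) / (y \<bullet> y)" for h
  define \<beta> where "\<beta> h = (h \<bullet> perp y) / (y \<bullet> y)" for h
  define m where "m h = ln ((1 + \<rho> h)\<^sup>2 + (\<beta> h)\<^sup>2) / 2" for h
  define \<tau> where "\<tau> h = arctan (\<beta> h / (1 + \<rho> h))" for h
  have ny: "norm y > 1" using y(2) by (simp add: annulus_def)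
  then have y0: "y \<noteq> 0" by auto
  have bl: "bounded_linear \<rho>" "bounded_linear \<beta>"
    unfolding \<rho>_def \<beta>_def
    by (rule bounded_linear_compose[OF bounded_linear_divide bounded_linear_inner_left])+
  have z0: "\<rho> 0 = 0" "\<beta> 0 = 0" by (simp_all add: \<rho>_def \<beta>_def)
  have d\<rho>: "(\<rho> has_derivative \<rho>) (at 0)" and d\<beta>: "(\<beta> has_derivative \<beta>) (at 0)"
    using bl by (auto intro: bounded_linear_imp_has_derivative)
  have dm: "(m has_derivative \<rho>) (at 0)"
    unfolding m_def by (rule derivative_eq_intros d\<rho> d\<beta> refl | simp add: z0)+
  have d\<tau>: "(\<tau> has_derivative \<beta>) (at 0)"
    unfolding \<tau>_def by (rule derivative_eq_intros d\<rho> d\<beta> refl | simp add: z0)+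
  have m0: "m 0 = 0" "\<tau> 0 = 0" by (simp_all add: m_def \<tau>_def z0)
  \<comment> \<open>The model motion of a sheet, up to the factor \<open>E0\<close>; its linear part
    at 0 is the action of the polar jet.\<close>
  define N where "N a h = exp (\<sigma> * m h) *\<^sub>R (a + \<tau> h *\<^sub>R D a)" for a h
  have dN: "(N a has_derivative (\<lambda>h. (\<sigma> * \<rho> h) *\<^sub>R a + \<beta> h *\<^sub>R D a)) (at 0)" for a
    unfolding N_def by (rule derivative_eq_intros dm d\<tau> refl | simp add: m0 add.commute)+
  have N0: "N a 0 = a" for a by (simp add: N_def m0)
  have \<beta>b: "\<bar>\<beta> h\<bar> \<le> norm h" for h
  proof -
    have "\<bar>h \<bullet> perp y\<bar> \<le> norm h * norm y" using Cauchy_Schwarz_ineq2[of h "perp y"] by simp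
    also have "\<dots> \<le> norm h * (norm y * norm y)"
    proof (rule mult_left_mono)
      show "norm y \<le> norm y * norm y" using ny mult_left_mono[of 1 "norm y" "norm y"] by simp
    qed simp
    also have "norm y * norm y = y \<bullet> y" by (simp add: dot_square_norm power2_eq_square)
    finally show ?thesis using y0 by (simp add: \<beta>_def divide_le_eq)
  qed
  have spiral: "spiral (s0 + m h, t0 + \<tau> h) x = y + h" if "0 < 1 + \<rho> h" for h
  proof -
    have "spiral (s0 + m h, t0 + \<tau> h) x = exp (m h) *\<^sub>R rot (\<tau> h) y"
      unfolding y(1) spiral_def rot_scaleR by (simp add: exp_add rot_add[symmetric] add.commute mult.commute)
    then show ?thesis using spiral_inverse[OF y0, of h] that by (simp add: m_def \<tau>_def \<rho>_def \<beta>_def)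
  qed
  define P where "P = {p. \<not> (spiral p x \<in> annulus \<longrightarrow> w (spiral p x) = image_mset (\<lambda>a. exp (\<sigma> * fst p) *\<^sub>R a) (w (rot (snd p) x)))}
     \<union> {p. snd p \<in> {0..L} - G}"
  have "negligible P" unfolding P_def using hom negligible_snd[OF G] by (simp add: AE_lborel_iff_negligible)
  then have "negligible ((\<lambda>p. spiral p x) ` P)"
  proof (rule negligible_differentiable_image_negligible[rotated])
    show "(\<lambda>p. spiral p x) differentiable_on P" by (rule differentiable_on_spiral)
  qed simp
  define F where "F = - ((\<lambda>p. spiral p x) ` P)"
  have F: "density_one F y" by (rule density_one_conegligible) (simp add: F_def \<open>negligible ((\<lambda>p. spiral p x) ` P)\<close>)
  let ?W = "w (rot t0 x)"
  have x_rot: "rot t x \<in> annulus" for t using x by simp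
  \<comment> \<open>The 5 collects \<open>2 * 2\<close> from \<open>exp (\<sigma> * m h) < 2\<close>
    and \<open>\<bar>\<tau> h\<bar> \<le> 2 * norm h\<close>, and 1 from the Taylor error of
    \<open>N\<close>. \<open>E0\<close> is the scale of the sheets, and the root of \<open>q\<close>
    comes from the metric on multisets.\<close>
  have key: "\<forall>\<^sub>F h in nhds 0. y + h \<in> F \<longrightarrow> qdist (w (y + h)) (image_mset (\<lambda>(a, A). a + A *v h) ?J) \<le> (sqrt (real q) * (E0 * 5)) * e * norm h"
    if e: "e > 0" for e
  proof -
    obtain \<delta> where \<delta>: "\<delta> > 0" "\<And>s. s \<in> G \<Longrightarrow> \<bar>s - t0\<bar> < \<delta> \<Longrightarrow>
     (\<exists>xs ys. mset xs = w (rot s x) \<and> mset ys = ?W \<and> length xs = length ys \<and>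
        (\<forall>i<length xs. norm (xs ! i - ys ! i - (s - t0) *\<^sub>R D (ys ! i)) \<le> e * \<bar>s - t0\<bar>))"
      using qd e unfolding qdiff_def by blast
    have tl: "\<tau> \<midarrow>0\<rightarrow> 0" "m \<midarrow>0\<rightarrow> 0" "\<rho> \<midarrow>0\<rightarrow> 0"
      using has_derivative_continuous[OF d\<tau>] has_derivative_continuous[OF dm] has_derivative_continuous[OF d\<rho>]
      by (simp_all add: continuous_within m0 z0)
    have tln: "(\<tau> \<longlongrightarrow> 0) (nhds 0)" "(m \<longlongrightarrow> 0) (nhds 0)" "(\<rho> \<longlongrightarrow> 0) (nhds 0)"
      using tl m0 z0 tendsto_at_iff_tendsto_nhds[of \<tau> 0] tendsto_at_iff_tendsto_nhds[of m 0] tendsto_at_iff_tendsto_nhds[of \<rho> 0]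
      by simp_all
    have "\<forall>\<^sub>F h in nhds 0. \<forall>a\<in>set_mset ?W. norm (N a h - a - ((\<sigma> * \<rho> h) *\<^sub>R a + \<beta> h *\<^sub>R D a)) \<le> e * norm h"
      using derivative_bound_eventually[OF dN e] by (intro eventually_ball_finite) (auto simp: N0)
    moreover have "\<forall>\<^sub>F h in nhds 0. norm (\<tau> h - \<beta> h) \<le> 1 * norm h"
      using derivative_bound_eventually[OF d\<tau>, of 1] by (simp add: m0)
    moreover have "\<forall>\<^sub>F h in nhds 0. \<tau> h < min \<delta> (L - t0)" "\<forall>\<^sub>F h in nhds 0. - min \<delta> t0 < \<tau> h"
      using tln(1) t0 \<delta>(1) by (intro order_tendstoD[of \<tau> 0]; simp)+
    moreover have "\<forall>\<^sub>F h in nhds 0. exp (\<sigma> * m h) < 2"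
      using tendsto_exp[OF tendsto_mult_right[OF tln(2), of \<sigma>]] by (intro order_tendstoD(2)[of _ "exp (\<sigma> * 0)"]) (simp_all add: mult.commute)
    moreover have "\<forall>\<^sub>F h in nhds 0. - 1 < \<rho> h" using tln(3) by (intro order_tendstoD[of \<rho> 0]) auto
    moreover have "\<forall>\<^sub>F h in nhds 0. y + h \<in> annulus"
    proof -
      obtain r where "r > 0" "ball y r \<subseteq> annulus" using open_annulus y(2) open_contains_ball by blast
      then show ?thesis unfolding eventually_nhds_metric by (intro exI[of _ r]) (auto simp: dist_norm)
    qed
    ultimately show ?thesis
    proof eventually_elim
      case (elim h)
      show ?case
      proof
        assume yF: "y + h \<in> F"
        have sp: "spiral (s0 + m h, t0 + \<tau> h) x = y + h" by (rule spiral) (use elim(6) in simp)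
        then have "(s0 + m h, t0 + \<tau> h) \<notin> P" using yF unfolding F_def by (metis ComplD imageI)
        moreover have "t0 + \<tau> h \<in> {0..L}" using elim(3,4) by simp
        ultimately have wh: "w (y + h) = image_mset (\<lambda>a. exp (\<sigma> * (s0 + m h)) *\<^sub>R a) (w (rot (t0 + \<tau> h) x))"
          and tG: "t0 + \<tau> h \<in> G" using sp elim(7) by (auto simp: P_def)
        have "\<bar>t0 + \<tau> h - t0\<bar> < \<delta>" using elim(3,4) by linarith
        from \<delta>(2)[OF tG this] obtain xs ys where xy: "mset xs = w (rot (t0 + \<tau> h) x)" "mset ys = ?W" "length xs = length ys"
          "\<And>i. i < length xs \<Longrightarrow> norm (xs ! i - ys ! i - \<tau> h *\<^sub>R D (ys ! i)) \<le> e * \<bar>\<tau> h\<bar>" by auto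
        have lq: "length xs = q" using xy(1) sz[OF x_rot] by (metis size_mset)
        define us where "us = map (\<lambda>a. exp (\<sigma> * (s0 + m h)) *\<^sub>R a) xs"
        define vs where "vs = map (\<lambda>a. E0 *\<^sub>R a + polar_jet \<sigma> y (E0 *\<^sub>R a) (E0 *\<^sub>R D a) *v h) ys"
        have u: "mset us = w (y + h)" by (simp add: us_def wh xy(1))
        have v: "mset vs = image_mset (\<lambda>(a, A). a + A *v h) ?J"
          by (simp add: vs_def xy(2) multiset.map_comp o_def E0_def)
        have \<tau>b: "\<bar>\<tau> h\<bar> \<le> 2 * norm h" using elim(2) \<beta>b[of h] by simp
        have "norm (us ! i - vs ! i) \<le> E0 * 5 * e * norm h" if i: "i < length us" for i
        proof -
          have i': "i < length xs" "i < length ys" using i xy(3) by (simp_all add: us_def)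
          let ?R1 = "xs ! i - ys ! i - \<tau> h *\<^sub>R D (ys ! i)"
          let ?R2 = "N (ys ! i) h - ys ! i - ((\<sigma> * \<rho> h) *\<^sub>R (ys ! i) + \<beta> h *\<^sub>R D (ys ! i))"
          have "us ! i - vs ! i = E0 *\<^sub>R (exp (\<sigma> * m h) *\<^sub>R ?R1 + ?R2)"
            using i' by (simp add: us_def vs_def polar_jet_mult N_def E0_def \<rho>_def \<beta>_def exp_add distrib_left
                scaleR_add_right scaleR_diff_right algebra_simps)
          then have "norm (us ! i - vs ! i) = E0 * norm (exp (\<sigma> * m h) *\<^sub>R ?R1 + ?R2)" using E0 by simp
          also have "\<dots> \<le> E0 * (exp (\<sigma> * m h) * norm ?R1 + norm ?R2)"
            using E0 norm_triangle_ineq[of "exp (\<sigma> * m h) *\<^sub>R ?R1" ?R2] by (intro mult_left_mono) auto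
          also have "\<dots> \<le> E0 * (2 * (e * (2 * norm h)) + e * norm h)"
          proof (intro mult_left_mono add_mono mult_mono)
            show "norm ?R1 \<le> e * (2 * norm h)"
              using xy(4)[OF i'(1)] mult_left_mono[OF \<tau>b, of e] e by linarith
            have "ys ! i \<in># ?W" using i'(2) xy(2) by (metis nth_mem set_mset_mset)
            then show "norm ?R2 \<le> e * norm h" using elim(1) by blast
          qed (use elim(5) E0 e in auto)
          also have "\<dots> = E0 * 5 * e * norm h" by (simp add: algebra_simps)
          finally show ?thesis .
        qed
        moreover have "length us = length vs" using xy(3) by (simp add: us_def vs_def)
        ultimately have "qdist (mset us) (mset vs) \<le> sqrt (real (length us)) * (E0 * 5 * e * norm h)"
          by (intro qdist_le_uniform) (use E0 e in auto)
        then show "qdist (w (y + h)) (image_mset (\<lambda>(a, A). a + A *v h) ?J) \<le> (sqrt (real q) * (E0 * 5)) * e * norm h"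
          unfolding u v using lq by (simp add: us_def mult.assoc)
      qed
    qed
  qed
  show ?thesis unfolding approx_jet_def
  proof (intro conjI)
    show "image_mset fst ?J = w y" by (simp add: multiset.map_comp o_def wy)
    show "\<forall>a A B. (a, A) \<in># ?J \<and> (a, B) \<in># ?J \<longrightarrow> A = B" by auto
    show "\<exists>F. density_one F y \<and> ((\<lambda>h. qdist (w (y + h)) (image_mset (\<lambda>(a, A). a + A *v h) ?J) / norm h) \<longlongrightarrow> 0) (at 0 within {h. y + h \<in> F})"
    proof (intro exI[of _ F] conjI F tendstoI)
      fix r :: real assume r: "r > 0"
      define C where "C = sqrt (real q) * (E0 * 5)"
      have C: "C \<ge> 0" using E0 by (simp add: C_def)
      define e where "e = r / (2 * (C + 1))"
      have e: "e > 0" using r C by (simp add: e_def)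
      have "C * e < r"
      proof -
        have "C * e \<le> (C + 1) * e" using e by (intro mult_right_mono) auto
        also have "\<dots> = r / 2"
        proof -
          have "k * (z / (2 * k)) = z / 2" if "k > 0" for z k :: real using that by simp
          from this[of "C + 1" r] show ?thesis using C unfolding e_def by linarith
        qed
        finally show ?thesis using r by simp
      qed
      have "\<forall>\<^sub>F h in at 0 within {h. y + h \<in> F}. y + h \<in> F \<and> h \<noteq> 0"
        by (simp add: eventually_at_filter)
      moreover have "\<forall>\<^sub>F h in at 0 within {h. y + h \<in> F}. y + h \<in> F \<longrightarrow> qdist (w (y + h)) (image_mset (\<lambda>(a, A). a + A *v h) ?J) \<le> C * e * norm h"
        using key[OF e] unfolding C_def eventually_at_filter by (rule eventually_mono) blast
      moreover have "\<forall>\<^sub>F h in at 0 within {h. y + h \<in> F}. y + h \<in> annulus"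
      proof -
        obtain r where "r > 0" "ball y r \<subseteq> annulus" using open_annulus y(2) open_contains_ball by blast
        then show ?thesis unfolding eventually_at by (intro exI[of _ r]) (auto simp: dist_norm)
      qed
      ultimately show "\<forall>\<^sub>F h in at 0 within {h. y + h \<in> F}. dist (qdist (w (y + h)) (image_mset (\<lambda>(a, A). a + A *v h) ?J) / norm h) 0 < r"
      proof eventually_elim
        case (elim h)
        let ?q = "qdist (w (y + h)) (image_mset (\<lambda>(a, A). a + A *v h) ?J)"
        have "size (w (y + h)) = size (image_mset (\<lambda>(a, A). a + A *v h) ?J)" using sz elim(3) x by simp
        then have "0 \<le> ?q" by (rule qdist_nonneg)
        moreover have "?q \<le> C * e * norm h" using elim by blast
        ultimately have "\<bar>?q / norm h\<bar> \<le> C * e" using elim(1) by (simp add: divide_le_eq)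
        then show ?case using \<open>C * e < r\<close> by (simp add: dist_real_def)
      qed
    qed
  qed
qed

text \<open>The speed \<open>D a\<close> along the circle reappears as the tangential part of the
  jet; this couples differentiability on the circle with approximate differentiability in the
  plane.\<close>

definition circle_jets :: "real \<Rightarrow> (real^2 \<Rightarrow> (real^'k) multiset) \<Rightarrow> real^2 \<Rightarrow> real set \<Rightarrow> bool" where
  "circle_jets \<sigma> w x G \<longleftrightarrow> negligible {t \<in> G. \<not> (\<exists>D. qdiff (\<lambda>t. w (rot t x)) G t D \<and>
     j1 w (rot t x) = image_mset (\<lambda>a. (a, polar_jet \<sigma> (rot t x) a (D a))) (w (rot t x)))}"

text \<open>The last clause is Euler's relation, the infinitesimal form of homogeneity of degree
  \<open>\<sigma>\<close>.\<close>

definition euler_jet :: "real \<Rightarrow> (real^2 \<Rightarrow> (real^'k) multiset) \<Rightarrow> real^2 \<Rightarrow> bool" where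
  "euler_jet \<sigma> w y \<longleftrightarrow> image_mset fst (j1 w y) = w y \<and>
     (\<forall>a A B. (a, A) \<in># j1 w y \<and> (a, B) \<in># j1 w y \<longrightarrow> A = B) \<and> (\<forall>a A. (a, A) \<in># j1 w y \<longrightarrow> A *v y = \<sigma> *\<^sub>R a)"

text \<open>Both claims are the jet formula at spiral parameters. On the circle itself the
  logarithmic dilation is 0 and the relation between the values is trivial, so only a differential
  at the angle is required; off the circle the parameters must also be generic for
  homogeneity.\<close>

lemma homogeneous_circle_jets:
  fixes w :: "real^2 \<Rightarrow> (real^'k) multiset"
  assumes W: "W12 annulus q w" and q: "q \<ge> 1" and hom: "homogeneous_map \<sigma> w"
  shows "AE x in lborel. x \<in> annulus \<longrightarrow> (\<exists>G g. circle_regular L (\<lambda>t. w (rot t x)) G g \<and> circle_jets \<sigma> w x G \<and>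
    (AE p in lborel. spiral p x \<in> annulus \<longrightarrow> snd p \<in> {0<..<L} \<longrightarrow> euler_jet \<sigma> w (spiral p x)))"
  using W12_circle_regular[OF W q, of L] homogeneous_spiral[OF W hom]
proof eventually_elim
  case (elim x)
  show ?case
  proof
    assume x: "x \<in> annulus"
    have sz: "size (w y) = q" if "y \<in> annulus" for y using W that by (simp add: W12_def)
    obtain G g where G: "circle_regular L (\<lambda>t. w (rot t x)) G g" using elim(1) x by blast
    have hp: "AE p in lborel. spiral p x \<in> annulus \<longrightarrow> w (spiral p x) = image_mset (\<lambda>a. exp (\<sigma> * fst p) *\<^sub>R a) (w (rot (snd p) x))"
      using elim(2) x by blast
    have Gn: "negligible ({0..L} - G)" "G \<subseteq> {0..L}" "negligible {t \<in> G. \<not> (\<exists>D. qdiff (\<lambda>t. w (rot t x)) G t D)}"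
      using G by (auto simp: circle_regular_def)
    have jet: "j1 w y = image_mset (\<lambda>a. (exp (\<sigma> * s) *\<^sub>R a, polar_jet \<sigma> y (exp (\<sigma> * s) *\<^sub>R a) (exp (\<sigma> * s) *\<^sub>R D a))) (w (rot t x))"
      if t: "0 < t" "t < L" "qdiff (\<lambda>t. w (rot t x)) G t D"
        and y: "y = spiral (s, t) x" "y \<in> annulus" "w y = image_mset (\<lambda>a. exp (\<sigma> * s) *\<^sub>R a) (w (rot t x))" for s t D y
      by (rule j1_eq[OF homogeneous_jet_at[OF sz x Gn(1) hp t y] open_annulus y(2) sz])
    have "circle_jets \<sigma> w x G" unfolding circle_jets_def
    proof (rule negligible_subset[OF negligible_Un[OF Gn(3) negligible_finite[of "{0, L}"]]])
      show "{t \<in> G. \<not> (\<exists>D. qdiff (\<lambda>t. w (rot t x)) G t D \<and> j1 w (rot t x) = image_mset (\<lambda>a. (a, polar_jet \<sigma> (rot t x) a (D a))) (w (rot t x)))}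
        \<subseteq> {t \<in> G. \<not> (\<exists>D. qdiff (\<lambda>t. w (rot t x)) G t D)} \<union> {0, L}"
      proof (rule subsetI, rule ccontr)
        fix t assume t: "t \<in> {t \<in> G. \<not> (\<exists>D. qdiff (\<lambda>t. w (rot t x)) G t D \<and> j1 w (rot t x) = image_mset (\<lambda>a. (a, polar_jet \<sigma> (rot t x) a (D a))) (w (rot t x)))}"
          and n: "t \<notin> {t \<in> G. \<not> (\<exists>D. qdiff (\<lambda>t. w (rot t x)) G t D)} \<union> {0, L}"
        then have tG: "t \<in> G" "t \<in> {0..L}" "t \<noteq> 0" "t \<noteq> L" using Gn(2) by auto
        obtain D where D: "qdiff (\<lambda>t. w (rot t x)) G t D" using t n by blast
        have "j1 w (rot t x) = image_mset (\<lambda>a. (exp (\<sigma> * 0) *\<^sub>R a, polar_jet \<sigma> (rot t x) (exp (\<sigma> * 0) *\<^sub>R a) (exp (\<sigma> * 0) *\<^sub>R D a))) (w (rot t x))"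
          by (rule jet[OF _ _ D]) (use tG x in \<open>auto simp: spiral_def\<close>)
        then have "j1 w (rot t x) = image_mset (\<lambda>a. (a, polar_jet \<sigma> (rot t x) a (D a))) (w (rot t x))" by simp
        then show False using t D by blast
      qed
    qed simp
    moreover have "AE p in lborel. spiral p x \<in> annulus \<longrightarrow> snd p \<in> {0<..<L} \<longrightarrow> euler_jet \<sigma> w (spiral p x)"
    proof -
      define X where "X = ({0..L} - G) \<union> {t \<in> G. \<not> (\<exists>D. qdiff (\<lambda>t. w (rot t x)) G t D)}"
      have "negligible X" unfolding X_def by (rule negligible_Un[OF Gn(1,3)])
      then have "AE p::real \<times> real in lborel. snd p \<notin> X"
        using negligible_snd by (simp add: AE_lborel_iff_negligible)
      with hp show ?thesis
      proof eventually_elim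
        case (elim p)
        show ?case
        proof (intro impI)
          assume sp: "spiral p x \<in> annulus" and s: "snd p \<in> {0<..<L}"
          then have "snd p \<in> G" using elim(2) by (auto simp: X_def)
          then obtain D where D: "qdiff (\<lambda>t. w (rot t x)) G (snd p) D" using elim(2) unfolding X_def by blast
          have wp: "w (spiral p x) = image_mset (\<lambda>a. exp (\<sigma> * fst p) *\<^sub>R a) (w (rot (snd p) x))" using elim(1) sp by blast
          have j: "j1 w (spiral p x) = image_mset (\<lambda>a. (exp (\<sigma> * fst p) *\<^sub>R a, polar_jet \<sigma> (spiral p x) (exp (\<sigma> * fst p) *\<^sub>R a) (exp (\<sigma> * fst p) *\<^sub>R D a))) (w (rot (snd p) x))"
            by (rule jet[OF _ _ D _ sp wp]) (use s in auto)
          have "spiral p x \<noteq> 0" using sp by (auto simp: annulus_def)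
          then show "euler_jet \<sigma> w (spiral p x)"
            unfolding euler_jet_def j by (auto simp: multiset.map_comp o_def wp polar_jet_radial)
        qed
      qed
    qed
    ultimately show "\<exists>G g. circle_regular L (\<lambda>t. w (rot t x)) G g \<and> circle_jets \<sigma> w x G \<and>
      (AE p in lborel. spiral p x \<in> annulus \<longrightarrow> snd p \<in> {0<..<L} \<longrightarrow> euler_jet \<sigma> w (spiral p x))"
      using G by blast
  qed
qed

lemma spiral_surj:
  assumes "x \<noteq> 0" "y \<noteq> 0"
  obtains s t where "y = spiral (s, t) x" "2 * pi \<le> t" "t < 4 * pi"
proof -
  define \<alpha> where "\<alpha> = (y \<bullet> x) / (x \<bullet> x)"
  define \<beta> where "\<beta> = (y \<bullet> perp x) / (x \<bullet> x)"
  have yd: "y = \<alpha> *\<^sub>R x + \<beta> *\<^sub>R perp x"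
  proof -
    have "y = (1 / (x \<bullet> x)) *\<^sub>R ((x \<bullet> x) *\<^sub>R y)" using assms(1) by simp
    also have "\<dots> = \<alpha> *\<^sub>R x + \<beta> *\<^sub>R perp x"
      unfolding perp_decomposition by (simp add: \<alpha>_def \<beta>_def scaleR_add_right)
    finally show ?thesis .
  qed
  define r where "r = sqrt (\<alpha>\<^sup>2 + \<beta>\<^sup>2)"
  have "\<alpha>\<^sup>2 + \<beta>\<^sup>2 \<noteq> 0" using yd assms(2) by (auto simp: sum_power2_eq_zero_iff)
  then have "\<alpha>\<^sup>2 + \<beta>\<^sup>2 > 0" by (simp add: sum_power2_gt_zero_iff sum_power2_eq_zero_iff)
  then have r: "r > 0" "r\<^sup>2 = \<alpha>\<^sup>2 + \<beta>\<^sup>2" by (simp_all add: r_def)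
  have "(\<alpha> / r)\<^sup>2 + (\<beta> / r)\<^sup>2 = 1"
    unfolding power_divide add_divide_distrib[symmetric] r(2)[symmetric] using r(1) by simp
  then obtain t where t: "0 \<le> t" "t < 2 * pi" "\<alpha> / r = cos t" "\<beta> / r = sin t"
    by (rule sincos_total_2pi)
  show ?thesis
  proof (rule that[of "ln r" "t + 2 * pi"])
    have "\<alpha> = r * cos t" "\<beta> = r * sin t" using t(3,4) r(1) by (simp_all add: field_simps)
    then show "y = spiral (ln r, t + 2 * pi) x"
      using r(1) by (subst yd) (simp add: spiral_def rot_2pi, simp add: rot_def scaleR_add_right)
  qed (use t in auto)
qed

text \<open>One generic starting point suffices: its spirals reach every point of the annulus, and
  the differentiable parametrization maps null sets to null sets.\<close>

lemma AE_annulus_of_spiral: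
  assumes x: "x \<in> annulus"
    and AEp: "AE p in lborel. spiral p x \<in> annulus \<longrightarrow> snd p \<in> {0<..<4 * pi} \<longrightarrow> R (spiral p x)"
  shows "AE y in lborel. y \<in> annulus \<longrightarrow> R y"
proof -
  define P where "P = {p. \<not> (spiral p x \<in> annulus \<longrightarrow> snd p \<in> {0<..<4 * pi} \<longrightarrow> R (spiral p x))}"
  have "negligible P" using AEp by (simp only: AE_lborel_iff_negligible P_def)
  then have "negligible ((\<lambda>p. spiral p x) ` P)"
  proof (rule negligible_differentiable_image_negligible[rotated])
    show "(\<lambda>p. spiral p x) differentiable_on P" by (rule differentiable_on_spiral)
  qed simp
  moreover have "{y. \<not> (y \<in> annulus \<longrightarrow> R y)} \<subseteq> (\<lambda>p. spiral p x) ` P"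
  proof
    fix y assume y: "y \<in> {y. \<not> (y \<in> annulus \<longrightarrow> R y)}"
    have "x \<noteq> 0" "y \<noteq> 0" using x y by (auto simp: annulus_def)
    then obtain s t where st: "y = spiral (s, t) x" "2 * pi \<le> t" "t < 4 * pi" by (rule spiral_surj)
    have "0 < t" using st(2) pi_gt_zero by linarith
    then have "(s, t) \<in> P" using y st by (simp add: P_def)
    then show "y \<in> (\<lambda>p. spiral p x) ` P" using st(1) by blast
  qed
  ultimately show ?thesis unfolding AE_lborel_iff_negligible by (rule negligible_subset)
qed

lemma ex_annulus_point:
  assumes "AE x in lborel. x \<in> annulus \<longrightarrow> Q x"
  obtains x where "x \<in> annulus" "Q x"
proof -
  have "\<not> negligible annulus"
  proof (rule open_not_negligible[OF open_annulus])
    have "(3 / 2) *\<^sub>R axis 1 (1::real) \<in> annulus" by (simp add: annulus_def)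
    then show "annulus \<noteq> {}" by blast
  qed
  moreover have "negligible {x. \<not> (x \<in> annulus \<longrightarrow> Q x)}" using assms by (simp only: AE_lborel_iff_negligible)
  ultimately have "\<not> annulus \<subseteq> {x. \<not> (x \<in> annulus \<longrightarrow> Q x)}" using negligible_subset by blast
  then show thesis using that by blast
qed

lemma AE_euler_jet:
  fixes w :: "real^2 \<Rightarrow> (real^'k) multiset"
  assumes W: "W12 annulus q w" and q: "q \<ge> 1" and hom: "homogeneous_map \<sigma> w"
  shows "AE y in lborel. y \<in> annulus \<longrightarrow> euler_jet \<sigma> w y"
proof -
  have "AE x in lborel. x \<in> annulus \<longrightarrow>
    (AE p in lborel. spiral p x \<in> annulus \<longrightarrow> snd p \<in> {0<..<4 * pi} \<longrightarrow> euler_jet \<sigma> w (spiral p x))"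
    using homogeneous_circle_jets[OF W q hom, of "4 * pi"] by eventually_elim blast
  then obtain x where "x \<in> annulus"
    "AE p in lborel. spiral p x \<in> annulus \<longrightarrow> snd p \<in> {0<..<4 * pi} \<longrightarrow> euler_jet \<sigma> w (spiral p x)"
    by (rule ex_annulus_point) (rule that)
  then show ?thesis by (rule AE_annulus_of_spiral)
qed

section \<open>The dilation identity\<close>

text \<open>An optimal matching turns convergence in \<open>qdist\<close> into convergence of
  matched points, and continuity of \<open>F\<close> is uniform over the finitely many limit
  values.\<close>

lemma sum_mset_qdist_tendsto:
  fixes F :: "'a::metric_space \<times> 'e::euclidean_space \<Rightarrow> real"
  assumes F: "continuous_on UNIV F" and x: "x \<longlonglongrightarrow> a"
    and S: "\<And>n. size (S n) = Q" "size S0 = Q" and q: "(\<lambda>n. qdist (S n) S0) \<longlonglongrightarrow> 0"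
  shows "(\<lambda>n. \<Sum>z\<in>#S n. F (x n, z)) \<longlonglongrightarrow> (\<Sum>z\<in>#S0. F (a, z))"
proof (rule tendstoI)
  fix e :: real assume e: "e > 0"
  define e1 where "e1 = e / (real Q + 1)"
  have e1: "e1 > 0" using e by (simp add: e1_def)
  have "\<exists>d>0. \<forall>w. dist w (a, z) < d \<longrightarrow> dist (F w) (F (a, z)) < e1" for z
    using F e1 by (auto simp: continuous_on_iff)
  then obtain d where d: "\<And>z. d z > 0" "\<And>z w. dist w (a, z) < d z \<Longrightarrow> dist (F w) (F (a, z)) < e1" by metis
  define \<delta> where "\<delta> = Min (insert 1 (d ` set_mset S0))"
  have \<delta>: "\<delta> > 0" "\<And>z. z \<in># S0 \<Longrightarrow> \<delta> \<le> d z" using d(1) by (auto simp: \<delta>_def)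
  have "\<forall>\<^sub>F n in sequentially. dist (x n) a < \<delta> / 2" using x \<delta>(1) by (intro tendstoD) auto
  moreover have "\<forall>\<^sub>F n in sequentially. qdist (S n) S0 < \<delta> / 2" using q \<delta>(1) by (intro order_tendstoD(2)) auto
  ultimately show "\<forall>\<^sub>F n in sequentially. dist (\<Sum>z\<in>#S n. F (x n, z)) (\<Sum>z\<in>#S0. F (a, z)) < e"
  proof eventually_elim
    case (elim n)
    have "size (S n) = size S0" using S by simp
    then obtain xs ys where xy: "mset xs = S n" "mset ys = S0" "length xs = length ys"
      "\<And>i. i < length xs \<Longrightarrow> norm (xs ! i - ys ! i) \<le> qdist (S n) S0"
      by (rule qdist_matching) (rule that)
    have lq: "length xs = Q" using xy(1) S(1) by (metis size_mset)
    have "\<bar>F (x n, xs ! i) - F (a, ys ! i)\<bar> \<le> e1" if i: "i < length xs" for i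
    proof -
      have yi: "ys ! i \<in># S0" using i xy(2,3) by (metis nth_mem set_mset_mset)
      have "dist (x n, xs ! i) (a, ys ! i) \<le> dist (x n) a + dist (xs ! i) (ys ! i)"
        unfolding dist_Pair_Pair by (rule sqrt_sum_squares_le_sum) auto
      also have "\<dots> < \<delta>" using elim xy(4)[OF i] by (simp add: dist_norm)
      also have "\<delta> \<le> d (ys ! i)" by (rule \<delta>(2)[OF yi])
      finally have "dist (F (x n, xs ! i)) (F (a, ys ! i)) < e1" by (rule d(2))
      then show ?thesis by (simp add: dist_real_def)
    qed
    then have "(\<Sum>i<length xs. \<bar>F (x n, xs ! i) - F (a, ys ! i)\<bar>) \<le> (\<Sum>i<length xs. e1)"
      by (intro sum_mono) auto
    moreover have "(\<Sum>i<length xs. e1) < e"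
    proof -
      have "real Q * e1 < (real Q + 1) * e1" using e1 by (simp add: distrib_right)
      also have "\<dots> = e" by (simp add: e1_def)
      finally show ?thesis by (simp add: lq)
    qed
    moreover have "\<bar>(\<Sum>i<length xs. F (x n, xs ! i)) - (\<Sum>i<length xs. F (a, ys ! i))\<bar> \<le> (\<Sum>i<length xs. \<bar>F (x n, xs ! i) - F (a, ys ! i)\<bar>)"
      unfolding sum_subtractf[symmetric] by (rule sum_abs)
    ultimately show ?case
      unfolding dist_real_def xy(1,2)[symmetric] sum_mset_nth xy(3)[symmetric] by linarith
  qed
qed

text \<open>The sum depends only on the point and on the Almgren coordinates, and it does so
  continuously on the image of the embedding, since the coordinates control \<open>qdist\<close>.
  Measurability of the coordinates is therefore enough.\<close>

lemma borel_measurable_sum_mset: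
  fixes T :: "real^2 \<Rightarrow> 'e::euclidean_space multiset" and F :: "(real^2) \<times> 'e \<Rightarrow> real"
  assumes W: "W12 annulus Q T" and F: "continuous_on UNIV F"
  shows "(\<lambda>x. \<Sum>z\<in>#T x. F (x, z)) \<in> borel_measurable (lebesgue_on annulus)"
proof -
  let ?M = "lebesgue_on annulus"
  from W obtain es where emb: "almgren_embedding Q es"
    and Wr: "\<And>l m. l < length es \<Longrightarrow> m < Q \<Longrightarrow> W12_real annulus (\<lambda>x. almgren_xi es l m (T x))"
    by (auto simp: W12_def)
  have sz: "size (T x) = Q" if "x \<in> annulus" for x using W that by (simp add: W12_def)
  let ?h = "length es"
  obtain K where K: "K > 0" "\<And>T S. size T = Q \<Longrightarrow> size S = Q \<Longrightarrow>
    qdist T S \<le> K * (\<Sum>l<?h. \<Sum>m<Q. \<bar>almgren_xi es l m T - almgren_xi es l m (S::'e multiset)\<bar>)"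
    by (rule almgren_embedding_lower[OF emb]) (rule that)
  \<comment> \<open>Padded by 0 to a function of all pairs, so that the coordinates live in a
    product of real lines with the product topology.\<close>
  define X where "X S = (\<lambda>(l, m). if l < ?h \<and> m < Q then almgren_xi es l m S else 0)" for S :: "'e multiset"
  have XK: "qdist T S \<le> K * (\<Sum>l<?h. \<Sum>m<Q. \<bar>X T (l, m) - X S (l, m)\<bar>)" if "size T = Q" "size S = Q" for T S
    using K(2)[OF that] by (simp add: X_def)
  have inj: "S = S'" if "size S = Q" "size S' = Q" "X S = X S'" for S S'
    using XK[OF that(1,2)] that by (intro qdist_zero_imp_eq) auto
  define Y where "Y = X ` {S. size S = Q}"
  define \<Phi> where "\<Phi> p = (\<Sum>z\<in>#(SOME S. size S = Q \<and> X S = snd p). F (fst p, z))" for p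
  have \<Phi>: "\<Phi> (x, X S) = (\<Sum>z\<in>#S. F (x, z))" if "size S = Q" for x S
  proof -
    have "size (SOME S'. size S' = Q \<and> X S' = X S) = Q \<and> X (SOME S'. size S' = Q \<and> X S' = X S) = X S"
      by (rule someI[of _ S]) (simp add: that)
    then have "(SOME S'. size S' = Q \<and> X S' = X S) = S" using that by (intro inj) auto
    then show ?thesis by (simp add: \<Phi>_def)
  qed
  have "continuous_on (UNIV \<times> Y) \<Phi>"
    unfolding continuous_on_sequentially
  proof (intro allI ballI impI, elim conjE)
    fix u :: "nat \<Rightarrow> (real^2) \<times> (nat \<times> nat \<Rightarrow> real)" and p
    assume p: "p \<in> UNIV \<times> Y" and u: "\<forall>n. u n \<in> UNIV \<times> Y" and lim: "u \<longlonglongrightarrow> p"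
    obtain S0 where S0: "size S0 = Q" "snd p = X S0" using p by (auto simp: Y_def)
    have "\<exists>S. size S = Q \<and> snd (u n) = X S" for n
    proof -
      have "snd (u n) \<in> Y" using u[rule_format, of n] by (cases "u n") simp
      then show ?thesis by (auto simp: Y_def)
    qed
    then obtain S where S: "\<And>n. size (S n) = Q" "\<And>n. snd (u n) = X (S n)" by metis
    have l2: "(\<lambda>n. X (S n)) \<longlonglongrightarrow> X S0" using tendsto_snd[OF lim] by (simp add: S S0)
    have coord: "(\<lambda>n. X (S n) i) \<longlonglongrightarrow> X S0 i" for i
      using continuous_on_tendsto_compose[OF continuous_on_product_coordinates[of i] l2] by simp
    define b where "b n = K * (\<Sum>l<?h. \<Sum>m<Q. \<bar>X (S n) (l, m) - X S0 (l, m)\<bar>)" for n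
    have "b \<longlonglongrightarrow> K * (\<Sum>l<?h. \<Sum>m<Q. \<bar>X S0 (l, m) - X S0 (l, m)\<bar>)"
      unfolding b_def by (intro tendsto_intros coord)
    then have b0: "b \<longlonglongrightarrow> 0" by simp
    have "0 \<le> qdist (S n) S0" "qdist (S n) S0 \<le> b n" for n
      using XK[OF S(1)[of n] S0(1)] qdist_nonneg[of "S n" S0] S(1)[of n] S0(1) by (simp_all add: b_def)
    then have "(\<lambda>n. qdist (S n) S0) \<longlonglongrightarrow> 0"
      by (intro tendsto_sandwich[OF _ _ tendsto_const[of 0] b0] always_eventually allI)
    from sum_mset_qdist_tendsto[OF F tendsto_fst[OF lim] S(1) S0(1) this]
    have "(\<lambda>n. \<Phi> (fst (u n), X (S n))) \<longlonglongrightarrow> \<Phi> (fst p, X S0)" by (simp only: \<Phi>[OF S(1)] \<Phi>[OF S0(1)])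
    then show "(\<Phi> \<circ> u) \<longlonglongrightarrow> \<Phi> p"
      unfolding o_def S(2)[symmetric] S0(2)[symmetric] prod.collapse .
  qed
  then have \<Phi>m: "\<Phi> \<in> borel_measurable (restrict_space borel (UNIV \<times> Y))"
    by (rule borel_measurable_continuous_on_restrict)
  have "(\<lambda>x. X (T x)) \<in> borel_measurable ?M"
  proof (rule measurable_coordinatewise_then_product)
    fix i :: "nat \<times> nat"
    obtain l m where i: "i = (l, m)" by (cases i)
    show "(\<lambda>x. X (T x) i) \<in> borel_measurable ?M"
      using Wr[of l m] by (cases "l < ?h \<and> m < Q") (auto simp: X_def i W12_real_def L2_on_def)
  qed
  moreover have "(\<lambda>x. x) \<in> borel_measurable ?M"
    by (intro measurable_restrict_space1 measurable_completion) simp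
  ultimately have "(\<lambda>x. (x, X (T x))) \<in> borel_measurable ?M" by (rule borel_measurable_Pair[rotated])
  then have "(\<lambda>x. (x, X (T x))) \<in> measurable ?M (restrict_space borel (UNIV \<times> Y))"
    by (rule measurable_restrict_space2[rotated]) (auto simp: Y_def space_restrict_space sz)
  from measurable_compose[OF this \<Phi>m] have "(\<lambda>x. \<Phi> (x, X (T x))) \<in> borel_measurable ?M" .
  then show ?thesis
    by (rule measurable_cong[THEN iffD1, rotated]) (simp add: space_restrict_space \<Phi> sz)
qed

section \<open>Scaling of integrals and difference quotients\<close>

lemma integral_scaleR_plane:
  fixes g :: "real^2 \<Rightarrow> real"
  assumes g: "g \<in> borel_measurable borel" and c: "c > 0"
  shows "(\<integral>x. g x \<partial>lborel) = c\<^sup>2 * (\<integral>x. g (c *\<^sub>R x) \<partial>lborel)"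
proof -
  have "(\<integral>x. g x \<partial>lborel) = (\<integral>x. g x \<partial>density (distr lborel borel (\<lambda>x. c *\<^sub>R x)) (\<lambda>_. ennreal (\<bar>c\<bar> ^ DIM(real^2))))"
    using lborel_affine[of c "0 :: real^2"] c by simp
  also have "\<dots> = (\<integral>x. \<bar>c\<bar> ^ DIM(real^2) * g x \<partial>distr lborel borel (\<lambda>x. c *\<^sub>R x))"
    using g by (subst integral_density) auto
  also have "\<dots> = (\<integral>x. \<bar>c\<bar> ^ DIM(real^2) * g (c *\<^sub>R x) \<partial>lborel)"
    using g by (subst integral_distr) auto
  finally show ?thesis using c by simp
qed

lemma Cc1_radial_bound:
  fixes \<phi> :: "'a::euclidean_space \<Rightarrow> real"
  assumes "Cc1 U \<phi>"
  obtains M where "M \<ge> 0" "\<And>z. \<bar>frechet_derivative \<phi> (at z) z\<bar> \<le> M"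
proof -
  obtain K where K: "compact K" "K \<subseteq> U" "\<And>x. x \<notin> K \<Longrightarrow> \<phi> x = 0"
    "\<And>x h. x \<notin> K \<Longrightarrow> frechet_derivative \<phi> (at x) h = 0"
    by (rule Cc1_compact_support[OF assms]) (rule that)
  obtain B where B: "\<And>x. norm (\<phi> x) \<le> B" "\<And>x h. norm (frechet_derivative \<phi> (at x) h) \<le> B * norm h" "B \<ge> 0"
    by (rule Cc1_bounded[OF assms]) (rule that)
  have "\<exists>R. \<forall>x\<in>K. norm x \<le> R" using compact_imp_bounded[OF K(1)] by (simp only: bounded_iff)
  then obtain R where R: "\<forall>x\<in>K. norm x \<le> R" ..
  show ?thesis
  proof (rule that[of "B * \<bar>R\<bar>"])
    show "\<bar>frechet_derivative \<phi> (at z) z\<bar> \<le> B * \<bar>R\<bar>" for z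
    proof (cases "z \<in> K")
      case True
      have "\<bar>frechet_derivative \<phi> (at z) z\<bar> \<le> B * norm z" using B(2)[of z z] by simp
      also have "\<dots> \<le> B * \<bar>R\<bar>" using R[rule_format, OF True] B(3) by (intro mult_left_mono) auto
      finally show ?thesis .
    qed (use B(3) K(4) in auto)
  qed (use B(3) in auto)
qed

lemma C1_exp_scale_derivative:
  fixes \<phi> :: "'a::euclidean_space \<Rightarrow> real"
  assumes "C1 \<phi>"
  shows "((\<lambda>s. \<phi> (exp (c * s) *\<^sub>R x)) has_real_derivative c * frechet_derivative \<phi> (at (exp (c * s) *\<^sub>R x)) (exp (c * s) *\<^sub>R x)) (at s)"
proof -
  let ?z = "exp (c * s) *\<^sub>R x"
  have "((\<lambda>s. exp (c * s) *\<^sub>R x) has_derivative (\<lambda>r. (r * c) *\<^sub>R ?z)) (at s)"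
    by (rule derivative_eq_intros refl | simp add: mult_ac)+
  from diff_chain_at[OF this C1D[OF assms]]
  have "((\<lambda>s. \<phi> (exp (c * s) *\<^sub>R x)) has_derivative (\<lambda>r. frechet_derivative \<phi> (at ?z) ((r * c) *\<^sub>R ?z))) (at s)"
    by (simp add: o_def)
  moreover have "frechet_derivative \<phi> (at ?z) ((r * c) *\<^sub>R ?z) = c * frechet_derivative \<phi> (at ?z) ?z * r" for r
    using linear_scale[OF C1_linear[OF assms], of ?z "r * c" ?z] by simp
  ultimately show ?thesis by (simp add: has_field_derivative_def)
qed

lemma difference_quotient_bound:
  fixes u :: "real \<Rightarrow> real"
  assumes "\<And>r. (u has_real_derivative u' r) (at r)" "\<And>r. 0 \<le> r \<Longrightarrow> r \<le> 1 \<Longrightarrow> \<bar>u' r\<bar> \<le> C" "0 < s" "s \<le> 1"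
  shows "\<bar>(u s - u 0) / s\<bar> \<le> C"
proof -
  obtain z where "0 < z" "z < s" "u s - u 0 = (s - 0) * u' z"
    using MVT2[OF assms(3), of u u'] assms(1) by blast
  then show ?thesis using assms(2)[of z] assms(3,4) by simp
qed

text \<open>Differentiating the scaled integral in the scaling parameter replaces the radial derivative of the test
  function by Euler's relation, so that no polar coordinates are needed.\<close>

lemma dilation_identity:
  fixes w :: "real^2 \<Rightarrow> (real^'k) multiset" and J :: "real^2 \<Rightarrow> ((real^'k) \<times> 'e::euclidean_space) multiset"
  assumes W: "W12 annulus q J" and fstJ: "AE y in lborel. y \<in> annulus \<longrightarrow> image_mset fst (J y) = w y"
    and hom: "homogeneous_map \<sigma> w" and \<kappa>: "Cc1 UNIV \<kappa>" and \<phi>: "Cc1 annulus \<phi>"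
  shows "(\<integral>x. (\<Sum>z\<in>#J x. \<kappa> (fst z)) * (2 * \<phi> x + frechet_derivative \<phi> (at x) x) \<partial>lebesgue_on annulus)
     = - (\<integral>x. \<sigma> * (\<Sum>z\<in>#J x. frechet_derivative \<kappa> (at (fst z)) (fst z)) * \<phi> x \<partial>lebesgue_on annulus)"
proof -
  have C\<kappa>: "C1 \<kappa>" and C\<phi>: "C1 \<phi>" using \<kappa> \<phi> by (simp_all add: Cc1_iff)
  have sz: "size (J x) = q" if "x \<in> annulus" for x using W that by (simp add: W12_def)
  define k where "k x = (\<Sum>z\<in>#J x. \<kappa> (fst z))" for x
  define rk where "rk x = (\<Sum>z\<in>#J x. frechet_derivative \<kappa> (at (fst z)) (fst z))" for x
  have km: "k \<in> borel_measurable (lebesgue_on annulus)"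
    unfolding k_def by (rule borel_measurable_sum_mset[OF W, of "\<lambda>(x, z). \<kappa> (fst z)", simplified])
      (simp add: split_beta', intro continuous_on_compose2[OF C1_continuous[OF C\<kappa>, of UNIV]] continuous_intros, simp)
  have rkm: "rk \<in> borel_measurable (lebesgue_on annulus)"
    unfolding rk_def by (rule borel_measurable_sum_mset[OF W, of "\<lambda>(x, z). frechet_derivative \<kappa> (at (fst z)) (fst z)", simplified])
      (simp add: split_beta', intro C1_derivative_continuous[OF C\<kappa>] continuous_intros)
  obtain k0 where k0: "k0 \<in> borel_measurable borel" "AE x in lborel. x \<in> annulus \<longrightarrow> k0 x = k x" "\<And>x. x \<notin> annulus \<Longrightarrow> k0 x = 0"
    by (rule borel_representative[OF km]) (rule that)
  obtain rk0 where rk0: "rk0 \<in> borel_measurable borel" "AE x in lborel. x \<in> annulus \<longrightarrow> rk0 x = rk x" "\<And>x. x \<notin> annulus \<Longrightarrow> rk0 x = 0"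
    by (rule borel_representative[OF rkm]) (rule that)
  obtain Bk where Bk: "\<And>x. norm (\<kappa> x) \<le> Bk" "\<And>x h. norm (frechet_derivative \<kappa> (at x) h) \<le> Bk * norm h" "Bk \<ge> 0"
    by (rule Cc1_bounded[OF \<kappa>]) (rule that)
  obtain Mk where Mk: "Mk \<ge> 0" "\<And>z. \<bar>frechet_derivative \<kappa> (at z) z\<bar> \<le> Mk" by (rule Cc1_radial_bound[OF \<kappa>]) (rule that)
  obtain B where B: "\<And>x. norm (\<phi> x) \<le> B" "\<And>x h. norm (frechet_derivative \<phi> (at x) h) \<le> B * norm h" "B \<ge> 0"
    by (rule Cc1_bounded[OF \<phi>]) (rule that)
  obtain M where M: "M \<ge> 0" "\<And>z. \<bar>frechet_derivative \<phi> (at z) z\<bar> \<le> M" by (rule Cc1_radial_bound[OF \<phi>]) (rule that)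
  obtain S where S: "compact S" "S \<subseteq> annulus" "\<And>x. x \<notin> S \<Longrightarrow> \<phi> x = 0" "\<And>x h. x \<notin> S \<Longrightarrow> frechet_derivative \<phi> (at x) h = 0"
    by (rule Cc1_compact_support[OF \<phi>]) (rule that)
  have \<phi>m[measurable]: "\<phi> \<in> borel_measurable borel" by (rule borel_measurable_continuous_onI[OF C1_continuous[OF C\<phi>]])
  have d\<phi>m[measurable]: "(\<lambda>x. frechet_derivative \<phi> (at x) x) \<in> borel_measurable borel"
    by (intro borel_measurable_continuous_onI C1_derivative_continuous[OF C\<phi>] continuous_intros)
  note [measurable] = k0(1) rk0(1)
  \<comment> \<open>The support of \<open>\<phi>\<close> is a compact subset of the open annulus, so
    slight contractions keep it inside. Its least norm \<open>m > 1\<close> gives the bound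
    \<open>ln m\<close> for the logarithm of the factor.\<close>
  obtain s0 where s0: "0 < s0" "s0 \<le> 1" "\<And>s y. 0 \<le> s \<Longrightarrow> s < s0 \<Longrightarrow> y \<in> S \<Longrightarrow> exp (- s) *\<^sub>R y \<in> annulus"
  proof -
    have "\<exists>m>1. \<forall>y\<in>S. m \<le> norm y"
    proof (cases "S = {}")
      case True
      then show ?thesis by (intro exI[of _ 2]) auto
    next
      case False
      obtain y0 where "y0 \<in> S" "\<forall>y\<in>S. norm y0 \<le> norm y"
        using continuous_attains_inf[OF S(1) False, of norm] continuous_on_norm_id by blast
      then show ?thesis using S(2) by (intro exI[of _ "norm y0"]) (auto simp: annulus_def)
    qed
    then obtain m where m: "m > 1" "\<forall>y\<in>S. m \<le> norm y" by blast
    show ?thesis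
    proof (rule that[of "min 1 (ln m)"])
      show "0 < min 1 (ln m)" "min 1 (ln m) \<le> 1" using m(1) by simp_all
      fix s y assume s: "0 \<le> s" "s < min 1 (ln m)" "y \<in> S"
      have "exp s < exp (ln m)" using s(2) by simp
      then have "exp s < m" using m(1) by simp
      then have "exp (- s) * exp s < exp (- s) * m" by (intro mult_strict_left_mono) auto
      then have "1 < exp (- s) * m" by (simp add: exp_add[symmetric])
      also have "\<dots> \<le> exp (- s) * norm y" using m(2) s(3) by (intro mult_left_mono) auto
      finally have "1 < exp (- s) * norm y" .
      moreover have "exp (- s) * norm y \<le> 1 * norm y" using s(1) by (intro mult_right_mono) auto
      moreover have "norm y < 2" using S(2) s(3) by (auto simp: annulus_def)
      ultimately show "exp (- s) *\<^sub>R y \<in> annulus" by (simp add: annulus_def)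
    qed
  qed
  \<comment> \<open>A sequence rather than a continuous parameter: the null sets of homogeneity for
    countably many factors can be united.\<close>
  define s where "s n = s0 / 2 * inverse (real (Suc n))" for n
  have s: "0 < s n" "s n < s0" "s n \<le> 1" for n
  proof -
    show "0 < s n" using s0(1) by (simp add: s_def)
    have "s n \<le> s0 / 2 * 1" unfolding s_def using s0(1) by (intro mult_left_mono) (simp_all add: inverse_le_1_iff)
    then show "s n < s0" using s0(1) by simp
    then show "s n \<le> 1" using s0(2) by linarith
  qed
  have slim: "s \<longlonglongrightarrow> 0"
    unfolding s_def by (rule tendsto_mult_right_zero[OF LIMSEQ_inverse_real_of_nat])
  have slim': "filterlim s (at 0) sequentially"
    using slim s(1) by (auto simp: filterlim_at intro!: always_eventually less_imp_neq[THEN not_sym])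
  have AEk: "AE y in lborel. y \<in> annulus \<longrightarrow> k0 y = (\<Sum>a\<in>#w y. \<kappa> a) \<and> rk0 y = (\<Sum>a\<in>#w y. frechet_derivative \<kappa> (at a) a) \<and> size (w y) = q"
    using fstJ k0(2) rk0(2)
  proof eventually_elim
    case (elim y)
    show ?case
    proof
      assume y: "y \<in> annulus"
      have f: "image_mset fst (J y) = w y" using elim y by blast
      have "(\<Sum>z\<in>#J y. \<kappa> (fst z)) = (\<Sum>a\<in>#image_mset fst (J y). \<kappa> a)" by (simp add: multiset.map_comp o_def)
      moreover have "(\<Sum>z\<in>#J y. frechet_derivative \<kappa> (at (fst z)) (fst z)) = (\<Sum>a\<in>#image_mset fst (J y). frechet_derivative \<kappa> (at a) a)"
        by (simp add: multiset.map_comp o_def)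
      moreover have "size (w y) = q" using sz[OF y] f by (metis size_image_mset)
      ultimately show "k0 y = (\<Sum>a\<in>#w y. \<kappa> a) \<and> rk0 y = (\<Sum>a\<in>#w y. frechet_derivative \<kappa> (at a) a) \<and> size (w y) = q"
        using elim y f by (simp add: k_def rk_def)
    qed
  qed
  have k0b: "AE y in lborel. \<bar>k0 y\<bar> \<le> real q * Bk"
    using AEk
  proof eventually_elim
    case (elim y)
    show ?case
    proof (cases "y \<in> annulus")
      case True
      obtain ys where ys: "mset ys = w y" using ex_mset by blast
      have "\<bar>\<Sum>i<length ys. \<kappa> (ys ! i)\<bar> \<le> (\<Sum>i<length ys. Bk)"
        by (rule order_trans[OF sum_abs], rule sum_mono) (use Bk(1) in simp)
      moreover have "length ys = q" using elim True ys by (metis size_mset)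
      moreover have "k0 y = (\<Sum>i<length ys. \<kappa> (ys ! i))"
        using elim True by (simp only: ys[symmetric] sum_mset_nth simp_thms)
      ultimately show ?thesis by simp
    next
      case False
      then show ?thesis using k0(3) Bk(3) by simp
    qed
  qed
  have annint: "integrable lborel (\<lambda>x. indicator annulus x * c)" for c :: real
  proof -
    have "emeasure lborel annulus < \<infinity>"
      using lmeasurable_annulus by (simp add: fmeasurable_def)
    then show ?thesis by (intro integrable_mult_left integrable_real_indicator) auto
  qed
  have kint: "integrable lborel (\<lambda>x. k0 x * u x)" if um: "u \<in> borel_measurable borel" and ub: "\<And>x. \<bar>u x\<bar> \<le> C" for u C
  proof (rule Bochner_Integration.integrable_bound)
    show "integrable lborel (\<lambda>x. indicator annulus x * (real q * Bk * C))" by (rule annint)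
    show "(\<lambda>x. k0 x * u x) \<in> borel_measurable lborel" using um by simp
    show "AE x in lborel. norm (k0 x * u x) \<le> norm (indicator annulus x * (real q * Bk * C))"
      using k0b
    proof eventually_elim
      case (elim x)
      have "0 \<le> C" using ub[of x] by linarith
      show ?case
      proof (cases "x \<in> annulus")
        case True
        have "\<bar>k0 x\<bar> * \<bar>u x\<bar> \<le> real q * Bk * C" using elim ub Bk(3) by (intro mult_mono) auto
        then show ?thesis using True Bk(3) \<open>0 \<le> C\<close> by (simp add: abs_mult)
      qed (simp add: k0(3))
    qed
  qed
  \<comment> \<open>\<open>exp (2 * r)\<close> is the Jacobian of the dilation by
    \<open>exp r\<close>, so a change of variables moves the dilation from \<open>\<phi>\<close> to
    \<open>k0\<close>. The derivative at 0 is \<open>2 * \<phi> x\<close> plus the radial derivative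
    of \<open>\<phi>\<close>.\<close>
  define u where "u x r = exp (2 * r) * \<phi> (exp (1 * r) *\<^sub>R x)" for x r
  define u' where "u' x r = 2 * exp (2 * r) * \<phi> (exp (1 * r) *\<^sub>R x) + exp (2 * r) * (1 * frechet_derivative \<phi> (at (exp (1 * r) *\<^sub>R x)) (exp (1 * r) *\<^sub>R x))" for x r
  have du: "(u x has_real_derivative u' x r) (at r)" for x r
    unfolding u_def u'_def by (rule derivative_eq_intros C1_exp_scale_derivative[OF C\<phi>] refl | simp)+
  define C where "C = 2 * exp 2 * B + exp 2 * M"
  have u'b: "\<bar>u' x r\<bar> \<le> C" if "0 \<le> r" "r \<le> 1" for x r
  proof -
    have e2: "exp (2 * r) \<le> exp 2" using that by simp
    have "\<bar>u' x r\<bar> \<le> 2 * (exp (2 * r) * \<bar>\<phi> (exp (1 * r) *\<^sub>R x)\<bar>) + exp (2 * r) * \<bar>frechet_derivative \<phi> (at (exp (1 * r) *\<^sub>R x)) (exp (1 * r) *\<^sub>R x)\<bar>"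
      unfolding u'_def by (rule order_trans[OF abs_triangle_ineq]) (simp add: abs_mult)
    also have "\<dots> \<le> 2 * (exp 2 * B) + exp 2 * M"
      using e2 M B(1) by (intro add_mono mult_left_mono mult_mono) (auto simp: real_norm_def[symmetric] simp del: real_norm_def)
    finally show ?thesis by (simp add: C_def)
  qed
  define L where "L n = (\<integral>x. k0 x * ((u x (s n) - u x 0) / s n) \<partial>lborel)" for n
  have um[measurable]: "(\<lambda>x. u x r) \<in> borel_measurable borel" for r unfolding u_def by measurable
  have lim1: "L \<longlonglongrightarrow> (\<integral>x. k0 x * u' x 0 \<partial>lborel)"
    unfolding L_def
  proof (rule integral_dominated_convergence[where w = "\<lambda>x. indicator annulus x * (real q * Bk * C)"])
    show "(\<lambda>x. k0 x * u' x 0) \<in> borel_measurable lborel" unfolding u'_def by simp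
    show "(\<lambda>x. k0 x * ((u x (s n) - u x 0) / s n)) \<in> borel_measurable lborel" for n by measurable
    show "integrable lborel (\<lambda>x. indicator annulus x * (real q * Bk * C))" by (rule annint)
    show "AE x in lborel. (\<lambda>n. k0 x * ((u x (s n) - u x 0) / s n)) \<longlonglongrightarrow> k0 x * u' x 0"
    proof (rule AE_I2)
      fix x
      have "((\<lambda>r. (u x r - u x 0) / (r - 0)) \<longlongrightarrow> u' x 0) (at 0)" using du[of x 0] by (simp only: has_field_derivative_iff)
      from filterlim_compose[OF this slim'] show "(\<lambda>n. k0 x * ((u x (s n) - u x 0) / s n)) \<longlonglongrightarrow> k0 x * u' x 0"
        by (intro tendsto_mult tendsto_const) simp
    qed
    show "AE x in lborel. norm (k0 x * ((u x (s n) - u x 0) / s n)) \<le> indicator annulus x * (real q * Bk * C)" for n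
      using k0b
    proof eventually_elim
      case (elim x)
      have b: "\<bar>(u x (s n) - u x 0) / s n\<bar> \<le> C" by (rule difference_quotient_bound[OF du u'b s(1,3)])
      show ?case
      proof (cases "x \<in> annulus")
        case True
        have "\<bar>k0 x\<bar> * \<bar>(u x (s n) - u x 0) / s n\<bar> \<le> real q * Bk * C" using elim b Bk(3) by (intro mult_mono) auto
        then show ?thesis using True by (simp add: abs_mult)
      qed (simp add: k0(3))
    qed
  qed
  have Leq: "L n = (\<integral>y. \<phi> y * ((k0 (exp (- s n) *\<^sub>R y) - k0 y) / s n) \<partial>lborel)" for n
  proof -
    have i1: "integrable lborel (\<lambda>x. k0 x * u x (s n))" "integrable lborel (\<lambda>x. k0 x * \<phi> x)"
    proof -
      show "integrable lborel (\<lambda>x. k0 x * u x (s n))"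
      proof (rule kint[OF um, of _ "exp (2 * s n) * B"])
        show "\<bar>u x (s n)\<bar> \<le> exp (2 * s n) * B" for x using B(1) by (simp add: u_def abs_mult)
      qed
      show "integrable lborel (\<lambda>x. k0 x * \<phi> x)" by (rule kint[OF \<phi>m, of B]) (use B(1) in simp)
    qed
    have cv: "(\<integral>y. k0 (exp (- s n) *\<^sub>R y) * \<phi> y \<partial>lborel) = (\<integral>x. k0 x * u x (s n) \<partial>lborel)"
    proof -
      have "(\<integral>y. k0 (exp (- s n) *\<^sub>R y) * \<phi> y \<partial>lborel)
        = (exp (s n))\<^sup>2 * (\<integral>x. k0 (exp (- s n) *\<^sub>R (exp (s n) *\<^sub>R x)) * \<phi> (exp (s n) *\<^sub>R x) \<partial>lborel)"
      proof (rule integral_scaleR_plane)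
        have "(\<lambda>y. k0 (exp (- s n) *\<^sub>R y) * \<phi> y) \<in> borel_measurable lborel" by measurable
        then show "(\<lambda>y. k0 (exp (- s n) *\<^sub>R y) * \<phi> y) \<in> borel_measurable borel" by simp
      qed simp
      also have "\<dots> = (\<integral>x. (exp (s n))\<^sup>2 * (k0 x * \<phi> (exp (s n) *\<^sub>R x)) \<partial>lborel)"
        by (simp add: exp_minus)
      also have "\<dots> = (\<integral>x. k0 x * u x (s n) \<partial>lborel)"
        by (simp add: u_def mult_ac power2_eq_square exp_add[symmetric])
      finally show ?thesis .
    qed
    have i2: "integrable lborel (\<lambda>y. k0 (exp (- s n) *\<^sub>R y) * \<phi> y)"
    proof (rule Bochner_Integration.integrable_bound)
      show "integrable lborel (\<lambda>x. indicator annulus x * (real q * Bk * B))" by (rule annint)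
      show "(\<lambda>y. k0 (exp (- s n) *\<^sub>R y) * \<phi> y) \<in> borel_measurable lborel" by measurable
      show "AE y in lborel. norm (k0 (exp (- s n) *\<^sub>R y) * \<phi> y) \<le> norm (indicator annulus y * (real q * Bk * B))"
        using AE_scaleR[OF k0b, of "exp (- s n)", simplified]
      proof eventually_elim
        case (elim y)
        show ?case
        proof (cases "y \<in> annulus")
          case True
          have "\<bar>k0 (exp (- s n) *\<^sub>R y)\<bar> * \<bar>\<phi> y\<bar> \<le> real q * Bk * B" using elim B(1)[of y] Bk(3) by (intro mult_mono) auto
          then show ?thesis using True Bk(3) B(3) by (simp add: abs_mult)
        next
          case False
          then show ?thesis using S(2,3) by (auto simp: subset_iff)
        qed
      qed
    qed
    have "L n = (\<integral>x. (k0 x * u x (s n) - k0 x * \<phi> x) / s n \<partial>lborel)"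
      unfolding L_def by (simp add: u_def right_diff_distrib)
    also have "\<dots> = ((\<integral>x. k0 x * u x (s n) \<partial>lborel) - (\<integral>x. k0 x * \<phi> x \<partial>lborel)) / s n"
      using i1 by simp
    also have "\<dots> = (\<integral>y. (k0 (exp (- s n) *\<^sub>R y) * \<phi> y - k0 y * \<phi> y) / s n \<partial>lborel)"
      using i1 i2 by (simp add: cv)
    also have "\<dots> = (\<integral>y. \<phi> y * ((k0 (exp (- s n) *\<^sub>R y) - k0 y) / s n) \<partial>lborel)"
    proof -
      have "(a * p - b * p) / r = p * ((a - b) / r)" for a b p r :: real by (simp add: algebra_simps diff_divide_distrib)
      then show ?thesis by presburger
    qed
    finally show ?thesis .
  qed
  \<comment> \<open>Homogeneity turns the contraction of the point into a contraction of the values,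
    so that the same difference quotient, seen from the other side, falls on
    \<open>\<kappa>\<close>.\<close>
  have AEs: "AE y in lborel. \<forall>n. y \<in> S \<longrightarrow> k0 (exp (- s n) *\<^sub>R y) = (\<Sum>a\<in>#w y. \<kappa> (exp (- \<sigma> * s n) *\<^sub>R a))"
  proof (rule AE_all_countable[THEN iffD2], rule allI)
    fix n
    have "AE y in lborel. w (exp (- s n) *\<^sub>R y) = image_mset (\<lambda>a. (exp (- s n) powr \<sigma>) *\<^sub>R a) (w y)"
      using hom by (simp add: homogeneous_map_def AE_completion_iff)
    with AE_scaleR[OF AEk, of "exp (- s n)", simplified]
    show "AE y in lborel. y \<in> S \<longrightarrow> k0 (exp (- s n) *\<^sub>R y) = (\<Sum>a\<in>#w y. \<kappa> (exp (- \<sigma> * s n) *\<^sub>R a))"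
    proof eventually_elim
      case (elim y)
      show ?case
      proof
        assume y: "y \<in> S"
        have "exp (- s n) *\<^sub>R y \<in> annulus" using s0(3)[of "s n" y] s[of n] y by simp
        then have "k0 (exp (- s n) *\<^sub>R y) = (\<Sum>a\<in>#w (exp (- s n) *\<^sub>R y). \<kappa> a)" using elim(1) by blast
        moreover have "exp (- s n) powr \<sigma> = exp (- \<sigma> * s n)" by (simp add: powr_def mult.commute)
        ultimately show "k0 (exp (- s n) *\<^sub>R y) = (\<Sum>a\<in>#w y. \<kappa> (exp (- \<sigma> * s n) *\<^sub>R a))"
          using elim(2) by (simp add: multiset.map_comp o_def)
      qed
    qed
  qed
  have lim2: "(\<lambda>n. \<integral>y. \<phi> y * ((k0 (exp (- s n) *\<^sub>R y) - k0 y) / s n) \<partial>lborel) \<longlonglongrightarrow> (\<integral>y. \<phi> y * (- \<sigma> * rk0 y) \<partial>lborel)"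
  proof (rule integral_dominated_convergence[where w = "\<lambda>x. indicator annulus x * (B * (real q * (\<bar>\<sigma>\<bar> * Mk)))"])
    show "(\<lambda>y. \<phi> y * (- \<sigma> * rk0 y)) \<in> borel_measurable lborel" by measurable
    show "(\<lambda>y. \<phi> y * ((k0 (exp (- s n) *\<^sub>R y) - k0 y) / s n)) \<in> borel_measurable lborel" for n by measurable
    show "integrable lborel (\<lambda>x. indicator annulus x * (B * (real q * (\<bar>\<sigma>\<bar> * Mk))))" by (rule annint)
    have eq: "(k0 (exp (- s n) *\<^sub>R y) - k0 y) / s n = (\<Sum>i<length ys. (\<kappa> (exp (- \<sigma> * s n) *\<^sub>R (ys ! i)) - \<kappa> (exp (- \<sigma> * 0) *\<^sub>R (ys ! i))) / s n)"
      if "y \<in> S" "mset ys = w y" "k0 y = (\<Sum>a\<in>#w y. \<kappa> a)" "\<forall>n. y \<in> S \<longrightarrow> k0 (exp (- s n) *\<^sub>R y) = (\<Sum>a\<in>#w y. \<kappa> (exp (- \<sigma> * s n) *\<^sub>R a))" for y ys n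
    proof -
      have "k0 (exp (- s n) *\<^sub>R y) = (\<Sum>i<length ys. \<kappa> (exp (- \<sigma> * s n) *\<^sub>R (ys ! i)))" "k0 y = (\<Sum>i<length ys. \<kappa> (ys ! i))"
        using that by (simp_all only: that(2)[symmetric] sum_mset_nth)
      then show ?thesis by (simp add: sum_subtractf sum_divide_distrib[symmetric])
    qed
    show "AE y in lborel. (\<lambda>n. \<phi> y * ((k0 (exp (- s n) *\<^sub>R y) - k0 y) / s n)) \<longlonglongrightarrow> \<phi> y * (- \<sigma> * rk0 y)"
      using AEk AEs
    proof eventually_elim
      case (elim y)
      show ?case
      proof (cases "y \<in> S")
        case True
        then have yA: "y \<in> annulus" using S(2) by blast
        obtain ys where ys: "mset ys = w y" using ex_mset by blast
        have "(\<lambda>n. (\<kappa> (exp (- \<sigma> * s n) *\<^sub>R a) - \<kappa> (exp (- \<sigma> * 0) *\<^sub>R a)) / s n) \<longlonglongrightarrow> - \<sigma> * frechet_derivative \<kappa> (at a) a" for a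
        proof -
          have "((\<lambda>r. (\<kappa> (exp (- \<sigma> * r) *\<^sub>R a) - \<kappa> (exp (- \<sigma> * 0) *\<^sub>R a)) / (r - 0)) \<longlongrightarrow>
             - \<sigma> * frechet_derivative \<kappa> (at (exp (- \<sigma> * 0) *\<^sub>R a)) (exp (- \<sigma> * 0) *\<^sub>R a)) (at 0)"
            using C1_exp_scale_derivative[OF C\<kappa>, of "- \<sigma>" a 0] by (simp only: has_field_derivative_iff)
          from filterlim_compose[OF this slim'] show ?thesis by simp
        qed
        then have "(\<lambda>n. \<Sum>i<length ys. (\<kappa> (exp (- \<sigma> * s n) *\<^sub>R (ys ! i)) - \<kappa> (exp (- \<sigma> * 0) *\<^sub>R (ys ! i))) / s n)
          \<longlonglongrightarrow> (\<Sum>i<length ys. - \<sigma> * frechet_derivative \<kappa> (at (ys ! i)) (ys ! i))"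
          by (intro tendsto_sum)
        moreover have "(\<Sum>i<length ys. - \<sigma> * frechet_derivative \<kappa> (at (ys ! i)) (ys ! i)) = - \<sigma> * rk0 y"
        proof -
          have "rk0 y = (\<Sum>i<length ys. frechet_derivative \<kappa> (at (ys ! i)) (ys ! i))"
            using elim(1) yA by (simp only: ys[symmetric] sum_mset_nth)
          then show ?thesis by (simp only: sum_distrib_left)
        qed
        ultimately show ?thesis
          using eq[OF True ys] elim yA by (intro tendsto_mult tendsto_const) simp
      next
        case False
        then show ?thesis using S(3) by simp
      qed
    qed
    show "AE y in lborel. norm (\<phi> y * ((k0 (exp (- s n) *\<^sub>R y) - k0 y) / s n)) \<le> indicator annulus y * (B * (real q * (\<bar>\<sigma>\<bar> * Mk)))" for n
      using AEk AEs
    proof eventually_elim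
      case (elim y)
      show ?case
      proof (cases "y \<in> S")
        case True
        then have yA: "y \<in> annulus" using S(2) by blast
        obtain ys where ys: "mset ys = w y" using ex_mset by blast
        have lq: "length ys = q" using elim(1) yA ys by (metis size_mset)
        have each: "\<bar>(\<kappa> (exp (- \<sigma> * s n) *\<^sub>R a) - \<kappa> (exp (- \<sigma> * 0) *\<^sub>R a)) / s n\<bar> \<le> \<bar>\<sigma>\<bar> * Mk" for a
        proof (rule difference_quotient_bound[OF C1_exp_scale_derivative[OF C\<kappa>, of "- \<sigma>" a] _ s(1,3)])
          show "\<bar>- \<sigma> * frechet_derivative \<kappa> (at (exp (- \<sigma> * r) *\<^sub>R a)) (exp (- \<sigma> * r) *\<^sub>R a)\<bar> \<le> \<bar>\<sigma>\<bar> * Mk" for r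
            unfolding abs_mult abs_minus_cancel by (intro mult_left_mono Mk(2)) simp
        qed
        have "\<bar>(k0 (exp (- s n) *\<^sub>R y) - k0 y) / s n\<bar> \<le> (\<Sum>i<length ys. \<bar>\<sigma>\<bar> * Mk)"
          unfolding eq[OF True ys conjunct1[OF elim(1)[rule_format, OF yA]] elim(2)]
          by (rule order_trans[OF sum_abs]) (intro sum_mono each)
        then have "\<bar>\<phi> y\<bar> * \<bar>(k0 (exp (- s n) *\<^sub>R y) - k0 y) / s n\<bar> \<le> B * (real q * (\<bar>\<sigma>\<bar> * Mk))"
          using B(1)[of y] B(3) by (intro mult_mono) (auto simp: lq)
        then show ?thesis using yA by (simp add: abs_mult)
      next
        case False
        then show ?thesis using S(3) B(3) Mk(1) by (simp add: indicator_def)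
      qed
    qed
  qed
  have "(\<integral>x. k0 x * u' x 0 \<partial>lborel) = (\<integral>y. \<phi> y * (- \<sigma> * rk0 y) \<partial>lborel)"
    using LIMSEQ_unique[OF lim1] lim2 by (simp add: Leq[abs_def])
  then have "(\<integral>x. k0 x * (2 * \<phi> x + frechet_derivative \<phi> (at x) x) \<partial>lborel) = - (\<integral>y. rk0 y * (\<sigma> * \<phi> y) \<partial>lborel)"
    by (simp add: u'_def mult_ac)
  moreover have "(\<integral>x. k x * (2 * \<phi> x + frechet_derivative \<phi> (at x) x) \<partial>lebesgue_on annulus) = (\<integral>x. k0 x * (2 * \<phi> x + frechet_derivative \<phi> (at x) x) \<partial>lborel)"
    by (rule integral_annulus_representative(1)[OF k0 _ km]) measurable
  moreover have "(\<integral>x. rk x * (\<sigma> * \<phi> x) \<partial>lebesgue_on annulus) = (\<integral>x. rk0 x * (\<sigma> * \<phi> x) \<partial>lborel)"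
    by (rule integral_annulus_representative(1)[OF rk0 _ rkm]) measurable
  moreover have "(\<integral>x. \<sigma> * (\<Sum>z\<in>#J x. frechet_derivative \<kappa> (at (fst z)) (fst z)) * \<phi> x \<partial>lebesgue_on annulus)
     = (\<integral>x. rk x * (\<sigma> * \<phi> x) \<partial>lebesgue_on annulus)"
    unfolding rk_def by (intro Bochner_Integration.integral_cong) (simp_all only: mult.commute mult.left_commute)
  ultimately show ?thesis by (simp only: k_def)
qed

section \<open>The outer variation along rotations\<close>

lemma sum_mset_add_fun: "(\<Sum>z\<in>#M. f z + g z) = (\<Sum>z\<in>#M. f z) + (\<Sum>z\<in>#M. g z :: real)"
  by (induction M) simp_all

lemma sum_mset_diff_fun: "(\<Sum>z\<in>#M. f z - g z) = (\<Sum>z\<in>#M. f z) - (\<Sum>z\<in>#M. g z :: real)"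
  by (induction M) simp_all

lemma norm_matrix_vector_mult_le:
  fixes A :: "real^'n^'k"
  shows "norm (A *v x) \<le> norm A * norm x"
proof -
  have "norm (A *v x) \<le> L2_set (\<lambda>i. norm (A $ i) * norm x) UNIV"
    unfolding norm_vec_def[of "A *v x"]
    by (rule L2_set_mono) (simp_all add: matrix_vector_mul_component Cauchy_Schwarz_ineq2)
  also have "\<dots> = norm A * norm x"
    by (simp add: norm_vec_def[of A] L2_set_left_distrib)
  finally show ?thesis .
qed

lemma bounded_bilinear_matrix_vector_mult:
  "bounded_bilinear (\<lambda>(A :: real^'n^'k) x. A *v x)"
proof (rule bounded_bilinear.intro)
  show "\<exists>K. \<forall>(A :: real^'n^'k) x. norm (A *v x) \<le> norm A * norm x * K"
    by (rule exI[of _ 1]) (simp add: norm_matrix_vector_mult_le)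
qed (simp_all add: matrix_vector_mult_add_rdistrib matrix_vector_right_distrib matrix_vector_mult_scaleR scaleR_matrix_vector_assoc)

text \<open>A matrix with the single row \<open>i\<close> pairs with \<open>A\<close> through that
  row only. The pairing is then evaluated in the orthogonal basis \<open>x\<close>,
  \<open>perp x\<close>, whose squared length is the factor on the left.\<close>

lemma inner_matrix_rank_one:
  fixes A :: "real^2^'k" and c :: "real^2 \<Rightarrow> real"
  assumes c: "linear c"
  shows "(x \<bullet> x) * (A \<bullet> matrix (\<lambda>h. c h *\<^sub>R axis i 1)) = (A *v x) $ i * c x + (A *v perp x) $ i * c (perp x)"
proof -
  have ch: "c h = h $ 1 * c (axis 1 1) + h $ 2 * c (axis 2 1)" for h
  proof -
    have "h = h $ 1 *\<^sub>R axis 1 1 + h $ 2 *\<^sub>R axis 2 1" by (simp add: vec2_eq_iff axis_def)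
    then have "c h = c (h $ 1 *\<^sub>R axis 1 1 + h $ 2 *\<^sub>R axis 2 1)" by simp
    then show ?thesis by (simp only: linear_add[OF c] linear_scale[OF c] real_scaleR_def)
  qed
  have "A \<bullet> matrix (\<lambda>h. c h *\<^sub>R axis i 1) = (\<Sum>r\<in>UNIV. (if r = i then A $ r \<bullet> (\<chi> j. c (axis j 1)) else 0))"
    unfolding inner_vec_def[of A] by (intro sum.cong) (auto simp: matrix_def inner_vec_def axis_def)
  also have "\<dots> = A $ i $ 1 * c (axis 1 1) + A $ i $ 2 * c (axis 2 1)"
    by (simp add: inner_vec2)
  finally have AM: "A \<bullet> matrix (\<lambda>h. c h *\<^sub>R axis i 1) = A $ i $ 1 * c (axis 1 1) + A $ i $ 2 * c (axis 2 1)" .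
  have Av: "(A *v y) $ i = A $ i $ 1 * y $ 1 + A $ i $ 2 * y $ 2" for y
    by (simp add: matrix_vector_mult_def sum_2)
  show ?thesis unfolding AM Av ch[of x] ch[of "perp x"] by (simp add: inner_vec2 algebra_simps)
qed

lemma matrix_rank_one_mult:
  fixes A :: "real^2^'k"
  assumes "linear d"
  shows "matrix (\<lambda>h. d h *\<^sub>R (axis i 1 :: real^'k)) ** A = matrix (\<lambda>h. d (A *v h) *\<^sub>R axis i 1)"
proof -
  have "linear (\<lambda>h. d h *\<^sub>R (axis i 1 :: real^'k))"
    using assms by (intro linearI) (simp_all add: linear_add linear_scale scaleR_add_left)
  then have "matrix ((\<lambda>h. d h *\<^sub>R (axis i 1 :: real^'k)) \<circ> (*v) A) = matrix (\<lambda>h. d h *\<^sub>R (axis i 1 :: real^'k)) ** matrix ((*v) A)"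
    by (intro matrix_compose matrix_vector_mul_linear)
  then show ?thesis by (simp add: o_def matrix_of_matrix_vector_mul)
qed

text \<open>Every jet is at most as long as the distance to \<open>q\<close> copies of 0. The
  Almgren coordinates of those copies vanish, so \<open>R\<close> is built from coordinates that are
  square integrable.\<close>

lemma jets_square_integrable:
  fixes J :: "real^2 \<Rightarrow> 'e::euclidean_space multiset"
  assumes W: "W12 annulus q J"
  obtains R where "integrable (lebesgue_on annulus) (\<lambda>x. (R x)\<^sup>2)" "\<And>x. x \<in> annulus \<Longrightarrow> 0 \<le> R x"
    "\<And>x z. x \<in> annulus \<Longrightarrow> z \<in># J x \<Longrightarrow> norm z \<le> R x"
proof -
  from W obtain es where emb: "almgren_embedding q es"
    and Wr: "\<And>l m. l < length es \<Longrightarrow> m < q \<Longrightarrow> W12_real annulus (\<lambda>x. almgren_xi es l m (J x))"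
    by (auto simp: W12_def)
  have sz: "size (J x) = q" if "x \<in> annulus" for x using W that by (simp add: W12_def)
  let ?h = "length es"
  obtain K where K: "K > 0" "\<And>T S. size T = q \<Longrightarrow> size S = q \<Longrightarrow>
    qdist T S \<le> K * (\<Sum>l<?h. \<Sum>m<q. \<bar>almgren_xi es l m T - almgren_xi es l m (S::'e multiset)\<bar>)"
    by (rule almgren_embedding_lower[OF emb]) (rule that)
  let ?I = "{..<?h} \<times> {..<q}"
  define X where "X x = (\<lambda>(l, m). \<bar>almgren_xi es l m (J x)\<bar>)" for x
  define R where "R x = K * (\<Sum>i\<in>?I. X x i)" for x
  show ?thesis
  proof (rule that[of R])
    have Xm: "(\<lambda>x. X x i) \<in> borel_measurable (lebesgue_on annulus)" "integrable (lebesgue_on annulus) (\<lambda>x. (X x i)\<^sup>2)" if iI: "i \<in> ?I" for i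
      proof -
      obtain l m where i: "i = (l, m)" "l < ?h" "m < q" using iI by blast
      then have "L2_on annulus (\<lambda>x. almgren_xi es l m (J x))" using Wr by (auto simp: W12_real_def)
      then show "(\<lambda>x. X x i) \<in> borel_measurable (lebesgue_on annulus)" "integrable (lebesgue_on annulus) (\<lambda>x. (X x i)\<^sup>2)"
        unfolding X_def i(1) L2_on_def prod.case by (auto intro: borel_measurable_abs)
    qed
    show "integrable (lebesgue_on annulus) (\<lambda>x. (R x)\<^sup>2)"
    proof (rule Bochner_Integration.integrable_bound)
      show "integrable (lebesgue_on annulus) (\<lambda>x. K\<^sup>2 * ((\<Sum>i\<in>?I. (X x i)\<^sup>2) * real (card ?I)))"
        by (intro integrable_mult_right integrable_mult_left Bochner_Integration.integrable_sum Xm)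
      show "(\<lambda>x. (R x)\<^sup>2) \<in> borel_measurable (lebesgue_on annulus)"
        unfolding R_def by (intro borel_measurable_power borel_measurable_times borel_measurable_const borel_measurable_sum Xm)
      show "AE x in lebesgue_on annulus. norm ((R x)\<^sup>2) \<le> norm (K\<^sup>2 * ((\<Sum>i\<in>?I. (X x i)\<^sup>2) * real (card ?I)))"
      proof (rule AE_I2)
        fix x
        have "(\<Sum>i\<in>?I. X x i)\<^sup>2 \<le> (\<Sum>i\<in>?I. (X x i)\<^sup>2) * real (card ?I)"
          by (rule sum_squared_le_sum_of_squares)
        then have "(R x)\<^sup>2 \<le> K\<^sup>2 * ((\<Sum>i\<in>?I. (X x i)\<^sup>2) * real (card ?I))"
          unfolding R_def power_mult_distrib by (rule mult_left_mono) simp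
        then show "norm ((R x)\<^sup>2) \<le> norm (K\<^sup>2 * ((\<Sum>i\<in>?I. (X x i)\<^sup>2) * real (card ?I)))" by simp
      qed
    qed
    show "0 \<le> R x" for x unfolding R_def X_def using K(1) by (intro mult_nonneg_nonneg sum_nonneg) auto
    fix x z assume x: "x \<in> annulus" and z: "z \<in># J x"
    let ?S = "replicate_mset q (0::'e)"
    have s: "size (J x) = size ?S" using sz[OF x] by simp
    obtain xs ys where xy: "mset xs = J x" "mset ys = ?S" "length xs = length ys"
      "\<And>i. i < length xs \<Longrightarrow> norm (xs ! i - ys ! i) \<le> qdist (J x) ?S"
      by (rule qdist_matching[OF s]) (rule that)
    have "z \<in> set xs" using z xy(1) by (metis set_mset_mset)
    then obtain i where i: "i < length xs" "xs ! i = z" by (auto simp: in_set_conv_nth)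
    then have "ys ! i \<in># mset ys" using xy(3) by simp
    then have "ys ! i = 0" unfolding xy(2) by (simp split: if_splits)
    then have "norm z \<le> qdist (J x) ?S" using xy(4)[OF i(1)] i(2) by simp
    also have "\<dots> \<le> K * (\<Sum>l<?h. \<Sum>m<q. \<bar>almgren_xi es l m (J x) - almgren_xi es l m ?S\<bar>)"
      by (rule K(2)) (use sz[OF x] in auto)
    also have "\<dots> = R x"
      by (simp add: R_def X_def sum.cartesian_product[symmetric] almgren_xi_replicate)
    finally show "norm z \<le> R x" .
  qed
qed

lemma integrable_of_jet_bound:
  fixes J :: "real^2 \<Rightarrow> 'e::euclidean_space multiset" and F :: "(real^2) \<times> 'e \<Rightarrow> real"
  assumes W: "W12 annulus q J" and F: "continuous_on UNIV F"
    and b: "\<And>x z. x \<in> annulus \<Longrightarrow> \<bar>F (x, z)\<bar> \<le> C * (1 + (norm z)\<^sup>2)" and C: "C \<ge> 0"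
  shows "integrable (lebesgue_on annulus) (\<lambda>x. \<Sum>z\<in>#J x. F (x, z))"
proof -
  obtain R where R: "integrable (lebesgue_on annulus) (\<lambda>x. (R x)\<^sup>2)" "\<And>x. x \<in> annulus \<Longrightarrow> 0 \<le> R x"
    "\<And>x z. x \<in> annulus \<Longrightarrow> z \<in># J x \<Longrightarrow> norm z \<le> R x"
    by (rule jets_square_integrable[OF W]) (rule that)
  show ?thesis
  proof (rule Bochner_Integration.integrable_bound)
    show "integrable (lebesgue_on annulus) (\<lambda>x. real q * (C * (1 + (R x)\<^sup>2)))"
      using R(1) integrable_annulus_const[of 1] by (intro integrable_mult_right Bochner_Integration.integrable_add)
    show "(\<lambda>x. \<Sum>z\<in>#J x. F (x, z)) \<in> borel_measurable (lebesgue_on annulus)"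
      by (rule borel_measurable_sum_mset[OF W F])
    show "AE x in lebesgue_on annulus. norm (\<Sum>z\<in>#J x. F (x, z)) \<le> norm (real q * (C * (1 + (R x)\<^sup>2)))"
    proof (rule AE_I2)
      fix x assume "x \<in> space (lebesgue_on annulus)"
      then have x: "x \<in> annulus" by (simp add: space_restrict_space)
      obtain zs where zs: "mset zs = J x" using ex_mset by blast
      have lq: "length zs = q" using zs W x unfolding W12_def by (metis size_mset)
      have "\<bar>\<Sum>i<length zs. F (x, zs ! i)\<bar> \<le> (\<Sum>i<length zs. C * (1 + (R x)\<^sup>2))"
      proof (rule order_trans[OF sum_abs], rule sum_mono)
        fix i assume "i \<in> {..<length zs}"
        then have "zs ! i \<in># J x" using zs by (metis lessThan_iff nth_mem set_mset_mset)
        then have "(norm (zs ! i))\<^sup>2 \<le> (R x)\<^sup>2" using R(3)[OF x] by (intro power_mono) auto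
        then have "C * (1 + (norm (zs ! i))\<^sup>2) \<le> C * (1 + (R x)\<^sup>2)" using C by (intro mult_left_mono) auto
        then show "\<bar>F (x, zs ! i)\<bar> \<le> C * (1 + (R x)\<^sup>2)" using b[OF x] by (rule order_trans[rotated])
      qed
      then show "norm (\<Sum>z\<in>#J x. F (x, z)) \<le> norm (real q * (C * (1 + (R x)\<^sup>2)))"
        using C by (simp add: zs[symmetric] sum_mset_nth lq)
    qed
  qed
qed

lemma integrable_annulus_mult_bounded:
  fixes u v :: "real^2 \<Rightarrow> real"
  assumes u: "integrable (lebesgue_on annulus) u" and v: "continuous_on UNIV v" "\<And>x. \<bar>v x\<bar> \<le> C"
  shows "integrable (lebesgue_on annulus) (\<lambda>x. u x * v x)"
proof (rule Bochner_Integration.integrable_bound)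
  show "integrable (lebesgue_on annulus) (\<lambda>x. C * u x)" using u by simp
  have "v \<in> borel_measurable (lebesgue_on annulus)"
    using borel_measurable_continuous_onI[OF v(1)] by (intro measurable_restrict_space1 measurable_completion) simp
  then show "(\<lambda>x. u x * v x) \<in> borel_measurable (lebesgue_on annulus)" using u by simp
  show "AE x in lebesgue_on annulus. norm (u x * v x) \<le> norm (C * u x)"
  proof (rule AE_I2)
    fix x
    have "\<bar>v x\<bar> \<le> \<bar>C\<bar>" using v(2)[of x] by linarith
    then show "norm (u x * v x) \<le> norm (C * u x)" by (simp add: abs_mult mult.commute[of "\<bar>C\<bar>"] mult_left_mono)
  qed
qed

text \<open>The factor \<open>fst p \<bullet> fst p\<close> is there to cancel the squared length
  that appears when the gradient is paired with a rank one matrix.\<close>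

lemma outer_test_function:
  fixes \<phi> :: "real^2 \<Rightarrow> real" and \<theta> :: "real^'k \<Rightarrow> real"
  assumes \<phi>: "Cc1 annulus \<phi>" and \<theta>: "Cc1 UNIV \<theta>"
  shows "Cc1 (UNIV \<times> UNIV) (\<lambda>p. ((fst p \<bullet> fst p) * \<phi> (fst p) * \<theta> (snd p)) *\<^sub>R (axis i 1 :: real^'k))"
proof -
  obtain S where S: "compact S" "S \<subseteq> annulus" "\<And>x. x \<notin> S \<Longrightarrow> \<phi> x = 0" "\<And>x h. x \<notin> S \<Longrightarrow> frechet_derivative \<phi> (at x) h = 0"
    by (rule Cc1_compact_support[OF \<phi>]) (rule that)
  obtain S' where S': "compact S'" "S' \<subseteq> UNIV" "\<And>x. x \<notin> S' \<Longrightarrow> \<theta> x = 0" "\<And>x h. x \<notin> S' \<Longrightarrow> frechet_derivative \<theta> (at x) h = 0"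
    by (rule Cc1_compact_support[OF \<theta>]) (rule that)
  have c: "C1 \<phi>" "C1 \<theta>" using \<phi> \<theta> by (simp_all add: Cc1_iff)
  have f: "C1 (fst :: (real^2) \<times> (real^'k) \<Rightarrow> _)" "C1 (snd :: (real^2) \<times> (real^'k) \<Rightarrow> _)"
    by (rule C1_bounded_linear[OF bounded_linear_fst], rule C1_bounded_linear[OF bounded_linear_snd])
  show ?thesis
  proof (rule Cc1_intro)
    show "C1 (\<lambda>p. ((fst p \<bullet> fst p) * \<phi> (fst p) * \<theta> (snd p)) *\<^sub>R (axis i 1 :: real^'k))"
      by (rule C1_scaleR[OF C1_mult[OF C1_mult[OF C1_inner[OF f(1) f(1)] C1_compose[OF c(1) f(1)]] C1_compose[OF c(2) f(2)]] C1_const])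
    show "compact (S \<times> S')" using S S' by (intro compact_Times)
    show "S \<times> S' \<subseteq> UNIV \<times> UNIV" by simp
    show "((fst p \<bullet> fst p) * \<phi> (fst p) * \<theta> (snd p)) *\<^sub>R (axis i 1 :: real^'k) = 0" if "p \<notin> S \<times> S'" for p
    proof -
      have "fst p \<notin> S \<or> snd p \<notin> S'" using that by (simp add: mem_Times_iff)
      then show ?thesis using S(3)[of "fst p"] S'(3)[of "snd p"] by (metis mult_zero_left mult_zero_right scaleR_zero_left)
    qed
  qed
qed

text \<open>Euler's relation splits the outer variation into radial and tangential terms.
  \<open>dilation_identity\<close> trades the radial derivative of \<open>\<phi>\<close> for the
  zero order term \<open>- \<sigma>\<^sup>2 * (K + D)\<close>; its part with \<open>D\<close>
  cancels the term from the radial derivative of \<open>\<theta>\<close>. What remains is a weak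
  equation \<open>f' = g\<close> along rotations, in which the radial direction survives only as
  \<open>- \<sigma>\<^sup>2 * K\<close>.\<close>

lemma outer_stationary_rotational:
  fixes w :: "real^2 \<Rightarrow> (real^'k) multiset" and i :: 'k
  assumes W: "W12 annulus q (j1 w)" and hom: "homogeneous_map \<sigma> w"
    and jet: "AE y in lborel. y \<in> annulus \<longrightarrow> euler_jet \<sigma> w y"
    and out: "outer_stationary UNIV w" and \<theta>: "Cc1 UNIV \<theta>"
  defines "f \<equiv> \<lambda>x. \<Sum>z\<in>#j1 w x. \<theta> (fst z) * (snd z *v perp x) $ i"
    and "g \<equiv> \<lambda>x. \<Sum>z\<in>#j1 w x. frechet_derivative \<theta> (at (fst z)) (snd z *v perp x) * (snd z *v perp x) $ i
       - \<sigma>\<^sup>2 * (\<theta> (fst z) * fst z $ i)"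
  shows "integrable (lebesgue_on annulus) f" "integrable (lebesgue_on annulus) g"
    and "\<And>\<phi>. Cc1 annulus \<phi> \<Longrightarrow>
      (\<integral>x. f x * frechet_derivative \<phi> (at x) (perp x) \<partial>lebesgue_on annulus) = - (\<integral>x. g x * \<phi> x \<partial>lebesgue_on annulus)"
proof -
  have C\<theta>: "C1 \<theta>" using \<theta> by (simp add: Cc1_iff)
  obtain B where B: "\<And>x. norm (\<theta> x) \<le> B" "\<And>x h. norm (frechet_derivative \<theta> (at x) h) \<le> B * norm h" "B \<ge> 0"
    by (rule Cc1_bounded[OF \<theta>]) (rule that)
  obtain M where M: "M \<ge> 0" "\<And>z. \<bar>frechet_derivative \<theta> (at z) z\<bar> \<le> M" by (rule Cc1_radial_bound[OF \<theta>]) (rule that)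
  \<comment> \<open>The function of the value that multiplies the radial derivative of
    \<open>\<phi>\<close>; the dilation identity is applied to it.\<close>
  define \<kappa> where "\<kappa> a = \<theta> a * a $ i" for a
  have lin_i: "bounded_linear (\<lambda>a::real^'k. a $ i)" by (rule bounded_linear_vec_nth)
  have C\<kappa>: "C1 \<kappa>" unfolding \<kappa>_def by (rule C1_mult[OF C\<theta> C1_bounded_linear[OF lin_i]])
  have Cc\<kappa>: "Cc1 UNIV \<kappa>"
  proof -
    obtain S where S: "compact S" "S \<subseteq> UNIV" "\<And>x. x \<notin> S \<Longrightarrow> \<theta> x = 0" "\<And>x h. x \<notin> S \<Longrightarrow> frechet_derivative \<theta> (at x) h = 0"
      by (rule Cc1_compact_support[OF \<theta>]) (rule that)
    show ?thesis by (rule Cc1_intro[OF C\<kappa> S(1,2)]) (simp add: \<kappa>_def S(3))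
  qed
  have d\<kappa>: "frechet_derivative \<kappa> (at a) h = \<theta> a * h $ i + frechet_derivative \<theta> (at a) h * a $ i" for a h
  proof -
    have "(\<kappa> has_derivative (\<lambda>h. \<theta> a * h $ i + frechet_derivative \<theta> (at a) h * a $ i)) (at a)"
      unfolding \<kappa>_def by (rule has_derivative_mult[OF C1D[OF C\<theta>] bounded_linear_imp_has_derivative[OF lin_i]])
    from frechet_derivative_at[OF this, symmetric] show ?thesis by simp
  qed
  obtain B\<kappa> where B\<kappa>: "\<And>x. norm (\<kappa> x) \<le> B\<kappa>" "\<And>x h. norm (frechet_derivative \<kappa> (at x) h) \<le> B\<kappa> * norm h" "B\<kappa> \<ge> 0"
    by (rule Cc1_bounded[OF Cc\<kappa>]) (rule that)
  obtain M\<kappa> where M\<kappa>: "M\<kappa> \<ge> 0" "\<And>z. \<bar>frechet_derivative \<kappa> (at z) z\<bar> \<le> M\<kappa>" by (rule Cc1_radial_bound[OF Cc\<kappa>]) (rule that)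
  have mv: "norm (A *v perp x) \<le> 2 * norm (a, A)" if "x \<in> annulus" for x and a :: "real^'k" and A :: "real^2^'k"
  proof -
    have "norm (A *v perp x) \<le> norm A * norm (perp x)" by (rule norm_matrix_vector_mult_le)
    also have "\<dots> \<le> norm (a, A) * 2"
      using that norm_snd_le[of A a] by (intro mult_mono) (auto simp: annulus_def)
    finally show ?thesis by simp
  qed
  have le1: "n \<le> 1 + n\<^sup>2" for n :: real using zero_le_power2[of "n - 1/2"] by (simp add: power2_eq_square algebra_simps)
  have cont_mv: "continuous_on UNIV (\<lambda>p::(real^2) \<times> (real^'k) \<times> (real^2^'k). snd (snd p) *v perp (fst p))"
    by (intro bounded_bilinear.continuous_on[OF bounded_bilinear_matrix_vector_mult] continuous_intros)
  have cont_i: "continuous_on UNIV (\<lambda>p. u p $ i)" if "continuous_on UNIV u" for u :: "(real^2) \<times> (real^'k) \<times> (real^2^'k) \<Rightarrow> real^'k"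
    using that by (rule bounded_linear.continuous_on[OF lin_i])
  have fst_c: "continuous_on UNIV (\<lambda>p::(real^2) \<times> (real^'k) \<times> (real^2^'k). fst (snd p))" by (intro continuous_intros)
  have cont_\<theta>: "continuous_on UNIV (\<lambda>p::(real^2) \<times> (real^'k) \<times> (real^2^'k). \<theta> (fst (snd p)))"
    by (rule continuous_on_compose2[OF C1_continuous[OF C\<theta>, of UNIV] fst_c]) simp
  have cont_d: "continuous_on UNIV (\<lambda>p. frechet_derivative \<theta> (at (fst (snd p))) (u p))" if "continuous_on UNIV u"
    for u :: "(real^2) \<times> (real^'k) \<times> (real^2^'k) \<Rightarrow> real^'k"
    by (rule C1_derivative_continuous[OF C\<theta> _ that]) (intro continuous_intros)
  have cfi: "\<bar>v $ i\<bar> \<le> norm v" for v :: "real^'k" by (rule component_le_norm_cart)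
  define F where "F p = \<theta> (fst (snd p)) * (snd (snd p) *v perp (fst p)) $ i" for p
  define G1 where "G1 p = frechet_derivative \<theta> (at (fst (snd p))) (snd (snd p) *v perp (fst p)) * (snd (snd p) *v perp (fst p)) $ i" for p
  define K where "K p = \<kappa> (fst (snd p))" for p :: "(real^2) \<times> (real^'k) \<times> (real^2^'k)"
  define R where "R p = frechet_derivative \<kappa> (at (fst (snd p))) (fst (snd p))" for p :: "(real^2) \<times> (real^'k) \<times> (real^2^'k)"
  define D where "D p = frechet_derivative \<theta> (at (fst (snd p))) (fst (snd p)) * fst (snd p) $ i" for p :: "(real^2) \<times> (real^'k) \<times> (real^2^'k)"
  have R_eq: "R p = K p + D p" for p by (simp add: R_def K_def D_def d\<kappa> \<kappa>_def)
  have iF: "integrable (lebesgue_on annulus) (\<lambda>x. \<Sum>z\<in>#j1 w x. F (x, z))"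
  proof (rule integrable_of_jet_bound[OF W])
    show "continuous_on UNIV F" unfolding F_def by (intro continuous_on_mult cont_\<theta> cont_i cont_mv)
    show "\<bar>F (x, z)\<bar> \<le> (2 * B) * (1 + (norm z)\<^sup>2)" if "x \<in> annulus" for x z
    proof -
      have "\<bar>F (x, z)\<bar> \<le> B * (2 * norm z)"
        unfolding F_def abs_mult using B(1)[of "fst z"] B(3) cfi[of "snd z *v perp x"] mv[OF that, of "snd z" "fst z"]
        by (intro mult_mono) auto
      also have "\<dots> \<le> B * (2 * (1 + (norm z)\<^sup>2))" using le1 B(3) by (intro mult_left_mono) auto
      finally show ?thesis by (simp add: mult_ac)
    qed
  qed (use B in simp)
  have iG1: "integrable (lebesgue_on annulus) (\<lambda>x. \<Sum>z\<in>#j1 w x. G1 (x, z))"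
  proof (rule integrable_of_jet_bound[OF W])
    show "continuous_on UNIV G1" unfolding G1_def by (intro continuous_on_mult cont_d cont_i cont_mv)
    show "\<bar>G1 (x, z)\<bar> \<le> (4 * B) * (1 + (norm z)\<^sup>2)" if "x \<in> annulus" for x z
    proof -
      let ?n = "norm (snd z *v perp x)"
      have n2: "?n \<le> 2 * norm z" using mv[OF that, of "snd z" "fst z"] by simp
      have "\<bar>G1 (x, z)\<bar> \<le> (B * ?n) * ?n"
        unfolding G1_def abs_mult using B(2)[of "fst z" "snd z *v perp x"] B(3) cfi[of "snd z *v perp x"]
        by (intro mult_mono) auto
      also have "\<dots> \<le> (B * (2 * norm z)) * (2 * norm z)" using n2 B(3) by (intro mult_mono) auto
      also have "\<dots> \<le> (4 * B) * (1 + (norm z)\<^sup>2)" using B(3) by (simp add: power2_eq_square algebra_simps)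
      finally show ?thesis .
    qed
  qed (use B in simp)
  have iK: "integrable (lebesgue_on annulus) (\<lambda>x. \<Sum>z\<in>#j1 w x. K (x, z))"
  proof (rule integrable_of_jet_bound[OF W])
    show "continuous_on UNIV K"
      unfolding K_def by (rule continuous_on_compose2[OF C1_continuous[OF C\<kappa>, of UNIV] fst_c]) simp
    have "B\<kappa> * 1 \<le> B\<kappa> * (1 + (norm z)\<^sup>2)" for z :: "(real^'k) \<times> (real^2^'k)" using B\<kappa>(3) by (intro mult_left_mono) auto
    then show "\<bar>K (x, z)\<bar> \<le> B\<kappa> * (1 + (norm z)\<^sup>2)" for x z
      using B\<kappa>(1)[of "fst z"] by (simp add: K_def) (meson order_trans)
  qed (use B\<kappa> in simp)
  have iR: "integrable (lebesgue_on annulus) (\<lambda>x. \<Sum>z\<in>#j1 w x. R (x, z))"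
  proof (rule integrable_of_jet_bound[OF W])
    show "continuous_on UNIV R"
      unfolding R_def by (rule C1_derivative_continuous[OF C\<kappa> fst_c fst_c])
    have "M\<kappa> * 1 \<le> M\<kappa> * (1 + (norm z)\<^sup>2)" for z :: "(real^'k) \<times> (real^2^'k)" using M\<kappa>(1) by (intro mult_left_mono) auto
    then show "\<bar>R (x, z)\<bar> \<le> M\<kappa> * (1 + (norm z)\<^sup>2)" for x z
      using M\<kappa>(2)[of "fst z"] by (simp add: R_def) (meson order_trans)
  qed (use M\<kappa> in simp)
  have f_eq: "f = (\<lambda>x. \<Sum>z\<in>#j1 w x. F (x, z))" by (simp add: f_def F_def)
  have g_eq: "g = (\<lambda>x. (\<Sum>z\<in>#j1 w x. G1 (x, z)) - \<sigma>\<^sup>2 * (\<Sum>z\<in>#j1 w x. K (x, z)))"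
    by (simp add: g_def G1_def K_def \<kappa>_def sum_mset_diff_fun sum_mset_distrib_left)
  show fi: "integrable (lebesgue_on annulus) f" unfolding f_eq by (rule iF)
  show gi: "integrable (lebesgue_on annulus) g" unfolding g_eq using iG1 iK by simp
  fix \<phi> :: "real^2 \<Rightarrow> real" assume \<phi>: "Cc1 annulus \<phi>"
  have C\<phi>: "C1 \<phi>" using \<phi> by (simp add: Cc1_iff)
  obtain S where S: "compact S" "S \<subseteq> annulus" "\<And>x. x \<notin> S \<Longrightarrow> \<phi> x = 0" "\<And>x h. x \<notin> S \<Longrightarrow> frechet_derivative \<phi> (at x) h = 0"
    by (rule Cc1_compact_support[OF \<phi>]) (rule that)
  obtain B\<phi> where B\<phi>: "\<And>x. norm (\<phi> x) \<le> B\<phi>" "\<And>x h. norm (frechet_derivative \<phi> (at x) h) \<le> B\<phi> * norm h" "B\<phi> \<ge> 0"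
    by (rule Cc1_bounded[OF \<phi>]) (rule that)
  obtain M\<phi> where M\<phi>: "M\<phi> \<ge> 0" "\<And>z. \<bar>frechet_derivative \<phi> (at z) z\<bar> \<le> M\<phi>" by (rule Cc1_radial_bound[OF \<phi>]) (rule that)
  define \<psi> where "\<psi> p = ((fst p \<bullet> fst p) * \<phi> (fst p) * \<theta> (snd p)) *\<^sub>R (axis i 1 :: real^'k)" for p
  define h where "h x = (\<Sum>(a, A)\<in>#j1 w x. A \<bullet> (jacobian (\<lambda>x'. \<psi> (x', a)) (at x) + jacobian (\<lambda>y. \<psi> (x, y)) (at a) ** A))" for x
  have "Cc1 (UNIV \<times> UNIV) \<psi>" unfolding \<psi>_def by (rule outer_test_function[OF \<phi> \<theta>])
  then have hb: "has_bochner_integral (lebesgue_on UNIV) h 0"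
    using out unfolding outer_stationary_def h_def by blast
  have dx: "jacobian (\<lambda>x'. \<psi> (x', a)) (at x) =
      matrix (\<lambda>v. (\<theta> a * ((x \<bullet> x) * frechet_derivative \<phi> (at x) v + 2 * (x \<bullet> v) * \<phi> x)) *\<^sub>R axis i 1)" for x a
  proof -
    have "((\<lambda>x'. \<psi> (x', a)) has_derivative (\<lambda>v. (\<theta> a * ((x \<bullet> x) * frechet_derivative \<phi> (at x) v + 2 * (x \<bullet> v) * \<phi> x)) *\<^sub>R axis i 1)) (at x)"
      unfolding \<psi>_def fst_conv snd_conv
      by (rule derivative_eq_intros C1D[OF C\<phi>] refl | simp add: inner_commute algebra_simps)+
    from frechet_derivative_at[OF this, symmetric] show ?thesis by (simp add: jacobian_def)
  qed
  have dy: "jacobian (\<lambda>y. \<psi> (x, y)) (at a) = matrix (\<lambda>v. ((x \<bullet> x) * \<phi> x * frechet_derivative \<theta> (at a) v) *\<^sub>R axis i 1)" for x a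
  proof -
    have "((\<lambda>y. \<psi> (x, y)) has_derivative (\<lambda>v. ((x \<bullet> x) * \<phi> x * frechet_derivative \<theta> (at a) v) *\<^sub>R axis i 1)) (at a)"
      unfolding \<psi>_def fst_conv snd_conv
      by (rule derivative_eq_intros C1D[OF C\<theta>] refl | simp)+
    from frechet_derivative_at[OF this, symmetric] show ?thesis by (simp add: jacobian_def)
  qed
  note l\<phi> = C1_linear[OF C\<phi>] and l\<theta> = C1_linear[OF C\<theta>]
  \<comment> \<open>Both gradient terms have the single row \<open>i\<close>, so the pairing is
    evaluated on \<open>x\<close>, where \<open>A\<close> acts by Euler's relation, and on
    \<open>perp x\<close>; the common factor \<open>x \<bullet> x\<close> cancels.\<close>
  have sheet: "A \<bullet> (jacobian (\<lambda>x'. \<psi> (x', a)) (at x) + jacobian (\<lambda>y. \<psi> (x, y)) (at a) ** A)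
     = \<sigma> * K (x, a, A) * (2 * \<phi> x + frechet_derivative \<phi> (at x) x) + F (x, a, A) * frechet_derivative \<phi> (at x) (perp x)
       + \<phi> x * (\<sigma>\<^sup>2 * D (x, a, A) + G1 (x, a, A))"
    if x: "x \<noteq> 0" and e: "A *v x = \<sigma> *\<^sub>R a" for x a A
  proof -
    define c1 where "c1 v = \<theta> a * ((x \<bullet> x) * frechet_derivative \<phi> (at x) v + 2 * (x \<bullet> v) * \<phi> x)" for v
    define c2 where "c2 v = (x \<bullet> x) * \<phi> x * frechet_derivative \<theta> (at a) (A *v v)" for v
    have lc1: "linear c1" unfolding c1_def
      by (rule linearI) (simp_all add: linear_add[OF l\<phi>] linear_scale[OF l\<phi>] inner_add_right algebra_simps)
    have lc2: "linear c2" unfolding c2_def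
      by (rule linearI) (simp_all add: linear_add[OF l\<theta>] linear_scale[OF l\<theta>] matrix_vector_right_distrib matrix_vector_mult_scaleR algebra_simps)
    have ld: "linear (\<lambda>v. (x \<bullet> x) * \<phi> x * frechet_derivative \<theta> (at a) v)"
      by (rule linearI) (simp_all add: linear_add[OF l\<theta>] linear_scale[OF l\<theta>] algebra_simps)
    have xx: "x \<bullet> x \<noteq> 0" using x by simp
    have "(x \<bullet> x) * (A \<bullet> (jacobian (\<lambda>x'. \<psi> (x', a)) (at x) + jacobian (\<lambda>y. \<psi> (x, y)) (at a) ** A))
      = (x \<bullet> x) * (A \<bullet> matrix (\<lambda>v. c1 v *\<^sub>R axis i 1)) + (x \<bullet> x) * (A \<bullet> matrix (\<lambda>v. c2 v *\<^sub>R axis i 1))"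
      unfolding dx dy matrix_rank_one_mult[OF ld] inner_add_right distrib_left c1_def c2_def ..
    also have "\<dots> = (\<sigma> * a $ i) * c1 x + (A *v perp x) $ i * c1 (perp x) + ((\<sigma> * a $ i) * c2 x + (A *v perp x) $ i * c2 (perp x))"
      unfolding inner_matrix_rank_one[OF lc1] inner_matrix_rank_one[OF lc2] e by simp
    also have "c1 x = (x \<bullet> x) * (\<theta> a * (frechet_derivative \<phi> (at x) x + 2 * \<phi> x))" by (simp add: c1_def algebra_simps)
    also have "c1 (perp x) = (x \<bullet> x) * (\<theta> a * frechet_derivative \<phi> (at x) (perp x))" by (simp add: c1_def)
    also have "c2 x = (x \<bullet> x) * (\<phi> x * (\<sigma> * frechet_derivative \<theta> (at a) a))" by (simp add: c2_def e linear_scale[OF l\<theta>])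
    also have "c2 (perp x) = (x \<bullet> x) * (\<phi> x * frechet_derivative \<theta> (at a) (A *v perp x))" by (simp add: c2_def)
    finally have "(x \<bullet> x) * (A \<bullet> (jacobian (\<lambda>x'. \<psi> (x', a)) (at x) + jacobian (\<lambda>y. \<psi> (x, y)) (at a) ** A))
      = (x \<bullet> x) * (\<sigma> * K (x, a, A) * (2 * \<phi> x + frechet_derivative \<phi> (at x) x) + F (x, a, A) * frechet_derivative \<phi> (at x) (perp x)
       + \<phi> x * (\<sigma>\<^sup>2 * D (x, a, A) + G1 (x, a, A)))"
      by (simp add: K_def F_def D_def G1_def \<kappa>_def power2_eq_square algebra_simps)
    then show ?thesis using xx by simp
  qed
  define k where "k x = (\<Sum>z\<in>#j1 w x. K (x, z))" for x
  define d where "d x = (\<Sum>z\<in>#j1 w x. D (x, z))" for x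
  define g1 where "g1 x = (\<Sum>z\<in>#j1 w x. G1 (x, z))" for x
  define rr where "rr x = (\<Sum>z\<in>#j1 w x. R (x, z))" for x
  have d_eq: "d x = rr x - k x" for x unfolding d_def rr_def k_def R_eq by (simp add: sum_mset_add_fun)
  have h_in: "AE x in lborel. x \<in> annulus \<longrightarrow> h x = \<sigma> * (k x * (2 * \<phi> x + frechet_derivative \<phi> (at x) x))
      + f x * frechet_derivative \<phi> (at x) (perp x) + (\<sigma>\<^sup>2 * (d x * \<phi> x) + g1 x * \<phi> x)"
    using jet
  proof eventually_elim
    case (elim x)
    show ?case
    proof
      assume x: "x \<in> annulus"
      then have x0: "x \<noteq> 0" by (auto simp: annulus_def)
      have e: "snd z *v x = \<sigma> *\<^sub>R fst z" if "z \<in># j1 w x" for z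
        using elim x that unfolding euler_jet_def by (metis prod.collapse)
      have "h x = (\<Sum>z\<in>#j1 w x. \<sigma> * K (x, z) * (2 * \<phi> x + frechet_derivative \<phi> (at x) x) + F (x, z) * frechet_derivative \<phi> (at x) (perp x)
       + \<phi> x * (\<sigma>\<^sup>2 * D (x, z) + G1 (x, z)))"
        unfolding h_def using sheet[OF x0 e] by (intro arg_cong[of _ _ sum_mset] image_mset_cong) (auto split: prod.splits)
      also have "\<dots> = \<sigma> * (k x * (2 * \<phi> x + frechet_derivative \<phi> (at x) x))
      + f x * frechet_derivative \<phi> (at x) (perp x) + (\<sigma>\<^sup>2 * (d x * \<phi> x) + g1 x * \<phi> x)"
        unfolding k_def f_eq d_def g1_def
        by (simp add: sum_mset_add_fun sum_mset_distrib_left sum_mset_distrib_right algebra_simps)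
      finally show "h x = \<sigma> * (k x * (2 * \<phi> x + frechet_derivative \<phi> (at x) x))
      + f x * frechet_derivative \<phi> (at x) (perp x) + (\<sigma>\<^sup>2 * (d x * \<phi> x) + g1 x * \<phi> x)" .
    qed
  qed
  have h_out: "h x = 0" if "x \<notin> annulus" for x
  proof -
    have "x \<notin> S" using that S(2) by blast
    then have "matrix (\<lambda>v. (\<theta> a * ((x \<bullet> x) * frechet_derivative \<phi> (at x) v + 2 * (x \<bullet> v) * \<phi> x)) *\<^sub>R (axis i 1 :: real^'k)) = (0 :: real^2^'k)"
      "matrix (\<lambda>v. ((x \<bullet> x) * \<phi> x * frechet_derivative \<theta> (at a) v) *\<^sub>R (axis i 1 :: real^'k)) = (0 :: real^'k^'k)" for a
      using S(3,4) by (simp_all add: matrix_def vec_eq_iff)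
    then show ?thesis unfolding h_def dx dy by (simp add: split_beta')
  qed
  have "0 = (\<integral>x. h x \<partial>lebesgue)"
    using has_bochner_integral_integral_eq[OF hb] by (simp add: lebesgue_on_UNIV_eq)
  also have "\<dots> = (\<integral>x. indicator annulus x *\<^sub>R h x \<partial>lebesgue)"
    by (intro Bochner_Integration.integral_cong) (use h_out in \<open>auto split: split_indicator\<close>)
  also have "\<dots> = (\<integral>x. h x \<partial>lebesgue_on annulus)"
    by (rule integral_restrict_space[symmetric]) simp
  also have "\<dots> = (\<integral>x. \<sigma> * (k x * (2 * \<phi> x + frechet_derivative \<phi> (at x) x))
      + f x * frechet_derivative \<phi> (at x) (perp x) + (\<sigma>\<^sup>2 * (d x * \<phi> x) + g1 x * \<phi> x) \<partial>lebesgue_on annulus)"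
  proof (rule Bochner_Integration.integral_cong_AE)
    have hbm: "h \<in> borel_measurable lebesgue"
      using hb by (auto simp: lebesgue_on_UNIV_eq has_bochner_integral_iff)
    then show "h \<in> borel_measurable (lebesgue_on annulus)" by (rule measurable_restrict_space1)
    have [measurable]: "\<phi> \<in> borel_measurable (lebesgue_on annulus)" "(\<lambda>x. frechet_derivative \<phi> (at x) x) \<in> borel_measurable (lebesgue_on annulus)"
      "(\<lambda>x. frechet_derivative \<phi> (at x) (perp x)) \<in> borel_measurable (lebesgue_on annulus)"
      using borel_measurable_continuous_onI[OF C1_continuous[OF C\<phi>]]
        borel_measurable_continuous_onI[OF C1_derivative_continuous[OF C\<phi> continuous_on_id continuous_on_id]]
        borel_measurable_continuous_onI[OF C1_derivative_continuous[OF C\<phi> continuous_on_id continuous_on_perp[OF continuous_on_id]]]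
      by (auto intro!: measurable_restrict_space1 measurable_completion)
    have [measurable]: "k \<in> borel_measurable (lebesgue_on annulus)" "g1 \<in> borel_measurable (lebesgue_on annulus)" "rr \<in> borel_measurable (lebesgue_on annulus)"
      "f \<in> borel_measurable (lebesgue_on annulus)"
      using iK iG1 iR fi by (auto simp: k_def[abs_def] g1_def[abs_def] rr_def[abs_def])
    show "(\<lambda>x. \<sigma> * (k x * (2 * \<phi> x + frechet_derivative \<phi> (at x) x))
      + f x * frechet_derivative \<phi> (at x) (perp x) + (\<sigma>\<^sup>2 * (d x * \<phi> x) + g1 x * \<phi> x)) \<in> borel_measurable (lebesgue_on annulus)"
      unfolding d_eq by measurable
    show "AE x in lebesgue_on annulus. h x = \<sigma> * (k x * (2 * \<phi> x + frechet_derivative \<phi> (at x) x))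
      + f x * frechet_derivative \<phi> (at x) (perp x) + (\<sigma>\<^sup>2 * (d x * \<phi> x) + g1 x * \<phi> x)"
      unfolding AE_annulus_iff by (rule h_in)
  qed
  also have "\<dots> = \<sigma> * (\<integral>x. k x * (2 * \<phi> x + frechet_derivative \<phi> (at x) x) \<partial>lebesgue_on annulus)
      + (\<integral>x. f x * frechet_derivative \<phi> (at x) (perp x) \<partial>lebesgue_on annulus)
      + (\<sigma>\<^sup>2 * ((\<integral>x. rr x * \<phi> x \<partial>lebesgue_on annulus) - (\<integral>x. k x * \<phi> x \<partial>lebesgue_on annulus)) + (\<integral>x. g1 x * \<phi> x \<partial>lebesgue_on annulus))"
  proof -
    have c\<phi>: "continuous_on UNIV \<phi>" by (rule C1_continuous[OF C\<phi>])
    have c\<phi>x: "continuous_on UNIV (\<lambda>x. frechet_derivative \<phi> (at x) x)"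
      by (rule C1_derivative_continuous[OF C\<phi> continuous_on_id continuous_on_id])
    have c\<phi>p: "continuous_on UNIV (\<lambda>x. frechet_derivative \<phi> (at x) (perp x))"
      by (rule C1_derivative_continuous[OF C\<phi> continuous_on_id continuous_on_perp[OF continuous_on_id]])
    have bp: "\<bar>frechet_derivative \<phi> (at x) (perp x)\<bar> \<le> B\<phi> * 2" for x
    proof (cases "x \<in> S")
      case True
      then have "norm (perp x) \<le> 2" using S(2) by (auto simp: annulus_def)
      then show ?thesis using B\<phi>(2)[of x "perp x"] mult_left_mono[of "norm (perp x)" 2 B\<phi>] B\<phi>(3) by simp
    next
      case False
      then show ?thesis using S(4) B\<phi>(3) by simp
    qed
    have b1: "\<bar>2 * \<phi> x + frechet_derivative \<phi> (at x) x\<bar> \<le> 2 * B\<phi> + M\<phi>" for x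
      using B\<phi>(1)[of x] M\<phi>(2)[of x] by (simp add: abs_le_iff)
    have i: "integrable (lebesgue_on annulus) (\<lambda>x. k x * (2 * \<phi> x + frechet_derivative \<phi> (at x) x))"
      "integrable (lebesgue_on annulus) (\<lambda>x. f x * frechet_derivative \<phi> (at x) (perp x))"
      "integrable (lebesgue_on annulus) (\<lambda>x. rr x * \<phi> x)" "integrable (lebesgue_on annulus) (\<lambda>x. k x * \<phi> x)"
      "integrable (lebesgue_on annulus) (\<lambda>x. g1 x * \<phi> x)"
    proof -
      show "integrable (lebesgue_on annulus) (\<lambda>x. k x * (2 * \<phi> x + frechet_derivative \<phi> (at x) x))"
        by (rule integrable_annulus_mult_bounded[OF _ _ b1]) (use iK in \<open>simp add: k_def[abs_def]\<close>, intro continuous_intros c\<phi> c\<phi>x)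
      show "integrable (lebesgue_on annulus) (\<lambda>x. f x * frechet_derivative \<phi> (at x) (perp x))"
        by (rule integrable_annulus_mult_bounded[OF fi c\<phi>p bp])
      show "integrable (lebesgue_on annulus) (\<lambda>x. rr x * \<phi> x)"
        by (rule integrable_annulus_mult_bounded[OF _ c\<phi>, of _ B\<phi>]) (use iR B\<phi>(1) in \<open>simp_all add: rr_def[abs_def]\<close>)
      show "integrable (lebesgue_on annulus) (\<lambda>x. k x * \<phi> x)"
        by (rule integrable_annulus_mult_bounded[OF _ c\<phi>, of _ B\<phi>]) (use iK B\<phi>(1) in \<open>simp_all add: k_def[abs_def]\<close>)
      show "integrable (lebesgue_on annulus) (\<lambda>x. g1 x * \<phi> x)"
        by (rule integrable_annulus_mult_bounded[OF _ c\<phi>, of _ B\<phi>]) (use iG1 B\<phi>(1) in \<open>simp_all add: g1_def[abs_def]\<close>)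
    qed
    have "(\<integral>x. d x * \<phi> x \<partial>lebesgue_on annulus) = (\<integral>x. rr x * \<phi> x \<partial>lebesgue_on annulus) - (\<integral>x. k x * \<phi> x \<partial>lebesgue_on annulus)"
      "integrable (lebesgue_on annulus) (\<lambda>x. d x * \<phi> x)"
      unfolding d_eq left_diff_distrib using i by simp_all
    then show ?thesis using i by simp
  qed
  also have "(\<integral>x. k x * (2 * \<phi> x + frechet_derivative \<phi> (at x) x) \<partial>lebesgue_on annulus) = - (\<sigma> * (\<integral>x. rr x * \<phi> x \<partial>lebesgue_on annulus))"
  proof -
    have "AE y in lborel. y \<in> annulus \<longrightarrow> image_mset fst (j1 w y) = w y"
      using jet by eventually_elim (simp add: euler_jet_def)
    from dilation_identity[OF W this hom Cc\<kappa> \<phi>] show ?thesis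
      by (simp add: k_def K_def rr_def R_def mult.assoc)
  qed
  finally have "(\<integral>x. f x * frechet_derivative \<phi> (at x) (perp x) \<partial>lebesgue_on annulus)
     = \<sigma>\<^sup>2 * (\<integral>x. k x * \<phi> x \<partial>lebesgue_on annulus) - (\<integral>x. g1 x * \<phi> x \<partial>lebesgue_on annulus)"
    by (simp add: power2_eq_square algebra_simps)
  moreover have "(\<integral>x. g x * \<phi> x \<partial>lebesgue_on annulus) = (\<integral>x. g1 x * \<phi> x \<partial>lebesgue_on annulus) - \<sigma>\<^sup>2 * (\<integral>x. k x * \<phi> x \<partial>lebesgue_on annulus)"
  proof -
    note bnd = integrable_annulus_mult_bounded[OF _ C1_continuous[OF C\<phi>] B\<phi>(1)[unfolded real_norm_def]]
    have "integrable (lebesgue_on annulus) (\<lambda>x. g1 x * \<phi> x)" "integrable (lebesgue_on annulus) (\<lambda>x. k x * \<phi> x)"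
      using iG1 iK by (auto intro!: bnd simp: g1_def[abs_def] k_def[abs_def])
    then show ?thesis unfolding g_eq g1_def[symmetric] k_def[symmetric] by (simp add: left_diff_distrib mult.assoc)
  qed
  ultimately show "(\<integral>x. f x * frechet_derivative \<phi> (at x) (perp x) \<partial>lebesgue_on annulus) = - (\<integral>x. g x * \<phi> x \<partial>lebesgue_on annulus)"
    by simp
qed

section \<open>Oscillator phases\<close>

definition bump :: "'e::euclidean_space \<Rightarrow> real \<Rightarrow> 'e \<Rightarrow> real" where
  "bump c r y = (max 0 (r\<^sup>2 - (y - c) \<bullet> (y - c)))\<^sup>2"

lemma bump_has_derivative:
  "(bump c r has_derivative (\<lambda>h. - 4 * max 0 (r\<^sup>2 - (y - c) \<bullet> (y - c)) * ((y - c) \<bullet> h))) (at y)"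
proof -
  have "((\<lambda>y. r\<^sup>2 - (y - c) \<bullet> (y - c)) has_derivative (\<lambda>h. - 2 * ((y - c) \<bullet> h))) (at y)"
    by (rule derivative_eq_intros refl | simp add: inner_commute)+
  from has_derivative_compose[OF this pos_part_square_has_derivative] show ?thesis
    unfolding bump_def[abs_def] by (simp add: mult_ac)
qed

lemma C1_bump: "C1 (bump c r)"
  by (rule C1I[OF bump_has_derivative]) (intro continuous_intros)

lemma bump_pos_iff: "r > 0 \<Longrightarrow> bump c r y \<noteq> 0 \<longleftrightarrow> norm (y - c) < r"
proof -
  assume r: "r > 0"
  have "bump c r y \<noteq> 0 \<longleftrightarrow> (norm (y - c))\<^sup>2 < r\<^sup>2" by (auto simp: bump_def power2_norm_eq_inner max_def)
  also have "\<dots> \<longleftrightarrow> norm (y - c) < r"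
    using r power2_less_imp_less[of "norm (y - c)" r] power_strict_mono[of "norm (y - c)" r 2] by auto
  finally show ?thesis .
qed

lemma Cc1_bump: "r > 0 \<Longrightarrow> Cc1 UNIV (bump c r)"
proof (rule Cc1_intro[OF C1_bump compact_cball])
  fix x assume "r > 0" "x \<notin> cball c r"
  then show "bump c r x = 0" using bump_pos_iff[of r c x] by (simp add: dist_norm norm_minus_commute)
qed simp

lemma sum_mset_single:
  fixes f :: "'a \<Rightarrow> real"
  assumes "\<And>z. z \<in># M \<Longrightarrow> z \<noteq> z0 \<Longrightarrow> f z = 0"
  shows "(\<Sum>z\<in>#M. f z) = real (count M z0) * f z0"
  using assms by (induction M) (auto simp: algebra_simps)

text \<open>A bump around \<open>z0\<close> whose radius does not exceed the distance to the other
  entries sees only \<open>z0\<close>, so its sum reads off the multiplicity.\<close>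

lemma multiset_eq_of_C1_sums:
  fixes M N :: "'e::euclidean_space multiset"
  assumes eq: "\<And>f. C1 f \<Longrightarrow> (\<Sum>z\<in>#M. f z) = (\<Sum>z\<in>#N. f z :: real)"
  shows "M = N"
proof (rule multiset_eqI)
  fix z0
  have "finite (set_mset M \<union> set_mset N)" by simp
  from finite_set_avoid[OF this, of z0]
  obtain r where r: "r > 0" "\<And>z. z \<in> set_mset M \<union> set_mset N \<Longrightarrow> z \<noteq> z0 \<Longrightarrow> r \<le> dist z0 z" by blast
  have z: "bump z0 r z = 0" if "z \<in># M \<or> z \<in># N" "z \<noteq> z0" for z
    using r(2)[of z] that bump_pos_iff[OF r(1), of z0 z] by (auto simp: dist_norm norm_minus_commute)
  have "real (count M z0) * bump z0 r z0 = real (count N z0) * bump z0 r z0"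
    using eq[OF C1_bump, of z0 r] sum_mset_single[of M z0 "bump z0 r"] sum_mset_single[of N z0 "bump z0 r"] z by simp
  moreover have "bump z0 r z0 \<noteq> 0" using bump_pos_iff[OF r(1), of z0 z0] r(1) by simp
  ultimately show "count M z0 = count N z0" by simp
qed

text \<open>Centres from a dense set and radii \<open>1 / Suc n\<close> suffice to isolate one
  value, so that countably many test functions will do. Injectivity of \<open>fst\<close> makes an
  isolated value an isolated entry.\<close>

lemma zero_of_bump_sums:
  fixes M :: "('e::euclidean_space \<times> 'f) multiset"
  assumes C: "\<And>X. open X \<Longrightarrow> X \<noteq> {} \<Longrightarrow> \<exists>c\<in>C. c \<in> (X :: 'e set)"
    and inj: "inj_on fst (set_mset M)"
    and eq: "\<And>c n. c \<in> C \<Longrightarrow> (\<Sum>z\<in>#M. bump c (1 / real (Suc n)) (fst z) * h z) = 0"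
    and z0: "z0 \<in># M"
  shows "h z0 = 0"
proof -
  have "finite (fst ` set_mset M)" by simp
  from finite_set_avoid[OF this, of "fst z0"]
  obtain r where r: "r > 0" "\<And>a. a \<in> fst ` set_mset M \<Longrightarrow> a \<noteq> fst z0 \<Longrightarrow> r \<le> dist (fst z0) a" by blast
  obtain n where n: "1 / real (Suc n) < r / 2" using r(1) nat_approx_posE[of "r / 2"] by auto
  \<comment> \<open>A radius below \<open>r / 2\<close> and a centre within that radius of
    \<open>fst z0\<close> keep all other values, at distance at least \<open>r\<close>, outside the
    bump.\<close>
  define \<rho> where "\<rho> = 1 / real (Suc n)"
  have \<rho>: "\<rho> > 0" "\<rho> < r / 2" using n by (simp_all add: \<rho>_def)
  obtain c where c: "c \<in> C" "c \<in> ball (fst z0) \<rho>" using C[of "ball (fst z0) \<rho>"] \<rho>(1) by auto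
  have 0: "bump c \<rho> (fst z) = 0" if "z \<in># M" "z \<noteq> z0" for z
  proof -
    have "fst z \<noteq> fst z0" using inj_onD[OF inj, of z z0] that z0 by blast
    then have "r \<le> dist (fst z0) (fst z)" using r(2)[of "fst z"] that by blast
    also have "\<dots> \<le> dist (fst z0) c + dist c (fst z)" by (rule dist_triangle)
    finally have "\<not> norm (fst z - c) < \<rho>" using c(2) \<rho> by (simp add: dist_norm norm_minus_commute)
    then show ?thesis using bump_pos_iff[OF \<rho>(1), of c "fst z"] by blast
  qed
  have "real (count M z0) * (bump c \<rho> (fst z0) * h z0) = 0"
    using eq[OF c(1), of n] 0 sum_mset_single[of M z0 "\<lambda>z. bump c \<rho> (fst z) * h z"] by (simp add: \<rho>_def)
  moreover have "bump c \<rho> (fst z0) \<noteq> 0" using bump_pos_iff[OF \<rho>(1), of c "fst z0"] c(2) by (simp add: dist_norm norm_minus_commute)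
  ultimately show ?thesis using z0 by (simp add: not_in_iff[symmetric])
qed

section \<open>Uniqueness and images of the differential\<close>

lemma qdiff_subset: "qdiff T G t D \<Longrightarrow> G' \<subseteq> G \<Longrightarrow> qdiff T G' t D"
  unfolding qdiff_def by (meson subset_iff)

text \<open>The symmetric sum of a bump around \<open>p\<close> times the linear function in the
  direction \<open>e = D p - D' p\<close> has a derivative proportional to both
  \<open>D p \<bullet> e\<close> and \<open>D' p \<bullet> e\<close>, with the same nonzero factor;
  hence \<open>e \<bullet> e = 0\<close>.\<close>

lemma qdiff_unique:
  fixes T :: "real \<Rightarrow> 'e::euclidean_space multiset"
  assumes D: "qdiff T G t D" and D': "qdiff T G t D'" and t: "at t within G \<noteq> bot" and p: "p \<in># T t"
  shows "D p = D' p"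
proof -
  have "finite (set_mset (T t))" by simp
  from finite_set_avoid[OF this, of p]
  obtain r where r: "r > 0" "\<And>z. z \<in># T t \<Longrightarrow> z \<noteq> p \<Longrightarrow> r \<le> dist p z" by blast
  define e where "e = D p - D' p"
  define F where "F z = bump p r (snd z) * ((snd z - p) \<bullet> e)" for z :: "real \<times> 'e"
  define F' where "F' z h = bump p r z * (snd h \<bullet> e) + (- 4 * max 0 (r\<^sup>2 - (z - p) \<bullet> (z - p)) * ((z - p) \<bullet> snd h)) * ((z - p) \<bullet> e)"
    for z and h :: "real \<times> 'e"
  have F: "(F has_derivative F' z) (at (t, z))" for z
  proof -
    have s: "(snd has_derivative snd) (at (t, z))" by (rule has_derivative_snd) (rule has_derivative_ident)
    have "((\<lambda>y. bump p r (snd y)) has_derivative (\<lambda>h. - 4 * max 0 (r\<^sup>2 - (z - p) \<bullet> (z - p)) * ((z - p) \<bullet> snd h))) (at (t, z))"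
      using has_derivative_compose[OF s, of "bump p r"] bump_has_derivative[of p r z] by simp
    moreover have "((\<lambda>y::real \<times> 'e. (snd y - p) \<bullet> e) has_derivative (\<lambda>h. snd h \<bullet> e)) (at (t, z))"
      using has_derivative_inner_left[OF has_derivative_diff[OF s has_derivative_const[of p]], of e] by simp
    ultimately show ?thesis unfolding F_def F'_def
      by (rule has_derivative_eq_rhs[OF has_derivative_mult]) simp
  qed
  have F'0: "F' z h = 0" if "z \<in># T t" "z \<noteq> p" for z h
  proof -
    have n: "r \<le> norm (z - p)" using r(2)[OF that] by (simp add: dist_norm norm_minus_commute)
    then have "r\<^sup>2 \<le> (z - p) \<bullet> (z - p)" unfolding power2_norm_eq_inner[symmetric] using r(1) by (intro power_mono) auto
    then show ?thesis using n bump_pos_iff[OF r(1), of p z] by (simp add: F'_def)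
  qed
  have "(\<Sum>z\<in>#T t. F' z (1, D z)) = (\<Sum>z\<in>#T t. F' z (1, D' z))"
    using qdiff_sum_mset_derivative[OF D F] qdiff_sum_mset_derivative[OF D' F]
    unfolding has_real_derivative_iff_has_vector_derivative by (rule vector_derivative_unique_within[OF t])
  then have "real (count (T t) p) * F' p (1, D p) = real (count (T t) p) * F' p (1, D' p)"
    using sum_mset_single[of "T t" p "\<lambda>z. F' z (1, D z)"] sum_mset_single[of "T t" p "\<lambda>z. F' z (1, D' z)"] F'0 by simp
  then have "bump p r p * (e \<bullet> e) = 0" using p
    by (simp add: F'_def e_def not_in_iff[symmetric] inner_diff_left right_diff_distrib)
  moreover have "bump p r p \<noteq> 0" using bump_pos_iff[OF r(1), of p p] r(1) by simp
  ultimately show ?thesis by (simp add: e_def)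
qed

text \<open>A differential is a function of the value, so the image multiset needs a way back from
  \<open>h z\<close> to \<open>z\<close>; this is the left inverse \<open>k\<close> on the values at
  time \<open>t\<close>.\<close>

lemma qdiff_image_mset:
  assumes "qdiff T G t D" and h: "linear h" "\<And>z. norm (h z) \<le> norm z"
    and inj: "\<And>z. z \<in># T t \<Longrightarrow> k (h z) = z"
  shows "qdiff (\<lambda>s. image_mset h (T s)) G t (\<lambda>a. h (D (k a)))"
  unfolding qdiff_def
proof (intro allI impI)
  fix e :: real assume "e > 0"
  then obtain d where d: "d > 0" "\<And>s. s \<in> G \<Longrightarrow> \<bar>s - t\<bar> < d \<Longrightarrow> \<exists>xs ys. mset xs = T s \<and> mset ys = T t \<and> length xs = length ys \<and>
        (\<forall>i<length xs. norm (xs ! i - ys ! i - (s - t) *\<^sub>R D (ys ! i)) \<le> e * \<bar>s - t\<bar>)"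
    using assms(1) unfolding qdiff_def by blast
  show "\<exists>d>0. \<forall>s\<in>G. \<bar>s - t\<bar> < d \<longrightarrow>
     (\<exists>xs ys. mset xs = image_mset h (T s) \<and> mset ys = image_mset h (T t) \<and> length xs = length ys \<and>
        (\<forall>i<length xs. norm (xs ! i - ys ! i - (s - t) *\<^sub>R h (D (k (ys ! i)))) \<le> e * \<bar>s - t\<bar>))"
  proof (rule exI[of _ d], intro conjI ballI impI)
    fix s assume "s \<in> G" "\<bar>s - t\<bar> < d"
    from d(2)[OF this] obtain xs ys where xy: "mset xs = T s" "mset ys = T t" "length xs = length ys"
      "\<And>i. i < length xs \<Longrightarrow> norm (xs ! i - ys ! i - (s - t) *\<^sub>R D (ys ! i)) \<le> e * \<bar>s - t\<bar>" by blast
    have "norm (map h xs ! i - map h ys ! i - (s - t) *\<^sub>R h (D (k (map h ys ! i)))) \<le> e * \<bar>s - t\<bar>" if i: "i < length xs" for i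
    proof -
      have "ys ! i \<in># T t" using i xy(2,3) by (metis nth_mem set_mset_mset)
      then have "map h xs ! i - map h ys ! i - (s - t) *\<^sub>R h (D (k (map h ys ! i))) = h (xs ! i - ys ! i - (s - t) *\<^sub>R D (ys ! i))"
        using i xy(3) by (simp add: inj linear_diff[OF h(1)] linear_scale[OF h(1)])
      then show ?thesis using h(2) xy(4)[OF i] by (metis order_trans)
    qed
    then show "\<exists>xs ys. mset xs = image_mset h (T s) \<and> mset ys = image_mset h (T t) \<and> length xs = length ys \<and>
        (\<forall>i<length xs. norm (xs ! i - ys ! i - (s - t) *\<^sub>R h (D (k (ys ! i)))) \<le> e * \<bar>s - t\<bar>)"
      using xy(1-3) by (intro exI[of _ "map h xs"] exI[of _ "map h ys"]) simp
  qed (rule d(1))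
qed

text \<open>The flow of \<open>a' = b\<close>, \<open>b' = - \<sigma>\<^sup>2 a\<close> run
  backwards for the time \<open>t\<close>.\<close>

definition phase_rot :: "real \<Rightarrow> real \<Rightarrow> 'v \<times> 'v \<Rightarrow> 'v \<times> 'v::real_vector" where
  "phase_rot \<sigma> t p = (cos (\<sigma> * t) *\<^sub>R fst p - (sin (\<sigma> * t) / \<sigma>) *\<^sub>R snd p,
     (\<sigma> * sin (\<sigma> * t)) *\<^sub>R fst p + cos (\<sigma> * t) *\<^sub>R snd p)"

lemma phase_rot_add:
  fixes p :: "'v \<times> 'v::real_vector"
  assumes "\<sigma> \<noteq> 0"
  shows "phase_rot \<sigma> (s + t) p = phase_rot \<sigma> s (phase_rot \<sigma> t p)"
proof -
  have "cos (\<sigma> * (s + t)) *\<^sub>R a - (sin (\<sigma> * (s + t)) / \<sigma>) *\<^sub>R b =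
      cos (\<sigma> * s) *\<^sub>R (cos (\<sigma> * t) *\<^sub>R a - (sin (\<sigma> * t) / \<sigma>) *\<^sub>R b)
      - (sin (\<sigma> * s) / \<sigma>) *\<^sub>R ((\<sigma> * sin (\<sigma> * t)) *\<^sub>R a + cos (\<sigma> * t) *\<^sub>R b)"
    "(\<sigma> * sin (\<sigma> * (s + t))) *\<^sub>R a + cos (\<sigma> * (s + t)) *\<^sub>R b =
      (\<sigma> * sin (\<sigma> * s)) *\<^sub>R (cos (\<sigma> * t) *\<^sub>R a - (sin (\<sigma> * t) / \<sigma>) *\<^sub>R b)
      + cos (\<sigma> * s) *\<^sub>R ((\<sigma> * sin (\<sigma> * t)) *\<^sub>R a + cos (\<sigma> * t) *\<^sub>R b)" for a b :: 'v
    using assms by (simp_all add: distrib_left cos_add sin_add scaleR_add_left scaleR_add_right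
        scaleR_diff_left scaleR_diff_right add_divide_distrib mult_ac)
  then show ?thesis by (simp add: phase_rot_def)
qed

lemma phase_rot_0 [simp]: "phase_rot \<sigma> 0 p = p"
  by (simp add: phase_rot_def)

lemma phase_rot_inj:
  assumes "\<sigma> \<noteq> 0" "phase_rot \<sigma> t p = phase_rot \<sigma> t p'" shows "p = p'"
  using arg_cong[OF assms(2), of "phase_rot \<sigma> (- t)"] phase_rot_add[OF assms(1), of "- t" t] by (metis add.left_inverse phase_rot_0)

text \<open>Eliminating one component from the fixed point equations leaves the other multiplied by
  \<open>(c - 1)\<^sup>2 + s\<^sup>2\<close>, the determinant of the flow map minus the
  identity.\<close>

lemma phase_rot_fixed:
  assumes \<sigma>: "\<sigma> \<noteq> 0" and fx: "phase_rot \<sigma> t p = p" and p: "p \<noteq> 0"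
  shows "cos (\<sigma> * t) = 1"
proof -
  obtain a b where ab: "p = (a, b)" by fastforce
  define c s where "c = cos (\<sigma> * t)" and "s = sin (\<sigma> * t)"
  have 1: "(c - 1) *\<^sub>R a = (s / \<sigma>) *\<^sub>R b" and 2: "(\<sigma> * s) *\<^sub>R a = - ((c - 1) *\<^sub>R b)"
    using fx by (simp_all add: ab phase_rot_def c_def s_def algebra_simps)
  have "((c - 1) * (c - 1)) *\<^sub>R a = (s / \<sigma>) *\<^sub>R ((c - 1) *\<^sub>R b)"
    using arg_cong[OF 1, of "\<lambda>v. (c - 1) *\<^sub>R v"] by (simp add: mult.commute)
  also have "(c - 1) *\<^sub>R b = - ((\<sigma> * s) *\<^sub>R a)" using 2 by simp
  also have "(s / \<sigma>) *\<^sub>R - ((\<sigma> * s) *\<^sub>R a) = - ((s * s) *\<^sub>R a)" using \<sigma> by simp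
  finally have A: "((c - 1)\<^sup>2 + s\<^sup>2) *\<^sub>R a = 0" by (simp add: power2_eq_square scaleR_add_left)
  have "((c - 1) * (c - 1)) *\<^sub>R b = - ((\<sigma> * s) *\<^sub>R ((c - 1) *\<^sub>R a))"
    using arg_cong[OF 2, of "\<lambda>v. (c - 1) *\<^sub>R v"] by (simp add: mult.commute)
  also have "\<dots> = - ((s * s) *\<^sub>R b)" unfolding 1 using \<sigma> by simp
  finally have B: "((c - 1)\<^sup>2 + s\<^sup>2) *\<^sub>R b = 0" by (simp add: power2_eq_square scaleR_add_left)
  from A B p have "(c - 1)\<^sup>2 + s\<^sup>2 = 0" by (auto simp: ab zero_prod_def)
  then show ?thesis by (simp add: c_def sum_power2_eq_zero_iff)
qed

text \<open>The period comes from the pigeonhole principle: the orbit of \<open>m\<close> stays in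
  \<open>M\<close>, and \<open>{..size M}\<close> has one index more than \<open>M\<close> has
  entries, so two iterates agree. Injectivity of the flow cancels the earlier one.\<close>

lemma invariant_multiset_period:
  fixes M :: "('v \<times> 'v::real_vector) multiset"
  assumes \<sigma>: "\<sigma> > 1" and inv: "image_mset (phase_rot \<sigma> (2 * pi)) M = M" and m: "m \<in># M" "m \<noteq> 0"
  shows "\<sigma> \<ge> 1 + 1 / real (size M)"
proof -
  have \<sigma>0: "\<sigma> \<noteq> 0" using \<sigma> by simp
  have orb: "phase_rot \<sigma> (real j * (2 * pi)) m \<in># M" for j
  proof (induction j)
    case (Suc j)
    have "phase_rot \<sigma> (real (Suc j) * (2 * pi)) m = phase_rot \<sigma> (2 * pi) (phase_rot \<sigma> (real j * (2 * pi)) m)"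
      unfolding phase_rot_add[OF \<sigma>0, symmetric] by (simp add: algebra_simps)
    also have "\<dots> \<in># image_mset (phase_rot \<sigma> (2 * pi)) M" using Suc by simp
    finally show ?case by (simp only: inv)
  qed (use m in simp)
  have "\<not> inj_on (\<lambda>j. phase_rot \<sigma> (real j * (2 * pi)) m) {..size M}"
  proof
    assume "inj_on (\<lambda>j. phase_rot \<sigma> (real j * (2 * pi)) m) {..size M}"
    then have "card {..size M} \<le> card (set_mset M)" by (rule card_inj_on_le) (use orb in auto)
    also have "\<dots> \<le> size M" by (metis card_length ex_mset set_mset_mset size_mset)
    finally show False by simp
  qed
  then obtain i j where ij: "i < j" "j \<le> size M" "phase_rot \<sigma> (real i * (2 * pi)) m = phase_rot \<sigma> (real j * (2 * pi)) m"
    unfolding inj_on_def by (metis atMost_iff linorder_neqE_nat)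
  define l where "l = j - i"
  have l: "1 \<le> l" "l \<le> size M" "real j * (2 * pi) = real i * (2 * pi) + real l * (2 * pi)"
    using ij by (auto simp: l_def of_nat_diff algebra_simps)
  have "phase_rot \<sigma> (real i * (2 * pi)) (phase_rot \<sigma> (real l * (2 * pi)) m) = phase_rot \<sigma> (real i * (2 * pi)) m"
    using ij(3) unfolding l(3) phase_rot_add[OF \<sigma>0] by simp
  then have "phase_rot \<sigma> (real l * (2 * pi)) m = m" by (rule phase_rot_inj[OF \<sigma>0])
  then have "cos (\<sigma> * (real l * (2 * pi))) = 1" by (rule phase_rot_fixed[OF \<sigma>0 _ m(2)])
  then obtain n :: int where "\<sigma> * (real l * (2 * pi)) = of_int n * 2 * pi" unfolding cos_one_2pi_int by blast
  then have "(\<sigma> * real l) * (2 * pi) = of_int n * (2 * pi)" by (simp only: mult.assoc)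
  then have n: "\<sigma> * real l = of_int n" by simp
  have "1 * real l < \<sigma> * real l" using \<sigma> l(1) by (intro mult_strict_right_mono) auto
  \<comment> \<open>Strictness and integrality together gain a whole unit, which after division by
    \<open>l\<close> is the summand \<open>1 / l\<close>.\<close>
  then have "int l + 1 \<le> n" unfolding n by linarith
  then have "real_of_int (int l + 1) \<le> of_int n" by (simp only: of_int_le_iff)
  then have "real l + 1 \<le> \<sigma> * real l" by (simp add: n)
  then have "1 + 1 / real l \<le> \<sigma>" using l(1) by (simp add: field_simps)
  moreover have "1 / real (size M) \<le> 1 / real l" using l by (simp add: frac_le)
  ultimately show ?thesis by linarith
qed


section \<open>The phase of a jet and its constancy along the circle\<close>

lemma C1_cos: "C1 (\<lambda>t::real. cos t)" and C1_sin: "C1 (\<lambda>t::real. sin t)"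
proof -
  show "C1 (\<lambda>t::real. cos t)"
    by (rule C1I[where f' = "\<lambda>t h. - sin t * h"]) (auto intro!: derivative_eq_intros continuous_intros)
  show "C1 (\<lambda>t::real. sin t)"
    by (rule C1I[where f' = "\<lambda>t h. cos t * h"]) (auto intro!: derivative_eq_intros continuous_intros)
qed

lemma C1_Pair:
  assumes "C1 f" "C1 g" shows "C1 (\<lambda>x. (f x, g x))"
proof (rule C1I[where f' = "\<lambda>x h. (frechet_derivative f (at x) h, frechet_derivative g (at x) h)"])
  show "((\<lambda>x. (f x, g x)) has_derivative (\<lambda>h. (frechet_derivative f (at x) h, frechet_derivative g (at x) h))) (at x)" for x
    by (rule has_derivative_Pair[OF C1D[OF assms(1)] C1D[OF assms(2)]])
  show "continuous_on UNIV (\<lambda>x. (frechet_derivative f (at x) h, frechet_derivative g (at x) h))" for h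
    by (rule continuous_on_Pair[OF C1_partial_continuous[OF assms(1)] C1_partial_continuous[OF assms(2)]])
qed

lemma C1_lipschitz_cball:
  assumes f: "C1 f"
  obtains B where "B \<ge> 0" "\<And>x y. x \<in> cball 0 R \<Longrightarrow> y \<in> cball 0 R \<Longrightarrow> norm (f x - f y) \<le> B * norm (x - y)"
proof -
  obtain B where B: "B \<ge> 0" "\<And>x h. x \<in> cball 0 R \<Longrightarrow> norm (frechet_derivative f (at x) h) \<le> B * norm h"
    by (rule C1_derivative_bound_compact[OF f compact_cball[of 0 R]]) (rule that)
  show ?thesis
  proof (rule that[of B])
    fix x y :: 'a assume "x \<in> cball 0 R" "y \<in> cball 0 R"
    moreover have "onorm (frechet_derivative f (at z)) \<le> B" if "z \<in> cball 0 R" for z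
      by (rule onorm_bound[OF B(1) B(2)[OF that]])
    ultimately show "norm (f x - f y) \<le> B * norm (x - y)"
      by (intro differentiable_bound[OF convex_cball[of 0 R], where f' = "\<lambda>x. frechet_derivative f (at x)"])
         (auto intro: has_derivative_at_withinI C1D[OF f])
  qed (rule B(1))
qed

text \<open>The value and tangential speed at angle 0 of the oscillator solution that passes through
  the jet at angle \<open>fst p\<close>.\<close>

definition phase :: "real \<Rightarrow> real^2 \<Rightarrow> real \<times> (real^'k) \<times> (real^2^'k) \<Rightarrow> (real^'k) \<times> (real^'k)" where
  "phase \<sigma> x p = phase_rot \<sigma> (fst p) (fst (snd p), snd (snd p) *v perp (rot (fst p) x))"

lemma C1_phase: "C1 (phase \<sigma> x :: _ \<Rightarrow> (real^'k) \<times> (real^'k))"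
proof -
  have t: "C1 (fst :: real \<times> (real^'k) \<times> (real^2^'k) \<Rightarrow> real)" by (rule C1_bounded_linear[OF bounded_linear_fst])
  have z: "C1 (snd :: real \<times> (real^'k) \<times> (real^2^'k) \<Rightarrow> _)" by (rule C1_bounded_linear[OF bounded_linear_snd])
  have a: "C1 (\<lambda>p::real \<times> (real^'k) \<times> (real^2^'k). fst (snd p))" by (rule C1_compose[OF C1_bounded_linear[OF bounded_linear_fst] z])
  have A: "C1 (\<lambda>p::real \<times> (real^'k) \<times> (real^2^'k). snd (snd p))" by (rule C1_compose[OF C1_bounded_linear[OF bounded_linear_snd] z])
  have cs: "C1 (\<lambda>p::real \<times> (real^'k) \<times> (real^2^'k). c * cos (s * fst p))" "C1 (\<lambda>p::real \<times> (real^'k) \<times> (real^2^'k). c * sin (s * fst p))" for c s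
    by (rule C1_mult[OF C1_const C1_compose[OF C1_cos C1_mult[OF C1_const t]]],
        rule C1_mult[OF C1_const C1_compose[OF C1_sin C1_mult[OF C1_const t]]])
  have "C1 (\<lambda>p::real \<times> (real^'k) \<times> (real^2^'k). (1 * cos (1 * fst p)) *\<^sub>R perp x + (1 * sin (1 * fst p)) *\<^sub>R perp (perp x))"
    by (rule C1_add[OF C1_scaleR[OF cs(1) C1_const] C1_scaleR[OF cs(2) C1_const]])
  then have "C1 (\<lambda>p::real \<times> (real^'k) \<times> (real^2^'k). perp (rot (fst p) x))" by (simp add: perp_rot) (simp add: rot_def)
  then have b: "C1 (\<lambda>p::real \<times> (real^'k) \<times> (real^2^'k). snd (snd p) *v perp (rot (fst p) x))"
    by (rule C1_bilinear[OF bounded_bilinear_matrix_vector_mult A])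
  have "C1 (\<lambda>p::real \<times> (real^'k) \<times> (real^2^'k).
     ((1 * cos (\<sigma> * fst p)) *\<^sub>R fst (snd p) - (inverse \<sigma> * sin (\<sigma> * fst p)) *\<^sub>R (snd (snd p) *v perp (rot (fst p) x)),
      (\<sigma> * sin (\<sigma> * fst p)) *\<^sub>R fst (snd p) + (1 * cos (\<sigma> * fst p)) *\<^sub>R (snd (snd p) *v perp (rot (fst p) x))))"
    by (rule C1_Pair[OF C1_diff[OF C1_scaleR[OF cs(1) a] C1_scaleR[OF cs(2) b]] C1_add[OF C1_scaleR[OF cs(2) a] C1_scaleR[OF cs(1) b]]])
  then show ?thesis by (simp add: phase_def[abs_def] phase_rot_def divide_inverse mult.commute)
qed

text \<open>The oscillator equations \<open>a' = b\<close>, \<open>b' = - \<sigma>\<^sup>2 a\<close> along a sheet, where \<open>b\<close> is the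
  tangential derivative \<open>A *v perp (rot t x)\<close>. The last equation differentiates \<open>b\<close> by the
  product rule and uses \<open>perp (perp y) = - y\<close> and Euler's equation for the second factor.\<close>

definition oscillates :: "real \<Rightarrow> real^2 \<Rightarrow> (real^'k) \<times> (real^2^'k) \<Rightarrow> (real^'k) \<times> (real^2^'k) \<Rightarrow> bool" where
  "oscillates \<sigma> y z d \<longleftrightarrow> snd z *v y = \<sigma> *\<^sub>R fst z \<and> fst d = snd z *v perp y \<and>
     snd d *v perp y = \<sigma> *\<^sub>R fst z - \<sigma>\<^sup>2 *\<^sub>R fst z"

text \<open>Along the line through \<open>(t, z)\<close> with velocity \<open>(1, d)\<close> the
  phase is stationary to first order, because the backward flow undoes the motion prescribed by
  \<open>oscillates\<close>. Comparing with the chain rule for \<open>f\<close> gives the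
  claim.\<close>

lemma phase_derivative_zero:
  assumes osc: "oscillates \<sigma> (rot t x) z d" and \<sigma>: "\<sigma> \<noteq> 0" and f: "C1 (f :: _ \<Rightarrow> real)"
  shows "frechet_derivative (\<lambda>p. f (phase \<sigma> x p)) (at (t, z)) (1, d) = 0"
proof -
  define y where "y = rot t x"
  obtain a A h H where zd: "z = (a, A)" "d = (h, H)" by (cases z, cases d) blast
  have o: "A *v y = \<sigma> *\<^sub>R a" "h = A *v perp y" "H *v perp y = \<sigma> *\<^sub>R a - \<sigma>\<^sup>2 *\<^sub>R a"
    using osc by (simp_all add: oscillates_def zd y_def)
  define c where "c u = (t + u, a + u *\<^sub>R h, A + u *\<^sub>R H)" for u :: real
  have c0: "c 0 = (t, z)" by (simp add: c_def zd)
  have c': "(c has_vector_derivative (1, d)) (at 0)"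
    unfolding c_def[abs_def] zd by (auto intro!: has_vector_derivative_Pair derivative_eq_intros)
  \<comment> \<open>The product rule gives \<open>H *v perp y - A *v y = (\<sigma> a -
    \<sigma>\<^sup>2 a) - \<sigma> a\<close>.\<close>
  have b': "((\<lambda>u. (A + u *\<^sub>R H) *v perp (rot (t + u) x)) has_vector_derivative - (\<sigma>\<^sup>2 *\<^sub>R a)) (at 0)"
  proof -
    have r: "((\<lambda>u. rot (t + u) x) has_vector_derivative perp y) (at 0)"
      using rot_has_vector_derivative[of y 0 UNIV] by (simp add: y_def rot_add[symmetric] add.commute)
    have p: "((\<lambda>u. perp (rot (t + u) x)) has_vector_derivative - y) (at 0)"
      using bounded_linear.has_vector_derivative[OF bounded_linear_perp r] by simp
    have A: "((\<lambda>u. A + u *\<^sub>R H) has_vector_derivative H) (at 0)"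
      by (auto intro!: derivative_eq_intros)
    show ?thesis
      using bounded_bilinear.has_vector_derivative[OF bounded_bilinear_matrix_vector_mult A p]
      by (simp add: y_def[symmetric] o(1,3) linear_neg[OF matrix_vector_mul_linear])
  qed
  have a': "((\<lambda>u. a + u *\<^sub>R h) has_vector_derivative A *v perp y) (at 0)"
    unfolding o(2) by (auto intro!: derivative_eq_intros)
  have C': "((\<lambda>u. cos (\<sigma> * (t + u))) has_real_derivative - (\<sigma> * sin (\<sigma> * t))) (at 0)"
    and S': "((\<lambda>u. sin (\<sigma> * (t + u))) has_real_derivative \<sigma> * cos (\<sigma> * t)) (at 0)"
    by (auto intro!: derivative_eq_intros)
  have S1: "((\<lambda>u. sin (\<sigma> * (t + u)) / \<sigma>) has_real_derivative cos (\<sigma> * t)) (at 0)"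
    using DERIV_cdivide[OF S', of \<sigma>] \<sigma> by simp
  have S2: "((\<lambda>u. \<sigma> * sin (\<sigma> * (t + u))) has_real_derivative \<sigma> * (\<sigma> * cos (\<sigma> * t))) (at 0)"
    by (rule DERIV_cmult[OF S'])
  have "((\<lambda>u. phase \<sigma> x (c u)) has_vector_derivative (0, 0)) (at 0)"
    unfolding phase_def phase_rot_def c_def fst_conv snd_conv
  proof (rule has_vector_derivative_Pair)
    show "((\<lambda>u. cos (\<sigma> * (t + u)) *\<^sub>R (a + u *\<^sub>R h) - (sin (\<sigma> * (t + u)) / \<sigma>) *\<^sub>R ((A + u *\<^sub>R H) *v perp (rot (t + u) x))) has_vector_derivative 0) (at 0)"
      using has_vector_derivative_diff[OF has_vector_derivative_scaleR[OF C' a'] has_vector_derivative_scaleR[OF S1 b']] \<sigma>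
      by (simp add: y_def[symmetric] power2_eq_square mult_ac)
    show "((\<lambda>u. (\<sigma> * sin (\<sigma> * (t + u))) *\<^sub>R (a + u *\<^sub>R h) + cos (\<sigma> * (t + u)) *\<^sub>R ((A + u *\<^sub>R H) *v perp (rot (t + u) x))) has_vector_derivative 0) (at 0)"
      using has_vector_derivative_add[OF has_vector_derivative_scaleR[OF S2 a'] has_vector_derivative_scaleR[OF C' b']]
      by (simp add: y_def[symmetric] power2_eq_square mult_ac)
  qed
  then have "((\<lambda>u. phase \<sigma> x (c u)) has_derivative (\<lambda>v. 0)) (at 0)" by (simp add: has_vector_derivative_def zero_prod_def[symmetric])
  from has_derivative_compose[OF this C1D[OF f, of "phase \<sigma> x (c 0)"]]
  have 1: "((\<lambda>u. f (phase \<sigma> x (c u))) has_derivative (\<lambda>v. 0)) (at 0)"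
    unfolding linear_0[OF C1_linear[OF f, of "phase \<sigma> x (c 0)"]] .
  have Cf: "C1 (\<lambda>p. f (phase \<sigma> x p))" by (rule C1_compose[OF f C1_phase])
  have "((\<lambda>u. f (phase \<sigma> x (c u))) has_derivative (\<lambda>v. frechet_derivative (\<lambda>p. f (phase \<sigma> x p)) (at (t, z)) (v *\<^sub>R (1, d)))) (at 0)"
    by (rule has_derivative_compose[OF c'[unfolded has_vector_derivative_def] C1D[OF Cf, of "c 0"], unfolded c0])
  from has_derivative_unique[OF this 1] have "(\<lambda>v. frechet_derivative (\<lambda>p. f (phase \<sigma> x p)) (at (t, z)) (v *\<^sub>R (1, d))) 1 = 0"
    by (rule fun_cong)
  then show ?thesis by (simp only: scaleR_one)
qed


text \<open>Every symmetric sum of a \<open>C1\<close> function of the phases has zero derivative at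
  almost every good angle and an integral modulus of continuity, hence is constant on
  \<open>G\<close>. Such sums determine the multiset, so nothing has to be said about individual
  sheets.\<close>

lemma phase_multiset_constant:
  fixes J :: "real \<Rightarrow> ((real^'k) \<times> (real^2^'k)) multiset"
  assumes reg: "circle_regular L J G0 g" and G: "G \<subseteq> G0" "negligible ({0..L} - G)"
    and sz: "\<And>s. s \<in> G \<Longrightarrow> size (J s) = q" and \<sigma>: "\<sigma> \<noteq> 0"
    and ode: "negligible {t \<in> G. \<not> (\<exists>D. qdiff J G t D \<and> (\<forall>z\<in>#J t. oscillates \<sigma> (rot t x) z (D z)))}"
    and st: "s \<in> G" "t \<in> G"
  shows "image_mset (\<lambda>z. phase \<sigma> x (s, z)) (J s) = image_mset (\<lambda>z. phase \<sigma> x (t, z)) (J t)"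
proof -
  have GI: "G \<subseteq> {0..L}" and g: "g integrable_on {0..L}" "\<And>t. 0 \<le> g t"
    and qd: "\<And>s t. s \<in> G \<Longrightarrow> t \<in> G \<Longrightarrow> s \<le> t \<Longrightarrow> qdist (J t) (J s) \<le> integral {s..t} g"
    using reg G(1) unfolding circle_regular_def by blast+
  have gi: "g integrable_on {a..b}" if "a \<in> G" "b \<in> G" for a b
    using integrable_subinterval_real[OF g(1), of a b] that GI by (metis atLeastAtMost_iff atLeastatMost_subset_iff subsetD)
  have match: "\<exists>xs ys. mset xs = J a \<and> mset ys = J b \<and> length xs = q \<and> length ys = q \<and>
      (\<forall>i<q. norm (xs ! i - ys ! i) \<le> integral {b..a} g)" if ab: "a \<in> G" "b \<in> G" "b \<le> a" for a b
  proof -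
    have "size (J a) = size (J b)" using sz ab by simp
    then obtain xs ys where xy: "mset xs = J a" "mset ys = J b" "length xs = length ys"
      "\<And>i. i < length xs \<Longrightarrow> norm (xs ! i - ys ! i) \<le> qdist (J a) (J b)"
      by (rule qdist_matching) (rule that)
    have l: "length xs = q" using xy(1) sz[OF ab(1)] by (metis size_mset)
    have "norm (xs ! i - ys ! i) \<le> integral {b..a} g" if "i < q" for i
      using xy(4)[of i] qd[OF ab(2,1,3)] that l by linarith
    then show ?thesis using xy(1-3) l by metis
  qed
  define I where "I = integral {0..L} g"
  have Ile: "integral {b..a} g \<le> I" if "a \<in> G" "b \<in> G" for a b
    unfolding I_def by (rule integral_subset_le[OF _ gi[OF that(2,1)] g(1)]) (use that GI g(2) in auto)
  \<comment> \<open>Each jet over \<open>G\<close> is matched to a jet at \<open>s\<close> within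
    the total integral \<open>I\<close> of the metric speed. The curve therefore stays in a ball, on
    which a \<open>C1\<close> function is Lipschitz.\<close>
  define R0 where "R0 = I + (\<Sum>z\<in>set_mset (J s). norm z)"
  have bd: "norm z \<le> R0" if u: "u \<in> G" and z: "z \<in># J u" for u z
  proof -
    obtain y where y: "y \<in># J s" "norm (z - y) \<le> I"
    proof (cases "s \<le> u")
      case True
      obtain xs ys where m: "mset xs = J u" "mset ys = J s" "length xs = q" "length ys = q" "\<And>i. i < q \<Longrightarrow> norm (xs ! i - ys ! i) \<le> integral {s..u} g"
        using match[OF u st(1) True] by blast
      have "z \<in> set xs" using z m(1) by (metis set_mset_mset)
      then obtain i where i: "i < q" "xs ! i = z" using m(3) by (metis in_set_conv_nth)
      have "ys ! i \<in># J s" using i m(2,4) by (metis nth_mem set_mset_mset)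
      moreover have "norm (z - ys ! i) \<le> I" using m(5)[OF i(1)] i(2) Ile[OF u st(1)] by simp
      ultimately show thesis by (rule that)
    next
      case False
      then have le: "u \<le> s" by simp
      obtain xs ys where m: "mset xs = J s" "mset ys = J u" "length xs = q" "length ys = q" "\<And>i. i < q \<Longrightarrow> norm (xs ! i - ys ! i) \<le> integral {u..s} g"
        using match[OF st(1) u le] by blast
      have "z \<in> set ys" using z m(2) by (metis set_mset_mset)
      then obtain i where i: "i < q" "ys ! i = z" using m(4) by (metis in_set_conv_nth)
      have "xs ! i \<in># J s" using i m(1,3) by (metis nth_mem set_mset_mset)
      moreover have "norm (z - xs ! i) \<le> I" using m(5)[OF i(1)] i(2) Ile[OF st(1) u] by (simp add: norm_minus_commute)
      ultimately show thesis by (rule that)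
    qed
    have "norm y \<le> (\<Sum>z\<in>set_mset (J s). norm z)" using member_le_sum[of y "set_mset (J s)" norm] y(1) by simp
    moreover have "norm z \<le> norm y + norm (z - y)" using norm_triangle_ineq[of y "z - y"] by simp
    ultimately show ?thesis using y(2) unfolding R0_def by linarith
  qed
  define R where "R = L + R0"
  have bdR: "(u, z) \<in> cball 0 R" if "u \<in> G" "z \<in># J u" for u z
  proof -
    have "norm (u, z) \<le> norm u + norm z" by (rule norm_Pair_le)
    moreover have "norm u \<le> L" using GI that(1) by auto
    ultimately show ?thesis using bd[OF that] by (simp add: R_def)
  qed
  have const: "(\<Sum>z\<in>#J a. f (phase \<sigma> x (a, z))) = (\<Sum>z\<in>#J b. f (phase \<sigma> x (b, z)))"
    if f: "C1 f" and ab: "a \<in> G" "b \<in> G" "a < b" for f :: "(real^'k) \<times> (real^'k) \<Rightarrow> real" and a b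
  proof -
    define h where "h = (\<lambda>p. f (phase \<sigma> x p))"
    have Ch: "C1 h" unfolding h_def by (rule C1_compose[OF f C1_phase])
    obtain B where B: "B \<ge> 0" "\<And>p p'. p \<in> cball 0 R \<Longrightarrow> p' \<in> cball 0 R \<Longrightarrow> norm (h p - h p') \<le> B * norm (p - p')"
      by (rule C1_lipschitz_cball[OF Ch]) (rule that)
    define F where "F t = (\<Sum>z\<in>#J t. h (t, z))" for t
    \<comment> \<open>There are \<open>q\<close> matched pairs with Lipschitz constant
      \<open>B\<close>; the summand 1 pays for the explicit dependence on the angle.\<close>
    define g' where "g' t = (real q * B) * (1 + g t)" for t
    have "F a = F b"
    proof (rule constant_of_integral_modulus[OF _ G(2) GI _ _ _ ab])
      show "g' integrable_on {0..L}"
        unfolding g'_def by (intro integrable_on_mult_right integrable_add integrable_const_ivl g(1))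
      show "0 \<le> g' t" for t unfolding g'_def using B(1) g(2)[of t] by (intro mult_nonneg_nonneg add_nonneg_nonneg) auto
      show "\<bar>F t - F s\<bar> \<le> integral {s..t} g'" if s: "s \<in> G" and t: "t \<in> G" and le: "s \<le> t" for s t
      proof -
        obtain xs ys where m: "mset xs = J t" "mset ys = J s" "length xs = q" "length ys = q" "\<And>i. i < q \<Longrightarrow> norm (xs ! i - ys ! i) \<le> integral {s..t} g"
          using match[OF t s le] by blast
        have "F t - F s = (\<Sum>i<q. h (t, xs ! i) - h (s, ys ! i))"
          unfolding F_def m(1,2)[symmetric] sum_mset_nth m(3,4) by (rule sum_subtractf[symmetric])
        also have "\<bar>\<dots>\<bar> \<le> (\<Sum>i<q. B * ((t - s) + integral {s..t} g))"
        proof (rule order_trans[OF sum_abs], rule sum_mono)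
          fix i assume "i \<in> {..<q}"
          then have i: "i < q" by simp
          have "xs ! i \<in># J t" "ys ! i \<in># J s" using i m(1-4) by (metis nth_mem set_mset_mset)+
          then have "norm (h (t, xs ! i) - h (s, ys ! i)) \<le> B * norm ((t, xs ! i) - (s, ys ! i))"
            by (intro B(2) bdR s t)
          also have "\<dots> \<le> B * ((t - s) + integral {s..t} g)"
          proof (rule mult_left_mono[OF _ B(1)])
            have "norm ((t, xs ! i) - (s, ys ! i)) \<le> norm (t - s) + norm (xs ! i - ys ! i)"
              unfolding diff_Pair by (rule norm_Pair_le)
            then show "norm ((t, xs ! i) - (s, ys ! i)) \<le> (t - s) + integral {s..t} g" using m(5)[OF i] le by simp
          qed
          finally show "\<bar>h (t, xs ! i) - h (s, ys ! i)\<bar> \<le> B * ((t - s) + integral {s..t} g)" by simp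
        qed
        also have "\<dots> = integral {s..t} g'"
        proof -
          have "integral {s..t} (\<lambda>x. 1 + g x) = (t - s) + integral {s..t} g"
            using integral_add[OF integrable_const_ivl[of 1 s t] gi[OF s t]] le by simp
          then show ?thesis unfolding g'_def integral_mult_right by simp
        qed
        finally show ?thesis .
      qed
      show "negligible {t \<in> G. \<not> (\<forall>e>0. \<exists>d>0. \<forall>s\<in>G. \<bar>s - t\<bar> < d \<longrightarrow> \<bar>F s - F t\<bar> \<le> e * \<bar>s - t\<bar>)}"
      proof (rule negligible_subset[OF ode], rule subsetI, rule ccontr)
        fix t assume t: "t \<in> {t \<in> G. \<not> (\<forall>e>0. \<exists>d>0. \<forall>s\<in>G. \<bar>s - t\<bar> < d \<longrightarrow> \<bar>F s - F t\<bar> \<le> e * \<bar>s - t\<bar>)}"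
          and "t \<notin> {t \<in> G. \<not> (\<exists>D. qdiff J G t D \<and> (\<forall>z\<in>#J t. oscillates \<sigma> (rot t x) z (D z)))}"
        then obtain D where D: "qdiff J G t D" "\<And>z. z \<in># J t \<Longrightarrow> oscillates \<sigma> (rot t x) z (D z)" by blast
        have "(F has_real_derivative (\<Sum>z\<in>#J t. frechet_derivative h (at (t, z)) (1, D z))) (at t within G)"
          unfolding F_def by (rule qdiff_sum_mset_derivative[OF D(1) C1D[OF Ch]])
        moreover have "image_mset (\<lambda>z. frechet_derivative h (at (t, z)) (1, D z)) (J t) = image_mset (\<lambda>z. 0) (J t)"
          unfolding h_def by (intro image_mset_cong phase_derivative_zero[OF D(2) \<sigma> f])
        ultimately have "(F has_real_derivative 0) (at t within G)" by (simp add: sum_mset_constant)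
        then have "\<forall>e>0. \<exists>d>0. \<forall>s\<in>G. \<bar>s - t\<bar> < d \<longrightarrow> \<bar>F s - F t\<bar> \<le> e * \<bar>s - t\<bar>"
          unfolding has_field_derivative_def has_derivative_within_alt real_norm_def mult_zero_left diff_zero by blast
        then show False using t by blast
      qed
    qed
    then show ?thesis by (simp add: F_def h_def)
  qed
  show ?thesis
  proof (rule multiset_eq_of_C1_sums)
    fix f :: "(real^'k) \<times> (real^'k) \<Rightarrow> real" assume f: "C1 f"
    have "(\<Sum>z\<in>#J s. f (phase \<sigma> x (s, z))) = (\<Sum>z\<in>#J t. f (phase \<sigma> x (t, z)))"
    proof (cases s t rule: linorder_cases)
      case less
      then show ?thesis by (rule const[OF f st])
    next
      case greater
      then show ?thesis by (rule const[OF f st(2,1), symmetric])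
    qed simp
    then show "(\<Sum>z\<in>#image_mset (\<lambda>z. phase \<sigma> x (s, z)) (J s). f z) = (\<Sum>z\<in>#image_mset (\<lambda>z. phase \<sigma> x (t, z)) (J t). f z)"
      by (simp add: multiset.map_comp o_def)
  qed
qed

section \<open>Conclusion\<close>

lemma qdiff_cong:
  assumes "\<And>s. s \<in> G \<Longrightarrow> T s = T' s" "t \<in> G"
  shows "qdiff T G t D \<longleftrightarrow> qdiff T' G t D"
  using assms unfolding qdiff_def by simp

text \<open>The derivative of a bump sum is computed twice, by the chain rule from the unknown
  \<open>D\<close> and by the weak equation. The differential of the values is unique, so
  \<open>fst (D z)\<close> is the tangential speed; then the terms with the derivative of the bump
  cancel, and isolating a sheet leaves the second oscillator equation.\<close>

lemma jet_oscillates: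
  fixes J :: "real \<Rightarrow> ((real^'k) \<times> (real^2^'k)) multiset"
  assumes D: "qdiff J G t D" and t: "at t within G \<noteq> bot" "t \<in> G" and y0: "rot t x \<noteq> 0"
    and v: "\<And>s. s \<in> G \<Longrightarrow> image_mset fst (J s) = v s" and D1: "qdiff v G t D1"
    and Jt: "J t = image_mset (\<lambda>a. (a, polar_jet \<sigma> (rot t x) a (D1 a))) (v t)"
    and C: "\<And>X. open X \<Longrightarrow> X \<noteq> {} \<Longrightarrow> \<exists>c\<in>C. c \<in> (X :: (real^'k) set)"
    and pde: "\<And>c n i. c \<in> C \<Longrightarrow>
      ((\<lambda>s. \<Sum>z\<in>#J s. bump c (1 / real (Suc n)) (fst z) * (snd z *v perp (rot s x)) $ i) has_real_derivative
       (\<Sum>z\<in>#J t. frechet_derivative (bump c (1 / real (Suc n))) (at (fst z)) (snd z *v perp (rot t x)) * (snd z *v perp (rot t x)) $ i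
         - \<sigma>\<^sup>2 * (bump c (1 / real (Suc n)) (fst z) * fst z $ i))) (at t within G)"
    and z: "z \<in># J t"
  shows "oscillates \<sigma> (rot t x) z (D z)"
proof -
  define y where "y = rot t x"
  have y: "y \<noteq> 0" using y0 by (simp add: y_def)
  define k where "k a = (a, polar_jet \<sigma> y a (D1 a))" for a
  have Jk: "J t = image_mset k (v t)" using Jt by (simp add: k_def[abs_def] y_def)
  have zk: "z = k (fst z)" "fst z \<in># v t" if "z \<in># J t" for z using that unfolding Jk by (auto simp: k_def)
  have rad: "snd z *v y = \<sigma> *\<^sub>R fst z" and tan: "snd z *v perp y = D1 (fst z)" if "z \<in># J t" for z
  proof -
    have "snd z = polar_jet \<sigma> y (fst z) (D1 (fst z))" using arg_cong[OF zk(1)[OF that], of snd] by (simp add: k_def)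
    then show "snd z *v y = \<sigma> *\<^sub>R fst z" "snd z *v perp y = D1 (fst z)"
      by (simp_all only: polar_jet_radial[OF y] polar_jet_tangential[OF y])
  qed
  have "qdiff (\<lambda>s. image_mset fst (J s)) G t (\<lambda>a. fst (D (k a)))"
    by (rule qdiff_image_mset[OF D linear_fst]) (use zk(1) norm_fst_le in \<open>auto simp: norm_fst_le\<close>)
  then have q: "qdiff v G t (\<lambda>a. fst (D (k a)))" using qdiff_cong[of G "\<lambda>s. image_mset fst (J s)" v, OF v t(2)] by simp
  have fD: "fst (D z) = D1 (fst z)" if "z \<in># J t" for z
    using qdiff_unique[OF q D1 t(1) zk(2)[OF that]] zk(1)[OF that] by simp
  have comp: "(snd (D z) *v perp y - \<sigma> *\<^sub>R fst z + \<sigma>\<^sup>2 *\<^sub>R fst z) $ i = 0" if zJ: "z \<in># J t" for i z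
  proof (rule zero_of_bump_sums[OF C _ _ zJ, of "\<lambda>z. (snd (D z) *v perp y - \<sigma> *\<^sub>R fst z + \<sigma>\<^sup>2 *\<^sub>R fst z) $ i"])
    show "inj_on fst (set_mset (J t))"
    proof (rule inj_onI)
      fix z z' assume "z \<in># J t" "z' \<in># J t" "fst z = fst z'"
      then show "z = z'" using zk(1)[of z] zk(1)[of z'] by simp
    qed
    fix c n assume c: "c \<in> C"
    define \<theta> where "\<theta> = bump c (1 / real (Suc n))"
    have C\<theta>: "C1 \<theta>" unfolding \<theta>_def by (rule C1_bump)
    define F where "F p = \<theta> (fst (snd p)) * (snd (snd p) *v perp (rot (fst p) x)) $ i" for p :: "real \<times> (real^'k) \<times> (real^2^'k)"
    \<comment> \<open>The summand with \<open>- y\<close> is due to the tangential direction turning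
      with the angle, as \<open>perp (perp y) = - y\<close>.\<close>
    define F' where "F' z p = \<theta> (fst z) * (snd z *v (fst p *\<^sub>R - y) + snd (snd p) *v perp y) $ i
       + frechet_derivative \<theta> (at (fst z)) (fst (snd p)) * (snd z *v perp y) $ i" for z and p :: "real \<times> (real^'k) \<times> (real^2^'k)"
    have F: "(F has_derivative F' z) (at (t, z))" for z
    proof -
      have i1: "(fst has_derivative fst) (at (t, z))" by (rule has_derivative_fst) (rule has_derivative_ident)
      have i2: "(snd has_derivative snd) (at (t, z))" by (rule has_derivative_snd) (rule has_derivative_ident)
      have a: "((\<lambda>p. fst (snd p)) has_derivative (\<lambda>p. fst (snd p))) (at (t, z))" by (rule has_derivative_fst[OF i2])
      have A: "((\<lambda>p. snd (snd p)) has_derivative (\<lambda>p. snd (snd p))) (at (t, z))" by (rule has_derivative_snd[OF i2])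
      have "((\<lambda>s. perp (rot s x)) has_derivative (\<lambda>h. h *\<^sub>R - y)) (at (fst (t, z)))"
        using bounded_linear.has_vector_derivative[OF bounded_linear_perp rot_has_vector_derivative[of x t UNIV]]
        by (simp add: has_vector_derivative_def y_def)
      from has_derivative_compose[OF i1 this]
      have r: "((\<lambda>p. perp (rot (fst p) x)) has_derivative (\<lambda>p. fst p *\<^sub>R - y)) (at (t, z))" .
      have b: "((\<lambda>p. (snd (snd p) *v perp (rot (fst p) x)) $ i) has_derivative
          (\<lambda>p. (snd z *v (fst p *\<^sub>R - y) + snd (snd p) *v perp y) $ i)) (at (t, z))"
        using bounded_linear.has_derivative[OF bounded_linear_vec_nth bounded_bilinear.FDERIV[OF bounded_bilinear_matrix_vector_mult A r]]
        by (simp only: fst_conv snd_conv y_def)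
      have c: "((\<lambda>p. \<theta> (fst (snd p))) has_derivative (\<lambda>p. frechet_derivative \<theta> (at (fst z)) (fst (snd p)))) (at (t, z))"
        using has_derivative_compose[OF a C1D[OF C\<theta>, of "fst (snd (t, z))"]] by (simp only: snd_conv)
      show ?thesis
        unfolding F_def[abs_def] F'_def[abs_def]
        using has_derivative_mult[OF c b] by (simp only: fst_conv snd_conv y_def)
    qed
    have d1: "((\<lambda>s. \<Sum>z\<in>#J s. F (s, z)) has_real_derivative (\<Sum>z\<in>#J t. F' z (1, D z))) (at t within G)"
      by (rule qdiff_sum_mset_derivative[OF D F])
    have d2: "((\<lambda>s. \<Sum>z\<in>#J s. F (s, z)) has_real_derivative
       (\<Sum>z\<in>#J t. frechet_derivative \<theta> (at (fst z)) (snd z *v perp y) * (snd z *v perp y) $ i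
         - \<sigma>\<^sup>2 * (\<theta> (fst z) * fst z $ i))) (at t within G)"
      using pde[OF c, of n i] by (simp only: F_def \<theta>_def y_def fst_conv snd_conv)
    have "(\<Sum>z\<in>#J t. F' z (1, D z)) = (\<Sum>z\<in>#J t. frechet_derivative \<theta> (at (fst z)) (snd z *v perp y) * (snd z *v perp y) $ i
         - \<sigma>\<^sup>2 * (\<theta> (fst z) * fst z $ i))"
      using d1 d2 unfolding has_real_derivative_iff_has_vector_derivative by (rule vector_derivative_unique_within[OF t(1)])
    then have "(\<Sum>z\<in>#J t. F' z (1, D z) - (frechet_derivative \<theta> (at (fst z)) (snd z *v perp y) * (snd z *v perp y) $ i
         - \<sigma>\<^sup>2 * (\<theta> (fst z) * fst z $ i))) = 0" by (simp only: sum_mset_diff_fun diff_self)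
    moreover have "image_mset (\<lambda>z. F' z (1, D z) - (frechet_derivative \<theta> (at (fst z)) (snd z *v perp y) * (snd z *v perp y) $ i
         - \<sigma>\<^sup>2 * (\<theta> (fst z) * fst z $ i))) (J t)
       = image_mset (\<lambda>z. \<theta> (fst z) * (snd (D z) *v perp y - \<sigma> *\<^sub>R fst z + \<sigma>\<^sup>2 *\<^sub>R fst z) $ i) (J t)"
    proof (rule image_mset_cong)
      fix z assume z: "z \<in># J t"
      have "snd z *v (1 *\<^sub>R - y) = - (\<sigma> *\<^sub>R fst z)" using rad[OF z] by (simp add: linear_neg[OF matrix_vector_mul_linear])
      then show "F' z (1, D z) - (frechet_derivative \<theta> (at (fst z)) (snd z *v perp y) * (snd z *v perp y) $ i
         - \<sigma>\<^sup>2 * (\<theta> (fst z) * fst z $ i)) = \<theta> (fst z) * (snd (D z) *v perp y - \<sigma> *\<^sub>R fst z + \<sigma>\<^sup>2 *\<^sub>R fst z) $ i"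
        by (simp add: F'_def fD[OF z] tan[OF z] algebra_simps)
    qed
    ultimately show "(\<Sum>z\<in>#J t. bump c (1 / real (Suc n)) (fst z) * (snd (D z) *v perp y - \<sigma> *\<^sub>R fst z + \<sigma>\<^sup>2 *\<^sub>R fst z) $ i) = 0"
      by (simp only: \<theta>_def)
  qed
  have "snd (D z) *v perp y - \<sigma> *\<^sub>R fst z + \<sigma>\<^sup>2 *\<^sub>R fst z = 0"
    using comp[OF z] by (simp only: vec_eq_iff zero_index simp_thms)
  moreover have "u = b - c" if "u - b + c = 0" for u b c :: "real^'k"
  proof -
    have "u = (u - b + c) + (b - c)" by simp
    then show ?thesis unfolding that by simp
  qed
  ultimately have "snd (D z) *v perp y = \<sigma> *\<^sub>R fst z - \<sigma>\<^sup>2 *\<^sub>R fst z" by blast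
  then show ?thesis using rad[OF z] tan[OF z] fD[OF z] by (simp add: oscillates_def y_def)
qed


section \<open>Vanishing maps and sets of good angles\<close>

lemma replicate_of_scaled_replicate:
  assumes "image_mset (\<lambda>a. c *\<^sub>R a) M = replicate_mset q (0 :: 'e::real_vector)" "c \<noteq> 0"
  shows "M = replicate_mset q 0"
proof -
  have "c *\<^sub>R a = 0" if "a \<in># M" for a
  proof -
    have "c *\<^sub>R a \<in># image_mset (\<lambda>a. c *\<^sub>R a) M" using imageI[OF that, of "\<lambda>a. c *\<^sub>R a"] by simp
    then show ?thesis unfolding assms(1) by (simp split: if_splits)
  qed
  then have "set_mset M \<subseteq> {0}" using assms(2) by auto
  moreover have "size M = q" using arg_cong[OF assms(1), of size] by simp
  ultimately show ?thesis using set_mset_subset_singletonD by metis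
qed

text \<open>Each dilation has its own null set, so only rational factors are used; they are dense
  enough to bring every nonzero point into the annulus.\<close>

lemma homogeneous_zero_extension:
  fixes w :: "real^2 \<Rightarrow> 'e::euclidean_space multiset"
  assumes hom: "homogeneous_map \<sigma> w" and z: "AE y in lborel. y \<in> annulus \<longrightarrow> w y = replicate_mset q 0"
  shows "AE y in lborel. w y = replicate_mset q 0"
proof -
  define Qp where "Qp = {r :: real. r \<in> \<rat> \<and> 0 < r}"
  have "countable Qp" unfolding Qp_def by (rule countable_subset[OF _ countable_rat]) blast
  have "AE y in lborel. w (r *\<^sub>R y) = image_mset (\<lambda>a. (r powr \<sigma>) *\<^sub>R a) (w y) \<and>
      (r *\<^sub>R y \<in> annulus \<longrightarrow> w (r *\<^sub>R y) = replicate_mset q 0)" if "r \<in> Qp" for r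
  proof -
    have r: "r > 0" using that by (simp add: Qp_def)
    then have "AE y in lborel. w (r *\<^sub>R y) = image_mset (\<lambda>a. (r powr \<sigma>) *\<^sub>R a) (w y)"
      using hom by (simp add: homogeneous_map_def AE_completion_iff)
    moreover have "AE y in lborel. r *\<^sub>R y \<in> annulus \<longrightarrow> w (r *\<^sub>R y) = replicate_mset q 0"
      using AE_scaleR[OF z, of r] r by simp
    ultimately show ?thesis by eventually_elim simp
  qed
  then have "AE y in lborel. \<forall>r\<in>Qp. w (r *\<^sub>R y) = image_mset (\<lambda>a. (r powr \<sigma>) *\<^sub>R a) (w y) \<and>
      (r *\<^sub>R y \<in> annulus \<longrightarrow> w (r *\<^sub>R y) = replicate_mset q 0)"
    using \<open>countable Qp\<close> by (rule AE_ball_countable')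
  moreover have "AE y in lborel. y \<noteq> (0 :: real^2)" by (rule AE_lborel_singleton)
  ultimately show ?thesis
  proof eventually_elim
    case (elim y)
    then have n: "norm y > 0" by simp
    then have "1 / norm y < 2 / norm y" by (simp add: divide_strict_right_mono)
    then obtain r where r: "r \<in> \<rat>" "1 / norm y < r" "r < 2 / norm y" using Rats_dense_in_real by blast
    have "0 < r" using r(2) n by (meson divide_pos_pos less_trans zero_less_one)
    then have "norm (r *\<^sub>R y) = r * norm y" by simp
    moreover have "1 < r * norm y" "r * norm y < 2" using r(2,3) n by (simp_all add: field_simps)
    ultimately have "r *\<^sub>R y \<in> annulus" by (simp only: annulus_def mem_Collect_eq simp_thms)
    then have "image_mset (\<lambda>a. (r powr \<sigma>) *\<^sub>R a) (w y) = replicate_mset q 0"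
      using elim(1) r(1) \<open>0 < r\<close> unfolding Qp_def by (metis (mono_tags, lifting) mem_Collect_eq)
    then show ?case by (rule replicate_of_scaled_replicate) (use \<open>0 < r\<close> in simp)
  qed
qed

lemma interval_meets_conegligible:
  fixes L :: real
  assumes "negligible ({0..L} - G)" "0 \<le> a" "a < b" "b \<le> L"
  obtains t where "t \<in> G" "a < t" "t < b"
proof -
  have "\<not> negligible {a<..<b}" using assms(3) by (intro open_not_negligible) auto
  then have "\<not> {a<..<b} \<subseteq> {0..L} - G" using assms(1) negligible_subset by blast
  then obtain t where "t \<in> {a<..<b}" "t \<notin> {0..L} - G" by blast
  then show thesis using assms by (intro that[of t]) auto
qed

text \<open>Points of \<open>G\<close> accumulate at \<open>t\<close>, which makes derivatives
  within \<open>G\<close> unique.\<close>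

lemma at_within_conegligible:
  fixes t :: real
  assumes "negligible ({0..L} - G)" "0 < t" "t < L"
  shows "at t within G \<noteq> bot"
  unfolding trivial_limit_within islimpt_approachable not_not
proof (intro allI impI)
  fix e :: real assume "e > 0"
  then have i: "0 \<le> t" "t < min L (t + e)" "min L (t + e) \<le> L" using assms by auto
  obtain s where "s \<in> G" "t < s" "s < min L (t + e)"
    by (rule interval_meets_conegligible[OF assms(1) i]) (rule that)
  then show "\<exists>x'\<in>G. x' \<noteq> t \<and> dist x' t < e" by (intro bexI[of _ s]) (auto simp: dist_real_def)
qed


text \<open>Each analytic fact has its own null set of starting points and of angles. The good
  angles are intersected to \<open>G\<close>, and derivatives are taken within \<open>G\<close>, so
  that the arbitrary values elsewhere do not interfere.\<close>

lemma circle_oscillation: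
  fixes w :: "real^2 \<Rightarrow> (real^'k) multiset"
  assumes W: "W12 annulus q w" and WJ: "W12 annulus q (j1 w)" and q: "q \<ge> 1" and hom: "homogeneous_map \<sigma> w"
    and out: "outer_stationary UNIV w"
  shows "AE x in lborel. x \<in> annulus \<longrightarrow> (\<exists>G0 G g. circle_regular L (\<lambda>t. j1 w (rot t x)) G0 g \<and> G \<subseteq> G0 \<and>
     negligible ({0..L} - G) \<and> (\<forall>t\<in>G. image_mset fst (j1 w (rot t x)) = w (rot t x)) \<and>
     negligible {t \<in> G. \<not> (\<exists>D. qdiff (\<lambda>t. j1 w (rot t x)) G t D \<and> (\<forall>z\<in>#j1 w (rot t x). oscillates \<sigma> (rot t x) z (D z)))})"
proof -
  have jet: "AE y in lborel. y \<in> annulus \<longrightarrow> euler_jet \<sigma> w y" by (rule AE_euler_jet[OF W q hom])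
  obtain C :: "(real^'k) set" where C: "countable C" "\<And>X. open X \<Longrightarrow> X \<noteq> {} \<Longrightarrow> \<exists>c\<in>C. c \<in> X"
    using countable_dense_exists by metis
  \<comment> \<open>Centres in a countable dense set, radii \<open>1 / Suc n\<close> and components
    of the target: countably many test fields, so one null set serves all of them.\<close>
  define I where "I = C \<times> (UNIV :: nat set) \<times> (UNIV :: 'k set)"
  have I: "countable I" unfolding I_def using C(1) by (intro countable_SIGMA) auto
  define b where "b k = bump (fst k) (1 / real (Suc (fst (snd k))))" for k :: "(real^'k) \<times> nat \<times> 'k"
  define f where "f k x = (\<Sum>z\<in>#j1 w x. b k (fst z) * (snd z *v perp x) $ (snd (snd k)))" for k x
  define h where "h k x = (\<Sum>z\<in>#j1 w x. frechet_derivative (b k) (at (fst z)) (snd z *v perp x) * (snd z *v perp x) $ (snd (snd k))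
       - \<sigma>\<^sup>2 * (b k (fst z) * fst z $ (snd (snd k))))" for k x
  have "AE x in lborel. x \<in> annulus \<longrightarrow> (\<exists>c \<gamma>. \<gamma> integrable_on {0..L} \<and> (\<lambda>s. \<bar>\<gamma> s\<bar>) integrable_on {0..L} \<and>
      (AE t in lborel. t \<in> {0..L} \<longrightarrow> f k (rot t x) = c + integral {0..t} \<gamma> \<and> \<gamma> t = h k (rot t x)))" for k
  proof -
    have "Cc1 UNIV (b k)" unfolding b_def by (rule Cc1_bump) simp
    note pde = outer_stationary_rotational[OF WJ hom jet out this, where i = "snd (snd k)"]
    show ?thesis
      by (rule weak_rot_derivative_annulus) (unfold f_def h_def, rule pde(1), rule pde(2), rule pde(3))
  qed
  then have Q4: "AE x in lborel. \<forall>k\<in>I. x \<in> annulus \<longrightarrow> (\<exists>c \<gamma>. \<gamma> integrable_on {0..L} \<and> (\<lambda>s. \<bar>\<gamma> s\<bar>) integrable_on {0..L} \<and>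
      (AE t in lborel. t \<in> {0..L} \<longrightarrow> f k (rot t x) = c + integral {0..t} \<gamma> \<and> \<gamma> t = h k (rot t x)))"
    using I by (rule AE_ball_countable')
  show ?thesis
    using homogeneous_circle_jets[OF W q hom, of L] W12_circle_regular[OF WJ q, of L] AE_swap_rot[OF jet] Q4
  proof eventually_elim
    case (elim x)
    show ?case
    proof
      assume x: "x \<in> annulus"
      obtain G1 g1 where G1: "circle_regular L (\<lambda>t. w (rot t x)) G1 g1" "circle_jets \<sigma> w x G1" using elim(1) x by blast
      obtain G2 g2 where G2: "circle_regular L (\<lambda>t. j1 w (rot t x)) G2 g2" using elim(2) x by blast
      have AEj: "AE t in lborel. euler_jet \<sigma> w (rot t x)" using elim(3) by (simp add: x)
      from elim(4) x have "\<forall>k\<in>I. \<exists>c \<gamma>. \<gamma> integrable_on {0..L} \<and>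
        (AE t in lborel. t \<in> {0..L} \<longrightarrow> f k (rot t x) = c + integral {0..t} \<gamma> \<and> \<gamma> t = h k (rot t x))" by blast
      from bchoice[OF this] obtain c where "\<forall>k\<in>I. \<exists>\<gamma>. \<gamma> integrable_on {0..L} \<and>
        (AE t in lborel. t \<in> {0..L} \<longrightarrow> f k (rot t x) = c k + integral {0..t} \<gamma> \<and> \<gamma> t = h k (rot t x))" by (rule exE)
      from bchoice[OF this] obtain \<gamma> where \<gamma>: "\<forall>k\<in>I. \<gamma> k integrable_on {0..L} \<and>
        (AE t in lborel. t \<in> {0..L} \<longrightarrow> f k (rot t x) = c k + integral {0..t} (\<gamma> k) \<and> \<gamma> k t = h k (rot t x))" by (rule exE)
      have c\<gamma>: "\<And>k. k \<in> I \<Longrightarrow> \<gamma> k integrable_on {0..L}"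
        "\<And>k. k \<in> I \<Longrightarrow> AE t in lborel. t \<in> {0..L} \<longrightarrow> f k (rot t x) = c k + integral {0..t} (\<gamma> k) \<and> \<gamma> k t = h k (rot t x)"
        using \<gamma> by blast+
      have AEc: "AE t in lborel. \<forall>k\<in>I. t \<in> {0..L} \<longrightarrow> f k (rot t x) = c k + integral {0..t} (\<gamma> k) \<and> \<gamma> k t = h k (rot t x)"
        using c\<gamma>(2) I by (rule AE_ball_countable')
      have AEd: "AE t in lborel. \<forall>k\<in>I. t \<in> {0<..<L} \<longrightarrow> ((\<lambda>s. integral {0..s} (\<gamma> k)) has_real_derivative \<gamma> k t) (at t)"
      proof (rule AE_ball_countable'[OF _ I])
        fix k assume "k \<in> I"
        have "{t. \<not> (t \<in> {0<..<L} \<longrightarrow> ((\<lambda>s. integral {0..s} (\<gamma> k)) has_real_derivative \<gamma> k t) (at t))}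
          = {t \<in> {0<..<L}. \<not> ((\<lambda>s. integral {0..s} (\<gamma> k)) has_real_derivative \<gamma> k t) (at t)}" by blast
        then show "AE t in lborel. t \<in> {0<..<L} \<longrightarrow> ((\<lambda>s. integral {0..s} (\<gamma> k)) has_real_derivative \<gamma> k t) (at t)"
          unfolding AE_lborel_iff_negligible using negligible_not_derivative_of_integral[OF c\<gamma>(1)[OF \<open>k \<in> I\<close>]] by simp
      qed
      have AEG: "AE t in lborel. t \<in> {0..L} \<longrightarrow> t \<in> H" if "negligible ({0..L} - H)" for H
      proof -
        have "{t. \<not> (t \<in> {0..L} \<longrightarrow> t \<in> H)} = {0..L} - H" by blast
        then show ?thesis unfolding AE_lborel_iff_negligible using that by simp
      qed
      have n12: "negligible ({0..L} - G1)" "negligible ({0..L} - G2)" and sub: "G1 \<subseteq> {0..L}"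
        using G1(1) G2 unfolding circle_regular_def by blast+
      define G where "G = {t \<in> G1 \<inter> G2. euler_jet \<sigma> w (rot t x) \<and>
        (\<forall>k\<in>I. f k (rot t x) = c k + integral {0..t} (\<gamma> k) \<and> \<gamma> k t = h k (rot t x))}"
      have GI: "G \<subseteq> G1" "G \<subseteq> G2" "G \<subseteq> {0..L}" using sub by (auto simp: G_def)
      have "AE t in lborel. t \<in> {0..L} \<longrightarrow> t \<in> G"
        using AEG[OF n12(1)] AEG[OF n12(2)] AEj AEc by eventually_elim (simp add: G_def)
      then have nG: "negligible ({0..L} - G)"
        unfolding AE_lborel_iff_negligible by (rule negligible_subset) blast
      have fstJ: "image_mset fst (j1 w (rot t x)) = w (rot t x)" if "t \<in> G" for t
        using that by (simp add: G_def euler_jet_def)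
      have N1: "AE t in lborel. t \<in> G1 \<longrightarrow> (\<exists>D. qdiff (\<lambda>t. w (rot t x)) G1 t D \<and>
         j1 w (rot t x) = image_mset (\<lambda>a. (a, polar_jet \<sigma> (rot t x) a (D a))) (w (rot t x)))"
        unfolding AE_lborel_iff_negligible using G1(2)[unfolded circle_jets_def] by (rule negligible_subset) blast
      have N2: "AE t in lborel. t \<in> G2 \<longrightarrow> (\<exists>D. qdiff (\<lambda>t. j1 w (rot t x)) G2 t D)"
      proof -
        have "negligible {t \<in> G2. \<not> (\<exists>D. qdiff (\<lambda>t. j1 w (rot t x)) G2 t D)}" using G2 unfolding circle_regular_def by blast
        then show ?thesis unfolding AE_lborel_iff_negligible by (rule negligible_subset) blast
      qed
      have "AE t in lborel. t \<noteq> (0::real)" "AE t in lborel. t \<noteq> L" by (rule AE_lborel_singleton)+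
      with N1 N2 AEd have "AE t in lborel. t \<in> G \<longrightarrow>
        (\<exists>D. qdiff (\<lambda>t. j1 w (rot t x)) G t D \<and> (\<forall>z\<in>#j1 w (rot t x). oscillates \<sigma> (rot t x) z (D z)))"
      proof eventually_elim
        case (elim t)
        show ?case
        proof
          assume t: "t \<in> G"
          then have t0: "0 < t" "t < L" using GI(3) elim(4,5) by (auto simp: less_le)
          obtain D1 where D1: "qdiff (\<lambda>t. w (rot t x)) G1 t D1"
            "j1 w (rot t x) = image_mset (\<lambda>a. (a, polar_jet \<sigma> (rot t x) a (D1 a))) (w (rot t x))"
            using elim(1) t GI(1) by blast
          obtain D where D: "qdiff (\<lambda>t. j1 w (rot t x)) G2 t D" using elim(2) t GI(2) by blast
          note qD = qdiff_subset[OF D GI(2)] and qD1 = qdiff_subset[OF D1(1) GI(1)]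
          have y0: "rot t x \<noteq> 0" using x norm_rot[of t x] by (auto simp: annulus_def simp del: norm_rot)
          have pde: "((\<lambda>s. \<Sum>z\<in>#j1 w (rot s x). bump p (1 / real (Suc n)) (fst z) * (snd z *v perp (rot s x)) $ i) has_real_derivative
             (\<Sum>z\<in>#j1 w (rot t x). frechet_derivative (bump p (1 / real (Suc n))) (at (fst z)) (snd z *v perp (rot t x)) * (snd z *v perp (rot t x)) $ i
               - \<sigma>\<^sup>2 * (bump p (1 / real (Suc n)) (fst z) * fst z $ i))) (at t within G)" if p: "p \<in> C" for p n i
          proof -
            let ?k = "(p, n, i)"
            have k: "?k \<in> I" using p by (simp add: I_def)
            have "((\<lambda>s. integral {0..s} (\<gamma> ?k)) has_real_derivative \<gamma> ?k t) (at t within G)"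
              using elim(3) k t0 by (auto intro: has_field_derivative_at_within)
            then have "((\<lambda>s. c ?k + integral {0..s} (\<gamma> ?k)) has_real_derivative \<gamma> ?k t) (at t within G)"
              by (auto intro!: derivative_eq_intros)
            then have "((\<lambda>s. f ?k (rot s x)) has_real_derivative \<gamma> ?k t) (at t within G)"
              by (rule has_field_derivative_transform_within[OF _ zero_less_one t]) (use k in \<open>simp add: G_def\<close>)
            moreover have "\<gamma> ?k t = h ?k (rot t x)" using t k by (simp add: G_def)
            ultimately show ?thesis by (simp only: f_def h_def b_def fst_conv snd_conv)
          qed
          have "oscillates \<sigma> (rot t x) z (D z)" if "z \<in># j1 w (rot t x)" for z
            by (rule jet_oscillates[OF qD at_within_conegligible[OF nG t0] t y0 fstJ qD1 D1(2) C(2) pde that])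
          then show "\<exists>D. qdiff (\<lambda>t. j1 w (rot t x)) G t D \<and> (\<forall>z\<in>#j1 w (rot t x). oscillates \<sigma> (rot t x) z (D z))"
            using qD by blast
        qed
      qed
      then have "negligible {t \<in> G. \<not> (\<exists>D. qdiff (\<lambda>t. j1 w (rot t x)) G t D \<and> (\<forall>z\<in>#j1 w (rot t x). oscillates \<sigma> (rot t x) z (D z)))}"
        unfolding AE_lborel_iff_negligible by (rule negligible_subset) blast
      then show "\<exists>G0 G g. circle_regular L (\<lambda>t. j1 w (rot t x)) G0 g \<and> G \<subseteq> G0 \<and>
         negligible ({0..L} - G) \<and> (\<forall>t\<in>G. image_mset fst (j1 w (rot t x)) = w (rot t x)) \<and>
         negligible {t \<in> G. \<not> (\<exists>D. qdiff (\<lambda>t. j1 w (rot t x)) G t D \<and> (\<forall>z\<in>#j1 w (rot t x). oscillates \<sigma> (rot t x) z (D z)))}"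
        using G2 GI(2) nG fstJ by blast
    qed
  qed
qed

theorem theorem3p12:
  fixes w :: "real^2 \<Rightarrow> (real^'k) multiset" and q :: nat and \<sigma> :: real
  assumes "q \<ge> 1"
    and "W22_loc UNIV q w"
    and "nonzero_map q w"
    and "dirichlet_stationary UNIV q w"
    and "homogeneous_map \<sigma> w"
    and "\<sigma> > 1"
  shows "\<sigma> \<ge> 1 + 1 / real q"
proof -
  \<comment> \<open>Two turns, so that an angle and its successor by \<open>2 * pi\<close> can both
    be good.\<close>
  let ?L = "4 * pi"
  have W: "W12 annulus q w" and WJ: "W12 annulus q (j1 w)"
    using assms(2) compactly_inside_annulus unfolding W22_loc_def W22_def by blast+
  have szJ: "size (j1 w y) = q" if "y \<in> annulus" for y using WJ that by (simp add: W12_def)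
  have out: "outer_stationary UNIV w" using assms(4) by (simp add: dirichlet_stationary_def)
  define P where "P x \<longleftrightarrow> (\<exists>G0 G g. circle_regular ?L (\<lambda>t. j1 w (rot t x)) G0 g \<and> G \<subseteq> G0 \<and>
     negligible ({0..?L} - G) \<and> (\<forall>t\<in>G. image_mset fst (j1 w (rot t x)) = w (rot t x)) \<and>
     negligible {t \<in> G. \<not> (\<exists>D. qdiff (\<lambda>t. j1 w (rot t x)) G t D \<and> (\<forall>z\<in>#j1 w (rot t x). oscillates \<sigma> (rot t x) z (D z)))})" for x
  have "AE x in lborel. x \<in> annulus \<longrightarrow> P x \<and> (AE p in lborel. spiral p x \<in> annulus \<longrightarrow>
     w (spiral p x) = image_mset (\<lambda>a. exp (\<sigma> * fst p) *\<^sub>R a) (w (rot (snd p) x)))"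
    using circle_oscillation[OF W WJ assms(1,5) out, of ?L] homogeneous_spiral[OF W assms(5)]
    by eventually_elim (simp add: P_def)
  then obtain x where x: "x \<in> annulus" and Px: "P x"
    and sp: "AE p in lborel. spiral p x \<in> annulus \<longrightarrow>
     w (spiral p x) = image_mset (\<lambda>a. exp (\<sigma> * fst p) *\<^sub>R a) (w (rot (snd p) x))"
    by (rule ex_annulus_point) blast
  define J where "J t = j1 w (rot t x)" for t
  obtain G0 G g where G: "circle_regular ?L J G0 g" "G \<subseteq> G0" "negligible ({0..?L} - G)"
    "\<And>t. t \<in> G \<Longrightarrow> image_mset fst (J t) = w (rot t x)"
    "negligible {t \<in> G. \<not> (\<exists>D. qdiff J G t D \<and> (\<forall>z\<in>#J t. oscillates \<sigma> (rot t x) z (D z)))}"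
    using Px unfolding P_def J_def[symmetric] by blast
  have \<sigma>: "\<sigma> \<noteq> 0" using assms(6) by simp
  have sz: "size (J s) = q" for s unfolding J_def by (rule szJ) (simp add: x)
  have const: "image_mset (\<lambda>z. phase \<sigma> x (s, z)) (J s) = image_mset (\<lambda>z. phase \<sigma> x (t, z)) (J t)" if "s \<in> G" "t \<in> G" for s t
    by (rule phase_multiset_constant[OF G(1-3) sz \<sigma> G(5) that])
  \<comment> \<open>If \<open>w\<close> vanished at all good angles of this generic circle,
    homogeneity along spirals would make it vanish almost everywhere in the annulus and then in the
    plane.\<close>
  have "\<exists>t\<in>G. w (rot t x) \<noteq> replicate_mset q 0"
  proof (rule ccontr)
    assume "\<not> (\<exists>t\<in>G. w (rot t x) \<noteq> replicate_mset q 0)"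
    then have z: "\<And>t. t \<in> G \<Longrightarrow> w (rot t x) = replicate_mset q 0" by blast
    have "AE p in lborel. (p :: real \<times> real) \<notin> {p. snd p \<in> {0..?L} - G}"
      unfolding AE_lborel_iff_negligible using negligible_snd[OF G(3)] by (rule negligible_subset) blast
    with sp have "AE p in lborel. spiral p x \<in> annulus \<longrightarrow> snd p \<in> {0<..<?L} \<longrightarrow> w (spiral p x) = replicate_mset q 0"
    proof eventually_elim
      case (elim p)
      show ?case
      proof (intro impI)
        assume "spiral p x \<in> annulus" "snd p \<in> {0<..<?L}"
        then have "snd p \<in> G" using elim(2) by simp
        then show "w (spiral p x) = replicate_mset q 0"
          using elim(1) \<open>spiral p x \<in> annulus\<close> z by (simp add: image_replicate_mset)
      qed
    qed
    from AE_annulus_of_spiral[OF x this] have "AE y in lborel. w y = replicate_mset q 0"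
      by (rule homogeneous_zero_extension[OF assms(5)])
    then show False using assms(3) by (simp add: nonzero_map_def AE_completion_iff)
  qed
  then obtain t0 where t0: "t0 \<in> G" "w (rot t0 x) \<noteq> replicate_mset q 0" by blast
  have "\<exists>z\<in>#J t0. fst z \<noteq> 0"
  proof (rule ccontr)
    assume "\<not> (\<exists>z\<in>#J t0. fst z \<noteq> 0)"
    then have "set_mset (w (rot t0 x)) \<subseteq> {0}" unfolding G(4)[OF t0(1), symmetric] by auto
    moreover have "size (w (rot t0 x)) = q" unfolding G(4)[OF t0(1), symmetric] by (simp add: sz)
    ultimately show False using set_mset_subset_singletonD t0(2) by metis
  qed
  then obtain z0 where z0: "z0 \<in># J t0" "fst z0 \<noteq> 0" by blast
  define M where "M = image_mset (\<lambda>z. phase \<sigma> x (t0, z)) (J t0)"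
  \<comment> \<open>The backward flow is injective and fixes 0, so a jet with nonzero value has a
    nonzero phase.\<close>
  have "phase \<sigma> x (t0, z0) \<noteq> 0"
  proof
    assume "phase \<sigma> x (t0, z0) = 0"
    then have "phase_rot \<sigma> t0 (fst z0, snd z0 *v perp (rot t0 x)) = phase_rot \<sigma> t0 0"
      by (simp add: phase_def) (simp add: phase_rot_def zero_prod_def)
    from phase_rot_inj[OF \<sigma> this] show False using z0(2) by (simp add: zero_prod_def)
  qed
  moreover have "phase \<sigma> x (t0, z0) \<in># M" using z0(1) by (simp add: M_def)
  ultimately obtain m where m: "m \<in># M" "m \<noteq> 0" by blast
  \<comment> \<open>The exceptional angles of the second turn are moved back to the first; an angle
    outside both null sets serves as \<open>t1\<close>.\<close>
  have nG': "negligible ((+) (- 2 * pi) ` ({0..?L} - G))" by (rule negligible_translation[OF G(3)])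
  have "negligible ({0..2 * pi} - {t \<in> G. t + 2 * pi \<in> G})"
  proof (rule negligible_subset[OF negligible_Un[OF G(3) nG']], rule subsetI)
    fix t assume t: "t \<in> {0..2 * pi} - {t \<in> G. t + 2 * pi \<in> G}"
    show "t \<in> ({0..?L} - G) \<union> (+) (- 2 * pi) ` ({0..?L} - G)"
    proof (cases "t \<in> G")
      case True
      then have "t + 2 * pi \<in> {0..?L} - G" using t by auto
      then have "- 2 * pi + (t + 2 * pi) \<in> (+) (- 2 * pi) ` ({0..?L} - G)" by (rule imageI)
      then show ?thesis by simp
    qed (use t in auto)
  qed
  then obtain t1 where t1: "t1 \<in> G" "t1 + 2 * pi \<in> G"
    by (rule interval_meets_conegligible[of "2 * pi" "{t \<in> G. t + 2 * pi \<in> G}" 0 "2 * pi"]) auto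
  \<comment> \<open>After one turn the point \<open>rot t x\<close> has returned, but the clock of
    the oscillator has advanced by \<open>2 * pi\<close>; this discrepancy is what permutes the
    phases.\<close>
  have per: "phase \<sigma> x (t1 + 2 * pi, z) = phase_rot \<sigma> (2 * pi) (phase \<sigma> x (t1, z))" for z
    unfolding phase_def fst_conv snd_conv rot_2pi phase_rot_add[OF \<sigma>, symmetric] by (simp add: add.commute)
  have "image_mset (phase_rot \<sigma> (2 * pi)) M = image_mset (phase_rot \<sigma> (2 * pi)) (image_mset (\<lambda>z. phase \<sigma> x (t1, z)) (J t1))"
    unfolding M_def const[OF t0(1) t1(1)] ..
  also have "\<dots> = image_mset (\<lambda>z. phase \<sigma> x (t1 + 2 * pi, z)) (J t1)"
    by (simp add: multiset.map_comp o_def per)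
  also have "J t1 = J (t1 + 2 * pi)" by (simp only: J_def rot_2pi)
  also have "image_mset (\<lambda>z. phase \<sigma> x (t1 + 2 * pi, z)) (J (t1 + 2 * pi)) = M"
    unfolding M_def by (rule const[OF t1(2) t0(1)])
  finally have "image_mset (phase_rot \<sigma> (2 * pi)) M = M" .
  from invariant_multiset_period[OF assms(6) this m] show ?thesis by (simp add: M_def sz)
qed

end
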